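(* Let $N$ be a fixed positive integer. Let $L=L(\sigma,r_1,r_2)$ and $\tilde L=L(\tilde\sigma,\tilde r_1,\tilde r_2)$ be two boundary value problems with complex-valued $\sigma,\tilde\sigma\in L_2(0,\pi)$ and $(r_1,r_2),(\tilde r_1,\tilde r_2)\in\mathcal R_p$ (same $p\ge 0$). Suppose that their spectral data fulfill the conditions $\lambda_n = \tilde \lambda_n$, $\alpha_n = \tilde\alpha_n$ for $n \ge N$ and $\lambda_n, \tilde \lambda_n \in \operatorname{int}\Gamma_N$ for $n < N$, where $\Gamma_N=\{\lambda\in\mathbb C:|\lambda|=(N-p-\tfrac32)^2\}$. Put $\hat M_N=M_N-\tilde M_N$. Then the following relations hold: $$\sigma(x) = \tilde \sigma(x) - \frac{1}{2\pi i}\oint_{\Gamma_N}\big(2\tilde\varphi(x, \mu)\varphi(x, \mu) - 1\big)\hat M_N(\mu)\,d\mu,$$ $$r_1(\lambda) = \prod_{k = 1}^{N-1} \frac{\lambda-\lambda_{k}}{\lambda-\tilde \lambda_{k}} \Bigg(\tilde r_1(\lambda) - \frac{1}{2\pi i}\oint_{\Gamma_N}\frac{\tilde r_1(\lambda)\tilde\varphi^{[1]}(\pi, \mu) + \tilde r_2(\lambda)\tilde\varphi(\pi, \mu)}{\lambda - \mu}\varphi(\pi, \mu)\hat M_N(\mu)\,d\mu \Bigg),$$ $$r_2(\lambda) = \prod_{k = 1}^{N-1} \frac{\lambda-\lambda_{k}}{\lambda-\tilde \lambda_{k}}\Bigg(\tilde r_2(\lambda) - \tilde r_1(\lambda)\frac{1}{2\pi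 i}\oint_{\Gamma_N}\big(\tilde\varphi(\pi, \mu)\varphi(\pi, \mu) - 1\big)\hat M_N(\mu)\,d\mu +\frac{1}{2\pi i}\oint_{\Gamma_N}\frac{\tilde r_1(\lambda)\tilde\varphi^{[1]}(\pi, \mu) + \tilde r_2(\lambda)\tilde\varphi(\pi, \mu)}{\lambda - \mu}\varphi^{[1]}(\pi, \mu)\hat M_N(\mu)\,d\mu \Bigg).$$
   Context: Problem $L(\sigma,r_1,r_2)$: for complex-valued $\sigma\in L_2(0,\pi)$ and relatively prime polynomials $r_1,r_2$, it is the boundary value problem $$-(y^{[1]})'-\sigma(x)y^{[1]}-\sigma^2(x)y=\lambda y,\ x\in(0,\pi),\qquad y^{[1]}(0)=0,\quad r_1(\lambda)y^{[1]}(\pi)+r_2(\lambda)y(\pi)=0,$$ where $y^{[1]}:=y'-\sigma y$ is the quasi-derivative and $y,y^{[1]}\in AC[0,\pi]$ (this is the regularized form of $-y''+qy=\lambda y$ with $q=\sigma'\in W_2^{-1}(0,\pi)$). Objects with a tilde are the corresponding objects for $\tilde L$; the quasi-derivative of $\tilde\varphi$ is taken with $\tilde\sigma$, i.e. $\tilde\varphi^{[1]}=\tilde\varphi'-\tilde\sigma\tilde\varphi$, and that of $\varphi$ with $\sigma$. Class $\mathcal R_p$: $(r_1,r_2)\in\mathcal R_p$ means $r_1(\lambda)=\sum_{n=0}^p c_n\lambda^n$ with $c_p=1$ and $r_2(\lambda)=\sum_{n=0}^p d_n\lambda^n$ (the higher coefficients of $r_2$ may be zero). $S(x,\lambda)$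 and $\varphi(x,\lambda)$ are the solutions of the differential equation with $S(0,\lambda)=0$, $S^{[1]}(0,\lambda)=1$, $\varphi(0,\lambda)=1$, $\varphi^{[1]}(0,\lambda)=0$. Put $\Delta_1(\lambda)=r_1(\lambda)\varphi^{[1]}(\pi,\lambda)+r_2(\lambda)\varphi(\pi,\lambda)$ and $\Delta_0(\lambda)=r_1(\lambda)S^{[1]}(\pi,\lambda)+r_2(\lambda)S(\pi,\lambda)$. The eigenvalues of $L$ are the zeros of $\Delta_1$, and the Weyl function is $M(\lambda)=-\Delta_0(\lambda)/\Delta_1(\lambda)$. Spectral data: the eigenvalues, counted with multiplicity and with equal ones consecutive, are numbered as $\{\lambda_n\}_{n\ge1}$ according to the asymptotics $\sqrt{\lambda_n}=n-p-1+\varkappa_n$, $\{\varkappa_n\}\in l_2$. Let $I=\{1\}\cup\{n>1:\lambda_n\ne\lambda_{n-1}\}$ and let $m_n$ be the multiplicity of $\lambda_n$, $n\in I$. The weight numbers $\{\alpha_n\}_{n\ge1}$ are the coefficients in the representation $$M(\lambda)=\sum_{n\in I}\sum_{k=0}^{m_n-1}\frac{\alpha_{n+k}}{(\lambda-\lambda_n)^{k+1}}.$$ The spectral data of $L$ are $\{\lambda_n,\alpha_n\}_{n\ge1}$, and $$M_N(\lambda)=\sum_{n\in I,\,n<N}\ \sum_{k=0}^{m_n-1}\frac{\alpha_{n+k}}{(\lambda-\lambda_n)^{k+1}}.$$ The function $\tilde M_N$ is defined in the same way from the spectral data of $\tilde L$. Contour integrals are taken in the usual positive direction.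
   Formalization: The formulas for r_1, r_2 are stated for λ outside Γ_N (inside, the integral gains a residue at μ=λ), and it is assumed that N∈I for L exactly when N∈I for L̃, so the equal tails have the same multiplicity blocks; otherwise the σ formula fails. *)

theory Defs
  imports "HOL-Complex_Analysis.Complex_Analysis" "HOL-Computational_Algebra.Polynomial"
begin

definition L2_0_pi :: "(real \<Rightarrow> complex) \<Rightarrow> bool" where
  "L2_0_pi \<sigma> \<longleftrightarrow>
     \<sigma> \<in> borel_measurable (lebesgue_on {0<..<pi}) \<and>
     integrable (lebesgue_on {0<..<pi}) (\<lambda>x. (cmod (\<sigma> x))\<^sup>2)"

definition abs_cont :: "real \<Rightarrow> real \<Rightarrow> (real \<Rightarrow> complex) \<Rightarrow> bool" where
  "abs_cont a b f \<longleftrightarrow>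
     (\<forall>\<epsilon>>0. \<exists>\<delta>>0. \<forall>(n::nat) u v.
        (\<forall>i<n. a \<le> u i \<and> u i \<le> v i \<and> v i \<le> b) \<and>
        disjoint_family_on (\<lambda>i. {u i<..<v i}) {..<n} \<and>
        (\<Sum>i<n. v i - u i) < \<delta>
        \<longrightarrow> (\<Sum>i<n. cmod (f (v i) - f (u i))) < \<epsilon>)"

text \<open>The quasi-derivative \<open>y' - \<sigma> y\<close> is only defined almost everywhere; \<open>z\<close> is its absolutely
  continuous representative, which gives a meaning to its values at the endpoints.\<close>

definition quasi_deriv :: "(real \<Rightarrow> complex) \<Rightarrow> (real \<Rightarrow> complex) \<Rightarrow> (real \<Rightarrow> complex) \<Rightarrow> bool" where
  "quasi_deriv \<sigma> y z \<longleftrightarrow>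
     abs_cont 0 pi z \<and>
     (AE x in lebesgue_on {0<..<pi}.
        y differentiable (at x) \<and> z x = vector_derivative y (at x) - \<sigma> x * y x)"

definition SL_solution ::
    "(real \<Rightarrow> complex) \<Rightarrow> complex \<Rightarrow> (real \<Rightarrow> complex) \<Rightarrow> (real \<Rightarrow> complex) \<Rightarrow> bool" where
  "SL_solution \<sigma> \<mu> y z \<longleftrightarrow>
     abs_cont 0 pi y \<and> quasi_deriv \<sigma> y z \<and>
     (AE x in lebesgue_on {0<..<pi}.
        z differentiable (at x) \<and>
        - vector_derivative z (at x) - \<sigma> x * z x - (\<sigma> x)\<^sup>2 * y x = \<mu> * y x)"

text \<open>The solution together with its quasi-derivative. It is unique on \<open>[0, \<pi>]\<close>; its values
  outside this interval are arbitrary.\<close>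

definition SL_ivp ::
    "(real \<Rightarrow> complex) \<Rightarrow> complex \<Rightarrow> complex \<Rightarrow> complex \<Rightarrow> (real \<Rightarrow> complex) \<times> (real \<Rightarrow> complex)" where
  "SL_ivp \<sigma> \<mu> a b = (SOME yz. SL_solution \<sigma> \<mu> (fst yz) (snd yz) \<and> fst yz 0 = a \<and> snd yz 0 = b)"

definition phi :: "(real \<Rightarrow> complex) \<Rightarrow> real \<Rightarrow> complex \<Rightarrow> complex" where
  "phi \<sigma> x \<mu> = fst (SL_ivp \<sigma> \<mu> 1 0) x"

definition phi_qd :: "(real \<Rightarrow> complex) \<Rightarrow> real \<Rightarrow> complex \<Rightarrow> complex" where
  "phi_qd \<sigma> x \<mu> = snd (SL_ivp \<sigma> \<mu> 1 0) x"

definition S :: "(real \<Rightarrow> complex) \<Rightarrow> real \<Rightarrow> complex \<Rightarrow> complex" where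
  "S \<sigma> x \<mu> = fst (SL_ivp \<sigma> \<mu> 0 1) x"

definition S_qd :: "(real \<Rightarrow> complex) \<Rightarrow> real \<Rightarrow> complex \<Rightarrow> complex" where
  "S_qd \<sigma> x \<mu> = snd (SL_ivp \<sigma> \<mu> 0 1) x"

definition class_R :: "nat \<Rightarrow> complex poly \<Rightarrow> complex poly \<Rightarrow> bool" where
  "class_R p r1 r2 \<longleftrightarrow> degree r1 = p \<and> lead_coeff r1 = 1 \<and> degree r2 \<le> p"

definition Delta1 :: "(real \<Rightarrow> complex) \<Rightarrow> complex poly \<Rightarrow> complex poly \<Rightarrow> complex \<Rightarrow> complex" where
  "Delta1 \<sigma> r1 r2 \<mu> = poly r1 \<mu> * phi_qd \<sigma> pi \<mu> + poly r2 \<mu> * phi \<sigma> pi \<mu>"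

definition Delta0 :: "(real \<Rightarrow> complex) \<Rightarrow> complex poly \<Rightarrow> complex poly \<Rightarrow> complex \<Rightarrow> complex" where
  "Delta0 \<sigma> r1 r2 \<mu> = poly r1 \<mu> * S_qd \<sigma> pi \<mu> + poly r2 \<mu> * S \<sigma> pi \<mu>"

definition weyl_M :: "(real \<Rightarrow> complex) \<Rightarrow> complex poly \<Rightarrow> complex poly \<Rightarrow> complex \<Rightarrow> complex" where
  "weyl_M \<sigma> r1 r2 \<mu> = - Delta0 \<sigma> r1 r2 \<mu> / Delta1 \<sigma> r1 r2 \<mu>"

text \<open>Sequences \<open>ev\<close> (eigenvalues) and \<open>wt\<close> (weight numbers) are indexed from 1; their values at 0
  are irrelevant throughout.\<close>

definition idx_set :: "(nat \<Rightarrow> complex) \<Rightarrow> nat set" where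
  "idx_set ev = {1} \<union> {n. n > 1 \<and> ev n \<noteq> ev (n - 1)}"

definition mult :: "(nat \<Rightarrow> complex) \<Rightarrow> nat \<Rightarrow> nat" where
  "mult ev n = card {k. 1 \<le> k \<and> ev k = ev n}"

definition principal_part :: "(nat \<Rightarrow> complex) \<Rightarrow> (nat \<Rightarrow> complex) \<Rightarrow> nat \<Rightarrow> complex \<Rightarrow> complex" where
  "principal_part ev wt n \<mu> = (\<Sum>k<mult ev n. wt (n + k) / (\<mu> - ev n) ^ (k + 1))"

text \<open>The zeros of the entire function \<open>Delta1\<close>, repeated according to their order. The principal
  branch of the root may be used in the asymptotics: it differs from any other admissible choice for
  finitely many \<open>n\<close> only, and this does not affect summability.\<close>

definition eigenvalue_seq ::
    "nat \<Rightarrow> (real \<Rightarrow> complex) \<Rightarrow> complex poly \<Rightarrow> complex poly \<Rightarrow> (nat \<Rightarrow> complex) \<Rightarrow> bool" where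
  "eigenvalue_seq p \<sigma> r1 r2 ev \<longleftrightarrow>
     ev ` {1..} = {\<mu>. Delta1 \<sigma> r1 r2 \<mu> = 0} \<and>
     (\<forall>n\<ge>1. finite {k. 1 \<le> k \<and> ev k = ev n} \<and> int (mult ev n) = zorder (Delta1 \<sigma> r1 r2) (ev n)) \<and>
     (\<forall>m k n. 1 \<le> m \<and> m \<le> k \<and> k \<le> n \<and> ev m = ev n \<longrightarrow> ev k = ev m) \<and>
     summable (\<lambda>n. (cmod (csqrt (ev n) - of_real (real n - real p - 1)))\<^sup>2)"

definition spectral_data ::
    "nat \<Rightarrow> (real \<Rightarrow> complex) \<Rightarrow> complex poly \<Rightarrow> complex poly \<Rightarrow>
     (nat \<Rightarrow> complex) \<Rightarrow> (nat \<Rightarrow> complex) \<Rightarrow> bool" where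
  "spectral_data p \<sigma> r1 r2 ev wt \<longleftrightarrow>
     eigenvalue_seq p \<sigma> r1 r2 ev \<and>
     (\<forall>\<mu>. Delta1 \<sigma> r1 r2 \<mu> \<noteq> 0 \<longrightarrow>
        ((\<lambda>n. principal_part ev wt n \<mu>) has_sum weyl_M \<sigma> r1 r2 \<mu>) (idx_set ev))"

definition M_trunc :: "nat \<Rightarrow> (nat \<Rightarrow> complex) \<Rightarrow> (nat \<Rightarrow> complex) \<Rightarrow> complex \<Rightarrow> complex" where
  "M_trunc N ev wt \<mu> = (\<Sum>n\<in>{n \<in> idx_set ev. n < N}. principal_part ev wt n \<mu>)"

definition radius :: "nat \<Rightarrow> nat \<Rightarrow> real" where
  "radius p N = (real N - real p - 3/2)\<^sup>2"

definition Gamma_integral :: "nat \<Rightarrow> nat \<Rightarrow> (complex \<Rightarrow> complex) \<Rightarrow> complex" where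
  "Gamma_integral p N f =
     1 / (2 * of_real pi * \<i>) * contour_integral (circlepath 0 (radius p N)) f"

end

theory Submission
  imports Defs
begin

text \<open>The proof follows the method of spectral mappings. Let \<open>P\<close> be the matrix that carries the
  fundamental system of the second problem, formed by \<open>phi\<close> and the Weyl solution, to that of the
  first one. In terms of \<open>phi\<close> and \<open>S\<close> it depends on the spectral data only through the difference of
  the Weyl functions, which equals \<open>M_hat\<close>; hence its entries are holomorphic outside \<open>\<Gamma>\<^sub>N\<close>. Since
  the Weyl solution decays as fast as \<open>phi\<close> grows, the entries are \<open>O(sqrt \<bar>\<lambda>\<bar>)\<close> on the
  images of large squares in the plane of \<open>\<rho> = sqrt \<lambda>\<close>, so that each of them is a constant plus a
  Cauchy transform over \<open>\<Gamma>\<^sub>N\<close>. Comparing coefficients at infinity in the differential equation of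
  \<open>P\<close> yields these constants and the difference of the potentials.

  At \<open>x = \<pi>\<close> the Wronskian identity expresses \<open>r1\<close> and \<open>r2\<close> through \<open>Delta0\<close>, \<open>Delta1\<close> and the
  values of the solutions. Both characteristic functions have the same asymptotics, so their quotient
  is determined by their zeros and equals the product of the finitely many factors that differ; the
  formulas for \<open>r1\<close> and \<open>r2\<close> then follow from those for the entries of \<open>P\<close>.\<close>

section \<open>Absolutely continuous functions as indefinite integrals\<close>

text \<open>The potential is only square integrable, so the equation holds only almost everywhere
  and no expansion of the solutions in powers of \<open>1/\<rho>\<close> is at hand. Relations
  between functions of \<open>x\<close> are therefore kept in integrated form, and coefficients at
  infinity are compared by letting \<open>l\<close> grow under the integral sign, with an integrable
  bound uniform in \<open>l\<close>. The only sharp asymptotics concern the leading term of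
  \<open>Delta1\<close>; they come from a Riemann--Lebesgue estimate uniform in \<open>x\<close> and
  in the direction of \<open>\<rho>\<close>.

  The variable \<open>\<rho>\<close> is used because functions of \<open>\<rho>^2\<close> are even,
  and an even entire function of linear growth is constant; this is why a bound of order
  \<open>\<rho>\<close> is good enough for all four entries of \<open>P\<close>. The squares have
  half-integer half-sides, since there \<open>sin (pi \<rho>)\<close> is at least a quarter of
  \<open>exp (pi |Im \<rho>|)\<close>, which keeps \<open>Delta1\<close> away from zero.

  The constant terms of \<open>P11\<close> and \<open>P22\<close> are not visible from the bounds.
  They follow from \<open>det P = 1\<close>, the limit of the equation for \<open>P12\<close>,
  continuity in \<open>x\<close> and the value at \<open>x = 0\<close>.\<close>

lemma abs_cont_finite_family:
  assumes "abs_cont a b f" and "e > 0"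
  shows "\<exists>d>0. \<forall>(P::'i set) u v. finite P \<longrightarrow> (\<forall>i\<in>P. a \<le> u i \<and> u i \<le> v i \<and> v i \<le> b) \<longrightarrow>
           disjoint_family_on (\<lambda>i. {u i<..<v i}) P \<longrightarrow> (\<Sum>i\<in>P. v i - u i) < d \<longrightarrow>
           (\<Sum>i\<in>P. cmod (f (v i) - f (u i))) < e"
proof -
  obtain d where "d > 0" and d: "\<And>n u v. \<lbrakk>\<forall>i<n::nat. a \<le> u i \<and> u i \<le> v i \<and> v i \<le> b;
      disjoint_family_on (\<lambda>i. {u i<..<v i}) {..<n}; (\<Sum>i<n. v i - u i) < d\<rbrakk>
      \<Longrightarrow> (\<Sum>i<n. cmod (f (v i) - f (u i))) < e"
    using assms unfolding abs_cont_def by meson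
  show ?thesis
  proof (intro exI conjI allI impI)
    show "d > 0" by fact
    fix P :: "'i set" and u v
    assume P: "finite P" "\<forall>i\<in>P. a \<le> u i \<and> u i \<le> v i \<and> v i \<le> b"
      and disj: "disjoint_family_on (\<lambda>i. {u i<..<v i}) P" and less: "(\<Sum>i\<in>P. v i - u i) < d"
    \<comment> \<open>The definition of \<open>abs_cont\<close> speaks of initial segments of the
      naturals, whereas the cells of a tagged division are indexed by pairs; an enumeration bridges
      the two.\<close>
    obtain h where h: "bij_betw h {..<card P} P"
      using ex_bij_betw_nat_finite[OF \<open>finite P\<close>] by (auto simp: atLeast0LessThan)
    have inj: "inj_on h {..<card P}" and im: "h ` {..<card P} = P"
      using h by (auto simp: bij_betw_def)
    have "(\<Sum>i<card P. cmod (f (v (h i)) - f (u (h i)))) < e"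
    proof (rule d)
      show "\<forall>i<card P. a \<le> u (h i) \<and> u (h i) \<le> v (h i) \<and> v (h i) \<le> b"
        using P im by blast
      show "disjoint_family_on (\<lambda>i. {u (h i)<..<v (h i)}) {..<card P}"
        using disj inj im unfolding disjoint_family_on_def inj_on_def
        by (metis (no_types, lifting) image_eqI)
      show "(\<Sum>i<card P. v (h i) - u (h i)) < d"
        using sum.reindex_bij_betw[OF h, of "\<lambda>i. v i - u i"] less by simp
    qed
    then show "(\<Sum>i\<in>P. cmod (f (v i) - f (u i))) < e"
      using sum.reindex_bij_betw[OF h, of "\<lambda>i. cmod (f (v i) - f (u i))"] by simp
  qed
qed

lemma abs_cont_continuous_on:
  assumes "abs_cont a b f"
  shows "continuous_on {a..b} f"
proof (clarsimp simp: continuous_on_iff)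
  fix x e :: real
  assume x: "a \<le> x" "x \<le> b" and "0 < e"
  obtain d where "d > 0"
    and d: "\<forall>(P::nat set) u v. finite P \<longrightarrow>
           (\<forall>i\<in>P. a \<le> u i \<and> u i \<le> v i \<and> v i \<le> b) \<longrightarrow>
           disjoint_family_on (\<lambda>i. {u i<..<v i}) P \<longrightarrow> (\<Sum>i\<in>P. v i - u i) < d \<longrightarrow>
           (\<Sum>i\<in>P. cmod (f (v i) - f (u i))) < e"
    using abs_cont_finite_family[OF assms \<open>0 < e\<close>] by blast
  have "dist (f y) (f x) < e" if "a \<le> y" "y \<le> b" "dist y x < d" for y
  proof (cases "x \<le> y")
    case True
    then show ?thesis
      using d[rule_format, of "{0}" "\<lambda>_. x" "\<lambda>_. y"] that x by (simp add: disjoint_family_on_def dist_norm)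
  next
    case False
    then show ?thesis
      using d[rule_format, of "{0}" "\<lambda>_. y" "\<lambda>_. x"] that x
      by (simp add: disjoint_family_on_def dist_norm norm_minus_commute)
  qed
  then show "\<exists>d>0. \<forall>x'\<in>{a..b}. dist x' x < d \<longrightarrow> dist (f x') (f x) < e"
    using \<open>d > 0\<close> by auto
qed

text \<open>Cells of a division overlap in null sets only, so their total length is the measure of
  their union, which lies in \<open>U\<close>. In the application \<open>U\<close> is an open set of
  small measure around the exceptional set.\<close>

lemma sum_content_tagged_division_le:
  fixes U :: "real set"
  assumes p: "p tagged_division_of {a..b}" and q: "q \<subseteq> p" and U: "U \<in> lmeasurable"
    and sub: "\<And>x K. (x, K) \<in> q \<Longrightarrow> K \<subseteq> U"
  shows "(\<Sum>(x, K)\<in>q. measure lborel K) \<le> measure lebesgue U"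
proof -
  have fin: "finite q" using tagged_division_ofD(1)[OF p] q finite_subset by blast
  have meas: "snd z \<in> lmeasurable" if "z \<in> q" for z
  proof -
    have "(fst z, snd z) \<in> p" using that q by auto
    then obtain c d where "snd z = cbox c d" using tagged_division_ofD(4)[OF p] by blast
    then show ?thesis by simp
  qed
  have "(\<Sum>(x, K)\<in>q. measure lborel K) = (\<Sum>z\<in>q. measure lebesgue (snd z))"
  proof (rule sum.cong[OF refl])
    fix z assume "z \<in> q"
    then obtain c d where "snd z = cbox c d"
      using tagged_division_ofD(4)[OF p, of "fst z" "snd z"] q by auto
    then show "(case z of (x, K) \<Rightarrow> measure lborel K) = measure lebesgue (snd z)"
      by (cases z) (simp add: measure_def)
  qed
  also have "\<dots> = measure lebesgue (\<Union>(snd ` q))"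
  proof (rule measure_negligible_finite_Union_image[OF fin meas, symmetric])
    show "pairwise (\<lambda>x y. negligible (snd x \<inter> snd y)) q"
    proof (rule pairwiseI)
      fix z w assume zw: "z \<in> q" "w \<in> q" "z \<noteq> w"
      obtain x K y L where zw': "z = (x, K)" "w = (y, L)" by (cases z, cases w)
      then have z: "(x, K) \<in> q" "(y, L) \<in> q" "x = y \<longrightarrow> K \<noteq> L" using zw by auto
      obtain c d c' d' where KL: "K = cbox c d" "L = cbox c' d'"
        using tagged_division_ofD(4)[OF p] z q by (meson subsetD)
      have "interior K \<inter> interior L = {}"
        using tagged_division_ofD(5)[OF p, of x K y L] z q by auto
      \<comment> \<open>The interiors are disjoint, so the common part is a closed interval with
        empty open box, hence at most a point.\<close>
      then have "box (max c c') (min d d') = {}" using KL by (auto simp: box_real)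
      then have "negligible (cbox (max c c') (min d d'))"
        unfolding negligible_interval .
      moreover have "K \<inter> L = cbox (max c c') (min d d')" using KL by auto
      ultimately show "negligible (snd z \<inter> snd w)" using zw' by simp
    qed
  qed
  also have "\<dots> \<le> measure lebesgue U"
  proof (rule measure_mono_fmeasurable)
    show "\<Union>(snd ` q) \<subseteq> U" using sub by fastforce
    show "\<Union>(snd ` q) \<in> sets lebesgue"
      using fmeasurable.finite_UN[OF fin, of snd] meas by (simp add: fmeasurableD)
  qed (rule U)
  finally show ?thesis .
qed

text \<open>The gauge controls the error of the derivative at tags outside the null set; intervals tagged
  inside the null set have small total length and contribute little by absolute continuity.\<close>

lemma abs_cont_has_integral:
  assumes ac: "abs_cont a b f" and "a \<le> b" and N: "negligible N"
    and der: "\<And>x. x \<in> {a..b} - N \<Longrightarrow> (f has_vector_derivative g x) (at x within {a..b})"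
  shows "(g has_integral (f b - f a)) {a..b}"
proof -
  \<comment> \<open>With the value 0 on \<open>N\<close>, cells tagged in \<open>N\<close>
    contribute to the error only through the increments of \<open>f\<close>, which absolute
    continuity controls.\<close>
  define g' where "g' x = (if x \<in> N then 0 else g x)" for x
  have "(g' has_integral (f b - f a)) {a..b}"
    unfolding has_integral_real
  proof (intro allI impI)
    fix e :: real assume "e > 0"
    \<comment> \<open>Errors at tags outside \<open>N\<close> add up to at most
      \<open>e1 * (b - a)\<close>, which is at most \<open>e / 2\<close>; the summand 1 covers the
      case \<open>a = b\<close>.\<close>
    define e1 where "e1 = e / (2 * (b - a + 1))"
    have "e1 > 0" using \<open>e > 0\<close> \<open>a \<le> b\<close> by (simp add: e1_def)
    have "\<exists>d>0. \<forall>y\<in>{a..b}. norm (y-x) < d \<longrightarrow> norm (f y - f x - (y-x) *\<^sub>R g x) \<le> e1 * norm (y-x)"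
      if "x \<in> {a..b} - N" for x
      using der[OF that] \<open>e1 > 0\<close> unfolding has_vector_derivative_def has_derivative_within_alt by blast
    then have "\<forall>x. \<exists>d>0. x \<in> {a..b} - N \<longrightarrow>
         (\<forall>y\<in>{a..b}. norm (y-x) < d \<longrightarrow> norm (f y - f x - (y-x) *\<^sub>R g x) \<le> e1 * norm (y-x))"
      using zero_less_one by blast
    then obtain d where d: "\<And>x. 0 < d x"
      "\<And>x y. \<lbrakk>x \<in> {a..b} - N; y \<in> {a..b}; norm (y-x) < d x\<rbrakk>
                        \<Longrightarrow> norm (f y - f x - (y-x) *\<^sub>R g x) \<le> e1 * norm (y-x)"
      by metis
    obtain \<delta> where "\<delta> > 0" and \<delta>: "\<forall>(P::(real \<times> real set) set) u v. finite P \<longrightarrow>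
           (\<forall>i\<in>P. a \<le> u i \<and> u i \<le> v i \<and> v i \<le> b) \<longrightarrow>
           disjoint_family_on (\<lambda>i. {u i<..<v i}) P \<longrightarrow> (\<Sum>i\<in>P. v i - u i) < \<delta> \<longrightarrow>
           (\<Sum>i\<in>P. cmod (f (v i) - f (u i))) < e / 2"
      using abs_cont_finite_family[OF ac half_gt_zero[OF \<open>e > 0\<close>]] by blast
    have Nl: "N \<in> sets lebesgue" "emeasure lebesgue N = 0"
      using N by (auto simp: negligible_iff_null_sets null_sets_def)
    obtain U where U: "open U" "N \<subseteq> U" "U - N \<in> lmeasurable" "emeasure lebesgue (U - N) < \<delta>"
      using sets_lebesgue_outer_open[OF Nl(1) \<open>\<delta> > 0\<close>] by metis
    have nm: "N \<in> lmeasurable"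
      using N negligible_imp_measurable by blast
    have UN: "U = (U - N) \<union> N" using U by blast
    have Um: "U \<in> lmeasurable"
      by (subst UN) (intro fmeasurable.Un U nm)
    have "emeasure lebesgue U \<le> emeasure lebesgue (U - N) + emeasure lebesgue N"
      by (subst UN) (rule emeasure_subadditive, use U Nl in auto)
    then have "emeasure lebesgue U < \<delta>" using U Nl by auto
    then have Ul: "measure lebesgue U < \<delta>"
      using Um \<open>\<delta> > 0\<close> by (simp add: emeasure_eq_measure2 ennreal_less_iff)
    have "\<forall>x. \<exists>r>0. x \<in> N \<longrightarrow> ball x r \<subseteq> U"
      using U by (meson openE subsetD zero_less_one)
    then obtain r where r: "\<And>x. r x > 0" "\<And>x. x \<in> N \<Longrightarrow> ball x (r x) \<subseteq> U"
      by metis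
    define \<gamma> where "\<gamma> x = (if x \<in> N then ball x (r x) else ball x (d x))" for x
    show "\<exists>\<gamma>. gauge \<gamma> \<and> (\<forall>p. p tagged_division_of {a..b} \<and> \<gamma> fine p \<longrightarrow>
        norm ((\<Sum>(x, k)\<in>p. measure lborel k *\<^sub>R g' x) - (f b - f a)) < e)"
    proof (intro exI conjI allI impI)
      show "gauge \<gamma>"
        using d(1) r(1) by (auto simp: gauge_def \<gamma>_def)
    next
      fix p assume *: "p tagged_division_of {a..b} \<and> \<gamma> fine p"
      then have p: "p tagged_division_of {a..b}" and fine: "\<gamma> fine p" by auto
      have fin: "finite p" using p by blast
      have ba: "b - a = (\<Sum>(x,K)\<in>p. Sup K - Inf K)" "f b - f a = (\<Sum>(x,K)\<in>p. f(Sup K) - f(Inf K))"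
        using additive_tagged_division_1[OF \<open>a \<le> b\<close> p, of "\<lambda>x. x"]
          additive_tagged_division_1[OF \<open>a \<le> b\<close> p, of f] by auto
      define p1 where "p1 = {z \<in> p. fst z \<in> N}"
      define E where "E z = measure lborel (snd z) *\<^sub>R g' (fst z) - (f (Sup (snd z)) - f (Inf (snd z)))" for z
      have iv: "\<exists>u v. K = {u..v} \<and> u \<le> v \<and> a \<le> u \<and> v \<le> b \<and> x \<in> {u..v} \<and> Inf K = u \<and> Sup K = v"
        if xK: "(x, K) \<in> p" for x K
      proof -
        obtain u v where k: "K = cbox u v" using p xK by blast
        moreover have "x \<in> K" "K \<subseteq> {a..b}" using p xK by blast+
        moreover have "u \<le> v" using \<open>x \<in> K\<close> k by auto
        ultimately show ?thesis by (intro exI[of _ u] exI[of _ v]) auto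
      qed
      have b1: "(\<Sum>z\<in>p1. norm (E z)) < e / 2"
      proof -
        have "(\<Sum>z\<in>p1. norm (E z)) = (\<Sum>z\<in>p1. cmod (f (Sup (snd z)) - f (Inf (snd z))))"
          by (rule sum.cong) (auto simp: p1_def E_def g'_def norm_minus_commute)
        also have "\<dots> < e / 2"
        proof (rule \<delta>[rule_format])
          show "finite p1" using fin by (simp add: p1_def)
          show "a \<le> Inf (snd i) \<and> Inf (snd i) \<le> Sup (snd i) \<and> Sup (snd i) \<le> b" if "i \<in> p1" for i
            using iv[of "fst i" "snd i"] that by (auto simp: p1_def)
          show "disjoint_family_on (\<lambda>i. {Inf (snd i)<..<Sup (snd i)}) p1"
            unfolding disjoint_family_on_def
          proof (intro ballI impI)
            fix i j assume ij: "i \<in> p1" "j \<in> p1" "i \<noteq> j"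
            have "interior (snd i) \<inter> interior (snd j) = {}"
              using tagged_division_ofD(5)[OF p, of "fst i" "snd i" "fst j" "snd j"] ij
              by (auto simp: p1_def prod_eq_iff)
            moreover have "interior (snd k) = {Inf (snd k)<..<Sup (snd k)}" if k: "k \<in> p1" for k
            proof -
              obtain u v where "snd k = {u..v}" "Inf (snd k) = u" "Sup (snd k) = v"
                using iv[of "fst k" "snd k"] k by (auto simp: p1_def)
              then show ?thesis by simp
            qed
            ultimately show "{Inf (snd i)<..<Sup (snd i)} \<inter> {Inf (snd j)<..<Sup (snd j)} = {}"
              using ij by simp
          qed
          have "(\<Sum>i\<in>p1. Sup (snd i) - Inf (snd i)) = (\<Sum>(x, K)\<in>p1. measure lborel K)"
          proof (rule sum.cong[OF refl])
            fix z assume z: "z \<in> p1"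
            obtain u v where "snd z = {u..v}" "u \<le> v" "Inf (snd z) = u" "Sup (snd z) = v"
              using iv[of "fst z" "snd z"] z by (auto simp: p1_def)
            then show "Sup (snd z) - Inf (snd z) = (case z of (x, K) \<Rightarrow> measure lborel K)"
              by (cases z) simp
          qed
          also have "\<dots> \<le> measure lebesgue U"
          proof (rule sum_content_tagged_division_le[OF p _ Um])
            show "p1 \<subseteq> p" by (auto simp: p1_def)
            fix x K assume "(x, K) \<in> p1"
            then have "(x, K) \<in> p" "x \<in> N" by (auto simp: p1_def)
            then have "K \<subseteq> ball x (r x)" using fineD[OF fine, of x K] by (simp add: \<gamma>_def)
            then show "K \<subseteq> U" using r(2)[OF \<open>x \<in> N\<close>] by blast
          qed
          finally show "(\<Sum>i\<in>p1. Sup (snd i) - Inf (snd i)) < \<delta>" using Ul by simp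
        qed
        finally show ?thesis .
      qed
      have b2: "norm (E z) \<le> e1 * (Sup (snd z) - Inf (snd z))" if z: "z \<in> p - p1" for z
      proof -
        obtain x K where zx: "z = (x, K)" by (cases z)
        have xK: "(x, K) \<in> p" and xN: "x \<notin> N" using z zx by (auto simp: p1_def)
        obtain u v where K: "K = {u..v}" "u \<le> v" "a \<le> u" "v \<le> b" "x \<in> {u..v}" "Inf K = u" "Sup K = v"
          using iv[OF xK] by blast
        have xab: "x \<in> {a..b} - N" using K xN by auto
        have "K \<subseteq> ball x (d x)" using fineD[OF fine xK] xN by (simp add: \<gamma>_def)
        moreover have "u \<in> K" "v \<in> K" using K by auto
        ultimately have "u \<in> ball x (d x)" "v \<in> ball x (d x)" by blast+
        then have 1: "norm (f u - f x - (u - x) *\<^sub>R g x) \<le> e1 * norm (u - x)"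
          and 2: "norm (f v - f x - (v - x) *\<^sub>R g x) \<le> e1 * norm (v - x)"
          using d(2)[OF xab, of u] d(2)[OF xab, of v] K by (auto simp: dist_real_def)
        \<comment> \<open>Straddling: the increment over a cell is compared with the linear
          approximation at its tag from both ends, and since the tag lies between the ends the two
          errors are bounded by \<open>e1\<close> times the length of the cell.\<close>
        have "E z = (f u - f x - (u - x) *\<^sub>R g x) - (f v - f x - (v - x) *\<^sub>R g x)"
          using K zx xN by (simp add: E_def g'_def algebra_simps)
        then have "norm (E z) \<le> e1 * norm (u - x) + e1 * norm (v - x)"
          using norm_triangle_ineq4[of "f u - f x - (u - x) *\<^sub>R g x" "f v - f x - (v - x) *\<^sub>R g x"] 1 2
          by simp
        also have "\<dots> = e1 * (Sup (snd z) - Inf (snd z))"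
          using K zx by (auto simp: algebra_simps)
        finally show ?thesis .
      qed
      have "(\<Sum>(x, k)\<in>p. measure lborel k *\<^sub>R g' x) - (f b - f a) = (\<Sum>z\<in>p. E z)"
        by (simp add: ba(2) E_def sum_subtractf[symmetric] split_def)
      also have "\<dots> = (\<Sum>z\<in>p1. E z) + (\<Sum>z\<in>p - p1. E z)"
        using fin by (subst sum.subset_diff[of p1 p]) (auto simp: p1_def)
      finally have eq: "(\<Sum>(x, k)\<in>p. measure lborel k *\<^sub>R g' x) - (f b - f a)
          = (\<Sum>z\<in>p1. E z) + (\<Sum>z\<in>p - p1. E z)" .
      have "norm ((\<Sum>(x, k)\<in>p. measure lborel k *\<^sub>R g' x) - (f b - f a))
          \<le> (\<Sum>z\<in>p1. norm (E z)) + (\<Sum>z\<in>p - p1. norm (E z))"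
        unfolding eq by (rule order_trans[OF norm_triangle_ineq add_mono[OF norm_sum norm_sum]])
      also have "(\<Sum>z\<in>p - p1. norm (E z)) \<le> (\<Sum>z\<in>p - p1. e1 * (Sup (snd z) - Inf (snd z)))"
        by (rule sum_mono) (rule b2)
      also have "\<dots> \<le> (\<Sum>z\<in>p. e1 * (Sup (snd z) - Inf (snd z)))"
      proof (rule sum_mono2[OF fin])
        fix z assume "z \<in> p - (p - p1)"
        then show "0 \<le> e1 * (Sup (snd z) - Inf (snd z))"
          using iv[of "fst z" "snd z"] \<open>e1 > 0\<close> by auto
      qed auto
      also have "\<dots> = e1 * (b - a)"
        by (simp add: ba(1) sum_distrib_left split_def)
      also have "\<dots> \<le> e / 2"
        using \<open>a \<le> b\<close> \<open>e > 0\<close> by (simp add: e1_def field_simps)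
      finally show "norm ((\<Sum>(x, k)\<in>p. measure lborel k *\<^sub>R g' x) - (f b - f a)) < e"
        using b1 by linarith
    qed
  qed
  then show ?thesis
    by (rule has_integral_spike[OF N, rotated]) (simp add: g'_def)
qed

text \<open>By disjointness at most one of the restrictions of \<open>k\<close> to the open
  intervals is nonzero at a point, so their sum is pointwise at most \<open>k\<close>; the endpoints
  do not affect the integrals.\<close>

lemma sum_integral_disjoint_le:
  fixes k :: "real \<Rightarrow> real"
  assumes k: "k integrable_on {a..b}" and pos: "\<And>x. x \<in> {a..b} \<Longrightarrow> 0 \<le> k x"
    and fin: "finite P" and uv: "\<And>i. i \<in> P \<Longrightarrow> a \<le> u i \<and> u i \<le> v i \<and> v i \<le> b"
    and disj: "disjoint_family_on (\<lambda>i. {u i<..<v i}) P"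
  shows "(\<Sum>i\<in>P. integral {u i..v i} k) \<le> integral {a..b} k"
proof -
  define q where "q i x = (if x \<in> {u i<..<v i} then k x else 0)" for i x
  have q: "(q i has_integral integral {u i..v i} k) {a..b}" if i: "i \<in> P" for i
  proof -
    have "k integrable_on {u i..v i}"
      by (rule integrable_on_subinterval[OF k]) (use uv[OF i] in auto)
    then have "(k has_integral integral {u i..v i} k) {u i<..<v i}"
      by (simp add: integrable_integral has_integral_Icc_iff_Ioo[symmetric])
    then show ?thesis
      unfolding q_def by (subst has_integral_restrict) (use uv[OF i] in auto)
  qed
  have "((\<lambda>x. \<Sum>i\<in>P. q i x) has_integral (\<Sum>i\<in>P. integral {u i..v i} k)) {a..b}"
    by (rule has_integral_sum[OF fin q])
  moreover have "(\<Sum>i\<in>P. q i x) \<le> k x" if x: "x \<in> {a..b}" for x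
  proof (cases "\<exists>j\<in>P. x \<in> {u j<..<v j}")
    case True
    then obtain j where j: "j \<in> P" "x \<in> {u j<..<v j}" by blast
    have "q i x = 0" if "i \<in> P - {j}" for i
    proof -
      have "{u i<..<v i} \<inter> {u j<..<v j} = {}"
        using disj that j unfolding disjoint_family_on_def by blast
      then have "x \<notin> {u i<..<v i}" using j by blast
      then show ?thesis unfolding q_def by (rule if_not_P)
    qed
    then have "(\<Sum>i\<in>P. q i x) = q j x"
      using fin j by (subst sum.remove[of P j]) auto
    then show ?thesis using j by (simp add: q_def)
  next
    case False
    then have "(\<Sum>i\<in>P. q i x) = 0" by (auto simp: q_def intro!: sum.neutral)
    then show ?thesis using pos[OF x] by simp
  qed
  ultimately show ?thesis
    using has_integral_le[OF _ integrable_integral[OF k]] by blast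
qed

text \<open>The norm of \<open>f\<close> is split into a bounded part \<open>min (norm f) n\<close>
  and a rest of integral below \<open>e / 2\<close>. The bounded part contributes at most
  \<open>n\<close> times the total length of the intervals, and the rest is bounded by its full
  integral.\<close>

lemma abs_cont_integral:
  fixes f :: "real \<Rightarrow> complex"
  assumes f: "f absolutely_integrable_on {a..b}"
  shows "abs_cont a b (\<lambda>x. integral {a..x} f)"
  unfolding abs_cont_def
proof (intro allI impI)
  fix e :: real assume "e > 0"
  have fi: "f integrable_on {a..b}" and nf: "(\<lambda>x. norm (f x)) integrable_on {a..b}"
    using f by (auto simp: absolutely_integrable_on_def)
  define h where "h n x = min (norm (f x)) (real n)" for n x
  have h: "h n integrable_on {a..b}" for n
  proof -
    have "(\<lambda>x. norm (f x)) absolutely_integrable_on {a..b}"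
      using f by (rule absolutely_integrable_norm[unfolded o_def])
    then show ?thesis unfolding h_def
      by (intro set_lebesgue_integral_eq_integral(1) absolutely_integrable_min_1) auto
  qed
  have "(\<lambda>n. integral {a..b} (h n)) \<longlonglongrightarrow> integral {a..b} (\<lambda>x. norm (f x))"
  proof (rule dominated_convergence(2)[OF h nf])
    show "norm (h k x) \<le> norm (f x)" for k x by (auto simp: h_def)
    show "(\<lambda>k. h k x) \<longlonglongrightarrow> norm (f x)" for x
    proof (rule tendsto_eventually)
      obtain m :: nat where "norm (f x) \<le> real m" using real_arch_simple by blast
      then have "\<forall>k\<ge>m. h k x = norm (f x)" unfolding h_def by (auto simp: min_def)
      then show "\<forall>\<^sub>F k in sequentially. h k x = norm (f x)"
        using eventually_sequentially by blast
    qed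
  qed
  then have "\<forall>\<^sub>F n in sequentially. \<bar>integral {a..b} (h n) - integral {a..b} (\<lambda>x. norm (f x))\<bar> < e / 2"
    using \<open>e > 0\<close> tendstoD[where e = "e / 2"] by (fastforce simp: dist_real_def)
  then obtain n where n: "\<bar>integral {a..b} (h n) - integral {a..b} (\<lambda>x. norm (f x))\<bar> < e / 2"
    by (meson eventually_sequentially order_refl)
  define k where "k x = norm (f x) - h n x" for x
  have k: "k integrable_on {a..b}" unfolding k_def by (rule integrable_diff[OF nf h])
  have kint: "integral {a..b} k < e / 2"
    using n integral_diff[OF nf h[of n]] unfolding k_def by arith
  show "\<exists>\<delta>>0. \<forall>(m::nat) u v. (\<forall>i<m. a \<le> u i \<and> u i \<le> v i \<and> v i \<le> b) \<and>
          disjoint_family_on (\<lambda>i. {u i<..<v i}) {..<m} \<and> (\<Sum>i<m. v i - u i) < \<delta> \<longrightarrow>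
          (\<Sum>i<m. cmod (integral {a..v i} f - integral {a..u i} f)) < e"
  proof (intro exI[of _ "e / (2 * (n + 1))"] conjI allI impI)
    show "e / (2 * (n + 1)) > 0" using \<open>e > 0\<close> by simp
    fix m :: nat and u v :: "nat \<Rightarrow> real"
    assume *: "(\<forall>i<m. a \<le> u i \<and> u i \<le> v i \<and> v i \<le> b) \<and>
          disjoint_family_on (\<lambda>i. {u i<..<v i}) {..<m} \<and> (\<Sum>i<m. v i - u i) < e / (2 * (n + 1))"
    then have uv: "\<And>i. i \<in> {..<m} \<Longrightarrow> a \<le> u i \<and> u i \<le> v i \<and> v i \<le> b" by auto
    have 1: "cmod (integral {a..v i} f - integral {a..u i} f) \<le> integral {u i..v i} k + n * (v i - u i)"
      if i: "i \<in> {..<m}" for i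
    proof -
      have sub: "{u i..v i} \<subseteq> {a..b}" using uv[OF i] by auto
      have "f integrable_on {a..v i}"
        by (rule integrable_on_subinterval[OF fi]) (use uv[OF i] in auto)
      then have "integral {a..v i} f - integral {a..u i} f = integral {u i..v i} f"
        using Henstock_Kurzweil_Integration.integral_combine[of a "u i" "v i" f] uv[OF i]
        by (simp add: algebra_simps)
      also have "cmod \<dots> \<le> integral {u i..v i} (\<lambda>x. k x + n)"
      proof (rule integral_norm_bound_integral)
        show "f integrable_on {u i..v i}" by (rule integrable_on_subinterval[OF fi sub])
        show "(\<lambda>x. k x + n) integrable_on {u i..v i}"
          by (intro integrable_add integrable_on_subinterval[OF k sub]) auto
        show "norm (f x) \<le> k x + n" for x by (auto simp: k_def h_def)
      qed
      also have "\<dots> = integral {u i..v i} k + n * (v i - u i)"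
        using uv[OF i] integrable_on_subinterval[OF k sub] by (subst integral_add) auto
      finally show ?thesis .
    qed
    have "(\<Sum>i<m. cmod (integral {a..v i} f - integral {a..u i} f))
        \<le> (\<Sum>i<m. integral {u i..v i} k + n * (v i - u i))"
      by (rule sum_mono[OF 1])
    also have "\<dots> = (\<Sum>i<m. integral {u i..v i} k) + n * (\<Sum>i<m. v i - u i)"
      by (simp add: sum.distrib sum_distrib_left)
    also have "(\<Sum>i<m. integral {u i..v i} k) \<le> integral {a..b} k"
      by (rule sum_integral_disjoint_le[OF k _ _ uv]) (use * in \<open>auto simp: k_def h_def\<close>)
    also have "real n * (\<Sum>i<m. v i - u i) \<le> n * (e / (2 * (n + 1)))"
      using * by (intro mult_left_mono) auto
    also have "\<dots> \<le> e / 2"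
      using \<open>e > 0\<close> by (simp add: field_simps)
    finally show "(\<Sum>i<m. cmod (integral {a..v i} f - integral {a..u i} f)) < e"
      using kint by simp
  qed
qed

lemma negligible_reflect_image:
  fixes N :: "real set"
  assumes "negligible N"
  shows "negligible ((\<lambda>x. c - x) ` N)"
  by (rule negligible_differentiable_image_negligible[OF _ assms])
    (auto intro!: derivative_intros simp: differentiable_on_def)

text \<open>Averages of \<open>g\<close> over intervals to the right of \<open>x\<close> converge
  for almost every \<open>x\<close>. The same statement for the reflected function handles intervals
  to the left, and together they give the two-sided derivative.\<close>

lemma integral_has_vector_derivative_AE:
  fixes f :: "real \<Rightarrow> 'a::euclidean_space"
  assumes f: "f integrable_on {a..b}"
  shows "\<exists>N. negligible N \<and>
           (\<forall>x\<in>{a<..<b} - N. ((\<lambda>x. integral {a..x} f) has_vector_derivative f x) (at x))"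
proof -
  define g where "g x = (if x \<in> {a..b} then f x else 0)" for x
  have gU: "g integrable_on UNIV"
    using f integrable_restrict_UNIV[of "{a..b}" f] unfolding g_def by blast
  have g: "g integrable_on cbox c d" for c d
    by (rule integrable_on_subcbox[OF gU]) auto
  have g': "(\<lambda>x. g (- x)) integrable_on cbox c d" for c d
    using g[of "- d" "- c"] integrable_reflect[of g "-c" "-d"] by simp
  obtain N1 where N1: "negligible N1" "\<And>x e. \<lbrakk>x \<notin> N1; 0 < e\<rbrakk> \<Longrightarrow>
       \<exists>d>0. \<forall>h. 0 < h \<and> h < d \<longrightarrow> norm (integral (cbox x (x + h *\<^sub>R One)) g /\<^sub>R h ^ DIM(real) - g x) < e"
    using integrable_ccontinuous_explicit[of g] g by metis
  obtain N2 where N2: "negligible N2" "\<And>x e. \<lbrakk>x \<notin> N2; 0 < e\<rbrakk> \<Longrightarrow>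
       \<exists>d>0. \<forall>h. 0 < h \<and> h < d \<longrightarrow>
         norm (integral (cbox x (x + h *\<^sub>R One)) (\<lambda>x. g (-x)) /\<^sub>R h ^ DIM(real) - g (-x)) < e"
    using integrable_ccontinuous_explicit[of "\<lambda>x. g (- x)"] g' by metis
  have "negligible (N1 \<union> (\<lambda>x. 0 - x) ` N2)"
    using N1(1) N2(1) by (intro negligible_Un negligible_reflect_image)
  moreover have "((\<lambda>x. integral {a..x} f) has_vector_derivative f x) (at x)"
    if x: "x \<in> {a<..<b} - (N1 \<union> (\<lambda>x. 0 - x) ` N2)" for x
    unfolding has_vector_derivative_def has_derivative_at_alt
  proof (intro conjI allI impI)
    show "bounded_linear (\<lambda>h. h *\<^sub>R f x)" by (rule bounded_linear_scaleR_left)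
    fix e :: real assume "e > 0"
    have xN: "x \<notin> N1" "- x \<notin> N2" using x by force+
    obtain d1 where d1: "d1 > 0" "\<And>h. 0 < h \<and> h < d1 \<Longrightarrow> norm (integral {x..x + h} g /\<^sub>R h - g x) < e"
      using N1(2)[OF xN(1) \<open>e > 0\<close>] by auto
    obtain d2 where d2: "d2 > 0"
      "\<And>h. 0 < h \<and> h < d2 \<Longrightarrow> norm (integral {-x..-x + h} (\<lambda>x. g (-x)) /\<^sub>R h - g x) < e"
      using N2(2)[OF xN(2) \<open>e > 0\<close>] by auto
    \<comment> \<open>The last two entries keep the moving endpoint inside \<open>{a..b}\<close>,
      where \<open>g\<close> agrees with \<open>f\<close>.\<close>
    define d where "d = Min {d1, d2, x - a, b - x}"
    have d: "d > 0" "d \<le> d1" "d \<le> d2" "d \<le> x - a" "d \<le> b - x"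
      using d1 d2 x by (auto simp: d_def)
    have *: "norm (integral {c..c + h} f - h *\<^sub>R f x) \<le> e * h"
      if "h > 0" "a \<le> c" "c + h \<le> b" "norm (integral {c..c + h} g /\<^sub>R h - g x) < e" for c h
    proof -
      have "integral {c..c + h} g = integral {c..c + h} f"
        by (rule integral_cong) (use that in \<open>auto simp: g_def\<close>)
      moreover have "g x = f x" using x by (simp add: g_def)
      ultimately have "norm (integral {c..c + h} f /\<^sub>R h - f x) < e" using that by simp
      then have "h * norm (integral {c..c + h} f /\<^sub>R h - f x) \<le> h * e"
        using \<open>h > 0\<close> by (intro mult_left_mono) auto
      also have "h * norm (integral {c..c + h} f /\<^sub>R h - f x) = norm (h *\<^sub>R (integral {c..c + h} f /\<^sub>R h - f x))"
        using \<open>h > 0\<close> by simp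
      also have "h *\<^sub>R (integral {c..c + h} f /\<^sub>R h - f x) = integral {c..c + h} f - h *\<^sub>R f x"
        using \<open>h > 0\<close> by (simp add: scaleR_diff_right)
      finally show ?thesis by (simp add: mult.commute)
    qed
    have comb: "integral {a..v} f - integral {a..u} f = integral {u..v} f"
      if "a \<le> u" "u \<le> v" "v \<le> b" for u v
      using Henstock_Kurzweil_Integration.integral_combine[of a u v f] that
        integrable_on_subinterval[OF f, of a v] by (auto simp: algebra_simps)
    show "\<exists>d>0. \<forall>y. norm (y - x) < d \<longrightarrow>
        norm (integral {a..y} f - integral {a..x} f - (y - x) *\<^sub>R f x) \<le> e * norm (y - x)"
    proof (intro exI[of _ d] conjI allI impI)
      show "d > 0" by fact
      fix y assume y: "norm (y - x) < d"
      consider "y = x" | "y > x" | "y < x" by linarith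
      then show "norm (integral {a..y} f - integral {a..x} f - (y - x) *\<^sub>R f x) \<le> e * norm (y - x)"
      proof cases
        case 2
        then show ?thesis
          using *[of "y - x" x] d1(2)[of "y - x"] comb[of x y] y d x by auto
      next
        case 3
        have "integral {-x..-x + (x - y)} (\<lambda>x. g (-x)) = integral {y..x} g"
          using integral_reflect_real[of x y g] by simp
        then have "norm (integral {y..y + (x - y)} g /\<^sub>R (x - y) - g x) < e"
          using d2(2)[of "x - y"] 3 y d by auto
        then have "norm (integral {y..x} f - (x - y) *\<^sub>R f x) \<le> e * (x - y)"
          using *[of "x - y" y] 3 y d x by auto
        moreover have "integral {a..y} f - integral {a..x} f - (y - x) *\<^sub>R f x
            = - (integral {y..x} f - (x - y) *\<^sub>R f x)"
          using comb[of y x] 3 y d x by (auto simp: algebra_simps)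
        ultimately show ?thesis using 3 by (simp only: norm_minus_cancel) auto
      qed auto
    qed
  qed
  ultimately show ?thesis by blast
qed

text \<open>An absolutely continuous function is carried along with a representative of its
  derivative. Differential equations that hold almost everywhere become statements without
  exceptional sets, closed under sums, products, exponentials and dominated limits.\<close>

definition primitive_on :: "real \<Rightarrow> real \<Rightarrow> (real \<Rightarrow> complex) \<Rightarrow> (real \<Rightarrow> complex) \<Rightarrow> bool" where
  "primitive_on a b F f \<longleftrightarrow>
     f absolutely_integrable_on {a..b} \<and> (\<forall>x\<in>{a..b}. F x = F a + integral {a..x} f)"

lemma primitive_onD:
  assumes "primitive_on a b F f" and "x \<in> {a..b}"
  shows "F x = F a + integral {a..x} f"
  using assms unfolding primitive_on_def by blast

text \<open>A single criterion for products, exponentials and indefinite integrals: increments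
  dominated by those of two absolutely continuous functions.\<close>

lemma abs_cont_Lipschitz:
  fixes f g h :: "real \<Rightarrow> complex"
  assumes g: "abs_cont a b g" and h: "abs_cont a b h" and "A \<ge> 0"
    and le: "\<And>x y. x \<in> {a..b} \<Longrightarrow> y \<in> {a..b} \<Longrightarrow>
       cmod (f x - f y) \<le> A * (cmod (g x - g y) + cmod (h x - h y))"
  shows "abs_cont a b f"
  unfolding abs_cont_def
proof (intro allI impI)
  fix e :: real assume "e > 0"
  define e' where "e' = e / (2 * (A + 1))"
  have "e' > 0" using \<open>e > 0\<close> \<open>A \<ge> 0\<close> by (simp add: e'_def)
  obtain d1 where "d1 > 0" and d1: "\<And>n u v. (\<forall>i<n::nat. a \<le> u i \<and> u i \<le> v i \<and> v i \<le> b) \<and>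
      disjoint_family_on (\<lambda>i. {u i<..<v i}) {..<n} \<and> (\<Sum>i<n. v i - u i) < d1
      \<Longrightarrow> (\<Sum>i<n. cmod (g (v i) - g (u i))) < e'"
    using g \<open>e' > 0\<close> unfolding abs_cont_def by meson
  obtain d2 where "d2 > 0" and d2: "\<And>n u v. (\<forall>i<n::nat. a \<le> u i \<and> u i \<le> v i \<and> v i \<le> b) \<and>
      disjoint_family_on (\<lambda>i. {u i<..<v i}) {..<n} \<and> (\<Sum>i<n. v i - u i) < d2
      \<Longrightarrow> (\<Sum>i<n. cmod (h (v i) - h (u i))) < e'"
    using h \<open>e' > 0\<close> unfolding abs_cont_def by meson
  have "(\<Sum>i<n. cmod (f (v i) - f (u i))) < e"
    if *: "(\<forall>i<n::nat. a \<le> u i \<and> u i \<le> v i \<and> v i \<le> b) \<and>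
      disjoint_family_on (\<lambda>i. {u i<..<v i}) {..<n} \<and> (\<Sum>i<n. v i - u i) < min d1 d2" for n u v
  proof -
    have "(\<Sum>i<n. cmod (f (v i) - f (u i)))
        \<le> (\<Sum>i<n. A * (cmod (g (v i) - g (u i)) + cmod (h (v i) - h (u i))))"
      by (rule sum_mono, rule le) (use * in \<open>force+\<close>)
    also have "\<dots> = A * ((\<Sum>i<n. cmod (g (v i) - g (u i))) + (\<Sum>i<n. cmod (h (v i) - h (u i))))"
      by (simp add: sum.distrib sum_distrib_left[symmetric])
    also have "\<dots> \<le> A * (e' + e')"
      using d1[of n u v] d2[of n u v] * \<open>A \<ge> 0\<close> by (intro mult_left_mono) auto
    also have "\<dots> < (A + 1) * (e' + e')" using \<open>e' > 0\<close> by (simp add: algebra_simps)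
    also have "\<dots> = e"
    proof -
      have "(A + 1) * e' = e / 2"
        using \<open>A \<ge> 0\<close> unfolding e'_def by (simp add: divide_simps)
      then show ?thesis by (simp add: algebra_simps)
    qed
    finally show ?thesis .
  qed
  then show "\<exists>d>0. \<forall>(n::nat) u v. (\<forall>i<n. a \<le> u i \<and> u i \<le> v i \<and> v i \<le> b) \<and>
      disjoint_family_on (\<lambda>i. {u i<..<v i}) {..<n} \<and> (\<Sum>i<n. v i - u i) < d
      \<longrightarrow> (\<Sum>i<n. cmod (f (v i) - f (u i))) < e"
    using \<open>d1 > 0\<close> \<open>d2 > 0\<close> by (intro exI[of _ "min d1 d2"]) auto
qed

lemma abs_cont_mult:
  assumes f: "abs_cont a b f" and g: "abs_cont a b g"
  shows "abs_cont a b (\<lambda>x. f x * g x)"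
proof -
  have "bounded (f ` {a..b})" "bounded (g ` {a..b})"
    using f g by (auto intro!: compact_imp_bounded compact_continuous_image abs_cont_continuous_on)
  then obtain A B where A: "\<forall>x\<in>{a..b}. cmod (f x) \<le> A" and B: "\<forall>x\<in>{a..b}. cmod (g x) \<le> B"
    by (auto simp: bounded_iff)
  show ?thesis
  proof (rule abs_cont_Lipschitz[OF f g, of "max 0 (max A B)"])
    fix x y assume xy: "x \<in> {a..b}" "y \<in> {a..b}"
    have "f x * g x - f y * g y = (f x - f y) * g x + f y * (g x - g y)" by (simp add: algebra_simps)
    then have "cmod (f x * g x - f y * g y) \<le> cmod (f x - f y) * cmod (g x) + cmod (f y) * cmod (g x - g y)"
      by (metis norm_mult norm_triangle_ineq)
    also have "\<dots> \<le> cmod (f x - f y) * max 0 (max A B) + max 0 (max A B) * cmod (g x - g y)"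
      using bspec[OF A xy(2)] bspec[OF B xy(1)] by (intro add_mono mult_left_mono mult_right_mono) auto
    finally show "cmod (f x * g x - f y * g y) \<le> max 0 (max A B) * (cmod (f x - f y) + cmod (g x - g y))"
      by (simp add: algebra_simps)
  qed auto
qed

lemma absolutely_integrable_continuous_mult:
  fixes f g :: "real \<Rightarrow> complex"
  assumes "continuous_on {a..b} g" and "f absolutely_integrable_on {a..b}"
  shows "(\<lambda>x. g x * f x) absolutely_integrable_on {a..b}"
proof (rule absolutely_integrable_bounded_measurable_product[where h = "(*)", OF _ _ _ _ assms(2)])
  show "bilinear ((*) :: complex \<Rightarrow> complex \<Rightarrow> complex)"
    by (simp add: bilinear_conv_bounded_bilinear bounded_bilinear_mult)
  show "g \<in> borel_measurable (lebesgue_on {a..b})"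
    by (rule continuous_imp_measurable_on_sets_lebesgue[OF assms(1)]) auto
  show "bounded (g ` {a..b})"
    by (rule compact_imp_bounded[OF compact_continuous_image[OF assms(1)]]) auto
qed auto

lemma primitive_on_continuous:
  assumes "primitive_on a b F f"
  shows "continuous_on {a..b} F"
proof -
  have "continuous_on {a..b} (\<lambda>x. F a + integral {a..x} f)"
    using assms unfolding primitive_on_def
    by (intro continuous_intros indefinite_integral_continuous_1) (auto simp: absolutely_integrable_on_def)
  then show ?thesis
    by (rule continuous_on_eq) (rule primitive_onD[OF assms, symmetric])
qed

lemma primitive_on_abs_cont:
  assumes "primitive_on a b F f"
  shows "abs_cont a b F"
proof (rule abs_cont_Lipschitz[of a b "\<lambda>x. integral {a..x} f" "\<lambda>x. integral {a..x} f" 1])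
  show "abs_cont a b (\<lambda>x. integral {a..x} f)"
    using assms by (auto simp: primitive_on_def intro: abs_cont_integral)
  then show "abs_cont a b (\<lambda>x. integral {a..x} f)" .
  show "cmod (F x - F y) \<le> 1 * (cmod (integral {a..x} f - integral {a..y} f) +
      cmod (integral {a..x} f - integral {a..y} f))" if "x \<in> {a..b}" "y \<in> {a..b}" for x y
  proof -
    have "F x = F a + integral {a..x} f" "F y = F a + integral {a..y} f"
      using primitive_onD[OF assms] that by blast+
    then have "F x - F y = integral {a..x} f - integral {a..y} f" by simp
    then show ?thesis by simp
  qed
qed auto

lemma primitive_on_AE:
  assumes "primitive_on a b F f"
  shows "\<exists>N. negligible N \<and> (\<forall>x\<in>{a<..<b} - N. (F has_vector_derivative f x) (at x))"
proof -
  have "f integrable_on {a..b}"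
    using assms by (simp add: primitive_on_def absolutely_integrable_on_def)
  then obtain N where N: "negligible N"
    "\<forall>x\<in>{a<..<b} - N. ((\<lambda>x. integral {a..x} f) has_vector_derivative f x) (at x)"
    using integral_has_vector_derivative_AE by blast
  have "(F has_vector_derivative f x) (at x)" if x: "x\<in>{a<..<b} - N" for x
  proof (rule has_vector_derivative_transform_within_open[of "\<lambda>x. F a + integral {a..x} f" _ _ "{a<..<b}"])
    show "((\<lambda>x. F a + integral {a..x} f) has_vector_derivative f x) (at x)"
      using has_vector_derivative_add[OF has_vector_derivative_const bspec[OF N(2) x], of "F a"] by simp
  qed (use x primitive_onD[OF assms, symmetric] in auto)
  then show ?thesis using N(1) by blast
qed

text \<open>The fundamental theorem for absolutely continuous functions, applied on each
  \<open>{a..x}\<close>. The derivative is given inside the interval only, so the endpoints join the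
  exceptional set.\<close>

lemma primitive_onI:
  assumes ac: "abs_cont a b F" and "negligible N"
    and der: "\<And>x. x \<in> {a<..<b} - N \<Longrightarrow> (F has_vector_derivative f x) (at x)"
    and f: "f absolutely_integrable_on {a..b}"
  shows "primitive_on a b F f"
  unfolding primitive_on_def
proof (intro conjI ballI f)
  fix x assume x: "x \<in> {a..b}"
  have ac': "abs_cont a x F"
    unfolding abs_cont_def
  proof (intro allI impI)
    fix e :: real assume "e > 0"
    then obtain d where "d > 0" and d: "\<And>n u v. (\<forall>i<n::nat. a \<le> u i \<and> u i \<le> v i \<and> v i \<le> b) \<and>
        disjoint_family_on (\<lambda>i. {u i<..<v i}) {..<n} \<and> (\<Sum>i<n. v i - u i) < d
        \<Longrightarrow> (\<Sum>i<n. cmod (F (v i) - F (u i))) < e"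
      using ac unfolding abs_cont_def by meson
    have "(\<Sum>i<n. cmod (F (v i) - F (u i))) < e"
      if *: "(\<forall>i<n::nat. a \<le> u i \<and> u i \<le> v i \<and> v i \<le> x) \<and>
        disjoint_family_on (\<lambda>i. {u i<..<v i}) {..<n} \<and> (\<Sum>i<n. v i - u i) < d" for n u v
    proof (rule d, intro conjI)
      show "\<forall>i<n. a \<le> u i \<and> u i \<le> v i \<and> v i \<le> b" using * x by fastforce
    qed (use * in blast)+
    then show "\<exists>d>0. \<forall>(n::nat) u v. (\<forall>i<n. a \<le> u i \<and> u i \<le> v i \<and> v i \<le> x) \<and>
        disjoint_family_on (\<lambda>i. {u i<..<v i}) {..<n} \<and> (\<Sum>i<n. v i - u i) < d
        \<longrightarrow> (\<Sum>i<n. cmod (F (v i) - F (u i))) < e"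
      using \<open>d > 0\<close> by blast
  qed
  have "(f has_integral (F x - F a)) {a..x}"
  proof (rule abs_cont_has_integral[OF ac'])
    show "negligible (N \<union> {a, b})" using assms by auto
    show "(F has_vector_derivative f y) (at y within {a..x})" if "y \<in> {a..x} - (N \<union> {a, b})" for y
      using der[of y] that x by (auto intro: has_vector_derivative_at_within)
  qed (use x in auto)
  then show "F x = F a + integral {a..x} f"
    by (simp add: integral_unique)
qed

lemma primitive_on_mult:
  assumes F: "primitive_on a b F f" and G: "primitive_on a b G g"
  shows "primitive_on a b (\<lambda>x. F x * G x) (\<lambda>x. F x * g x + f x * G x)"
proof -
  obtain N where N: "negligible N" "\<forall>x\<in>{a<..<b} - N. (F has_vector_derivative f x) (at x)"
    using primitive_on_AE[OF F] by blast
  obtain N' where N': "negligible N'" "\<forall>x\<in>{a<..<b} - N'. (G has_vector_derivative g x) (at x)"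
    using primitive_on_AE[OF G] by blast
  show ?thesis
  proof (rule primitive_onI)
    show "abs_cont a b (\<lambda>x. F x * G x)"
      by (intro abs_cont_mult primitive_on_abs_cont[OF F] primitive_on_abs_cont[OF G])
    show "negligible (N \<union> N')" using N N' by auto
    show "((\<lambda>x. F x * G x) has_vector_derivative F x * g x + f x * G x) (at x)"
      if "x \<in> {a<..<b} - (N \<union> N')" for x
      using has_vector_derivative_mult[OF bspec[OF N(2)] bspec[OF N'(2)], of x] that by auto
    show "(\<lambda>x. F x * g x + f x * G x) absolutely_integrable_on {a..b}"
      using absolutely_integrable_continuous_mult[OF primitive_on_continuous[OF F], of g]
        absolutely_integrable_continuous_mult[OF primitive_on_continuous[OF G], of f] F G
      by (intro set_integral_add) (auto simp: primitive_on_def mult.commute)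
  qed
qed

lemma primitive_on_integrand:
  assumes "primitive_on a b F f" "x \<in> {a..b}"
  shows "f integrable_on {a..x}" "f absolutely_integrable_on {a..x}"
proof -
  show "f absolutely_integrable_on {a..x}"
    using assms by (auto simp: primitive_on_def intro: absolutely_integrable_on_subinterval)
  then show "f integrable_on {a..x}" by (simp add: absolutely_integrable_on_def)
qed

lemma primitive_on_add:
  assumes "primitive_on a b F f" "primitive_on a b G g"
  shows "primitive_on a b (\<lambda>x. F x + G x) (\<lambda>x. f x + g x)"
  unfolding primitive_on_def
proof (intro conjI ballI)
  show "(\<lambda>x. f x + g x) absolutely_integrable_on {a..b}"
    using assms by (auto simp: primitive_on_def)
  show "F x + G x = F a + G a + integral {a..x} (\<lambda>x. f x + g x)" if "x \<in> {a..b}" for x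
    using primitive_onD[OF assms(1) that] primitive_onD[OF assms(2) that]
      integral_add[OF primitive_on_integrand(1)[OF assms(1) that] primitive_on_integrand(1)[OF assms(2) that]]
    by (simp only: add_ac)
qed

lemma primitive_on_diff:
  assumes "primitive_on a b F f" "primitive_on a b G g"
  shows "primitive_on a b (\<lambda>x. F x - G x) (\<lambda>x. f x - g x)"
  unfolding primitive_on_def
proof (intro conjI ballI)
  show "(\<lambda>x. f x - g x) absolutely_integrable_on {a..b}"
    using assms by (auto simp: primitive_on_def)
  show "F x - G x = F a - G a + integral {a..x} (\<lambda>x. f x - g x)" if "x \<in> {a..b}" for x
    using primitive_onD[OF assms(1) that] primitive_onD[OF assms(2) that]
      integral_diff[OF primitive_on_integrand(1)[OF assms(1) that] primitive_on_integrand(1)[OF assms(2) that]]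
    by (simp only: add_diff_add)
qed

lemma primitive_on_cmult:
  assumes "primitive_on a b F f"
  shows "primitive_on a b (\<lambda>x. c * F x) (\<lambda>x. c * f x)"
  unfolding primitive_on_def
proof (intro conjI ballI)
  show "(\<lambda>x. c * f x) absolutely_integrable_on {a..b}"
    using assms by (auto simp: primitive_on_def)
  show "c * F x = c * F a + integral {a..x} (\<lambda>x. c * f x)" if "x \<in> {a..b}" for x
    using primitive_onD[OF assms that] by (simp only: Henstock_Kurzweil_Integration.integral_mult_right distrib_left)
qed

lemma primitive_on_const: "primitive_on a b (\<lambda>x. c) (\<lambda>x. 0)"
  by (simp add: primitive_on_def)

lemma primitive_on_cong:
  assumes "primitive_on a b F f" and "\<And>x. x \<in> {a..b} \<Longrightarrow> F x = G x"
    and "\<And>x. x \<in> {a..b} \<Longrightarrow> f x = g x"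
  shows "primitive_on a b G g"
proof -
  have "g absolutely_integrable_on {a..b}"
  proof (rule absolutely_integrable_spike[where f = f and S = "{}"])
    show "f absolutely_integrable_on {a..b}" using assms(1) unfolding primitive_on_def by blast
  qed (use assms(3) in auto)
  moreover have "G x = G a + integral {a..x} g" if "x \<in> {a..b}" for x
  proof -
    have "integral {a..x} g = integral {a..x} f"
      by (rule integral_cong) (use assms that in auto)
    moreover have "F a = G a" using assms(2)[of a] that by auto
    ultimately show ?thesis using primitive_onD[OF assms(1) that] assms(2)[OF that] by simp
  qed
  ultimately show ?thesis unfolding primitive_on_def by blast
qed

lemma primitive_on_C1:
  assumes "\<And>x. x \<in> {a..b} \<Longrightarrow> (F has_vector_derivative f x) (at x within {a..b})"
    and "continuous_on {a..b} f"
  shows "primitive_on a b F f"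
  unfolding primitive_on_def
proof (intro conjI ballI)
  show "f absolutely_integrable_on {a..b}"
    using assms(2) by (rule absolutely_integrable_continuous_real)
  show "F x = F a + integral {a..x} f" if "x \<in> {a..b}" for x
    using fundamental_theorem_of_calculus[of a x F f] assms(1) that
    by (force simp: integral_unique intro: has_vector_derivative_within_subset)
qed

text \<open>This turns a limit into an equation: once an entry of the transfer matrix is known to
  have a constant limit, its limiting derivative vanishes almost everywhere. In this way the
  difference of the potentials is read off.\<close>

lemma primitive_on_constant_imp_AE_zero:
  assumes "primitive_on a b F f" and "\<And>x. x \<in> {a..b} \<Longrightarrow> F x = c"
  shows "\<exists>N. negligible N \<and> (\<forall>x\<in>{a..b} - N. f x = 0)"
proof -
  obtain N where N: "negligible N" "\<forall>x\<in>{a<..<b} - N. (F has_vector_derivative f x) (at x)"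
    using primitive_on_AE[OF assms(1)] by blast
  have "f x = 0" if "x \<in> {a<..<b} - N" for x
  proof -
    have "((\<lambda>_. c) has_vector_derivative f x) (at x)"
      by (rule has_vector_derivative_transform_within_open[OF bspec[OF N(2) that], of "{a<..<b}"])
        (use that assms in auto)
    then show ?thesis
      using vector_derivative_at vector_derivative_const_at by metis
  qed
  then show ?thesis
    using N(1) by (intro exI[of _ "N \<union> {a, b}"]) auto
qed

lemma primitive_on_zero_imp_constant:
  assumes "primitive_on a b F f" and "\<And>x. x \<in> {a..b} \<Longrightarrow> f x = 0" and "x \<in> {a..b}"
  shows "F x = F a"
proof -
  have "integral {a..x} f = integral {a..x} (\<lambda>_. 0)"
    by (rule integral_cong) (use assms in auto)
  then show ?thesis using primitive_onD[OF assms(1,3)] by simp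
qed

lemma primitive_on_AE_zero_imp_constant:
  assumes F: "primitive_on a b F f" and N: "negligible N" "\<forall>x\<in>{a..b} - N. f x = 0" and x: "x \<in> {a..b}"
  shows "F x = F a"
proof -
  have "integral {a..x} f = integral {a..x} (\<lambda>_. 0)"
    by (rule integral_spike[OF N(1)]) (use N(2) x in auto)
  then show ?thesis using primitive_onD[OF F x] by simp
qed

text \<open>Reversing the interval allows solutions to be estimated from their values at
  \<open>pi\<close>, as the decay of the Weyl solution requires.\<close>

lemma primitive_on_reflect:
  assumes "primitive_on 0 b F f"
  shows "primitive_on 0 b (\<lambda>x. F (b - x)) (\<lambda>x. - f (b - x))"
proof (cases "b \<ge> 0")
  case False
  then show ?thesis by (simp add: primitive_on_def)
next
  case True
  obtain N where N: "negligible N" "\<forall>x\<in>{0<..<b} - N. (F has_vector_derivative f x) (at x)"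
    using primitive_on_AE[OF assms] by blast
  have ab: "(\<lambda>x. f (b - x)) absolutely_integrable_on {0..b}"
  proof -
    have "f absolutely_integrable_on {0..b}" using assms by (simp add: primitive_on_def)
    then have f: "f integrable_on cbox 0 b" "(\<lambda>x. norm (f x)) integrable_on cbox 0 b"
      by (auto simp: absolutely_integrable_on_def)
    have "(\<lambda>x. g (b - x)) integrable_on {0..b}" if g: "g integrable_on cbox 0 b"
      for g :: "real \<Rightarrow> 'a :: real_normed_vector"
    proof -
      have "(\<lambda>x::real. (1 / - 1) *\<^sub>R x + - ((1 / - 1) *\<^sub>R b)) ` cbox 0 b = {0..b}"
      proof (intro set_eqI iffI)
        fix y assume "y \<in> {0..b}"
        then show "y \<in> (\<lambda>x::real. (1 / - 1) *\<^sub>R x + - ((1 / - 1) *\<^sub>R b)) ` cbox 0 b"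
          by (intro image_eqI[of _ _ "b - y"]) auto
      qed auto
      then show ?thesis
        using integrable_affinity[OF g, of "-1" b] by simp
    qed
    from this[OF f(1)] this[OF f(2)] show ?thesis
      by (simp add: absolutely_integrable_on_def)
  qed
  show ?thesis
  proof (rule primitive_onI)
    have ac: "abs_cont 0 b F" by (rule primitive_on_abs_cont[OF assms])
    show "abs_cont 0 b (\<lambda>x. F (b - x))"
      unfolding abs_cont_def
    proof (intro allI impI)
      fix e :: real assume "e > 0"
      then obtain d where "d > 0" and d: "\<And>n u v. (\<forall>i<n::nat. 0 \<le> u i \<and> u i \<le> v i \<and> v i \<le> b) \<and>
          disjoint_family_on (\<lambda>i. {u i<..<v i}) {..<n} \<and> (\<Sum>i<n. v i - u i) < d
          \<Longrightarrow> (\<Sum>i<n. cmod (F (v i) - F (u i))) < e"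
        using ac unfolding abs_cont_def by meson
      have "(\<Sum>i<n. cmod (F (b - v i) - F (b - u i))) < e"
        if *: "(\<forall>i<n::nat. 0 \<le> u i \<and> u i \<le> v i \<and> v i \<le> b) \<and>
          disjoint_family_on (\<lambda>i. {u i<..<v i}) {..<n} \<and> (\<Sum>i<n. v i - u i) < d" for n u v
      proof -
        have "(\<Sum>i<n. cmod (F (b - u i) - F (b - v i))) < e"
        proof (rule d, intro conjI)
          show "\<forall>i<n. 0 \<le> b - v i \<and> b - v i \<le> b - u i \<and> b - u i \<le> b"
            using * by auto
          show "disjoint_family_on (\<lambda>i. {b - v i<..<b - u i}) {..<n}"
          proof -
            have "{b - v i<..<b - u i} = (\<lambda>x. b - x) ` {u i<..<v i}" for i
            proof (intro set_eqI iffI)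
              fix y assume "y \<in> {b - v i<..<b - u i}"
              then show "y \<in> (\<lambda>x. b - x) ` {u i<..<v i}" by (intro image_eqI[of _ _ "b - y"]) auto
            qed auto
            moreover have "inj (\<lambda>x. b - x)" by (simp add: inj_def)
            ultimately show ?thesis
              using * unfolding disjoint_family_on_def by (metis image_Int image_empty)
          qed
          show "(\<Sum>i<n. b - u i - (b - v i)) < d" using * by simp
        qed
        then show ?thesis by (simp add: norm_minus_commute)
      qed
      then show "\<exists>d>0. \<forall>(n::nat) u v. (\<forall>i<n. 0 \<le> u i \<and> u i \<le> v i \<and> v i \<le> b) \<and>
          disjoint_family_on (\<lambda>i. {u i<..<v i}) {..<n} \<and> (\<Sum>i<n. v i - u i) < d
          \<longrightarrow> (\<Sum>i<n. cmod (F (b - v i) - F (b - u i))) < e"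
        using \<open>d > 0\<close> by blast
    qed
    show "negligible ((\<lambda>x. b - x) ` N)"
      by (rule negligible_reflect_image[OF N(1)])
    show "((\<lambda>x. F (b - x)) has_vector_derivative - f (b - x)) (at x)"
      if x: "x \<in> {0<..<b} - (\<lambda>x. b - x) ` N" for x
    proof -
      have "b - x \<in> {0<..<b} - N"
        using x by force
      then have "(F has_vector_derivative f (b - x)) (at (b - x))" by (rule bspec[OF N(2)])
      moreover have "((\<lambda>x. b - x) has_vector_derivative - 1) (at x)"
        by (auto intro!: derivative_eq_intros)
      ultimately have "(F \<circ> (\<lambda>x. b - x) has_vector_derivative (- 1) *\<^sub>R f (b - x)) (at x)"
        by (intro vector_diff_chain_at)
      then show ?thesis by (simp add: o_def)
    qed
    show "(\<lambda>x. - f (b - x)) absolutely_integrable_on {0..b}"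
      using absolutely_integrable_continuous_mult[OF continuous_on_const ab, of "- 1"] by simp
  qed
qed

text \<open>A continuous \<open>F\<close> has bounded range on \<open>{a..b}\<close>, and on a disc
  of radius \<open>B\<close> the exponential is Lipschitz with constant \<open>exp B\<close>; the
  chain rule then holds wherever \<open>F\<close> is differentiable.\<close>

lemma primitive_on_exp:
  assumes F: "primitive_on a b F f"
  shows "primitive_on a b (\<lambda>x. exp (F x)) (\<lambda>x. exp (F x) * f x)"
proof -
  obtain N where N: "negligible N" "\<forall>x\<in>{a<..<b} - N. (F has_vector_derivative f x) (at x)"
    using primitive_on_AE[OF F] by blast
  have "bounded (F ` {a..b})"
    by (rule compact_imp_bounded[OF compact_continuous_image[OF primitive_on_continuous[OF F]]]) auto
  then obtain B where B: "\<forall>x\<in>{a..b}. cmod (F x) \<le> B" by (auto simp: bounded_iff)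
  show ?thesis
  proof (rule primitive_onI[OF _ N(1)])
    show "abs_cont a b (\<lambda>x. exp (F x))"
    proof (rule abs_cont_Lipschitz[OF primitive_on_abs_cont[OF F] primitive_on_abs_cont[OF F]])
      show "exp B \<ge> 0" by simp
      fix x y assume xy: "x \<in> {a..b}" "y \<in> {a..b}"
      have "cmod (exp (F x) - exp (F y)) \<le> exp B * cmod (F x - F y)"
      proof (rule field_differentiable_bound[where S = "cball 0 B" and f' = exp])
        show "(exp has_field_derivative exp z) (at z within cball 0 B)" for z :: complex
          by (auto intro!: derivative_eq_intros)
        show "cmod (exp z) \<le> exp B" if "z \<in> cball 0 B" for z
          using that norm_exp[of z] by (auto intro: order_trans)
      qed (use B xy in auto)
      also have "\<dots> \<le> exp B * (cmod (F x - F y) + cmod (F x - F y))"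
        by (rule mult_left_mono) auto
      finally show "cmod (exp (F x) - exp (F y)) \<le> exp B * (cmod (F x - F y) + cmod (F x - F y))" .
    qed
    show "((\<lambda>x. exp (F x)) has_vector_derivative exp (F x) * f x) (at x)" if "x \<in> {a<..<b} - N" for x
      using field_vector_diff_chain_at[OF bspec[OF N(2) that] DERIV_exp] by (simp add: o_def mult.commute)
    show "(\<lambda>x. exp (F x) * f x) absolutely_integrable_on {a..b}"
      by (intro absolutely_integrable_continuous_mult continuous_intros primitive_on_continuous[OF F])
        (use F in \<open>unfold primitive_on_def, blast\<close>)
  qed
qed

lemma absolutely_integrable_of_real:
  assumes "h absolutely_integrable_on A"
  shows "(\<lambda>x. complex_of_real (h x)) absolutely_integrable_on A"
  using assms absolutely_integrable_linear[OF assms bounded_linear_of_real] by (simp add: o_def)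

lemma absolutely_integrable_continuous_mult_real:
  fixes f g :: "real \<Rightarrow> real"
  assumes "continuous_on {a..b} g" and "f absolutely_integrable_on {a..b}"
  shows "(\<lambda>x. f x * g x) absolutely_integrable_on {a..b}"
proof -
  have "(\<lambda>x. g x * f x) absolutely_integrable_on {a..b}"
  proof (rule absolutely_integrable_bounded_measurable_product_real[OF _ _ _ assms(2)])
    show "g \<in> borel_measurable (lebesgue_on {a..b})"
      by (rule continuous_imp_measurable_on_sets_lebesgue[OF assms(1)]) auto
    show "bounded (g ` {a..b})"
      by (rule compact_imp_bounded[OF compact_continuous_image[OF assms(1)]]) auto
  qed auto
  then show ?thesis by (simp add: mult.commute)
qed

section \<open>Gronwall and Riemann--Lebesgue estimates\<close>

text \<open>The weight \<open>exp (2 \<integral> h)\<close> makes every Volterra operator whose kernel is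
  bounded by \<open>h\<close> a contraction with constant \<open>1/2\<close>.\<close>

lemma integral_exp_weight:
  fixes h :: "real \<Rightarrow> real"
  assumes h: "h absolutely_integrable_on {a..b}" and x: "x \<in> {a..b}"
  shows "((\<lambda>t. h t * exp (2 * integral {a..t} h)) has_integral (exp (2 * integral {a..x} h) - 1) / 2) {a..x}"
proof -
  have hx: "h integrable_on {a..t}" if "t \<in> {a..b}" for t
    using h that by (meson absolutely_integrable_on_def atLeastAtMost_iff atLeastatMost_subset_iff
        integrable_on_subinterval order_refl)
  \<comment> \<open>The calculus of primitives is set up for complex values, so the real weight is
    embedded here and the real part is taken at the end.\<close>
  have "primitive_on a b (\<lambda>x. of_real (2 * integral {a..x} h)) (\<lambda>t. of_real (2 * h t))"
    unfolding primitive_on_def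
  proof (intro conjI ballI)
    show "(\<lambda>t. complex_of_real (2 * h t)) absolutely_integrable_on {a..b}"
      by (intro absolutely_integrable_of_real set_integrable_mult_right h)
    fix x assume "x \<in> {a..b}"
    show "complex_of_real (2 * integral {a..x} h) =
        complex_of_real (2 * integral {a..a} h) + integral {a..x} (\<lambda>t. complex_of_real (2 * h t))"
      using hx[OF \<open>x \<in> {a..b}\<close>]
      by (simp del: of_real_mult add: integral_linear[OF _ bounded_linear_of_real, unfolded o_def])
  qed
  from primitive_on_exp[OF this]
  have p: "primitive_on a b (\<lambda>x. of_real (exp (2 * integral {a..x} h)))
      (\<lambda>t. of_real (exp (2 * integral {a..t} h) * (2 * h t)))"
    by (simp add: exp_of_real[symmetric])
  have "((\<lambda>t. complex_of_real (exp (2 * integral {a..t} h) * (2 * h t))) has_integral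
      of_real (exp (2 * integral {a..x} h)) - 1) {a..x}"
    using primitive_onD[OF p x] primitive_on_integrand(1)[OF p x] by (simp add: has_integral_iff)
  from has_integral_linear[OF this bounded_linear_Re]
  have "((\<lambda>t. exp (2 * integral {a..t} h) * (2 * h t)) has_integral
      exp (2 * integral {a..x} h) - 1) {a..x}"
    by (simp add: o_def)
  from has_integral_mult_right[OF this, of "1/2"] show ?thesis
    by (simp add: mult_ac)
qed

lemma gronwall_L1:
  fixes u h :: "real \<Rightarrow> real"
  assumes h: "h absolutely_integrable_on {a..b}" and h0: "\<And>t. t \<in> {a..b} \<Longrightarrow> 0 \<le> h t"
    and u: "continuous_on {a..b} u" and "A \<ge> 0"
    and le: "\<And>x. x \<in> {a..b} \<Longrightarrow> u x \<le> A + integral {a..x} (\<lambda>t. h t * u t)"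
    and x: "x \<in> {a..b}"
  shows "u x \<le> 2 * A * exp (2 * integral {a..b} h)"
proof -
  define H where "H x = integral {a..x} h" for x
  have hi: "h integrable_on {a..b}" using h by (simp add: absolutely_integrable_on_def)
  have cH: "continuous_on {a..b} H"
    unfolding H_def by (rule indefinite_integral_continuous_1[OF hi])
  have "\<exists>x0\<in>{a..b}. \<forall>y\<in>{a..b}. u y * exp (- 2 * H y) \<le> u x0 * exp (- 2 * H x0)"
    by (rule continuous_attains_sup) (use x in \<open>auto intro!: continuous_intros u cH\<close>)
  then obtain x0 where x0: "x0 \<in> {a..b}"
    and max: "\<And>y. y \<in> {a..b} \<Longrightarrow> u y * exp (- 2 * H y) \<le> u x0 * exp (- 2 * H x0)" by blast
  define m where "m = u x0 * exp (- 2 * H x0)"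
  have um: "u y \<le> m * exp (2 * H y)" if "y \<in> {a..b}" for y
    using mult_right_mono[OF max[OF that], of "exp (2 * H y)"]
    by (simp add: m_def mult.assoc exp_add[symmetric])
  have H_mono: "H y \<le> H b" if "y \<in> {a..b}" for y
    unfolding H_def by (rule integral_subset_le) (use that hi h0 integrable_on_subinterval[OF hi] in auto)
  have "m \<le> 2 * A"
  proof (cases "m \<ge> 0")
    case True
    have "u x0 \<le> A + integral {a..x0} (\<lambda>t. h t * u t)" by (rule le[OF x0])
    also have "integral {a..x0} (\<lambda>t. h t * u t) \<le> integral {a..x0} (\<lambda>t. m * (h t * exp (2 * H t)))"
    proof (rule integral_le)
      show "(\<lambda>t. h t * u t) integrable_on {a..x0}"
        using absolutely_integrable_continuous_mult_real[OF u h] x0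
        by (auto simp: absolutely_integrable_on_def intro: integrable_on_subinterval)
      show "(\<lambda>t. m * (h t * exp (2 * H t))) integrable_on {a..x0}"
        using has_integral_mult_right[OF integral_exp_weight[OF h x0]] unfolding H_def
        by (rule has_integral_integrable)
      fix t assume "t \<in> {a..x0}"
      then have t: "t \<in> {a..b}" using x0 by auto
      show "h t * u t \<le> m * (h t * exp (2 * H t))"
        using mult_left_mono[OF um[OF t] h0[OF t]] by (simp add: mult_ac)
    qed
    also have "\<dots> = m * ((exp (2 * H x0) - 1) / 2)"
      using has_integral_mult_right[OF integral_exp_weight[OF h x0]] unfolding H_def
      by (rule integral_unique)
    also have "\<dots> \<le> m * exp (2 * H x0) / 2"
      using True by (simp add: algebra_simps)
    finally have "u x0 \<le> A + m * exp (2 * H x0) / 2" by simp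
    moreover have "u x0 = m * exp (2 * H x0)"
      by (simp add: m_def mult.assoc exp_add[symmetric])
    ultimately have "m * exp (2 * H x0) \<le> 2 * A" by simp
    moreover have "H x0 \<ge> 0" unfolding H_def
      by (rule integral_nonneg) (use x0 h0 integrable_on_subinterval[OF hi] in auto)
    then have "m * 1 \<le> m * exp (2 * H x0)" using True by (intro mult_left_mono) auto
    ultimately show ?thesis by simp
  qed (use \<open>A \<ge> 0\<close> in auto)
  have "u x \<le> m * exp (2 * H x)" by (rule um[OF x])
  also have "\<dots> \<le> (2 * A) * exp (2 * H x)" using \<open>m \<le> 2 * A\<close> by (rule mult_right_mono) auto
  also have "\<dots> \<le> (2 * A) * exp (2 * H b)" using \<open>A \<ge> 0\<close> H_mono[OF x] by (intro mult_left_mono) auto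
  finally show ?thesis by (simp add: H_def)
qed

section \<open>Density of polynomials in \<open>L1\<close> and the Riemann--Lebesgue
  estimate\<close>

lemma absolutely_integrable_truncate:
  fixes f :: "real \<Rightarrow> complex"
  assumes f: "f absolutely_integrable_on {a..b}" and "e > 0"
  shows "\<exists>g M. g absolutely_integrable_on {a..b} \<and> (\<forall>x. cmod (g x) \<le> M) \<and>
           integral {a..b} (\<lambda>x. cmod (f x - g x)) < e"
proof -
  define g where "g n x = (if cmod (f x) \<le> real n then f x else 0)" for n x
  have nf: "(\<lambda>x. norm (f x)) integrable_on {a..b}"
    using f by (auto simp: absolutely_integrable_on_def)
  have fm: "f \<in> borel_measurable (lebesgue_on {a..b})"
    using f absolutely_integrable_measurable[of "{a..b}" f] by simp
  have g: "g n absolutely_integrable_on {a..b}" for n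
  proof (rule measurable_bounded_by_integrable_imp_absolutely_integrable[OF _ _ nf])
    show "g n \<in> borel_measurable (lebesgue_on {a..b})"
      unfolding g_def using fm by measurable
    show "norm (g n x) \<le> norm (f x)" for x by (simp add: g_def)
  qed auto
  have fg: "(\<lambda>x. cmod (f x - g n x)) integrable_on {a..b}" for n
    using set_integral_diff(1)[OF f g[of n]] by (simp add: absolutely_integrable_on_def)
  have "(\<lambda>n. integral {a..b} (\<lambda>x. cmod (f x - g n x))) \<longlonglongrightarrow> integral {a..b} (\<lambda>x. 0)"
  proof (rule dominated_convergence(2)[OF fg nf])
    show "norm (cmod (f x - g k x)) \<le> cmod (f x)" for k x by (simp add: g_def)
    show "(\<lambda>k. cmod (f x - g k x)) \<longlonglongrightarrow> 0" for x
    proof (rule tendsto_eventually)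
      obtain m :: nat where "norm (f x) \<le> real m" using real_arch_simple by blast
      then have "\<forall>k\<ge>m. cmod (f x - g k x) = 0" unfolding g_def by auto
      then show "\<forall>\<^sub>F k in sequentially. cmod (f x - g k x) = 0"
        using eventually_sequentially by blast
    qed
  qed
  then have "\<forall>\<^sub>F n in sequentially. integral {a..b} (\<lambda>x. cmod (f x - g n x)) < e"
    using \<open>e > 0\<close> by (intro order_tendstoD(2)) auto
  then obtain n where "integral {a..b} (\<lambda>x. cmod (f x - g n x)) < e"
    by (meson eventually_sequentially order_refl)
  moreover have "\<forall>x. cmod (g n x) \<le> real n" by (simp add: g_def)
  ultimately show ?thesis using g by blast
qed

text \<open>Difference quotients of the indefinite integral are continuous, bounded by
  \<open>M\<close>, and converge to \<open>f\<close> almost everywhere by Lebesgue differentiation;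
  dominated convergence gives convergence in \<open>L1\<close>.\<close>

lemma bounded_approx_continuous:
  fixes f :: "real \<Rightarrow> complex"
  assumes "a \<le> b" and f: "f absolutely_integrable_on {a..b}" and M: "\<And>x. cmod (f x) \<le> M" and "e > 0"
  shows "\<exists>g. continuous_on {a..b} g \<and> integral {a..b} (\<lambda>x. cmod (f x - g x)) < e"
proof -
  have fi: "f integrable_on {a..b}" using f by (simp add: absolutely_integrable_on_def)
  define F where "F x = integral {a..x} f" for x
  have cF: "continuous_on {a..b} F" unfolding F_def by (rule indefinite_integral_continuous_1[OF fi])
  obtain N where N: "negligible N" "\<forall>x\<in>{a<..<b} - N. (F has_vector_derivative f x) (at x)"
    using integral_has_vector_derivative_AE[OF fi] unfolding F_def by blast
  \<comment> \<open>The minimum keeps the argument of \<open>F\<close> inside \<open>{a..b}\<close>.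
    Near \<open>b\<close> this is no longer a difference quotient, but each \<open>x < b\<close>
    leaves that zone for large \<open>n\<close>.\<close>
  define g where "g n x = real (Suc n) *\<^sub>R (F (min (x + 1 / real (Suc n)) b) - F x)" for n x
  have cg: "continuous_on {a..b} (g n)" for n
  proof -
    have "continuous_on {a..b} (\<lambda>x. F (min (x + 1 / real (Suc n)) b))"
      by (rule continuous_on_compose2[OF cF]) (use \<open>a \<le> b\<close> in \<open>auto intro!: continuous_intros simp: add_increasing2\<close>)
    then show ?thesis unfolding g_def by (intro continuous_intros cF)
  qed
  have gM: "cmod (g n x) \<le> M" if "x \<in> {a..b}" for n x
  proof -
    define y where "y = min (x + 1 / real (Suc n)) b"
    have y: "x \<le> y" "y \<le> b" "y - x \<le> 1 / real (Suc n)" using that by (auto simp: y_def)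
    have "F y - F x = integral {x..y} f"
      using Henstock_Kurzweil_Integration.integral_combine[of a x y f] that y
        integrable_on_subinterval[OF fi, of a y] by (auto simp: F_def algebra_simps)
    also have "cmod \<dots> \<le> integral {x..y} (\<lambda>_. M)"
      by (rule integral_norm_bound_integral) (use that y M integrable_on_subinterval[OF fi, of x y] in auto)
    also have "\<dots> = M * (y - x)" using y by simp
    also have "\<dots> \<le> M * (1 / real (Suc n))"
      using y M[of 0] by (intro mult_left_mono) (auto intro: order_trans[OF norm_ge_zero])
    finally have "cmod (F y - F x) \<le> M / real (Suc n)" by simp
    moreover have "g n x = real (Suc n) *\<^sub>R (F y - F x)" by (simp only: g_def y_def)
    ultimately show ?thesis by (simp add: pos_le_divide_eq mult.commute del: of_nat_Suc)
  qed
  define k where "k n x = (if x \<in> N \<union> {a, b} then 0 else cmod (f x - g n x))" for n x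
  have fg: "(\<lambda>x. cmod (f x - g n x)) integrable_on {a..b}" for n
    using set_integral_diff(1)[OF f absolutely_integrable_continuous_real[OF cg[of n]]]
    by (simp add: absolutely_integrable_on_def)
  have negl: "negligible (N \<union> {a, b})" using N(1) by auto
  have k: "k n integrable_on {a..b}" for n
    by (rule integrable_spike[OF fg[of n] negl]) (auto simp: k_def)
  have "(\<lambda>n. integral {a..b} (k n)) \<longlonglongrightarrow> integral {a..b} (\<lambda>x. 0)"
  proof (rule dominated_convergence(2)[OF k])
    show "(\<lambda>x. 2 * M) integrable_on {a..b}" by auto
    show "norm (k n x) \<le> 2 * M" if "x \<in> {a..b}" for n x
      using norm_triangle_ineq4[of "f x" "g n x"] M[of x] gM[OF that, of n]
        order_trans[OF norm_ge_zero M[of x]]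
      by (auto simp: k_def)
    show "(\<lambda>n. k n x) \<longlonglongrightarrow> 0" if x: "x \<in> {a..b}" for x
    proof (cases "x \<in> N \<union> {a, b}")
      case True
      then show ?thesis by (simp add: k_def)
    next
      case False
      then have x': "x \<in> {a<..<b} - N" using x by auto
      have "(\<lambda>n. g n x) \<longlonglongrightarrow> f x"
      proof (rule tendstoI)
        fix r :: real assume "r > 0"
        obtain d where d: "d > 0"
          "\<forall>y. norm (y - x) < d \<longrightarrow> cmod (F y - F x - (y - x) *\<^sub>R f x) \<le> r / 2 * norm (y - x)"
          using bspec[OF N(2) x'] half_gt_zero[OF \<open>r > 0\<close>]
          unfolding has_vector_derivative_def has_derivative_at_alt by blast
        have "\<forall>\<^sub>F n in sequentially. 1 / real (Suc n) < min d (b - x)"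
          using order_tendstoD(2)[OF LIMSEQ_inverse_real_of_nat, of "min d (b - x)"] x' d
          by (simp add: inverse_eq_divide)
        then show "\<forall>\<^sub>F n in sequentially. dist (g n x) (f x) < r"
        proof eventually_elim
          case (elim n)
          define h where "h = 1 / real (Suc n)"
          have h: "h > 0" "h < d" "x + h < b" "real (Suc n) * h = 1" using elim by (auto simp: h_def)
          have "g n x - f x = real (Suc n) *\<^sub>R (F (x + h) - F x - h *\<^sub>R f x)"
            using h by (simp add: g_def h_def[symmetric] min_def scaleR_diff_right del: of_nat_Suc)
          then have "cmod (g n x - f x) = real (Suc n) * cmod (F (x + h) - F x - h *\<^sub>R f x)"
            by simp
          also have "\<dots> \<le> real (Suc n) * (r / 2 * h)"
            using d(2)[rule_format, of "x + h"] h by (intro mult_left_mono) auto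
          also have "\<dots> = r / 2 * (real (Suc n) * h)" by simp
          also have "\<dots> < r" using h(4) \<open>r > 0\<close> by simp
          finally show ?case by (simp add: dist_norm)
        qed
      qed
      then have "(\<lambda>n. cmod (f x - g n x)) \<longlonglongrightarrow> cmod (f x - f x)"
        by (intro tendsto_intros)
      then show ?thesis using False by (simp add: k_def)
    qed
  qed
  then have "\<forall>\<^sub>F n in sequentially. integral {a..b} (k n) < e"
    using \<open>e > 0\<close> by (intro order_tendstoD(2)) auto
  then obtain n where "integral {a..b} (k n) < e"
    by (meson eventually_sequentially order_refl)
  moreover have "integral {a..b} (k n) = integral {a..b} (\<lambda>x. cmod (f x - g n x))"
    by (rule integral_spike[OF negl]) (auto simp: k_def)
  ultimately show ?thesis using cg by auto
qed

lemma absolutely_integrable_approx_polynomial: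
  fixes f :: "real \<Rightarrow> complex"
  assumes "a \<le> b" and f: "f absolutely_integrable_on {a..b}" and "e > 0"
  shows "\<exists>g. polynomial_function g \<and> integral {a..b} (\<lambda>x. cmod (f x - g x)) < e"
proof -
  obtain g1 M where g1: "g1 absolutely_integrable_on {a..b}" "\<forall>x. cmod (g1 x) \<le> M"
    "integral {a..b} (\<lambda>x. cmod (f x - g1 x)) < e / 3"
    using absolutely_integrable_truncate[OF f, of "e / 3"] \<open>e > 0\<close> by auto
  obtain g2 where g2: "continuous_on {a..b} g2" "integral {a..b} (\<lambda>x. cmod (g1 x - g2 x)) < e / 3"
    using bounded_approx_continuous[OF \<open>a \<le> b\<close> g1(1), of M "e / 3"] g1(2) \<open>e > 0\<close> by auto
  define d where "d = e / (3 * (b - a + 1))"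
  have "d > 0" using \<open>a \<le> b\<close> \<open>e > 0\<close> by (simp add: d_def)
  obtain g where g: "polynomial_function g" "\<forall>x\<in>{a..b}. norm (g2 x - g x) < d"
    using Stone_Weierstrass_polynomial_function[OF _ g2(1) \<open>d > 0\<close>] by auto
  have g2a: "g2 absolutely_integrable_on {a..b}" by (rule absolutely_integrable_continuous_real[OF g2(1)])
  have ga: "g absolutely_integrable_on {a..b}"
    by (rule absolutely_integrable_continuous_real) (rule continuous_on_polymonial_function[OF g(1)])
  have i1: "(\<lambda>x. cmod (f x - g1 x)) integrable_on {a..b}"
    using set_integral_diff(1)[OF f g1(1)] by (simp add: absolutely_integrable_on_def)
  have i2: "(\<lambda>x. cmod (g1 x - g2 x)) integrable_on {a..b}"
    using set_integral_diff(1)[OF g1(1) g2a] by (simp add: absolutely_integrable_on_def)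
  have i3: "(\<lambda>x. cmod (f x - g x)) integrable_on {a..b}"
    using set_integral_diff(1)[OF f ga] by (simp add: absolutely_integrable_on_def)
  have "integral {a..b} (\<lambda>x. cmod (f x - g x))
      \<le> integral {a..b} (\<lambda>x. cmod (f x - g1 x) + cmod (g1 x - g2 x) + d)"
  proof (rule integral_le[OF i3])
    show "(\<lambda>x. cmod (f x - g1 x) + cmod (g1 x - g2 x) + d) integrable_on {a..b}"
      by (intro integrable_add i1 i2) auto
    fix x assume "x \<in> {a..b}"
    then have "norm (g2 x - g x) < d" using g(2) by blast
    moreover have "f x - g x = (f x - g1 x) + (g1 x - g2 x) + (g2 x - g x)" by simp
    then have "cmod (f x - g x) \<le> cmod (f x - g1 x) + cmod (g1 x - g2 x) + cmod (g2 x - g x)"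
      by (metis add_mono_thms_linordered_semiring(3) norm_triangle_ineq order_trans)
    ultimately show "cmod (f x - g x) \<le> cmod (f x - g1 x) + cmod (g1 x - g2 x) + d" by simp
  qed
  also have "\<dots> = integral {a..b} (\<lambda>x. cmod (f x - g1 x)) + integral {a..b} (\<lambda>x. cmod (g1 x - g2 x)) + d * (b - a)"
    using \<open>a \<le> b\<close> integral_add[OF integrable_add[OF i1 i2] integrable_const_ivl[of d]] integral_add[OF i1 i2]
    by (simp add: mult.commute)
  also have "d * (b - a) \<le> e / 3"
    using \<open>a \<le> b\<close> \<open>e > 0\<close> by (simp add: d_def divide_simps)
  finally show ?thesis using g1(3) g2(2) g(1) by auto
qed

lemma cmod_exp_kernel_le:
  assumes "t \<in> {0..x}"
  shows "cmod (exp (\<i> * \<rho> * of_real (x - 2 * t))) \<le> exp (\<bar>Im \<rho>\<bar> * x)"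
proof -
  have "- (Im \<rho> * (x - 2 * t)) \<le> \<bar>Im \<rho>\<bar> * \<bar>x - 2 * t\<bar>"
    by (metis abs_ge_minus_self abs_mult)
  also have "\<dots> \<le> \<bar>Im \<rho>\<bar> * x" using assms by (intro mult_left_mono) auto
  finally show ?thesis by (simp add: norm_exp_eq_Re)
qed

text \<open>The approximating polynomial depends on neither \<open>\<rho>\<close> nor
  \<open>x\<close>, and one integration by parts gains a factor \<open>1/|\<rho>|\<close> for it;
  the remainder is small in \<open>L1\<close>. The kernel with \<open>x - 2 * t\<close> arises when
  a leading exponential of one sign is inserted into the equation of the other.\<close>

lemma riemann_lebesgue_uniform:
  fixes f :: "real \<Rightarrow> complex"
  assumes "c \<ge> 0" and f: "f absolutely_integrable_on {0..c}" and "e > 0"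
  shows "\<exists>R>0. \<forall>\<rho> x. cmod \<rho> \<ge> R \<longrightarrow> x \<in> {0..c} \<longrightarrow>
           cmod (integral {0..x} (\<lambda>t. exp (\<i> * \<rho> * of_real (x - 2 * t)) * f t)) \<le> e * exp (\<bar>Im \<rho>\<bar> * x)"
proof -
  obtain g where g: "polynomial_function g" "integral {0..c} (\<lambda>x. cmod (f x - g x)) < e / 2"
    using absolutely_integrable_approx_polynomial[OF \<open>c \<ge> 0\<close> f, of "e / 2"] \<open>e > 0\<close> by auto
  obtain g' where g': "polynomial_function g'" "\<And>x. (g has_vector_derivative g' x) (at x)"
    using has_vector_derivative_polynomial_function[OF g(1)] by metis
  have cg: "continuous_on X g" and cg': "continuous_on X g'" for X
    by (auto intro: continuous_on_polymonial_function g g')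
  have "bounded (g ` {0..c})" "bounded (g' ` {0..c})"
    by (auto intro!: compact_imp_bounded compact_continuous_image cg cg')
  then obtain A B where A: "\<forall>x\<in>{0..c}. cmod (g x) \<le> A" and B: "\<forall>x\<in>{0..c}. cmod (g' x) \<le> B"
    by (auto simp: bounded_iff)
  have "A \<ge> 0" "B \<ge> 0" using A B \<open>c \<ge> 0\<close> by (auto intro: order_trans[OF norm_ge_zero] dest!: bspec[of _ _ 0])
  \<comment> \<open>The two boundary terms and the remaining integral add up to
    \<open>(2 * A + c * B) / (2 * |\<rho>|)\<close> times the exponential; beyond \<open>R\<close>
    this is at most \<open>e / 2\<close> times it. The summand 1 makes \<open>R\<close>
    positive.\<close>
  define R where "R = (2 * A + c * B) / e + 1"
  have "R > 0" using \<open>A \<ge> 0\<close> \<open>B \<ge> 0\<close> \<open>c \<ge> 0\<close> \<open>e > 0\<close> by (simp add: R_def add_nonneg_pos)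
  have "cmod (integral {0..x} (\<lambda>t. exp (\<i> * \<rho> * of_real (x - 2 * t)) * f t)) \<le> e * exp (\<bar>Im \<rho>\<bar> * x)"
    if \<rho>: "cmod \<rho> \<ge> R" and x: "x \<in> {0..c}" for \<rho> x
  proof -
    define E where "E t = exp (\<i> * \<rho> * of_real (x - 2 * t))" for t
    define T where "T = exp (\<bar>Im \<rho>\<bar> * x)"
    have ET: "cmod (E t) \<le> T" if "t \<in> {0..x}" for t
      using cmod_exp_kernel_le[OF that] by (simp add: E_def T_def)
    have "\<rho> \<noteq> 0" using \<rho> \<open>R > 0\<close> by auto
    have cE: "continuous_on X E" for X unfolding E_def by (intro continuous_intros)
    have sub: "{0..x} \<subseteq> {0..c}" using x by auto
    have fx: "f absolutely_integrable_on {0..x}" by (rule absolutely_integrable_on_subinterval[OF f sub])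
    have ga: "g absolutely_integrable_on {0..x}" by (rule absolutely_integrable_continuous_real[OF cg])
    have i1: "(\<lambda>t. E t * (f t - g t)) integrable_on {0..x}"
      using absolutely_integrable_continuous_mult[OF cE set_integral_diff(1)[OF fx ga]]
      by (simp add: absolutely_integrable_on_def)
    have i2: "(\<lambda>t. E t * g t) integrable_on {0..x}"
      by (intro integrable_continuous_real continuous_intros cE cg)
    have n1: "(\<lambda>t. cmod (f t - g t)) integrable_on {0..c}"
      using set_integral_diff(1)[OF f absolutely_integrable_continuous_real[OF cg]]
      by (simp add: absolutely_integrable_on_def)
    have n1x: "(\<lambda>t. cmod (f t - g t)) integrable_on {0..x}"
      by (rule integrable_on_subinterval[OF n1 sub])
    have "cmod (integral {0..x} (\<lambda>t. E t * (f t - g t))) \<le> integral {0..x} (\<lambda>t. T * cmod (f t - g t))"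
    proof (rule integral_norm_bound_integral[OF i1])
      show "(\<lambda>t. T * cmod (f t - g t)) integrable_on {0..x}"
        using n1x by (rule integrable_on_mult_right)
      show "cmod (E t * (f t - g t)) \<le> T * cmod (f t - g t)" if "t \<in> {0..x}" for t
        using mult_right_mono[OF ET[OF that], of "cmod (f t - g t)"] by (simp add: norm_mult)
    qed
    also have "\<dots> = T * integral {0..x} (\<lambda>t. cmod (f t - g t))" by simp
    also have "integral {0..x} (\<lambda>t. cmod (f t - g t)) \<le> integral {0..c} (\<lambda>t. cmod (f t - g t))"
      by (rule integral_subset_le[OF sub n1x n1]) auto
    finally have b1: "cmod (integral {0..x} (\<lambda>t. E t * (f t - g t))) \<le> T * (e / 2)"
      using g(2) by (smt (verit, best) T_def exp_gt_zero mult_left_mono)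
    define K where "K t = E t / (- 2 * \<i> * \<rho>)" for t
    have K: "(K has_vector_derivative E t) (at t within X)" for t X
    proof -
      have "((\<lambda>z. exp (\<i> * \<rho> * (of_real x - 2 * z)) / (- 2 * \<i> * \<rho>)) has_field_derivative
          exp (\<i> * \<rho> * (of_real x - 2 * of_real t))) (at (of_real t))"
        by (rule derivative_eq_intros refl | simp add: \<open>\<rho> \<noteq> 0\<close>)+
      from has_vector_derivative_real_field[OF this]
      show ?thesis by (simp add: K_def[abs_def] E_def)
    qed
    have KT: "cmod (K t) \<le> T / (2 * cmod \<rho>)" if "t \<in> {0..x}" for t
      using ET[OF that] by (simp add: K_def norm_divide norm_mult divide_right_mono)
    have "((\<lambda>t. K t * g' t + E t * g t) has_integral (K x * g x - K 0 * g 0)) {0..x}"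
    proof (rule fundamental_theorem_of_calculus)
      show "((\<lambda>t. K t * g t) has_vector_derivative K t * g' t + E t * g t) (at t within {0..x})" for t
        by (rule has_vector_derivative_mult[OF K has_vector_derivative_at_within[OF g'(2)]])
    qed (use x in auto)
    moreover have i3: "(\<lambda>t. K t * g' t) integrable_on {0..x}"
      unfolding K_def by (intro integrable_continuous_real continuous_intros cE cg') (use \<open>\<rho> \<noteq> 0\<close> in auto)
    ultimately have "integral {0..x} (\<lambda>t. E t * g t) = K x * g x - K 0 * g 0 - integral {0..x} (\<lambda>t. K t * g' t)"
      using integral_add[OF i3 i2] by (simp add: integral_unique algebra_simps)
    then have "cmod (integral {0..x} (\<lambda>t. E t * g t))
        \<le> cmod (K x * g x) + cmod (K 0 * g 0) + cmod (integral {0..x} (\<lambda>t. K t * g' t))"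
      using norm_triangle_ineq4[of "K x * g x - K 0 * g 0" "integral {0..x} (\<lambda>t. K t * g' t)"]
        norm_triangle_ineq4[of "K x * g x" "K 0 * g 0"] by simp
    also have "cmod (K x * g x) \<le> T / (2 * cmod \<rho>) * A"
      unfolding norm_mult using KT[of x] A x \<open>A \<ge> 0\<close> by (intro mult_mono) (auto simp: T_def)
    also have "cmod (K 0 * g 0) \<le> T / (2 * cmod \<rho>) * A"
      unfolding norm_mult using KT[of 0] A x \<open>A \<ge> 0\<close> by (intro mult_mono) (auto simp: T_def)
    also have "cmod (integral {0..x} (\<lambda>t. K t * g' t)) \<le> integral {0..x} (\<lambda>t. T / (2 * cmod \<rho>) * B)"
    proof (rule integral_norm_bound_integral[OF i3])
      show "cmod (K t * g' t) \<le> T / (2 * cmod \<rho>) * B" if "t \<in> {0..x}" for t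
        unfolding norm_mult using KT[OF that] B x that \<open>B \<ge> 0\<close> by (intro mult_mono) (auto simp: T_def)
    qed auto
    also have "\<dots> = T / (2 * cmod \<rho>) * B * x" using x by simp
    also have "\<dots> \<le> T / (2 * cmod \<rho>) * B * c"
      using x \<open>B \<ge> 0\<close> by (intro mult_left_mono) (auto simp: T_def)
    finally have "cmod (integral {0..x} (\<lambda>t. E t * g t)) \<le> T / (2 * cmod \<rho>) * (2 * A + c * B)"
      by (simp add: algebra_simps)
    also have "\<dots> \<le> T * (e / 2)"
    proof -
      have "(2 * A + c * B) / e \<le> cmod \<rho>" using \<rho> by (simp add: R_def)
      then have "2 * A + c * B \<le> cmod \<rho> * e" using \<open>e > 0\<close> by (simp add: field_simps)
      then have "(2 * A + c * B) / cmod \<rho> \<le> e" using \<open>\<rho> \<noteq> 0\<close> by (simp add: field_simps)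
      then have "T / 2 * ((2 * A + c * B) / cmod \<rho>) \<le> T / 2 * e"
        by (intro mult_left_mono) (auto simp: T_def)
      moreover have "T / (2 * cmod \<rho>) * (2 * A + c * B) = T / 2 * ((2 * A + c * B) / cmod \<rho>)"
        by simp
      ultimately show ?thesis by simp
    qed
    finally have b2: "cmod (integral {0..x} (\<lambda>t. E t * g t)) \<le> T * (e / 2)" .
    have "integral {0..x} (\<lambda>t. E t * f t) = integral {0..x} (\<lambda>t. E t * (f t - g t)) + integral {0..x} (\<lambda>t. E t * g t)"
      using integral_add[OF i1 i2] by (simp add: algebra_simps)
    then have "cmod (integral {0..x} (\<lambda>t. E t * f t)) \<le> T * (e / 2) + T * (e / 2)"
      using add_mono[OF b1 b2] norm_triangle_ineq[of "integral {0..x} (\<lambda>t. E t * (f t - g t))" "integral {0..x} (\<lambda>t. E t * g t)"]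
      by (simp only:)
    then show ?thesis by (simp add: E_def T_def mult.commute)
  qed
  then show ?thesis using \<open>R > 0\<close> by blast
qed

section \<open>Solutions of the Sturm--Liouville system\<close>

definition sq_integrable :: "(real \<Rightarrow> complex) \<Rightarrow> bool" where
  "sq_integrable \<sigma> \<longleftrightarrow>
     \<sigma> absolutely_integrable_on {0..pi} \<and> (\<lambda>x. (\<sigma> x)\<^sup>2) absolutely_integrable_on {0..pi}"

text \<open>The equation solved for the derivatives of \<open>y\<close> and \<open>z\<close>: a
  linear first-order system whose coefficients \<open>\<sigma>\<close> and
  \<open>\<sigma>\<^sup>2\<close> are merely integrable.\<close>

definition sl_system ::
    "(real \<Rightarrow> complex) \<Rightarrow> complex \<Rightarrow> (real \<Rightarrow> complex) \<Rightarrow> (real \<Rightarrow> complex) \<Rightarrow> bool" where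
  "sl_system \<sigma> \<mu> y z \<longleftrightarrow>
     primitive_on 0 pi y (\<lambda>x. z x + \<sigma> x * y x) \<and>
     primitive_on 0 pi z (\<lambda>x. - \<sigma> x * z x - ((\<sigma> x)\<^sup>2 + \<mu>) * y x)"

lemma AE_lebesgue_on_iff_negligible:
  assumes "A \<in> sets lebesgue"
  shows "(AE x in lebesgue_on A. P x) \<longleftrightarrow> (\<exists>N. negligible N \<and> (\<forall>x\<in>A - N. P x))"
proof -
  have "(AE x in lebesgue_on A. P x) \<longleftrightarrow> (AE x in lebesgue. x \<in> A \<longrightarrow> P x)"
    using assms by (subst AE_restrict_space_iff) auto
  also have "\<dots> \<longleftrightarrow> (\<exists>N. negligible N \<and> (\<forall>x\<in>A - N. P x))"
  proof
    assume "AE x in lebesgue. x \<in> A \<longrightarrow> P x"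
    then obtain N where N: "N \<in> null_sets lebesgue" "{x \<in> space lebesgue. \<not> (x \<in> A \<longrightarrow> P x)} \<subseteq> N"
      unfolding eventually_ae_filter by blast
    then show "\<exists>N. negligible N \<and> (\<forall>x\<in>A - N. P x)"
      by (intro exI[of _ N]) (auto simp: negligible_iff_null_sets)
  next
    assume "\<exists>N. negligible N \<and> (\<forall>x\<in>A - N. P x)"
    then obtain N where "N \<in> null_sets lebesgue" "\<forall>x\<in>A - N. P x"
      by (auto simp: negligible_iff_null_sets)
    then show "AE x in lebesgue. x \<in> A \<longrightarrow> P x"
      by (intro AE_I') auto
  qed
  finally show ?thesis .
qed

text \<open>On a bounded interval \<open>L2\<close> is contained in \<open>L1\<close>, here through
  \<open>|s| <= 1 + |s|\<^sup>2\<close>. Adding the two endpoints to the interval changes a null set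
  only.\<close>

lemma L2_imp_sq_integrable:
  assumes "L2_0_pi \<sigma>"
  shows "sq_integrable \<sigma>"
proof -
  have m: "\<sigma> \<in> borel_measurable (lebesgue_on {0<..<pi})"
    and i: "integrable (lebesgue_on {0<..<pi}) (\<lambda>x. (cmod (\<sigma> x))\<^sup>2)"
    using assms by (auto simp: L2_0_pi_def)
  have i2: "(\<lambda>x. (cmod (\<sigma> x))\<^sup>2) integrable_on {0<..<pi}"
    using integrable_on_lebesgue_on[OF i] by simp
  have "(\<lambda>x. (\<sigma> x)\<^sup>2) absolutely_integrable_on {0<..<pi}"
    by (rule measurable_bounded_by_integrable_imp_absolutely_integrable[OF _ _ i2])
      (use m in \<open>auto simp: norm_power\<close>)
  moreover have "\<sigma> absolutely_integrable_on {0<..<pi}"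
  proof (rule measurable_bounded_by_integrable_imp_absolutely_integrable[OF m])
    show "(\<lambda>x. 1 + (cmod (\<sigma> x))\<^sup>2) integrable_on {0<..<pi}"
      by (intro integrable_add i2) (simp only: integrable_on_Icc_iff_Ioo[symmetric] integrable_const_ivl)
    show "cmod (\<sigma> x) \<le> 1 + (cmod (\<sigma> x))\<^sup>2" for x
      using zero_le_power2[of "cmod (\<sigma> x) - 1"] by (simp add: power2_eq_square algebra_simps)
        (smt (verit) norm_ge_zero)
  qed auto
  moreover have "f absolutely_integrable_on {0..pi}" if "f absolutely_integrable_on {0<..<pi}"
    for f :: "real \<Rightarrow> complex"
  proof (rule absolutely_integrable_spike_set[OF that])
    show "negligible {x \<in> {0<..<pi} - {0..pi}. f x \<noteq> 0}"
      by (rule negligible_subset[of "{}"]) auto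
    show "negligible {x \<in> {0..pi} - {0<..<pi}. f x \<noteq> 0}"
      by (rule negligible_subset[of "{0, pi}"]) auto
  qed
  ultimately show ?thesis by (simp add: sq_integrable_def)
qed

lemma sl_integrands_absolutely_integrable:
  assumes \<sigma>: "sq_integrable \<sigma>" and u: "continuous_on {0..pi} u" and v: "continuous_on {0..pi} v"
  shows "(\<lambda>t. v t + \<sigma> t * u t) absolutely_integrable_on {0..pi}"
    "(\<lambda>t. - \<sigma> t * v t - ((\<sigma> t)\<^sup>2 + \<mu>) * u t) absolutely_integrable_on {0..pi}"
proof -
  have s: "\<sigma> absolutely_integrable_on {0..pi}" "(\<lambda>x. (\<sigma> x)\<^sup>2) absolutely_integrable_on {0..pi}"
    using \<sigma> by (auto simp: sq_integrable_def)
  show "(\<lambda>t. v t + \<sigma> t * u t) absolutely_integrable_on {0..pi}"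
    using absolutely_integrable_continuous_real[OF v] absolutely_integrable_continuous_mult[OF u s(1)]
    by (simp add: mult.commute)
  have "(\<lambda>x. - v x * \<sigma> x - (u x * (\<sigma> x)\<^sup>2 + \<mu> * u x)) absolutely_integrable_on {0..pi}"
    using absolutely_integrable_continuous_mult[OF continuous_on_minus[OF v] s(1)]
      absolutely_integrable_continuous_mult[OF u s(2)]
      absolutely_integrable_continuous_real[OF continuous_on_mult_left[OF u, of \<mu>]]
    by (intro set_integral_diff(1) set_integral_add(1)) auto
  then show "(\<lambda>t. - \<sigma> t * v t - ((\<sigma> t)\<^sup>2 + \<mu>) * u t) absolutely_integrable_on {0..pi}"
    by (simp add: algebra_simps)
qed

text \<open>Absolute continuity makes \<open>y\<close> and \<open>z\<close> continuous, hence
  bounded, so the right-hand sides are integrable and the equations that hold almost everywhere may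
  be integrated.\<close>

lemma SL_solution_imp_sl_system:
  assumes \<sigma>: "sq_integrable \<sigma>" and sol: "SL_solution \<sigma> \<mu> y z"
  shows "sl_system \<sigma> \<mu> y z"
proof -
  have ac: "abs_cont 0 pi y" "abs_cont 0 pi z"
    and ae: "AE x in lebesgue_on {0<..<pi}. y differentiable (at x) \<and> z x = vector_derivative y (at x) - \<sigma> x * y x"
      "AE x in lebesgue_on {0<..<pi}. z differentiable (at x) \<and>
        - vector_derivative z (at x) - \<sigma> x * z x - (\<sigma> x)\<^sup>2 * y x = \<mu> * y x"
    using sol unfolding SL_solution_def quasi_deriv_def by auto
  have cy: "continuous_on {0..pi} y" and cz: "continuous_on {0..pi} z"
    using ac by (auto intro: abs_cont_continuous_on)
  obtain N1 where N1: "negligible N1" "\<forall>x\<in>{0<..<pi} - N1. y differentiable (at x) \<and>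
      z x = vector_derivative y (at x) - \<sigma> x * y x"
    using ae(1) by (subst (asm) AE_lebesgue_on_iff_negligible) auto
  obtain N2 where N2: "negligible N2" "\<forall>x\<in>{0<..<pi} - N2. z differentiable (at x) \<and>
        - vector_derivative z (at x) - \<sigma> x * z x - (\<sigma> x)\<^sup>2 * y x = \<mu> * y x"
    using ae(2) by (subst (asm) AE_lebesgue_on_iff_negligible) auto
  show ?thesis
    unfolding sl_system_def
  proof
    show "primitive_on 0 pi y (\<lambda>x. z x + \<sigma> x * y x)"
    proof (rule primitive_onI[OF ac(1) N1(1)])
      fix x assume "x \<in> {0<..<pi} - N1"
      then have "y differentiable (at x)" "z x = vector_derivative y (at x) - \<sigma> x * y x" using N1(2) by auto
      then show "(y has_vector_derivative z x + \<sigma> x * y x) (at x)"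
        by (simp add: vector_derivative_works)
    next
      show "(\<lambda>x. z x + \<sigma> x * y x) absolutely_integrable_on {0..pi}"
        by (rule sl_integrands_absolutely_integrable(1)[OF \<sigma> cy cz])
    qed
    show "primitive_on 0 pi z (\<lambda>x. - \<sigma> x * z x - ((\<sigma> x)\<^sup>2 + \<mu>) * y x)"
    proof (rule primitive_onI[OF ac(2) N2(1)])
      fix x assume "x \<in> {0<..<pi} - N2"
      then have *: "z differentiable (at x)" "- vector_derivative z (at x) - \<sigma> x * z x - (\<sigma> x)\<^sup>2 * y x = \<mu> * y x"
        using N2(2) by blast+
      then have "vector_derivative z (at x) = - \<sigma> x * z x - ((\<sigma> x)\<^sup>2 + \<mu>) * y x"
        by algebra
      note * = *(1) this
      then show "(z has_vector_derivative - \<sigma> x * z x - ((\<sigma> x)\<^sup>2 + \<mu>) * y x) (at x)"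
        using *(1) unfolding *(2)[symmetric] by (simp only: vector_derivative_works)
    next
      show "(\<lambda>x. - \<sigma> x * z x - ((\<sigma> x)\<^sup>2 + \<mu>) * y x) absolutely_integrable_on {0..pi}"
        by (rule sl_integrands_absolutely_integrable(2)[OF \<sigma> cy cz])
    qed
  qed
qed

lemma sl_system_imp_SL_solution:
  assumes "sl_system \<sigma> \<mu> y z"
  shows "SL_solution \<sigma> \<mu> y z"
proof -
  have y: "primitive_on 0 pi y (\<lambda>x. z x + \<sigma> x * y x)"
    and z: "primitive_on 0 pi z (\<lambda>x. - \<sigma> x * z x - ((\<sigma> x)\<^sup>2 + \<mu>) * y x)"
    using assms by (auto simp: sl_system_def)
  obtain N1 where N1: "negligible N1"
    "\<forall>x\<in>{0<..<pi} - N1. (y has_vector_derivative z x + \<sigma> x * y x) (at x)"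
    using primitive_on_AE[OF y] by blast
  obtain N2 where N2: "negligible N2"
    "\<forall>x\<in>{0<..<pi} - N2. (z has_vector_derivative - \<sigma> x * z x - ((\<sigma> x)\<^sup>2 + \<mu>) * y x) (at x)"
    using primitive_on_AE[OF z] by blast
  have "AE x in lebesgue_on {0<..<pi}. y differentiable (at x) \<and> z x = vector_derivative y (at x) - \<sigma> x * y x"
  proof (subst AE_lebesgue_on_iff_negligible; (intro exI[of _ N1] conjI ballI N1(1))?)
    fix x assume "x \<in> {0<..<pi} - N1"
    then have "(y has_vector_derivative z x + \<sigma> x * y x) (at x)" using N1(2) by blast
    then show "y differentiable at x" "z x = vector_derivative y (at x) - \<sigma> x * y x"
      by (auto simp: vector_derivative_at intro: differentiableI_vector)
  qed auto
  moreover have "AE x in lebesgue_on {0<..<pi}. z differentiable (at x) \<and>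
        - vector_derivative z (at x) - \<sigma> x * z x - (\<sigma> x)\<^sup>2 * y x = \<mu> * y x"
  proof (subst AE_lebesgue_on_iff_negligible; (intro exI[of _ N2] conjI ballI N2(1))?)
    fix x assume "x \<in> {0<..<pi} - N2"
    then have *: "(z has_vector_derivative - \<sigma> x * z x - ((\<sigma> x)\<^sup>2 + \<mu>) * y x) (at x)" using N2(2) by blast
    then show "z differentiable at x" by (rule differentiableI_vector)
    show "- vector_derivative z (at x) - \<sigma> x * z x - (\<sigma> x)\<^sup>2 * y x = \<mu> * y x"
      unfolding vector_derivative_at[OF *] by algebra
  qed auto
  ultimately show ?thesis
    unfolding SL_solution_def quasi_deriv_def
    using primitive_on_abs_cont[OF y] primitive_on_abs_cont[OF z] by blast
qed

text \<open>A bound, valid for all \<open>|\<mu>| <= R\<close>, of the norm of the coefficient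
  matrix with respect to \<open>|u| + |v|\<close>. With \<open>R = 0\<close> it also dominates the
  coupling terms of the diagonalized system.\<close>

definition kernel_bound :: "(real \<Rightarrow> complex) \<Rightarrow> real \<Rightarrow> real \<Rightarrow> real" where
  "kernel_bound \<sigma> R t = 1 + R + 2 * cmod (\<sigma> t) + (cmod (\<sigma> t))\<^sup>2"

lemma kernel_bound_absolutely_integrable:
  assumes "sq_integrable \<sigma>"
  shows "kernel_bound \<sigma> R absolutely_integrable_on {0..pi}"
proof -
  have s: "\<sigma> absolutely_integrable_on {0..pi}" "(\<lambda>x. (\<sigma> x)\<^sup>2) absolutely_integrable_on {0..pi}"
    using assms by (auto simp: sq_integrable_def)
  have "(\<lambda>x. cmod (\<sigma> x)) absolutely_integrable_on {0..pi}"
    using absolutely_integrable_norm[OF s(1)] by (simp add: o_def)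
  moreover have "(\<lambda>x. (cmod (\<sigma> x))\<^sup>2) absolutely_integrable_on {0..pi}"
    using absolutely_integrable_norm[OF s(2)] by (simp add: o_def norm_power)
  moreover have "(\<lambda>x. 1 + R) absolutely_integrable_on {0..pi}"
    by (rule absolutely_integrable_continuous_real) auto
  ultimately show ?thesis
    unfolding kernel_bound_def by (intro set_integral_add(1) set_integrable_mult_right) auto
qed

lemma kernel_bound_nonneg: "R \<ge> 0 \<Longrightarrow> 0 \<le> kernel_bound \<sigma> R t"
  by (simp add: kernel_bound_def)

lemma kernel_bound_le:
  assumes "cmod \<mu> \<le> R"
  shows "cmod (v + \<sigma> t * u) + cmod (- \<sigma> t * v - ((\<sigma> t)\<^sup>2 + \<mu>) * u)
     \<le> kernel_bound \<sigma> R t * (cmod u + cmod v)"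
proof -
  have 1: "cmod (v + \<sigma> t * u) \<le> cmod v + cmod (\<sigma> t) * cmod u"
    by (metis norm_mult norm_triangle_ineq)
  have "cmod (- \<sigma> t * v - ((\<sigma> t)\<^sup>2 + \<mu>) * u) \<le> cmod (- \<sigma> t * v) + cmod (((\<sigma> t)\<^sup>2 + \<mu>) * u)"
    by (rule norm_triangle_ineq4)
  also have "\<dots> = cmod (\<sigma> t) * cmod v + cmod ((\<sigma> t)\<^sup>2 + \<mu>) * cmod u"
    by (simp add: norm_mult)
  also have "\<dots> \<le> cmod (\<sigma> t) * cmod v + ((cmod (\<sigma> t))\<^sup>2 + R) * cmod u"
    using norm_triangle_ineq[of "(\<sigma> t)\<^sup>2" \<mu>] assms
    by (intro add_left_mono mult_right_mono) (auto simp: norm_power)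
  finally have 2: "cmod (- \<sigma> t * v - ((\<sigma> t)\<^sup>2 + \<mu>) * u) \<le> \<dots>" .
  have R: "R \<ge> 0" using assms norm_ge_zero order_trans by blast
  have "kernel_bound \<sigma> R t * (cmod u + cmod v) - (cmod v + cmod (\<sigma> t) * cmod u) -
      (cmod (\<sigma> t) * cmod v + ((cmod (\<sigma> t))\<^sup>2 + R) * cmod u)
    = cmod u + R * cmod v + cmod (\<sigma> t) * cmod u + cmod (\<sigma> t) * cmod v + (cmod (\<sigma> t))\<^sup>2 * cmod v"
    by (simp add: kernel_bound_def algebra_simps)
  also have "\<dots> \<ge> 0" using R by auto
  finally show ?thesis using 1 2 by linarith
qed

text \<open>One application of the Volterra operator, with input \<open>(u, v)\<close> and output
  \<open>(Y, Z)\<close> kept apart. With equal input and output it feeds the Gronwall argument;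
  otherwise it serves the differences of Picard iterates and their limit.\<close>

lemma sl_pair_le:
  assumes Y: "primitive_on 0 pi Y (\<lambda>t. v t + \<sigma> t * u t)"
    and Z: "primitive_on 0 pi Z (\<lambda>t. - \<sigma> t * v t - ((\<sigma> t)\<^sup>2 + \<mu>) * u t)"
    and \<mu>: "cmod \<mu> \<le> R" and x: "x \<in> {0..pi}"
    and w: "(\<lambda>t. kernel_bound \<sigma> R t * w t) integrable_on {0..x}"
    and le: "\<And>t. t \<in> {0..x} \<Longrightarrow> cmod (u t) + cmod (v t) \<le> w t"
  shows "cmod (Y x) + cmod (Z x) \<le> cmod (Y 0) + cmod (Z 0) + integral {0..x} (\<lambda>t. kernel_bound \<sigma> R t * w t)"
proof -
  have R: "R \<ge> 0" using \<mu> norm_ge_zero order_trans by blast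
  have eq: "Y x = Y 0 + integral {0..x} (\<lambda>t. v t + \<sigma> t * u t)"
    "Z x = Z 0 + integral {0..x} (\<lambda>t. - \<sigma> t * v t - ((\<sigma> t)\<^sup>2 + \<mu>) * u t)"
    using primitive_onD[OF Y x] primitive_onD[OF Z x] .
  have i: "(\<lambda>t. cmod (v t + \<sigma> t * u t)) integrable_on {0..x}"
    "(\<lambda>t. cmod (- \<sigma> t * v t - ((\<sigma> t)\<^sup>2 + \<mu>) * u t)) integrable_on {0..x}"
    using primitive_on_integrand(2)[OF Y x] primitive_on_integrand(2)[OF Z x]
    by (auto simp: absolutely_integrable_on_def)
  have "cmod (integral {0..x} (\<lambda>t. v t + \<sigma> t * u t)) +
      cmod (integral {0..x} (\<lambda>t. - \<sigma> t * v t - ((\<sigma> t)\<^sup>2 + \<mu>) * u t))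
    \<le> integral {0..x} (\<lambda>t. cmod (v t + \<sigma> t * u t)) +
      integral {0..x} (\<lambda>t. cmod (- \<sigma> t * v t - ((\<sigma> t)\<^sup>2 + \<mu>) * u t))"
    by (intro add_mono integral_norm_bound_integral primitive_on_integrand(1)[OF Y x]
        primitive_on_integrand(1)[OF Z x] i) auto
  also have "\<dots> = integral {0..x} (\<lambda>t. cmod (v t + \<sigma> t * u t) + cmod (- \<sigma> t * v t - ((\<sigma> t)\<^sup>2 + \<mu>) * u t))"
    by (rule integral_add[OF i, symmetric])
  also have "\<dots> \<le> integral {0..x} (\<lambda>t. kernel_bound \<sigma> R t * w t)"
  proof (rule integral_le[OF integrable_add[OF i] w])
    fix t assume t: "t \<in> {0..x}"
    show "cmod (v t + \<sigma> t * u t) + cmod (- \<sigma> t * v t - ((\<sigma> t)\<^sup>2 + \<mu>) * u t) \<le> kernel_bound \<sigma> R t * w t"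
      using kernel_bound_le[where \<mu> = \<mu> and R = R and \<sigma> = \<sigma> and t = t and u = "u t" and v = "v t", OF \<mu>]
        mult_left_mono[OF le[OF t] kernel_bound_nonneg[OF R, of \<sigma> t]] by linarith
  qed
  finally show ?thesis
    unfolding eq using norm_triangle_ineq[of "Y 0" "integral {0..x} (\<lambda>t. v t + \<sigma> t * u t)"]
      norm_triangle_ineq[of "Z 0" "integral {0..x} (\<lambda>t. - \<sigma> t * v t - ((\<sigma> t)\<^sup>2 + \<mu>) * u t)"]
    by linarith
qed

lemma sl_system_continuous:
  assumes "sl_system \<sigma> \<mu> y z"
  shows "continuous_on {0..pi} y" "continuous_on {0..pi} z"
  using assms unfolding sl_system_def by (auto intro: primitive_on_continuous)

text \<open>The constant depends on the parameter only through \<open>R\<close>. Zero initial data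
  give uniqueness, and \<open>|\<mu>| = R\<close> gives bounds on the circle that are uniform in
  \<open>x\<close>.\<close>

lemma sl_system_bound:
  assumes \<sigma>: "sq_integrable \<sigma>" and sys: "sl_system \<sigma> \<mu> y z" and \<mu>: "cmod \<mu> \<le> R" and x: "x \<in> {0..pi}"
  shows "cmod (y x) + cmod (z x) \<le> 2 * (cmod (y 0) + cmod (z 0)) * exp (2 * integral {0..pi} (kernel_bound \<sigma> R))"
proof -
  have R: "R \<ge> 0" using \<mu> norm_ge_zero order_trans by blast
  have c: "continuous_on {0..pi} (\<lambda>t. cmod (y t) + cmod (z t))"
    by (intro continuous_intros sl_system_continuous[OF sys])
  have i: "(\<lambda>t. kernel_bound \<sigma> R t * (cmod (y t) + cmod (z t))) absolutely_integrable_on {0..pi}"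
    by (rule absolutely_integrable_continuous_mult_real[OF c kernel_bound_absolutely_integrable[OF \<sigma>]])
  show ?thesis
  proof (rule gronwall_L1[OF kernel_bound_absolutely_integrable[OF \<sigma>] kernel_bound_nonneg[OF R] c _ _ x])
    fix x :: real assume x: "x \<in> {0..pi}"
    show "cmod (y x) + cmod (z x) \<le> cmod (y 0) + cmod (z 0) +
        integral {0..x} (\<lambda>t. kernel_bound \<sigma> R t * (cmod (y t) + cmod (z t)))"
    proof (rule sl_pair_le[OF _ _ \<mu> x])
      show "(\<lambda>t. kernel_bound \<sigma> R t * (cmod (y t) + cmod (z t))) integrable_on {0..x}"
        using i x by (auto simp: absolutely_integrable_on_def intro: integrable_on_subinterval)
    qed (use sys in \<open>auto simp: sl_system_def\<close>)
  qed auto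
qed

lemma sl_system_diff:
  assumes "sl_system \<sigma> \<mu> y z" and "sl_system \<sigma> \<mu> y' z'"
  shows "sl_system \<sigma> \<mu> (\<lambda>x. y x - y' x) (\<lambda>x. z x - z' x)"
  unfolding sl_system_def
proof
  show "primitive_on 0 pi (\<lambda>x. y x - y' x) (\<lambda>x. z x - z' x + \<sigma> x * (y x - y' x))"
    by (rule primitive_on_cong[OF primitive_on_diff[OF assms[unfolded sl_system_def, THEN conjunct1]]])
      (simp_all add: algebra_simps)
  show "primitive_on 0 pi (\<lambda>x. z x - z' x) (\<lambda>x. - \<sigma> x * (z x - z' x) - ((\<sigma> x)\<^sup>2 + \<mu>) * (y x - y' x))"
    by (rule primitive_on_cong[OF primitive_on_diff[OF assms[unfolded sl_system_def, THEN conjunct2]]])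
      (simp_all add: algebra_simps)
qed

lemma sl_system_cmult:
  assumes "sl_system \<sigma> \<mu> y z"
  shows "sl_system \<sigma> \<mu> (\<lambda>x. c * y x) (\<lambda>x. c * z x)"
  unfolding sl_system_def
proof
  show "primitive_on 0 pi (\<lambda>x. c * y x) (\<lambda>x. c * z x + \<sigma> x * (c * y x))"
    by (rule primitive_on_cong[OF primitive_on_cmult[OF assms[unfolded sl_system_def, THEN conjunct1]]])
      (simp_all add: algebra_simps)
  show "primitive_on 0 pi (\<lambda>x. c * z x) (\<lambda>x. - \<sigma> x * (c * z x) - ((\<sigma> x)\<^sup>2 + \<mu>) * (c * y x))"
    by (rule primitive_on_cong[OF primitive_on_cmult[OF assms[unfolded sl_system_def, THEN conjunct2]]])
      (simp_all add: algebra_simps)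
qed

lemma sl_system_add:
  assumes "sl_system \<sigma> \<mu> y z" and "sl_system \<sigma> \<mu> y' z'"
  shows "sl_system \<sigma> \<mu> (\<lambda>x. y x + y' x) (\<lambda>x. z x + z' x)"
  using sl_system_diff[OF assms(1) sl_system_cmult[OF assms(2), of "- 1"]] by simp

lemma sl_system_unique:
  assumes \<sigma>: "sq_integrable \<sigma>" and sys: "sl_system \<sigma> \<mu> y z" and sys': "sl_system \<sigma> \<mu> y' z'"
    and "y 0 = y' 0" "z 0 = z' 0" and x: "x \<in> {0..pi}"
  shows "y x = y' x" "z x = z' x"
proof -
  have "cmod (y x - y' x) + cmod (z x - z' x) \<le> 0"
    using sl_system_bound[OF \<sigma> sl_system_diff[OF sys sys'] order_refl x] assms by simp
  then have "cmod (y x - y' x) = 0 \<and> cmod (z x - z' x) = 0"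
    by (smt (verit) norm_ge_zero)
  then show "y x = y' x" "z x = z' x" by auto
qed

section \<open>Picard iteration: existence of solutions and holomorphy in the spectral
  parameter\<close>

definition poly_family :: "(complex \<Rightarrow> real \<Rightarrow> complex) \<Rightarrow> bool" where
  "poly_family f \<longleftrightarrow> (\<exists>m c. (\<forall>k<m. continuous_on {0..pi} (c k)) \<and>
     (\<forall>\<mu>. \<forall>x\<in>{0..pi}. f \<mu> x = (\<Sum>k<(m::nat). c k x * \<mu> ^ k)))"

lemma poly_family_const: "poly_family (\<lambda>\<mu> x. a)"
  unfolding poly_family_def by (rule exI[of _ 1], rule exI[of _ "\<lambda>_ _. a"]) auto

lemma poly_family_add:
  assumes "poly_family f" and "poly_family g"
  shows "poly_family (\<lambda>\<mu> x. f \<mu> x + g \<mu> x)"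
proof -
  obtain m c where c: "\<forall>k<m. continuous_on {0..pi} (c k)"
    "\<forall>\<mu>. \<forall>x\<in>{0..pi}. f \<mu> x = (\<Sum>k<(m::nat). c k x * \<mu> ^ k)"
    using assms(1) unfolding poly_family_def by blast
  obtain n d where d: "\<forall>k<n. continuous_on {0..pi} (d k)"
    "\<forall>\<mu>. \<forall>x\<in>{0..pi}. g \<mu> x = (\<Sum>k<(n::nat). d k x * \<mu> ^ k)"
    using assms(2) unfolding poly_family_def by blast
  define e where "e k = (\<lambda>x. (if k < m then c k x else 0) + (if k < n then d k x else 0))" for k
  show ?thesis
    unfolding poly_family_def
  proof (intro exI[of _ "m + n"] exI[of _ e] conjI allI impI ballI)
    show "continuous_on {0..pi} (e k)" for k
      unfolding e_def using c(1) d(1) by (cases "k < m"; cases "k < n") (auto intro: continuous_on_add)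
    fix \<mu> x assume x: "x \<in> {0..pi}"
    have "(\<Sum>k<m + n. e k x * \<mu> ^ k) = (\<Sum>k<m + n. if k < m then c k x * \<mu> ^ k else 0) +
        (\<Sum>k<m + n. if k < n then d k x * \<mu> ^ k else 0)"
      unfolding sum.distrib[symmetric] by (rule sum.cong) (auto simp: e_def algebra_simps)
    also have "(\<Sum>k<m + n. if k < m then c k x * \<mu> ^ k else 0) = (\<Sum>k<m. c k x * \<mu> ^ k)"
      by (rule sum.mono_neutral_cong_right) auto
    also have "(\<Sum>k<m + n. if k < n then d k x * \<mu> ^ k else 0) = (\<Sum>k<n. d k x * \<mu> ^ k)"
      by (rule sum.mono_neutral_cong_right) auto
    finally show "f \<mu> x + g \<mu> x = (\<Sum>k<m + n. e k x * \<mu> ^ k)"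
      using c(2) d(2) x by simp
  qed
qed

lemma poly_family_param_mult:
  assumes "poly_family f"
  shows "poly_family (\<lambda>\<mu> x. \<mu> * f \<mu> x)"
proof -
  obtain m c where c: "\<forall>k<m. continuous_on {0..pi} (c k)"
    "\<forall>\<mu>. \<forall>x\<in>{0..pi}. f \<mu> x = (\<Sum>k<(m::nat). c k x * \<mu> ^ k)"
    using assms unfolding poly_family_def by blast
  show ?thesis
    unfolding poly_family_def
  proof (intro exI[of _ "Suc m"] exI[of _ "\<lambda>k. if k = 0 then (\<lambda>_. 0) else c (k - 1)"] conjI allI impI ballI)
    show "continuous_on {0..pi} (if k = 0 then \<lambda>_. 0 else c (k - 1))" if "k < Suc m" for k
      using c(1) that by (auto simp: less_Suc_eq_0_disj)
    show "\<mu> * f \<mu> x = (\<Sum>k<Suc m. (if k = 0 then \<lambda>_. 0 else c (k - 1)) x * \<mu> ^ k)"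
      if "x \<in> {0..pi}" for \<mu> x
      using c(2) that by (subst sum.lessThan_Suc_shift) (simp add: sum_distrib_left mult_ac)
  qed
qed

lemma poly_family_continuous:
  assumes "poly_family f"
  shows "continuous_on {0..pi} (f \<mu>)"
proof -
  obtain m c where c: "\<forall>k<m. continuous_on {0..pi} (c k)"
    "\<forall>\<mu>. \<forall>x\<in>{0..pi}. f \<mu> x = (\<Sum>k<(m::nat). c k x * \<mu> ^ k)"
    using assms unfolding poly_family_def by blast
  have "continuous_on {0..pi} (\<lambda>x. \<Sum>k<m. c k x * \<mu> ^ k)"
    using c(1) by (intro continuous_intros) auto
  then show ?thesis
    by (rule continuous_on_eq) (use c(2) in auto)
qed

lemma poly_family_holomorphic:
  assumes "poly_family f" and "x \<in> {0..pi}"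
  shows "(\<lambda>\<mu>. f \<mu> x) holomorphic_on A"
proof -
  obtain m c where "\<forall>\<mu>. f \<mu> x = (\<Sum>k<(m::nat). c k x * \<mu> ^ k)"
    using assms unfolding poly_family_def by blast
  then have "(\<lambda>\<mu>. f \<mu> x) = (\<lambda>\<mu>. \<Sum>k<m. c k x * \<mu> ^ k)" by auto
  then show ?thesis by (auto intro!: holomorphic_intros)
qed

lemma poly_family_integral:
  assumes f: "poly_family f" and s: "s absolutely_integrable_on {0..pi}"
  shows "poly_family (\<lambda>\<mu> x. integral {0..x} (\<lambda>t. s t * f \<mu> t))"
proof -
  obtain m c where c: "\<forall>k<m. continuous_on {0..pi} (c k)"
    "\<forall>\<mu>. \<forall>x\<in>{0..pi}. f \<mu> x = (\<Sum>k<(m::nat). c k x * \<mu> ^ k)"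
    using f unfolding poly_family_def by blast
  define C where "C k x = integral {0..x} (\<lambda>t. s t * c k t)" for k x
  have i: "(\<lambda>t. s t * c k t) integrable_on {0..pi}" if "k < m" for k
    using absolutely_integrable_continuous_mult[OF c(1)[rule_format, OF that] s]
    by (simp add: absolutely_integrable_on_def mult.commute)
  show ?thesis
    unfolding poly_family_def
  proof (intro exI[of _ m] exI[of _ C] conjI allI impI ballI)
    show "continuous_on {0..pi} (C k)" if "k < m" for k
      unfolding C_def by (rule indefinite_integral_continuous_1[OF i[OF that]])
    fix \<mu> x assume x: "x \<in> {0..pi}"
    have "integral {0..x} (\<lambda>t. s t * f \<mu> t) = integral {0..x} (\<lambda>t. \<Sum>k<m. s t * c k t * \<mu> ^ k)"
      by (rule integral_cong) (use c(2) x in \<open>auto simp: sum_distrib_left mult_ac\<close>)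
    also have "\<dots> = (\<Sum>k<m. integral {0..x} (\<lambda>t. s t * c k t * \<mu> ^ k))"
    proof (rule integral_sum)
      fix k assume "k \<in> {..<m}"
      then have "(\<lambda>t. s t * c k t) integrable_on {0..x}"
        by (intro integrable_on_subinterval[OF i]) (use x in auto)
      then show "(\<lambda>t. s t * c k t * \<mu> ^ k) integrable_on {0..x}"
        by (rule integrable_on_mult_left)
    qed auto
    also have "\<dots> = (\<Sum>k<m. C k x * \<mu> ^ k)"
      by (simp add: C_def)
    finally show "integral {0..x} (\<lambda>t. s t * f \<mu> t) = (\<Sum>k<m. C k x * \<mu> ^ k)" .
  qed
qed

primrec picard ::
    "(real \<Rightarrow> complex) \<Rightarrow> complex \<Rightarrow> complex \<Rightarrow> nat \<Rightarrow> complex \<Rightarrow> real \<Rightarrow> complex \<times> complex" where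
  "picard \<sigma> a b 0 = (\<lambda>\<mu> x. (a, b))"
| "picard \<sigma> a b (Suc n) = (\<lambda>\<mu> x.
     (a + integral {0..x} (\<lambda>t. snd (picard \<sigma> a b n \<mu> t) + \<sigma> t * fst (picard \<sigma> a b n \<mu> t)),
      b + integral {0..x} (\<lambda>t. - \<sigma> t * snd (picard \<sigma> a b n \<mu> t) -
            ((\<sigma> t)\<^sup>2 + \<mu>) * fst (picard \<sigma> a b n \<mu> t))))"

text \<open>Each iterate is a polynomial in \<open>\<mu>\<close> with coefficients continuous in
  \<open>x\<close>. This gives holomorphy of the iterates without differentiating under an integral,
  since integration acts on the coefficients alone.\<close>

lemma poly_family_picard:
  assumes \<sigma>: "sq_integrable \<sigma>"
  shows "poly_family (\<lambda>\<mu> x. fst (picard \<sigma> a b n \<mu> x)) \<and> poly_family (\<lambda>\<mu> x. snd (picard \<sigma> a b n \<mu> x))"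
proof (induction n)
  case 0
  then show ?case by (simp add: poly_family_const)
next
  case (Suc n)
  define Y where "Y \<mu> x = fst (picard \<sigma> a b n \<mu> x)" for \<mu> x
  define Z where "Z \<mu> x = snd (picard \<sigma> a b n \<mu> x)" for \<mu> x
  have pY: "poly_family Y" and pZ: "poly_family Z" using Suc by (auto simp: Y_def[abs_def] Z_def[abs_def])
  have s: "\<sigma> absolutely_integrable_on {0..pi}" "(\<lambda>x. (\<sigma> x)\<^sup>2) absolutely_integrable_on {0..pi}"
    using \<sigma> by (auto simp: sq_integrable_def)
  have one: "(\<lambda>_. 1 :: complex) absolutely_integrable_on {0..pi}"
    by (rule absolutely_integrable_continuous_real) auto
  have neg: "(\<lambda>x. - \<sigma> x) absolutely_integrable_on {0..pi}" "(\<lambda>x. - (\<sigma> x)\<^sup>2) absolutely_integrable_on {0..pi}"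
    "(\<lambda>_. - 1 :: complex) absolutely_integrable_on {0..pi}"
    using absolutely_integrable_continuous_mult[OF continuous_on_const s(1), of "-1"]
      absolutely_integrable_continuous_mult[OF continuous_on_const s(2), of "-1"]
    by (auto intro!: absolutely_integrable_continuous_real)
  have i: "(\<lambda>t. k t * f \<mu> t) integrable_on {0..x}"
    if "k absolutely_integrable_on {0..pi}" "poly_family f" "x \<in> {0..pi}" for k f \<mu> x
  proof -
    have "(\<lambda>t. f \<mu> t * k t) integrable_on {0..pi}"
      using absolutely_integrable_continuous_mult[OF poly_family_continuous[OF that(2)] that(1)]
      by (simp add: absolutely_integrable_on_def)
    then have "(\<lambda>t. f \<mu> t * k t) integrable_on {0..x}"
      by (rule integrable_on_subinterval) (use that in auto)
    then show ?thesis by (simp add: mult.commute)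
  qed
  have eqY: "fst (picard \<sigma> a b (Suc n) \<mu> x) =
      a + (integral {0..x} (\<lambda>t. 1 * Z \<mu> t) + integral {0..x} (\<lambda>t. \<sigma> t * Y \<mu> t))" if "x \<in> {0..pi}" for \<mu> x
    using integral_add[OF i[OF one pZ that] i[OF s(1) pY that], of \<mu> \<mu>] by (simp add: Y_def Z_def)
  \<comment> \<open>The parameter is pulled out of the integral, so that the iterate is built from
    multiplication by \<open>\<mu>\<close> and from integrals with kernels free of
    \<open>\<mu>\<close>.\<close>
  have eqZ: "snd (picard \<sigma> a b (Suc n) \<mu> x) =
      b + (integral {0..x} (\<lambda>t. - \<sigma> t * Z \<mu> t) + (integral {0..x} (\<lambda>t. - (\<sigma> t)\<^sup>2 * Y \<mu> t) +
        \<mu> * integral {0..x} (\<lambda>t. - 1 * Y \<mu> t)))" if x: "x \<in> {0..pi}" for \<mu> x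
  proof -
    have "integral {0..x} (\<lambda>t. - \<sigma> t * Z \<mu> t) + (integral {0..x} (\<lambda>t. - (\<sigma> t)\<^sup>2 * Y \<mu> t) +
        integral {0..x} (\<lambda>t. \<mu> * (- 1 * Y \<mu> t))) =
      integral {0..x} (\<lambda>t. - \<sigma> t * Z \<mu> t + (- (\<sigma> t)\<^sup>2 * Y \<mu> t + \<mu> * (- 1 * Y \<mu> t)))"
      by (subst integral_add[symmetric] | intro i neg x pY pZ integrable_add integrable_on_mult_right)+ simp
    also have "(\<lambda>t. - \<sigma> t * Z \<mu> t + (- (\<sigma> t)\<^sup>2 * Y \<mu> t + \<mu> * (- 1 * Y \<mu> t))) =
       (\<lambda>t. - \<sigma> t * Z \<mu> t - ((\<sigma> t)\<^sup>2 + \<mu>) * Y \<mu> t)"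
      by (auto simp: algebra_simps)
    finally show ?thesis
      by (simp only: integral_mult_right picard.simps snd_conv Y_def Z_def)
  qed
  have pY': "poly_family (\<lambda>\<mu> x. a + (integral {0..x} (\<lambda>t. 1 * Z \<mu> t) + integral {0..x} (\<lambda>t. \<sigma> t * Y \<mu> t)))"
    by (intro poly_family_add poly_family_const poly_family_integral pY pZ one s)
  have pZ': "poly_family (\<lambda>\<mu> x. b + (integral {0..x} (\<lambda>t. - \<sigma> t * Z \<mu> t) +
     (integral {0..x} (\<lambda>t. - (\<sigma> t)\<^sup>2 * Y \<mu> t) + \<mu> * integral {0..x} (\<lambda>t. - 1 * Y \<mu> t))))"
    by (intro poly_family_add poly_family_const poly_family_param_mult poly_family_integral pY pZ neg)
  have cong: "poly_family f" if "poly_family g" "\<And>\<mu> x. x \<in> {0..pi} \<Longrightarrow> f \<mu> x = g \<mu> x" for f g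
    using that unfolding poly_family_def by simp
  show ?case
    using cong[OF pY' eqY] cong[OF pZ' eqZ] by blast
qed

lemma picard_primitive:
  assumes \<sigma>: "sq_integrable \<sigma>"
  shows "primitive_on 0 pi (\<lambda>x. fst (picard \<sigma> a b (Suc n) \<mu> x))
      (\<lambda>t. snd (picard \<sigma> a b n \<mu> t) + \<sigma> t * fst (picard \<sigma> a b n \<mu> t))"
    "primitive_on 0 pi (\<lambda>x. snd (picard \<sigma> a b (Suc n) \<mu> x))
      (\<lambda>t. - \<sigma> t * snd (picard \<sigma> a b n \<mu> t) - ((\<sigma> t)\<^sup>2 + \<mu>) * fst (picard \<sigma> a b n \<mu> t))"
  using sl_integrands_absolutely_integrable[OF \<sigma>
      poly_family_continuous[OF conjunct1[OF poly_family_picard[OF \<sigma>, of a b n]], of \<mu>]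
      poly_family_continuous[OF conjunct2[OF poly_family_picard[OF \<sigma>, of a b n]], of \<mu>]]
  unfolding primitive_on_def by auto

text \<open>Measured against the weight \<open>exp (2 * integral {0..x} k)\<close>, each application
  of the Volterra operator halves the bound, whence the factor \<open>2 ^ Suc n\<close>.\<close>

lemma picard_diff_le:
  assumes \<sigma>: "sq_integrable \<sigma>" and \<mu>: "cmod \<mu> \<le> R" and x: "x \<in> {0..pi}"
  shows "cmod (fst (picard \<sigma> a b (Suc n) \<mu> x) - fst (picard \<sigma> a b n \<mu> x)) +
      cmod (snd (picard \<sigma> a b (Suc n) \<mu> x) - snd (picard \<sigma> a b n \<mu> x))
    \<le> (cmod a + cmod b) / 2 ^ Suc n * exp (2 * integral {0..x} (kernel_bound \<sigma> R))"
  using x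
proof (induction n arbitrary: x)
  let ?k = "kernel_bound \<sigma> R"
  have R: "R \<ge> 0" using \<mu> norm_ge_zero order_trans by blast
  have ka: "?k absolutely_integrable_on {0..pi}" by (rule kernel_bound_absolutely_integrable[OF \<sigma>])
  have ki: "?k integrable_on {0..x}" if "x \<in> {0..pi}" for x
    using ka that by (auto simp: absolutely_integrable_on_def intro: integrable_on_subinterval)
  define E where "E x = exp (2 * integral {0..x} ?k)" for x
  have E1: "E x \<ge> 1" if "x \<in> {0..pi}" for x
    unfolding E_def using integral_nonneg[OF ki[OF that]] kernel_bound_nonneg[OF R] by auto
  have kE: "((\<lambda>t. ?k t * (K * E t)) has_integral K * (E x - 1) / 2) {0..x}" if "x \<in> {0..pi}" for K x
    using has_integral_mult_right[OF integral_exp_weight[OF ka that], of K]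
    by (simp add: E_def mult_ac)
  have step: "cmod (Y x) + cmod (Z x) \<le> K / 2 * E x"
    if Y: "primitive_on 0 pi Y (\<lambda>t. v t + \<sigma> t * u t)"
      and Z: "primitive_on 0 pi Z (\<lambda>t. - \<sigma> t * v t - ((\<sigma> t)\<^sup>2 + \<mu>) * u t)"
      and 0: "Y 0 = 0" "Z 0 = 0" and K: "K \<ge> 0" and x: "x \<in> {0..pi}"
      and le: "\<And>t. t \<in> {0..pi} \<Longrightarrow> cmod (u t) + cmod (v t) \<le> K * E t" for Y Z u v K x
  proof -
    have "cmod (Y x) + cmod (Z x) \<le> cmod (Y 0) + cmod (Z 0) + integral {0..x} (\<lambda>t. ?k t * (K * E t))"
      by (rule sl_pair_le[OF Y Z \<mu> x]) (use kE[OF x] le x in auto)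
    also have "\<dots> = K * (E x - 1) / 2" using integral_unique[OF kE[OF x]] 0 by simp
    also have "\<dots> \<le> K / 2 * E x" using K by (simp add: algebra_simps)
    finally show ?thesis .
  qed
  {
    case (0 x)
    have "cmod (fst (picard \<sigma> a b (Suc 0) \<mu> x) - a) + cmod (snd (picard \<sigma> a b (Suc 0) \<mu> x) - b)
        \<le> (cmod a + cmod b) / 2 * E x"
    proof (rule step)
      show "primitive_on 0 pi (\<lambda>x. fst (picard \<sigma> a b (Suc 0) \<mu> x) - a) (\<lambda>t. b + \<sigma> t * a)"
        by (rule primitive_on_cong[OF primitive_on_diff[OF picard_primitive(1)[OF \<sigma>, where n = 0] primitive_on_const[of _ _ a]]])
          simp_all
      show "primitive_on 0 pi (\<lambda>x. snd (picard \<sigma> a b (Suc 0) \<mu> x) - b) (\<lambda>t. - \<sigma> t * b - ((\<sigma> t)\<^sup>2 + \<mu>) * a)"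
        by (rule primitive_on_cong[OF primitive_on_diff[OF picard_primitive(2)[OF \<sigma>, where n = 0] primitive_on_const[of _ _ b]]])
          simp_all
      show "cmod a + cmod b \<le> (cmod a + cmod b) * E t" if "t \<in> {0..pi}" for t
        using mult_left_mono[OF E1[OF that], of "cmod a + cmod b"] by simp
    qed (use 0 in auto)
    then show ?case by (simp add: E_def)
  next
    case (Suc n x)
    have "cmod (fst (picard \<sigma> a b (Suc (Suc n)) \<mu> x) - fst (picard \<sigma> a b (Suc n) \<mu> x)) +
        cmod (snd (picard \<sigma> a b (Suc (Suc n)) \<mu> x) - snd (picard \<sigma> a b (Suc n) \<mu> x))
        \<le> ((cmod a + cmod b) / 2 ^ Suc n) / 2 * E x"
    proof (rule step)
      let ?u = "\<lambda>t. fst (picard \<sigma> a b (Suc n) \<mu> t) - fst (picard \<sigma> a b n \<mu> t)"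
      let ?v = "\<lambda>t. snd (picard \<sigma> a b (Suc n) \<mu> t) - snd (picard \<sigma> a b n \<mu> t)"
      show "primitive_on 0 pi (\<lambda>x. fst (picard \<sigma> a b (Suc (Suc n)) \<mu> x) - fst (picard \<sigma> a b (Suc n) \<mu> x))
        (\<lambda>t. ?v t + \<sigma> t * ?u t)"
        by (rule primitive_on_cong[OF primitive_on_diff[OF picard_primitive(1)[OF \<sigma>, where n = "Suc n"]
                picard_primitive(1)[OF \<sigma>, where n = n]]]) (simp_all only: algebra_simps)
      show "primitive_on 0 pi (\<lambda>x. snd (picard \<sigma> a b (Suc (Suc n)) \<mu> x) - snd (picard \<sigma> a b (Suc n) \<mu> x))
        (\<lambda>t. - \<sigma> t * ?v t - ((\<sigma> t)\<^sup>2 + \<mu>) * ?u t)"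
        by (rule primitive_on_cong[OF primitive_on_diff[OF picard_primitive(2)[OF \<sigma>, where n = "Suc n"]
                picard_primitive(2)[OF \<sigma>, where n = n]]]) (simp_all only: algebra_simps)
      show "cmod (?u t) + cmod (?v t) \<le> (cmod a + cmod b) / 2 ^ Suc n * E t" if "t \<in> {0..pi}" for t
        using Suc.IH[OF that] by (simp only: E_def)
    qed (use Suc.prems in auto)
    then show ?case by (simp add: E_def mult.commute)
  }
qed

lemma uniform_limit_reparametrize:
  assumes "uniform_limit A f g F" and "\<And>b. b \<in> B \<Longrightarrow> h b \<in> A"
  shows "uniform_limit B (\<lambda>n b. f n (h b)) (\<lambda>b. g (h b)) F"
  unfolding uniform_limit_iff
proof (intro allI impI)
  fix e :: real assume "e > 0"
  then have "\<forall>\<^sub>F n in F. \<forall>x\<in>A. dist (f n x) (g x) < e"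
    using assms(1) unfolding uniform_limit_iff by blast
  then show "\<forall>\<^sub>F n in F. \<forall>x\<in>B. dist (f n (h x)) (g (h x)) < e"
    by (rule eventually_mono) (use assms(2) in blast)
qed

text \<open>The telescoping series of iterates converges uniformly on each product of a disc in
  \<open>\<mu>\<close> with \<open>{0..pi}\<close>. Slices of this one limit give continuity in
  \<open>x\<close> for fixed \<open>\<mu>\<close> and holomorphy in \<open>\<mu>\<close> for fixed
  \<open>x\<close>.\<close>

lemma sl_family_exists:
  assumes \<sigma>: "sq_integrable \<sigma>"
  shows "\<exists>Y Z. (\<forall>\<mu>. sl_system \<sigma> \<mu> (Y \<mu>) (Z \<mu>) \<and> Y \<mu> 0 = a \<and> Z \<mu> 0 = b) \<and>
     (\<forall>x\<in>{0..pi}. (\<lambda>\<mu>. Y \<mu> x) holomorphic_on UNIV \<and> (\<lambda>\<mu>. Z \<mu> x) holomorphic_on UNIV)"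
proof -
  define P where "P n \<mu> x = fst (picard \<sigma> a b n \<mu> x)" for n \<mu> x
  define Q where "Q n \<mu> x = snd (picard \<sigma> a b n \<mu> x)" for n \<mu> x
  define Y where "Y \<mu> x = a + (\<Sum>i. P (Suc i) \<mu> x - P i \<mu> x)" for \<mu> x
  define Z where "Z \<mu> x = b + (\<Sum>i. Q (Suc i) \<mu> x - Q i \<mu> x)" for \<mu> x
  define C where "C R = (cmod a + cmod b) * exp (2 * integral {0..pi} (kernel_bound \<sigma> R))" for R
  have le: "cmod (P (Suc n) \<mu> x - P n \<mu> x) + cmod (Q (Suc n) \<mu> x - Q n \<mu> x) \<le> C R * (1 / 2) ^ n"
    if \<mu>: "cmod \<mu> \<le> R" and x: "x \<in> {0..pi}" for n \<mu> x R
  proof -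
    have R: "R \<ge> 0" using \<mu> norm_ge_zero order_trans by blast
    have ki: "kernel_bound \<sigma> R integrable_on {0..pi}"
      using kernel_bound_absolutely_integrable[OF \<sigma>, of R] by (simp add: absolutely_integrable_on_def)
    have "integral {0..x} (kernel_bound \<sigma> R) \<le> integral {0..pi} (kernel_bound \<sigma> R)"
      by (rule integral_subset_le) (use x ki integrable_on_subinterval[OF ki, of 0 x] kernel_bound_nonneg[OF R] in auto)
    then have "(cmod a + cmod b) / 2 ^ Suc n * exp (2 * integral {0..x} (kernel_bound \<sigma> R)) \<le>
        (cmod a + cmod b) / 2 ^ n * exp (2 * integral {0..pi} (kernel_bound \<sigma> R))"
      by (intro mult_mono) (auto simp: divide_simps)
    then show ?thesis
      using picard_diff_le[OF \<sigma> \<mu> x, of a b n] by (simp add: P_def Q_def C_def power_one_over divide_simps)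
  qed
  have ul: "uniform_limit (cball 0 R \<times> {0..pi}) (\<lambda>n p. P n (fst p) (snd p)) (\<lambda>p. Y (fst p) (snd p)) sequentially"
    "uniform_limit (cball 0 R \<times> {0..pi}) (\<lambda>n p. Q n (fst p) (snd p)) (\<lambda>p. Z (fst p) (snd p)) sequentially" for R
  proof -
    have tele: "(\<Sum>i<n. P (Suc i) \<mu> x - P i \<mu> x) = P n \<mu> x - a"
      "(\<Sum>i<n. Q (Suc i) \<mu> x - Q i \<mu> x) = Q n \<mu> x - b" for n \<mu> x
      by (subst sum_lessThan_telescope, simp add: P_def Q_def)+
    have sm: "summable (\<lambda>n. C R * (1 / 2) ^ n)" by (intro summable_mult summable_geometric) auto
    have "uniform_limit (cball 0 R \<times> {0..pi}) (\<lambda>n p. \<Sum>i<n. P (Suc i) (fst p) (snd p) - P i (fst p) (snd p))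
        (\<lambda>p. \<Sum>i. P (Suc i) (fst p) (snd p) - P i (fst p) (snd p)) sequentially"
    proof (rule Weierstrass_m_test[OF _ sm])
      fix n and p :: "complex \<times> real" assume "p \<in> cball 0 R \<times> {0..pi}"
      then show "cmod (P (Suc n) (fst p) (snd p) - P n (fst p) (snd p)) \<le> C R * (1 / 2) ^ n"
        using le[of "fst p" R "snd p" n] norm_ge_zero[of "Q (Suc n) (fst p) (snd p) - Q n (fst p) (snd p)"]
        by (auto simp del: norm_ge_zero)
    qed
    from uniform_limit_add[OF uniform_limit_const[where c = "\<lambda>_. a"] this]
    show "uniform_limit (cball 0 R \<times> {0..pi}) (\<lambda>n p. P n (fst p) (snd p)) (\<lambda>p. Y (fst p) (snd p)) sequentially"
      by (simp add: tele Y_def)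
    have "uniform_limit (cball 0 R \<times> {0..pi}) (\<lambda>n p. \<Sum>i<n. Q (Suc i) (fst p) (snd p) - Q i (fst p) (snd p))
        (\<lambda>p. \<Sum>i. Q (Suc i) (fst p) (snd p) - Q i (fst p) (snd p)) sequentially"
    proof (rule Weierstrass_m_test[OF _ sm])
      fix n and p :: "complex \<times> real" assume "p \<in> cball 0 R \<times> {0..pi}"
      then show "cmod (Q (Suc n) (fst p) (snd p) - Q n (fst p) (snd p)) \<le> C R * (1 / 2) ^ n"
        using le[of "fst p" R "snd p" n] norm_ge_zero[of "P (Suc n) (fst p) (snd p) - P n (fst p) (snd p)"]
        by (auto simp del: norm_ge_zero)
    qed
    from uniform_limit_add[OF uniform_limit_const[where c = "\<lambda>_. b"] this]
    show "uniform_limit (cball 0 R \<times> {0..pi}) (\<lambda>n p. Q n (fst p) (snd p)) (\<lambda>p. Z (fst p) (snd p)) sequentially"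
      by (simp add: tele Z_def)
  qed
  have ulx: "uniform_limit {0..pi} (\<lambda>n. P n \<mu>) (Y \<mu>) sequentially"
    "uniform_limit {0..pi} (\<lambda>n. Q n \<mu>) (Z \<mu>) sequentially" for \<mu>
    using uniform_limit_reparametrize[OF ul(1)[of "cmod \<mu>"], of "{0..pi}" "\<lambda>x. (\<mu>, x)"]
      uniform_limit_reparametrize[OF ul(2)[of "cmod \<mu>"], of "{0..pi}" "\<lambda>x. (\<mu>, x)"] by auto
  have ulm: "uniform_limit (cball z 1) (\<lambda>n \<mu>. P n \<mu> x) (\<lambda>\<mu>. Y \<mu> x) sequentially"
    "uniform_limit (cball z 1) (\<lambda>n \<mu>. Q n \<mu> x) (\<lambda>\<mu>. Z \<mu> x) sequentially" if x: "x \<in> {0..pi}" for z x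
  proof -
    have sub: "cmod w \<le> cmod z + 1" if "w \<in> cball z 1" for w
      using that norm_triangle_ineq2[of w z] by (simp add: dist_norm norm_minus_commute)
    show "uniform_limit (cball z 1) (\<lambda>n \<mu>. P n \<mu> x) (\<lambda>\<mu>. Y \<mu> x) sequentially"
      "uniform_limit (cball z 1) (\<lambda>n \<mu>. Q n \<mu> x) (\<lambda>\<mu>. Z \<mu> x) sequentially"
      using uniform_limit_reparametrize[OF ul(1)[of "cmod z + 1"], of "cball z 1" "\<lambda>\<mu>. (\<mu>, x)"]
        uniform_limit_reparametrize[OF ul(2)[of "cmod z + 1"], of "cball z 1" "\<lambda>\<mu>. (\<mu>, x)"] sub x by auto
  qed
  have hol: "(\<lambda>\<mu>. Y \<mu> x) holomorphic_on UNIV" "(\<lambda>\<mu>. Z \<mu> x) holomorphic_on UNIV" if x: "x \<in> {0..pi}" for x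
  proof -
    show "(\<lambda>\<mu>. Y \<mu> x) holomorphic_on UNIV"
    proof (rule holomorphic_uniform_sequence[OF open_UNIV])
      show "(\<lambda>\<mu>. P n \<mu> x) holomorphic_on UNIV" for n
        unfolding P_def by (rule poly_family_holomorphic[OF conjunct1[OF poly_family_picard[OF \<sigma>]] x])
      show "\<exists>d>0. cball z d \<subseteq> UNIV \<and> uniform_limit (cball z d) (\<lambda>n \<mu>. P n \<mu> x) (\<lambda>\<mu>. Y \<mu> x) sequentially" for z
        using ulm(1)[OF x, of z] by (intro exI[of _ 1]) auto
    qed
    show "(\<lambda>\<mu>. Z \<mu> x) holomorphic_on UNIV"
    proof (rule holomorphic_uniform_sequence[OF open_UNIV])
      show "(\<lambda>\<mu>. Q n \<mu> x) holomorphic_on UNIV" for n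
        unfolding Q_def by (rule poly_family_holomorphic[OF conjunct2[OF poly_family_picard[OF \<sigma>]] x])
      show "\<exists>d>0. cball z d \<subseteq> UNIV \<and> uniform_limit (cball z d) (\<lambda>n \<mu>. Q n \<mu> x) (\<lambda>\<mu>. Z \<mu> x) sequentially" for z
        using ulm(2)[OF x, of z] by (intro exI[of _ 1]) auto
    qed
  qed
  have sys: "sl_system \<sigma> \<mu> (Y \<mu>) (Z \<mu>) \<and> Y \<mu> 0 = a \<and> Z \<mu> 0 = b" for \<mu>
  proof -
    have cP: "continuous_on {0..pi} (P n \<mu>)" and cQ: "continuous_on {0..pi} (Q n \<mu>)" for n
      unfolding P_def Q_def
      by (rule poly_family_continuous[OF conjunct1[OF poly_family_picard[OF \<sigma>]]],
          rule poly_family_continuous[OF conjunct2[OF poly_family_picard[OF \<sigma>]]])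
    have cY: "continuous_on {0..pi} (Y \<mu>)"
      by (rule uniform_limit_theorem[OF _ ulx(1)]) (auto simp: cP)
    have cZ: "continuous_on {0..pi} (Z \<mu>)"
      by (rule uniform_limit_theorem[OF _ ulx(2)]) (auto simp: cQ)
    let ?f = "\<lambda>t. Z \<mu> t + \<sigma> t * Y \<mu> t"
    let ?g = "\<lambda>t. - \<sigma> t * Z \<mu> t - ((\<sigma> t)\<^sup>2 + \<mu>) * Y \<mu> t"
    have pY: "primitive_on 0 pi (\<lambda>x. a + integral {0..x} ?f) ?f"
      and pZ: "primitive_on 0 pi (\<lambda>x. b + integral {0..x} ?g) ?g"
      using sl_integrands_absolutely_integrable[OF \<sigma> cY cZ] unfolding primitive_on_def by auto
    have eq: "a + integral {0..x} ?f = Y \<mu> x \<and> b + integral {0..x} ?g = Z \<mu> x" if x: "x \<in> {0..pi}" for x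
    proof -
      \<comment> \<open>Distance of the next iterate from the integral operator applied to the
        limit. It is at most \<open>K\<close> times the uniform distance of the previous iterate
        from the limit, so the limit solves the integral equation.\<close>
      define D where "D n = cmod (P (Suc n) \<mu> x - (a + integral {0..x} ?f)) +
          cmod (Q (Suc n) \<mu> x - (b + integral {0..x} ?g))" for n
      have "D \<longlonglongrightarrow> 0"
      proof (rule tendstoI)
        fix e :: real assume "e > 0"
        define K where "K = integral {0..x} (kernel_bound \<sigma> (cmod \<mu>))"
        have ki: "kernel_bound \<sigma> (cmod \<mu>) integrable_on {0..x}"
          using kernel_bound_absolutely_integrable[OF \<sigma>, of "cmod \<mu>"] x
          by (auto simp: absolutely_integrable_on_def intro: integrable_on_subinterval)
        have "K \<ge> 0" unfolding K_def by (intro integral_nonneg ki kernel_bound_nonneg) auto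
        define d where "d = e / (2 * (K + 1))"
        have "d > 0" using \<open>e > 0\<close> \<open>K \<ge> 0\<close> by (simp add: d_def)
        have ev: "\<forall>\<^sub>F n in sequentially. \<forall>t\<in>{0..pi}. dist (P n \<mu> t) (Y \<mu> t) < d / 2"
          "\<forall>\<^sub>F n in sequentially. \<forall>t\<in>{0..pi}. dist (Q n \<mu> t) (Z \<mu> t) < d / 2"
          using ulx[of \<mu>, unfolded uniform_limit_iff] half_gt_zero[OF \<open>d > 0\<close>] by blast+
        from eventually_conj[OF this]
        show "\<forall>\<^sub>F n in sequentially. dist (D n) 0 < e"
        proof eventually_elim
          case (elim n)
          have "D n \<le> cmod (P (Suc n) \<mu> 0 - (a + integral {0..0} ?f)) + cmod (Q (Suc n) \<mu> 0 - (b + integral {0..0} ?g)) +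
              integral {0..x} (\<lambda>t. kernel_bound \<sigma> (cmod \<mu>) t * d)"
            unfolding D_def
          proof (rule sl_pair_le[where Y = "\<lambda>x. P (Suc n) \<mu> x - (a + integral {0..x} ?f)"
                and Z = "\<lambda>x. Q (Suc n) \<mu> x - (b + integral {0..x} ?g)"
                and u = "\<lambda>t. P n \<mu> t - Y \<mu> t" and v = "\<lambda>t. Q n \<mu> t - Z \<mu> t" and \<mu> = \<mu>, OF _ _ order_refl x])
            show "primitive_on 0 pi (\<lambda>x. P (Suc n) \<mu> x - (a + integral {0..x} ?f))
                (\<lambda>t. Q n \<mu> t - Z \<mu> t + \<sigma> t * (P n \<mu> t - Y \<mu> t))"
              unfolding P_def Q_def
              by (rule primitive_on_cong[OF primitive_on_diff[OF picard_primitive(1)[OF \<sigma>] pY]])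
                (simp_all only: algebra_simps)
            show "primitive_on 0 pi (\<lambda>x. Q (Suc n) \<mu> x - (b + integral {0..x} ?g))
                (\<lambda>t. - \<sigma> t * (Q n \<mu> t - Z \<mu> t) - ((\<sigma> t)\<^sup>2 + \<mu>) * (P n \<mu> t - Y \<mu> t))"
              unfolding P_def Q_def
              by (rule primitive_on_cong[OF primitive_on_diff[OF picard_primitive(2)[OF \<sigma>] pZ]])
                (simp_all only: algebra_simps)
            show "(\<lambda>t. kernel_bound \<sigma> (cmod \<mu>) t * d) integrable_on {0..x}"
              by (rule integrable_on_mult_left[OF ki])
            fix t assume "t \<in> {0..x}"
            then have "t \<in> {0..pi}" using x by auto
            then have "cmod (P n \<mu> t - Y \<mu> t) < d / 2" "cmod (Q n \<mu> t - Z \<mu> t) < d / 2"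
              using elim by (auto simp: dist_norm)
            then show "cmod (P n \<mu> t - Y \<mu> t) + cmod (Q n \<mu> t - Z \<mu> t) \<le> d" by simp
          qed
          also have "\<dots> = K * d"
            by (simp add: P_def Q_def K_def)
          also have "\<dots> \<le> e / 2" using \<open>K \<ge> 0\<close> \<open>e > 0\<close> by (simp add: d_def divide_simps)
          finally show ?case using \<open>e > 0\<close> by (simp add: D_def)
        qed
      qed
      then have "(\<lambda>n. P (Suc n) \<mu> x - (a + integral {0..x} ?f)) \<longlonglongrightarrow> 0"
        "(\<lambda>n. Q (Suc n) \<mu> x - (b + integral {0..x} ?g)) \<longlonglongrightarrow> 0"
        by (auto intro: Lim_null_comparison[rotated] simp: D_def)
      then have "(\<lambda>n. P (Suc n) \<mu> x) \<longlonglongrightarrow> a + integral {0..x} ?f" "(\<lambda>n. Q (Suc n) \<mu> x) \<longlonglongrightarrow> b + integral {0..x} ?g"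
        by (simp_all only: LIM_zero_iff)
      moreover have "(\<lambda>n. P (Suc n) \<mu> x) \<longlonglongrightarrow> Y \<mu> x" "(\<lambda>n. Q (Suc n) \<mu> x) \<longlonglongrightarrow> Z \<mu> x"
        using tendsto_uniform_limitI[OF ulx(1) x, THEN LIMSEQ_Suc] tendsto_uniform_limitI[OF ulx(2) x, THEN LIMSEQ_Suc] .
      ultimately show ?thesis using LIMSEQ_unique by blast
    qed
    have "sl_system \<sigma> \<mu> (Y \<mu>) (Z \<mu>)"
      unfolding sl_system_def
      using primitive_on_cong[OF pY conjunct1[OF eq] refl] primitive_on_cong[OF pZ conjunct2[OF eq] refl] by blast
    moreover have "Y \<mu> 0 = a" "Z \<mu> 0 = b" using eq[of 0] by auto
    ultimately show ?thesis by blast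
  qed
  show ?thesis using sys hol by blast
qed

lemma SL_ivp_sl_system:
  assumes \<sigma>: "sq_integrable \<sigma>"
  shows "sl_system \<sigma> \<mu> (fst (SL_ivp \<sigma> \<mu> a b)) (snd (SL_ivp \<sigma> \<mu> a b))"
    "fst (SL_ivp \<sigma> \<mu> a b) 0 = a" "snd (SL_ivp \<sigma> \<mu> a b) 0 = b"
proof -
  obtain Y Z where "sl_system \<sigma> \<mu> (Y \<mu>) (Z \<mu>)" "Y \<mu> 0 = a" "Z \<mu> 0 = b"
    using sl_family_exists[OF \<sigma>] by blast
  then have "\<exists>yz. SL_solution \<sigma> \<mu> (fst yz) (snd yz) \<and> fst yz 0 = a \<and> snd yz 0 = b"
    by (intro exI[of _ "(Y \<mu>, Z \<mu>)"]) (auto intro: sl_system_imp_SL_solution)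
  from someI_ex[OF this]
  show "sl_system \<sigma> \<mu> (fst (SL_ivp \<sigma> \<mu> a b)) (snd (SL_ivp \<sigma> \<mu> a b))"
    "fst (SL_ivp \<sigma> \<mu> a b) 0 = a" "snd (SL_ivp \<sigma> \<mu> a b) 0 = b"
    unfolding SL_ivp_def by (auto intro: SL_solution_imp_sl_system[OF \<sigma>])
qed

text \<open>The choice operator picks a solution separately for each \<open>\<mu>\<close>, which by
  itself says nothing about dependence on \<open>\<mu>\<close>; uniqueness on \<open>{0..pi}\<close>
  identifies the choices with the holomorphic family.\<close>

lemma SL_ivp_holomorphic:
  assumes \<sigma>: "sq_integrable \<sigma>" and x: "x \<in> {0..pi}"
  shows "(\<lambda>\<mu>. fst (SL_ivp \<sigma> \<mu> a b) x) holomorphic_on A" "(\<lambda>\<mu>. snd (SL_ivp \<sigma> \<mu> a b) x) holomorphic_on A"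
proof -
  obtain Y Z where YZ: "\<forall>\<mu>. sl_system \<sigma> \<mu> (Y \<mu>) (Z \<mu>) \<and> Y \<mu> 0 = a \<and> Z \<mu> 0 = b"
    "\<forall>x\<in>{0..pi}. (\<lambda>\<mu>. Y \<mu> x) holomorphic_on UNIV \<and> (\<lambda>\<mu>. Z \<mu> x) holomorphic_on UNIV"
    using sl_family_exists[OF \<sigma>] by blast
  have "fst (SL_ivp \<sigma> \<mu> a b) x = Y \<mu> x" "snd (SL_ivp \<sigma> \<mu> a b) x = Z \<mu> x" for \<mu>
    using sl_system_unique[OF \<sigma> SL_ivp_sl_system(1)[OF \<sigma>] YZ(1)[rule_format, THEN conjunct1] _ _ x]
      YZ(1) SL_ivp_sl_system(2,3)[OF \<sigma>] by auto
  moreover have "(\<lambda>\<mu>. Y \<mu> x) holomorphic_on A" "(\<lambda>\<mu>. Z \<mu> x) holomorphic_on A"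
    using YZ(2) x holomorphic_on_subset by blast+
  ultimately show "(\<lambda>\<mu>. fst (SL_ivp \<sigma> \<mu> a b) x) holomorphic_on A" "(\<lambda>\<mu>. snd (SL_ivp \<sigma> \<mu> a b) x) holomorphic_on A"
    by simp_all
qed

section \<open>The solutions \<open>phi\<close> and \<open>S\<close>, the Wronskian and variation of
  constants\<close>

lemma phi_sl_system:
  assumes "sq_integrable \<sigma>"
  shows "sl_system \<sigma> \<mu> (\<lambda>x. phi \<sigma> x \<mu>) (\<lambda>x. phi_qd \<sigma> x \<mu>)" "phi \<sigma> 0 \<mu> = 1" "phi_qd \<sigma> 0 \<mu> = 0"
  using SL_ivp_sl_system[OF assms, of \<mu> 1 0] by (simp_all add: phi_def phi_qd_def)

lemma S_sl_system:
  assumes "sq_integrable \<sigma>"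
  shows "sl_system \<sigma> \<mu> (\<lambda>x. S \<sigma> x \<mu>) (\<lambda>x. S_qd \<sigma> x \<mu>)" "S \<sigma> 0 \<mu> = 0" "S_qd \<sigma> 0 \<mu> = 1"
  using SL_ivp_sl_system[OF assms, of \<mu> 0 1] by (simp_all add: S_def S_qd_def)

lemma holomorphic_phi_S:
  assumes "sq_integrable \<sigma>" and "x \<in> {0..pi}"
  shows "phi \<sigma> x holomorphic_on A" "phi_qd \<sigma> x holomorphic_on A"
    "S \<sigma> x holomorphic_on A" "S_qd \<sigma> x holomorphic_on A"
  using SL_ivp_holomorphic[OF assms, of 1 0 A] SL_ivp_holomorphic[OF assms, of 0 1 A]
  by (simp_all add: phi_def[abs_def] phi_qd_def[abs_def] S_def[abs_def] S_qd_def[abs_def])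

text \<open>The coefficient matrix of the system has trace zero, so the derivative of the
  determinant of two solutions cancels identically.\<close>

lemma wronskian_constant:
  assumes yz: "sl_system \<sigma> \<mu> y z" and uv: "sl_system \<sigma> \<mu> u v" and x: "x \<in> {0..pi}"
  shows "y x * v x - z x * u x = y 0 * v 0 - z 0 * u 0"
proof -
  note p = yz[unfolded sl_system_def] uv[unfolded sl_system_def]
  note q = primitive_on_diff[OF primitive_on_mult[OF conjunct1[OF p(1)] conjunct2[OF p(2)]]
      primitive_on_mult[OF conjunct2[OF p(1)] conjunct1[OF p(2)]]]
  show ?thesis
    by (rule primitive_on_zero_imp_constant[OF q _ x]) (simp add: algebra_simps)
qed

lemma variation_of_constants:
  assumes w: "primitive_on 0 b w (\<lambda>t. c * w t + g t)" and x: "x \<in> {0..b}"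
  shows "((\<lambda>t. exp (- c * of_real t) * g t) has_integral exp (- c * of_real x) * w x - w 0) {0..x}"
    "(\<lambda>t. exp (- c * of_real t) * g t) absolutely_integrable_on {0..x}"
proof -
  have "primitive_on 0 b (\<lambda>t. exp (- c * of_real t)) (\<lambda>t. - c * exp (- c * of_real t))"
  proof (rule primitive_on_C1)
    fix t :: real
    have "((\<lambda>z. exp (- c * z)) has_field_derivative - c * exp (- c * of_real t)) (at (of_real t))"
      by (auto intro!: derivative_eq_intros)
    from has_vector_derivative_real_field[OF this]
    show "((\<lambda>t. exp (- c * of_real t)) has_vector_derivative - c * exp (- c * of_real t)) (at t within {0..b})" .
  qed (intro continuous_intros)
  from primitive_on_mult[OF this w]
  have p: "primitive_on 0 b (\<lambda>t. exp (- c * of_real t) * w t) (\<lambda>t. exp (- c * of_real t) * g t)"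
    by (rule primitive_on_cong) (simp_all add: algebra_simps)
  show "(\<lambda>t. exp (- c * of_real t) * g t) absolutely_integrable_on {0..x}"
    by (rule primitive_on_integrand(2)[OF p x])
  show "((\<lambda>t. exp (- c * of_real t) * g t) has_integral exp (- c * of_real x) * w x - w 0) {0..x}"
    using primitive_onD[OF p x] primitive_on_integrand(1)[OF p x] by (simp add: has_integral_iff)
qed

text \<open>Whatever the sign of \<open>Re c\<close>, the propagator from \<open>t\<close> to
  \<open>x\<close> has norm at most \<open>exp (\<tau> * (x - t))\<close>; the weight
  \<open>exp (- \<tau> * x)\<close> therefore passes under the integral as
  \<open>exp (- \<tau> * t)\<close>.\<close>

lemma variation_of_constants_le:
  assumes c: "\<bar>Re c\<bar> \<le> \<tau>" and "x \<ge> 0"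
    and g: "(\<lambda>t. exp (- c * of_real t) * g t) absolutely_integrable_on {0..x}"
    and h: "h integrable_on {0..x}" and le: "\<And>t. t \<in> {0..x} \<Longrightarrow> exp (- \<tau> * t) * cmod (g t) \<le> h t"
  shows "exp (- \<tau> * x) * cmod (exp (c * of_real x) * integral {0..x} (\<lambda>t. exp (- c * of_real t) * g t)) \<le> integral {0..x} h"
proof -
  have "exp (- \<tau> * x) * cmod (exp (c * of_real x) * integral {0..x} (\<lambda>t. exp (- c * of_real t) * g t))
     = cmod (integral {0..x} (\<lambda>t. of_real (exp (- \<tau> * x)) * exp (c * of_real x) * (exp (- c * of_real t) * g t)))"
    by (subst integral_mult_right) (simp add: norm_mult)
  also have "\<dots> \<le> integral {0..x} h"
  proof (rule integral_norm_bound_integral[OF _ h])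
    show "(\<lambda>t. of_real (exp (- \<tau> * x)) * exp (c * of_real x) * (exp (- c * of_real t) * g t)) integrable_on {0..x}"
      using g by (intro integrable_on_mult_right) (simp add: absolutely_integrable_on_def)
    fix t assume t: "t \<in> {0..x}"
    have "Re c * (x - t) \<le> \<tau> * (x - t)"
      using c t by (intro mult_right_mono) auto
    then have "exp (- \<tau> * x) * exp (Re c * x) * exp (- Re c * t) \<le> exp (- \<tau> * t)"
      by (simp add: exp_add[symmetric] algebra_simps)
    then have "exp (- \<tau> * x) * exp (Re c * x) * exp (- Re c * t) * cmod (g t) \<le> exp (- \<tau> * t) * cmod (g t)"
      by (rule mult_right_mono) auto
    also have "\<dots> \<le> h t" by (rule le[OF t])
    finally show "cmod (of_real (exp (- \<tau> * x)) * exp (c * of_real x) * (exp (- c * of_real t) * g t)) \<le> h t"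
      by (simp add: norm_mult norm_exp_eq_Re mult.assoc)
  qed
  finally show ?thesis .
qed

section \<open>Growth and asymptotics of solutions\<close>

text \<open>The combinations \<open>z \<plusminus> i \<rho> y\<close> diagonalize the system up to terms that do not grow with \<open>\<rho>\<close>.\<close>

lemma sl_system_diagonal:
  assumes sys: "sl_system \<sigma> (\<rho>\<^sup>2) y z"
  shows "primitive_on 0 pi (\<lambda>x. z x + \<i> * \<rho> * y x)
      (\<lambda>t. \<i> * \<rho> * (z t + \<i> * \<rho> * y t) + (- \<sigma> t * (z t - \<i> * \<rho> * y t) - (\<sigma> t)\<^sup>2 * y t))"
    "primitive_on 0 pi (\<lambda>x. z x - \<i> * \<rho> * y x)
      (\<lambda>t. - \<i> * \<rho> * (z t - \<i> * \<rho> * y t) + (- \<sigma> t * (z t + \<i> * \<rho> * y t) - (\<sigma> t)\<^sup>2 * y t))"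
proof -
  note p = sys[unfolded sl_system_def]
  have i: "\<i> * (\<i> * w) = - w" for w by (simp add: mult.assoc[symmetric])
  show "primitive_on 0 pi (\<lambda>x. z x + \<i> * \<rho> * y x)
      (\<lambda>t. \<i> * \<rho> * (z t + \<i> * \<rho> * y t) + (- \<sigma> t * (z t - \<i> * \<rho> * y t) - (\<sigma> t)\<^sup>2 * y t))"
    by (rule primitive_on_cong[OF primitive_on_add[OF conjunct2[OF p] primitive_on_cmult[OF conjunct1[OF p], of "\<i> * \<rho>"]]])
      (simp_all add: algebra_simps power2_eq_square i)
  show "primitive_on 0 pi (\<lambda>x. z x - \<i> * \<rho> * y x)
      (\<lambda>t. - \<i> * \<rho> * (z t - \<i> * \<rho> * y t) + (- \<sigma> t * (z t + \<i> * \<rho> * y t) - (\<sigma> t)\<^sup>2 * y t))"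
    by (rule primitive_on_cong[OF primitive_on_diff[OF conjunct2[OF p] primitive_on_cmult[OF conjunct1[OF p], of "\<i> * \<rho>"]]])
      (simp_all add: algebra_simps power2_eq_square i)
qed

text \<open>The 4 is the 2 of the Gronwall estimate times the 2 lost in bounding the initial values
  of \<open>z + i \<rho> y\<close> and \<open>z - i \<rho> y\<close> by those of
  \<open>\<rho> y\<close> and \<open>z\<close>.\<close>

definition growth_const :: "(real \<Rightarrow> complex) \<Rightarrow> real" where
  "growth_const \<sigma> = 4 * exp (2 * integral {0..pi} (kernel_bound \<sigma> 0))"

lemma cmod_pm_bounds:
  fixes y z \<rho> :: complex
  shows "2 * cmod z \<le> cmod (z + \<i> * \<rho> * y) + cmod (z - \<i> * \<rho> * y)"
    "2 * cmod \<rho> * cmod y \<le> cmod (z + \<i> * \<rho> * y) + cmod (z - \<i> * \<rho> * y)"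
    "cmod (z + \<i> * \<rho> * y) + cmod (z - \<i> * \<rho> * y) \<le> 2 * (cmod \<rho> * cmod y + cmod z)"
  using norm_triangle_ineq[of "z + \<i> * \<rho> * y" "z - \<i> * \<rho> * y"]
    norm_triangle_ineq4[of "z + \<i> * \<rho> * y" "z - \<i> * \<rho> * y"]
    norm_triangle_ineq[of z "\<i> * \<rho> * y"] norm_triangle_ineq4[of z "\<i> * \<rho> * y"]
  by (simp_all add: norm_mult)

text \<open>For \<open>|\<rho>| >= 1\<close> the value of \<open>y\<close> itself is controlled by
  the diagonal combinations, so the coupling terms have an integrable coefficient that does not
  depend on \<open>\<rho>\<close>.\<close>

lemma sl_diagonal_integrand_le:
  assumes "cmod \<rho> \<ge> 1"
  shows "cmod (- s * (z - \<i> * \<rho> * y) - s\<^sup>2 * y) + cmod (- s * (z + \<i> * \<rho> * y) - s\<^sup>2 * y)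
    \<le> (1 + 2 * cmod s + (cmod s)\<^sup>2) * (cmod (z + \<i> * \<rho> * y) + cmod (z - \<i> * \<rho> * y))"
proof -
  define p where "p = cmod (z + \<i> * \<rho> * y)"
  define q where "q = cmod (z - \<i> * \<rho> * y)"
  have pq: "p \<ge> 0" "q \<ge> 0" by (auto simp: p_def q_def)
  have "2 * cmod y \<le> 2 * cmod \<rho> * cmod y"
    using mult_right_mono[OF assms norm_ge_zero[of y]] by simp
  then have y: "2 * cmod y \<le> p + q"
    using cmod_pm_bounds(2)[of \<rho> y z] by (simp add: p_def q_def)
  have 1: "cmod (- s * (z - \<i> * \<rho> * y) - s\<^sup>2 * y) \<le> cmod s * q + (cmod s)\<^sup>2 * cmod y"
    using norm_triangle_ineq4[of "- s * (z - \<i> * \<rho> * y)" "s\<^sup>2 * y"]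
    by (simp add: norm_mult norm_power q_def)
  have 2: "cmod (- s * (z + \<i> * \<rho> * y) - s\<^sup>2 * y) \<le> cmod s * p + (cmod s)\<^sup>2 * cmod y"
    using norm_triangle_ineq4[of "- s * (z + \<i> * \<rho> * y)" "s\<^sup>2 * y"]
    by (simp add: norm_mult norm_power p_def)
  have 3: "(cmod s)\<^sup>2 * (2 * cmod y) \<le> (cmod s)\<^sup>2 * (p + q)"
    using y by (rule mult_left_mono) auto
  have "(1 + 2 * cmod s + (cmod s)\<^sup>2) * (p + q) = (p + q) + cmod s * (p + q) + cmod s * (p + q) + (cmod s)\<^sup>2 * (p + q)"
    by (simp add: algebra_simps)
  moreover have "(p + q) \<ge> 0" "cmod s * (p + q) \<ge> 0" using pq by auto
  moreover have "cmod s * (p + q) = cmod s * p + cmod s * q" by (simp add: algebra_simps)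
  ultimately have "cmod (- s * (z - \<i> * \<rho> * y) - s\<^sup>2 * y) + cmod (- s * (z + \<i> * \<rho> * y) - s\<^sup>2 * y)
    \<le> (1 + 2 * cmod s + (cmod s)\<^sup>2) * (p + q)"
    using 1 2 3 by linarith
  then show ?thesis by (simp add: p_def q_def)
qed

text \<open>The diagonal terms, which contain \<open>\<rho>\<close>, are solved exactly by variation
  of constants; the weight \<open>exp (- |Im \<rho>| * t)\<close> removes their growth. What remains
  is a Gronwall inequality with a kernel free of \<open>\<rho>\<close>, hence a constant uniform in
  \<open>\<rho>\<close>.\<close>

lemma sl_growth_bound:
  assumes \<sigma>: "sq_integrable \<sigma>" and sys: "sl_system \<sigma> (\<rho>\<^sup>2) y z" and \<rho>: "cmod \<rho> \<ge> 1" and x: "x \<in> {0..pi}"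
  shows "cmod \<rho> * cmod (y x) + cmod (z x)
     \<le> growth_const \<sigma> * exp (\<bar>Im \<rho>\<bar> * x) * (cmod \<rho> * cmod (y 0) + cmod (z 0))"
proof -
  define \<tau> where "\<tau> = \<bar>Im \<rho>\<bar>"
  define wp where "wp x = z x + \<i> * \<rho> * y x" for x
  define wm where "wm x = z x - \<i> * \<rho> * y x" for x
  define gp where "gp t = - \<sigma> t * wm t - (\<sigma> t)\<^sup>2 * y t" for t
  define gm where "gm t = - \<sigma> t * wp t - (\<sigma> t)\<^sup>2 * y t" for t
  have pp: "primitive_on 0 pi wp (\<lambda>t. \<i> * \<rho> * wp t + gp t)"
    and pm: "primitive_on 0 pi wm (\<lambda>t. - \<i> * \<rho> * wm t + gm t)"
    using sl_system_diagonal[OF sys] unfolding wp_def[abs_def] wm_def[abs_def] gp_def gm_def by auto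
  have cwp: "continuous_on {0..pi} wp" and cwm: "continuous_on {0..pi} wm"
    using primitive_on_continuous[OF pp] primitive_on_continuous[OF pm] .
  define u where "u t = exp (- \<tau> * t) * (cmod (wp t) + cmod (wm t))" for t
  let ?k = "kernel_bound \<sigma> 0"
  have ka: "?k absolutely_integrable_on {0..pi}" by (rule kernel_bound_absolutely_integrable[OF \<sigma>])
  have cu: "continuous_on {0..pi} u" unfolding u_def by (intro continuous_intros cwp cwm)
  have ku: "(\<lambda>t. ?k t * u t) absolutely_integrable_on {0..pi}"
    by (rule absolutely_integrable_continuous_mult_real[OF cu ka])
  have "u x \<le> 2 * (cmod (wp 0) + cmod (wm 0)) * exp (2 * integral {0..pi} ?k)"
  proof (rule gronwall_L1[OF ka kernel_bound_nonneg[OF order_refl] cu _ _ x])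
    fix x :: real assume x: "x \<in> {0..pi}"
    define hp where "hp t = exp (- \<tau> * t) * cmod (gp t)" for t
    define hm where "hm t = exp (- \<tau> * t) * cmod (gm t)" for t
    have wexp: "w x = exp (c * of_real x) * w 0 + exp (c * of_real x) * integral {0..x} (\<lambda>t. exp (- c * of_real t) * g t)"
      and le: "exp (- \<tau> * x) * cmod (w x) \<le> cmod (w 0) + integral {0..x} (\<lambda>t. exp (- \<tau> * t) * cmod (g t))"
      and hint: "(\<lambda>t. exp (- \<tau> * t) * cmod (g t)) integrable_on {0..x}"
      if w: "primitive_on 0 pi w (\<lambda>t. c * w t + g t)" and c: "\<bar>Re c\<bar> \<le> \<tau>" for w c g
    proof -
      have v: "((\<lambda>t. exp (- c * of_real t) * g t) has_integral exp (- c * of_real x) * w x - w 0) {0..x}"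
        "(\<lambda>t. exp (- c * of_real t) * g t) absolutely_integrable_on {0..x}"
        using variation_of_constants[OF w x] .
      show w_eq: "w x = exp (c * of_real x) * w 0 + exp (c * of_real x) * integral {0..x} (\<lambda>t. exp (- c * of_real t) * g t)"
        unfolding integral_unique[OF v(1)] by (simp add: algebra_simps exp_minus)
      have "(\<lambda>t. of_real (exp (- \<tau> * t)) * exp (c * of_real t) * (exp (- c * of_real t) * g t)) absolutely_integrable_on {0..x}"
        by (rule absolutely_integrable_continuous_mult[OF _ v(2)]) (intro continuous_intros)
      moreover have "(\<lambda>t. of_real (exp (- \<tau> * t)) * exp (c * of_real t) * (exp (- c * of_real t) * g t)) =
          (\<lambda>t. of_real (exp (- \<tau> * t)) * g t)"
        by (simp add: exp_minus field_simps)
      ultimately have "(\<lambda>t. cmod (of_real (exp (- \<tau> * t)) * g t)) integrable_on {0..x}"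
        by (simp only: absolutely_integrable_on_def)
      then show hi: "(\<lambda>t. exp (- \<tau> * t) * cmod (g t)) integrable_on {0..x}"
        by (simp add: norm_mult)
      have "exp (- \<tau> * x) * cmod (exp (c * of_real x) * w 0) \<le> cmod (w 0)"
      proof -
        have "Re c * x \<le> \<tau> * x" using c x by (intro mult_right_mono) auto
        then have "exp (- \<tau> * x) * exp (Re c * x) \<le> 1" by (simp add: exp_add[symmetric])
        then have "exp (- \<tau> * x) * exp (Re c * x) * cmod (w 0) \<le> 1 * cmod (w 0)"
          by (rule mult_right_mono) auto
        then show ?thesis by (simp add: norm_mult norm_exp_eq_Re mult.assoc)
      qed
      moreover have "exp (- \<tau> * x) * cmod (exp (c * of_real x) * integral {0..x} (\<lambda>t. exp (- c * of_real t) * g t))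
          \<le> integral {0..x} (\<lambda>t. exp (- \<tau> * t) * cmod (g t))"
        by (rule variation_of_constants_le[OF c _ v(2) hi]) (use x in auto)
      moreover have "exp (- \<tau> * x) * cmod (w x) \<le> exp (- \<tau> * x) * (cmod (exp (c * of_real x) * w 0) +
          cmod (exp (c * of_real x) * integral {0..x} (\<lambda>t. exp (- c * of_real t) * g t)))"
        by (subst w_eq) (intro mult_left_mono norm_triangle_ineq, simp)
      ultimately show "exp (- \<tau> * x) * cmod (w x) \<le> cmod (w 0) + integral {0..x} (\<lambda>t. exp (- \<tau> * t) * cmod (g t))"
        by (simp add: distrib_left)
    qed
    have Rep: "\<bar>Re (\<i> * \<rho>)\<bar> \<le> \<tau>" and Rem: "\<bar>Re (- \<i> * \<rho>)\<bar> \<le> \<tau>" by (simp_all add: \<tau>_def)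
    have "u x \<le> cmod (wp 0) + cmod (wm 0) + (integral {0..x} hp + integral {0..x} hm)"
      using le[OF pp Rep] le[OF pm Rem] by (simp add: u_def hp_def[abs_def] hm_def[abs_def] distrib_left)
    also have "integral {0..x} hp + integral {0..x} hm = integral {0..x} (\<lambda>t. hp t + hm t)"
      using integral_add[OF hint[OF pp Rep] hint[OF pm Rem]] by (simp add: hp_def[abs_def] hm_def[abs_def])
    also have "\<dots> \<le> integral {0..x} (\<lambda>t. ?k t * u t)"
    proof (rule integral_le)
      show "(\<lambda>t. hp t + hm t) integrable_on {0..x}"
        using integrable_add[OF hint[OF pp Rep] hint[OF pm Rem]] by (simp add: hp_def[abs_def] hm_def[abs_def])
      show "(\<lambda>t. ?k t * u t) integrable_on {0..x}"
        using ku x by (auto simp: absolutely_integrable_on_def intro: integrable_on_subinterval)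
      fix t assume "t \<in> {0..x}"
      have "cmod (gp t) + cmod (gm t) \<le> ?k t * (cmod (wp t) + cmod (wm t))"
        using sl_diagonal_integrand_le[OF \<rho>, of "\<sigma> t" "z t" "y t"]
        by (simp add: gp_def gm_def wp_def wm_def kernel_bound_def)
      then have "exp (- \<tau> * t) * (cmod (gp t) + cmod (gm t)) \<le> exp (- \<tau> * t) * (?k t * (cmod (wp t) + cmod (wm t)))"
        by (rule mult_left_mono) auto
      then show "hp t + hm t \<le> ?k t * u t"
        by (simp add: hp_def hm_def u_def algebra_simps)
    qed
    finally show "u x \<le> cmod (wp 0) + cmod (wm 0) + integral {0..x} (\<lambda>t. ?k t * u t)" by simp
  qed auto
  also have "\<dots> \<le> 2 * (2 * (cmod \<rho> * cmod (y 0) + cmod (z 0))) * exp (2 * integral {0..pi} ?k)"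
    using cmod_pm_bounds(3)[of "z 0" \<rho> "y 0"] by (intro mult_right_mono) (auto simp: wp_def wm_def)
  finally have "u x \<le> growth_const \<sigma> * (cmod \<rho> * cmod (y 0) + cmod (z 0))"
    by (simp add: growth_const_def algebra_simps)
  then have "exp (\<tau> * x) * u x \<le> exp (\<tau> * x) * (growth_const \<sigma> * (cmod \<rho> * cmod (y 0) + cmod (z 0)))"
    by (rule mult_left_mono) auto
  moreover have "exp (\<tau> * x) * u x = cmod (wp x) + cmod (wm x)"
    by (simp add: u_def mult.assoc[symmetric] exp_add[symmetric])
  moreover have "cmod \<rho> * cmod (y x) + cmod (z x) \<le> cmod (wp x) + cmod (wm x)"
    using cmod_pm_bounds(1,2)[of "z x" \<rho> "y x"] cmod_pm_bounds(2)[of \<rho> "y x" "z x"] by (simp add: wp_def wm_def)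
  ultimately have "cmod \<rho> * cmod (y x) + cmod (z x)
      \<le> exp (\<tau> * x) * (growth_const \<sigma> * (cmod \<rho> * cmod (y 0) + cmod (z 0)))"
    by linarith
  then show ?thesis by (simp add: \<tau>_def mult_ac)
qed

text \<open>The diagonal combinations start at \<open>i \<rho>\<close> and \<open>- i \<rho>\<close>
  and are compared with the free exponentials. The inhomogeneity of the resulting inequality
  consists of \<open>\<rho>\<close> times an oscillatory integral of \<open>\<sigma>\<close>, small
  by Riemann--Lebesgue, and of a term with \<open>\<sigma>\<^sup>2 * phi\<close> that lacks the
  factor \<open>\<rho>\<close>. Gronwall then keeps the deviation of order
  \<open>e * |\<rho>|\<close>.\<close>

lemma phi_qd_asymptotics:
  assumes \<sigma>: "sq_integrable \<sigma>" and "e > 0"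
  shows "\<exists>R. \<forall>\<rho> x. cmod \<rho> \<ge> R \<longrightarrow> x \<in> {0..pi} \<longrightarrow>
           cmod (phi_qd \<sigma> x (\<rho>\<^sup>2) + \<rho> * sin (\<rho> * of_real x)) \<le> e * cmod \<rho> * exp (\<bar>Im \<rho>\<bar> * x)"
proof -
  define G where "G = growth_const \<sigma>"
  define W where "W = integral {0..pi} (\<lambda>t. (cmod (\<sigma> t))\<^sup>2)"
  let ?k = "kernel_bound \<sigma> 0"
  have G: "G > 0" "2 * exp (2 * integral {0..pi} ?k) = G / 2" by (simp_all add: G_def growth_const_def)
  have s: "\<sigma> absolutely_integrable_on {0..pi}" "(\<lambda>x. (\<sigma> x)\<^sup>2) absolutely_integrable_on {0..pi}"
    using \<sigma> by (auto simp: sq_integrable_def)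
  have s2: "(\<lambda>t. (cmod (\<sigma> t))\<^sup>2) integrable_on {0..pi}"
    using s(2) by (auto simp: absolutely_integrable_on_def norm_power)
  have W: "W \<ge> 0" unfolding W_def by (rule integral_nonneg[OF s2]) auto
  obtain R1 where R1: "\<forall>\<rho> x. cmod \<rho> \<ge> R1 \<longrightarrow> x \<in> {0..pi} \<longrightarrow>
           cmod (integral {0..x} (\<lambda>t. exp (\<i> * \<rho> * of_real (x - 2 * t)) * \<sigma> t)) \<le> e / (2 * G) * exp (\<bar>Im \<rho>\<bar> * x)"
    using riemann_lebesgue_uniform[OF _ s(1), of "e / (2 * G)"] \<open>e > 0\<close> G by auto
  \<comment> \<open>The Gronwall bound evaluates to \<open>|\<rho>| * e / 2 + G\<^sup>2 * W\<close>;
    the last entry of the maximum makes the second summand at most the first.\<close>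
  define R where "R = max 1 (max R1 (2 * G\<^sup>2 * W / e))"
  have "cmod (phi_qd \<sigma> x (\<rho>\<^sup>2) + \<rho> * sin (\<rho> * of_real x)) \<le> e * cmod \<rho> * exp (\<bar>Im \<rho>\<bar> * x)"
    if \<rho>R: "cmod \<rho> \<ge> R" and x: "x \<in> {0..pi}" for \<rho> x
  proof -
    have \<rho>: "cmod \<rho> \<ge> 1" "cmod \<rho> \<ge> R1" "2 * G\<^sup>2 * W / e \<le> cmod \<rho>" using \<rho>R by (auto simp: R_def)
    define \<tau> where "\<tau> = \<bar>Im \<rho>\<bar>"
    define y where "y x = phi \<sigma> x (\<rho>\<^sup>2)" for x
    define z where "z x = phi_qd \<sigma> x (\<rho>\<^sup>2)" for x
    have sys: "sl_system \<sigma> (\<rho>\<^sup>2) y z" and y0: "y 0 = 1" "z 0 = 0"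
      using phi_sl_system[OF \<sigma>, of "\<rho>\<^sup>2"] by (simp_all add: y_def[abs_def] z_def[abs_def])
    define wp where "wp x = z x + \<i> * \<rho> * y x" for x
    define wm where "wm x = z x - \<i> * \<rho> * y x" for x
    define gp where "gp t = - \<sigma> t * wm t - (\<sigma> t)\<^sup>2 * y t" for t
    define gm where "gm t = - \<sigma> t * wp t - (\<sigma> t)\<^sup>2 * y t" for t
    have pp: "primitive_on 0 pi wp (\<lambda>t. \<i> * \<rho> * wp t + gp t)"
      and pm: "primitive_on 0 pi wm (\<lambda>t. - \<i> * \<rho> * wm t + gm t)"
      using sl_system_diagonal[OF sys] unfolding wp_def[abs_def] wm_def[abs_def] gp_def gm_def by auto
    define Dp where "Dp x = wp x - \<i> * \<rho> * exp (\<i> * \<rho> * of_real x)" for x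
    define Dm where "Dm x = wm x + \<i> * \<rho> * exp (- \<i> * \<rho> * of_real x)" for x
    have cD: "continuous_on {0..pi} Dp" "continuous_on {0..pi} Dm"
      unfolding Dp_def Dm_def
      by (intro continuous_intros primitive_on_continuous[OF pp] primitive_on_continuous[OF pm])+
    have cy: "continuous_on {0..pi} y" using sl_system_continuous[OF sys] by auto
    define hp where "hp t = - \<sigma> t * Dm t - (\<sigma> t)\<^sup>2 * y t" for t
    define hm where "hm t = - \<sigma> t * Dp t - (\<sigma> t)\<^sup>2 * y t" for t
    have h_int: "hp absolutely_integrable_on {0..pi}" "hm absolutely_integrable_on {0..pi}"
      using absolutely_integrable_continuous_mult[OF continuous_on_minus[OF cD(1)] s(1)]
        absolutely_integrable_continuous_mult[OF continuous_on_minus[OF cD(2)] s(1)]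
        absolutely_integrable_continuous_mult[OF cy s(2)]
      unfolding hp_def[abs_def] hm_def[abs_def]
      by (auto simp: mult.commute dest!: set_integral_diff(1)[of lebesgue "{0..pi}"])
    define u where "u t = exp (- \<tau> * t) * (cmod (Dp t) + cmod (Dm t))" for t
    have cu: "continuous_on {0..pi} u" unfolding u_def by (intro continuous_intros cD)
    have ka: "?k absolutely_integrable_on {0..pi}" by (rule kernel_bound_absolutely_integrable[OF \<sigma>])
    have ku: "(\<lambda>t. ?k t * u t) absolutely_integrable_on {0..pi}"
      by (rule absolutely_integrable_continuous_mult_real[OF cu ka])
    have ytau: "exp (- \<tau> * t) * cmod (y t) \<le> G" if "t \<in> {0..pi}" for t
    proof -
      have "cmod \<rho> * cmod (y t) \<le> G * exp (\<tau> * t) * cmod \<rho>"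
        using sl_growth_bound[OF \<sigma> sys \<rho>(1) that] norm_ge_zero[of "z t"] y0
        by (simp add: G_def \<tau>_def del: norm_ge_zero)
      then have "cmod \<rho> * cmod (y t) \<le> cmod \<rho> * (G * exp (\<tau> * t))" by (simp add: mult_ac)
      then have "cmod (y t) \<le> G * exp (\<tau> * t)"
        using \<rho>(1) by (cases "\<rho> = 0") (auto simp: mult_le_cancel_left)
      then have "exp (- \<tau> * t) * cmod (y t) \<le> exp (- \<tau> * t) * (G * exp (\<tau> * t))" by (rule mult_left_mono) auto
      also have "\<dots> = G" by (simp add: exp_minus)
      finally show ?thesis .
    qed
    have "u x \<le> 2 * (cmod \<rho> * (e / G) + 2 * G * W) * exp (2 * integral {0..pi} ?k)"
    proof (rule gronwall_L1[OF ka kernel_bound_nonneg[OF order_refl] cu _ _ x])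
      show "0 \<le> cmod \<rho> * (e / G) + 2 * G * W" using W G \<open>e > 0\<close> by auto
      fix x :: real assume x: "x \<in> {0..pi}"
      have part: "exp (- \<tau> * x) * cmod (w x - exp (c * of_real x) * w 0)
            \<le> integral {0..x} (\<lambda>t. exp (- \<tau> * t) * cmod (h t)) + cmod \<rho> * (e / (2 * G))"
        and hint: "(\<lambda>t. exp (- \<tau> * t) * cmod (h t)) integrable_on {0..x}"
        if w: "primitive_on 0 pi w (\<lambda>t. c * w t + g t)" and c: "\<bar>Re c\<bar> \<le> \<tau>" "c = \<i> * \<kappa>"
          and \<kappa>: "cmod \<kappa> = cmod \<rho>" "\<bar>Im \<kappa>\<bar> = \<tau>"
          and h: "h absolutely_integrable_on {0..pi}"
          and g: "\<And>t. g t = h t + c * exp (- c * of_real t) * \<sigma> t" for w c g h \<kappa>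
      proof -
        have sub: "{0..x} \<subseteq> {0..pi}" using x by auto
        have hx: "h absolutely_integrable_on {0..x}" and sx: "\<sigma> absolutely_integrable_on {0..x}"
          using absolutely_integrable_on_subinterval[OF h sub] absolutely_integrable_on_subinterval[OF s(1) sub] .
        have i1: "(\<lambda>t. exp (- c * of_real t) * h t) absolutely_integrable_on {0..x}"
          by (rule absolutely_integrable_continuous_mult[OF _ hx]) (intro continuous_intros)
        have i2: "(\<lambda>t. c * exp (- c * of_real t) * exp (- c * of_real t) * \<sigma> t) absolutely_integrable_on {0..x}"
          by (rule absolutely_integrable_continuous_mult[OF _ sx]) (intro continuous_intros)
        have "(\<lambda>t. of_real (exp (- \<tau> * t)) * h t) absolutely_integrable_on {0..x}"
          by (rule absolutely_integrable_continuous_mult[OF _ hx]) (intro continuous_intros)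
        then have "(\<lambda>t. cmod (of_real (exp (- \<tau> * t)) * h t)) integrable_on {0..x}"
          by (simp only: absolutely_integrable_on_def)
        then show hi: "(\<lambda>t. exp (- \<tau> * t) * cmod (h t)) integrable_on {0..x}"
          by (simp add: norm_mult)
        define J where "J = integral {0..x} (\<lambda>t. exp (c * of_real (x - 2 * t)) * \<sigma> t)"
        have J: "exp (- \<tau> * x) * cmod (c * J) \<le> cmod \<rho> * (e / (2 * G))"
        proof -
          have "cmod J \<le> e / (2 * G) * exp (\<tau> * x)"
            using R1[rule_format, of \<kappa> x] \<kappa> \<rho>(2) x c(2) by (simp add: J_def)
          then have "exp (- \<tau> * x) * (cmod \<rho> * cmod J) \<le> exp (- \<tau> * x) * (cmod \<rho> * (e / (2 * G) * exp (\<tau> * x)))"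
            by (intro mult_left_mono) auto
          also have "\<dots> = cmod \<rho> * (e / (2 * G)) * (exp (- \<tau> * x) * exp (\<tau> * x))" by (simp only: mult_ac)
          also have "exp (- \<tau> * x) * exp (\<tau> * x) = 1" by (simp add: exp_add[symmetric])
          finally show ?thesis using c(2) \<kappa>(1) by (simp add: norm_mult)
        qed
        have "w x - exp (c * of_real x) * w 0 = exp (c * of_real x) * integral {0..x} (\<lambda>t. exp (- c * of_real t) * g t)"
          unfolding integral_unique[OF variation_of_constants(1)[OF w x]] by (simp add: algebra_simps exp_minus)
        also have "(\<lambda>t. exp (- c * of_real t) * g t) =
            (\<lambda>t. exp (- c * of_real t) * h t + c * exp (- c * of_real t) * exp (- c * of_real t) * \<sigma> t)"
          by (simp add: g algebra_simps)
        also have "integral {0..x} \<dots> = integral {0..x} (\<lambda>t. exp (- c * of_real t) * h t) +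
            integral {0..x} (\<lambda>t. c * exp (- c * of_real t) * exp (- c * of_real t) * \<sigma> t)"
          using i1 i2 by (intro integral_add) (auto simp: absolutely_integrable_on_def)
        also have "exp (c * of_real x) * \<dots> = exp (c * of_real x) * integral {0..x} (\<lambda>t. exp (- c * of_real t) * h t) +
            integral {0..x} (\<lambda>t. exp (c * of_real x) * (c * exp (- c * of_real t) * exp (- c * of_real t) * \<sigma> t))"
          by (simp only: distrib_left integral_mult_right)
        also have "(\<lambda>t. exp (c * of_real x) * (c * exp (- c * of_real t) * exp (- c * of_real t) * \<sigma> t)) =
            (\<lambda>t. c * (exp (c * of_real (x - 2 * t)) * \<sigma> t))"
        proof
          fix t
          have "exp (c * of_real (x - 2 * t)) = exp (c * of_real x) * (exp (- c * of_real t) * exp (- c * of_real t))"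
            unfolding exp_add[symmetric] by (rule arg_cong[of _ _ exp]) (simp add: algebra_simps)
          then show "exp (c * of_real x) * (c * exp (- c * of_real t) * exp (- c * of_real t) * \<sigma> t) =
              c * (exp (c * of_real (x - 2 * t)) * \<sigma> t)"
            by (simp only: mult_ac)
        qed
        also have "integral {0..x} \<dots> = c * J" by (simp only: J_def integral_mult_right)
        finally have "cmod (w x - exp (c * of_real x) * w 0) \<le>
            cmod (exp (c * of_real x) * integral {0..x} (\<lambda>t. exp (- c * of_real t) * h t)) + cmod (c * J)"
          by (metis norm_triangle_ineq)
        then have "exp (- \<tau> * x) * cmod (w x - exp (c * of_real x) * w 0) \<le> exp (- \<tau> * x) *
            (cmod (exp (c * of_real x) * integral {0..x} (\<lambda>t. exp (- c * of_real t) * h t)) + cmod (c * J))"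
          by (rule mult_left_mono) auto
        also have "\<dots> \<le> integral {0..x} (\<lambda>t. exp (- \<tau> * t) * cmod (h t)) + cmod \<rho> * (e / (2 * G))"
          unfolding distrib_left
          by (intro add_mono J variation_of_constants_le[OF c(1) _ i1 hi]) (use x in auto)
        finally show "exp (- \<tau> * x) * cmod (w x - exp (c * of_real x) * w 0)
            \<le> integral {0..x} (\<lambda>t. exp (- \<tau> * t) * cmod (h t)) + cmod \<rho> * (e / (2 * G))" .
      qed
      \<comment> \<open>The coupling term of one combination carries the free exponential of the
        other. Together with the integrating factor it doubles the exponent, which yields the kernel
        in \<open>x - 2 * t\<close>.\<close>
      have gph: "gp t = hp t + \<i> * \<rho> * exp (- (\<i> * \<rho>) * of_real t) * \<sigma> t" for t
        by (simp add: gp_def hp_def Dm_def algebra_simps)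
      have gmh: "gm t = hm t + - \<i> * \<rho> * exp (- (- \<i> * \<rho>) * of_real t) * \<sigma> t" for t
        by (simp add: gm_def hm_def Dp_def algebra_simps)
      have re: "\<bar>Re (\<i> * \<rho>)\<bar> \<le> \<tau>" "\<bar>Re (- \<i> * \<rho>)\<bar> \<le> \<tau>" "- \<i> * \<rho> = \<i> * (- \<rho>)"
        "\<bar>Im \<rho>\<bar> = \<tau>" "\<bar>Im (- \<rho>)\<bar> = \<tau>" "cmod (- \<rho>) = cmod \<rho>" by (simp_all add: \<tau>_def)
      have "Dp x = wp x - exp (\<i> * \<rho> * of_real x) * wp 0" "Dm x = wm x - exp (- \<i> * \<rho> * of_real x) * wm 0"
        by (simp_all add: Dp_def Dm_def wp_def wm_def y0)
      then have dp: "exp (- \<tau> * x) * cmod (Dp x) \<le> integral {0..x} (\<lambda>t. exp (- \<tau> * t) * cmod (hp t)) + cmod \<rho> * (e / (2 * G))"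
        and dm: "exp (- \<tau> * x) * cmod (Dm x) \<le> integral {0..x} (\<lambda>t. exp (- \<tau> * t) * cmod (hm t)) + cmod \<rho> * (e / (2 * G))"
        using part[OF pp re(1) refl refl re(4) h_int(1) gph] part[OF pm re(2,3,6,5) h_int(2) gmh] by simp_all
      have hip: "(\<lambda>t. exp (- \<tau> * t) * cmod (hp t)) integrable_on {0..x}"
        and him: "(\<lambda>t. exp (- \<tau> * t) * cmod (hm t)) integrable_on {0..x}"
        using hint[OF pp re(1) refl refl re(4) h_int(1) gph] hint[OF pm re(2,3,6,5) h_int(2) gmh] by simp_all
      have s2x: "(\<lambda>t. 2 * G * (cmod (\<sigma> t))\<^sup>2) integrable_on {0..x}"
        by (intro integrable_on_mult_right integrable_on_subinterval[OF s2]) (use x in auto)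
      have kux: "(\<lambda>t. ?k t * u t) integrable_on {0..x}"
        using ku x by (auto simp: absolutely_integrable_on_def intro: integrable_on_subinterval)
      have "u x \<le> integral {0..x} (\<lambda>t. exp (- \<tau> * t) * cmod (hp t)) +
          integral {0..x} (\<lambda>t. exp (- \<tau> * t) * cmod (hm t)) + cmod \<rho> * (e / G)"
      proof -
        have "cmod \<rho> * (e / (2 * G)) + cmod \<rho> * (e / (2 * G)) = cmod \<rho> * (e / G)"
          using G by (simp add: field_simps)
        moreover have swap: "a + b \<le> I + J + r" if "a \<le> I + q" "b \<le> J + q" "q + q = r" for a b I J q r :: real
          using that by linarith
        ultimately show ?thesis
          unfolding u_def distrib_left using swap[OF dp dm] by blast
      qed
      also have "integral {0..x} (\<lambda>t. exp (- \<tau> * t) * cmod (hp t)) + integral {0..x} (\<lambda>t. exp (- \<tau> * t) * cmod (hm t))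
         = integral {0..x} (\<lambda>t. exp (- \<tau> * t) * cmod (hp t) + exp (- \<tau> * t) * cmod (hm t))"
        by (rule integral_add[OF hip him, symmetric])
      also have "\<dots> \<le> integral {0..x} (\<lambda>t. 2 * G * (cmod (\<sigma> t))\<^sup>2 + ?k t * u t)"
      proof (rule integral_le[OF integrable_add[OF hip him] integrable_add[OF s2x kux]])
        fix t assume t: "t \<in> {0..x}"
        then have tpi: "t \<in> {0..pi}" using x by auto
        have a: "cmod (hp t) \<le> cmod (\<sigma> t) * cmod (Dm t) + (cmod (\<sigma> t))\<^sup>2 * cmod (y t)"
          "cmod (hm t) \<le> cmod (\<sigma> t) * cmod (Dp t) + (cmod (\<sigma> t))\<^sup>2 * cmod (y t)"
          using norm_triangle_ineq4[of "- \<sigma> t * Dm t" "(\<sigma> t)\<^sup>2 * y t"]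
            norm_triangle_ineq4[of "- \<sigma> t * Dp t" "(\<sigma> t)\<^sup>2 * y t"]
          by (simp_all add: hp_def hm_def norm_mult norm_power)
        have "exp (- \<tau> * t) * cmod (hp t) + exp (- \<tau> * t) * cmod (hm t) = exp (- \<tau> * t) * (cmod (hp t) + cmod (hm t))"
          by (simp add: distrib_left)
        also have "\<dots> \<le> exp (- \<tau> * t) * (cmod (\<sigma> t) * (cmod (Dp t) + cmod (Dm t)) + 2 * ((cmod (\<sigma> t))\<^sup>2 * cmod (y t)))"
          using a by (intro mult_left_mono) (auto simp: algebra_simps)
        also have "\<dots> = cmod (\<sigma> t) * u t + 2 * (cmod (\<sigma> t))\<^sup>2 * (exp (- \<tau> * t) * cmod (y t))"
          by (simp add: u_def algebra_simps)
        also have "\<dots> \<le> ?k t * u t + 2 * (cmod (\<sigma> t))\<^sup>2 * G"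
        proof (intro add_mono mult_right_mono mult_left_mono ytau tpi)
          show "cmod (\<sigma> t) \<le> ?k t"
            using norm_ge_zero[of "\<sigma> t"] zero_le_power2[of "cmod (\<sigma> t)"] unfolding kernel_bound_def by linarith
        qed (auto simp: u_def)
        finally show "exp (- \<tau> * t) * cmod (hp t) + exp (- \<tau> * t) * cmod (hm t) \<le> 2 * G * (cmod (\<sigma> t))\<^sup>2 + ?k t * u t"
          by (simp add: mult_ac)
      qed
      also have "\<dots> = integral {0..x} (\<lambda>t. 2 * G * (cmod (\<sigma> t))\<^sup>2) + integral {0..x} (\<lambda>t. ?k t * u t)"
        by (rule integral_add[OF s2x kux])
      also have "integral {0..x} (\<lambda>t. 2 * G * (cmod (\<sigma> t))\<^sup>2) \<le> 2 * G * W"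
      proof -
        have "integral {0..x} (\<lambda>t. (cmod (\<sigma> t))\<^sup>2) \<le> W"
          unfolding W_def by (rule integral_subset_le) (use x s2 integrable_on_subinterval[OF s2, of 0 x] in auto)
        then show ?thesis using G by simp
      qed
      finally show "u x \<le> cmod \<rho> * (e / G) + 2 * G * W + integral {0..x} (\<lambda>t. ?k t * u t)" by simp
    qed
    also have "\<dots> = (cmod \<rho> * (e / G) + 2 * G * W) * (2 * exp (2 * integral {0..pi} ?k))" by simp
    also have "\<dots> = cmod \<rho> * e / 2 + G\<^sup>2 * W" unfolding G(2) using G(1) by (simp add: field_simps power2_eq_square)
    also have "G\<^sup>2 * W \<le> cmod \<rho> * e / 2" using \<rho>(3) \<open>e > 0\<close> by (simp add: field_simps)
    finally have ux: "u x \<le> cmod \<rho> * e" by (simp add: mult.commute)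
    have "cmod (Dp x) + cmod (Dm x) = exp (\<tau> * x) * u x"
      by (simp add: u_def mult.assoc[symmetric] exp_add[symmetric])
    also have "\<dots> \<le> exp (\<tau> * x) * (cmod \<rho> * e)" by (rule mult_left_mono[OF ux]) auto
    finally have D: "cmod (Dp x) + cmod (Dm x) \<le> e * cmod \<rho> * exp (\<tau> * x)" by (simp add: mult_ac)
    have "2 * (z x + \<rho> * sin (\<rho> * of_real x)) = Dp x + Dm x"
    proof -
      have "2 * (\<rho> * sin (\<rho> * of_real x)) = - \<i> * \<rho> * (exp (\<i> * (\<rho> * of_real x)) - exp (- (\<i> * (\<rho> * of_real x))))"
        by (simp add: sin_exp_eq field_simps)
      then show ?thesis by (simp add: Dp_def Dm_def wp_def wm_def algebra_simps)
    qed
    then have "2 * cmod (z x + \<rho> * sin (\<rho> * of_real x)) = cmod (Dp x + Dm x)"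
      by (metis norm_mult norm_numeral)
    also have "\<dots> \<le> e * cmod \<rho> * exp (\<tau> * x)" using norm_triangle_ineq[of "Dp x" "Dm x"] D by linarith
    finally have "cmod (z x + \<rho> * sin (\<rho> * of_real x)) \<le> e * cmod \<rho> * exp (\<tau> * x) / 2" by simp
    also have "\<dots> \<le> e * cmod \<rho> * exp (\<tau> * x)" using \<open>e > 0\<close> by simp
    finally show ?thesis by (simp add: z_def \<tau>_def)
  qed
  then show ?thesis by blast
qed

section \<open>Entire functions on expanding squares\<close>

text \<open>The boundary of a square centred at 0. Its vertical sides run halfway between integers,
  the zeros of \<open>sin (pi \<rho>)\<close>.\<close>

definition square :: "nat \<Rightarrow> complex set" where
  "square n = {\<rho>. max \<bar>Re \<rho>\<bar> \<bar>Im \<rho>\<bar> = real n + 1 / 2}"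

lemma square_cmod:
  assumes "\<rho> \<in> square n"
  shows "real n + 1 / 2 \<le> cmod \<rho>" "cmod \<rho> \<le> 2 * real n + 1"
  using assms abs_Re_le_cmod[of \<rho>] abs_Im_le_cmod[of \<rho>] cmod_le[of \<rho>]
  by (auto simp: square_def max_def split: if_splits)

text \<open>On the vertical sides the cosine in the formula for the squared modulus equals -1 and
  helps. On the horizontal sides \<open>2 * b >= pi\<close>, so \<open>exp (2 * b) >= 4\<close>
  outweighs the cosine.\<close>

lemma cmod_sin_ge_on_square:
  assumes "\<rho> \<in> square n"
  shows "exp (\<bar>Im \<rho>\<bar> * pi) / 4 \<le> cmod (sin (\<rho> * of_real pi))"
proof -
  define b where "b = \<bar>Im \<rho>\<bar> * pi"
  have "b \<ge> 0" by (simp add: b_def)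
  have sq: "(cmod (sin (\<rho> * of_real pi)))\<^sup>2 = (exp (2 * b) + exp (- 2 * b) - 2 * cos (2 * (Re \<rho> * pi))) / 4"
    by (auto simp: norm_sin_squared b_def exp_minus abs_if)
  have "exp (2 * b) / 16 \<le> (exp (2 * b) + exp (- 2 * b) - 2 * cos (2 * (Re \<rho> * pi))) / 4"
  proof (cases "\<bar>Re \<rho>\<bar> = real n + 1 / 2")
    case True
    have "cos (2 * (Re \<rho> * pi)) = cos (2 * (\<bar>Re \<rho>\<bar> * pi))"
      by (simp add: abs_if)
    also have "2 * (\<bar>Re \<rho>\<bar> * pi) = real (2 * n + 1) * pi"
      unfolding True by (simp add: algebra_simps)
    also have "cos \<dots> = - 1"
      by (subst cos_npi) simp
    finally show ?thesis using exp_gt_zero[of "2 * b"] exp_gt_zero[of "- 2 * b"] by simp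
  next
    case False
    then have "\<bar>Im \<rho>\<bar> = real n + 1 / 2" using assms by (auto simp: square_def max_def split: if_splits)
    then have "\<bar>Im \<rho>\<bar> \<ge> 1 / 2" by simp
    then have "2 * b \<ge> pi" by (simp add: b_def)
    then have "2 * b \<ge> 3" using pi_gt3 by linarith
    then have "exp (2 * b) \<ge> 4" using exp_ge_add_one_self[of "2 * b"] by linarith
    moreover define c where "c = cos (2 * (Re \<rho> * pi))"
    then have "c \<le> 1" by simp
    moreover define F where "F = exp (- 2 * b)"
    then have "F > 0" by simp
    ultimately show ?thesis unfolding c_def[symmetric] F_def[symmetric] by (simp add: field_simps)
  qed
  moreover have "(exp b / 4)\<^sup>2 = exp (2 * b) / 16"
    by (simp add: power_divide exp_double)
  ultimately have "(exp b / 4)\<^sup>2 \<le> (cmod (sin (\<rho> * of_real pi)))\<^sup>2" by (simp only: sq)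
  then have "exp b / 4 \<le> cmod (sin (\<rho> * of_real pi))" by (rule power2_le_imp_le) auto
  then show ?thesis by (simp add: b_def)
qed

lemma maximum_modulus_square:
  assumes f: "f holomorphic_on UNIV" and B: "\<And>z. z \<in> square n \<Longrightarrow> cmod (f z) \<le> B"
    and z: "max \<bar>Re z\<bar> \<bar>Im z\<bar> \<le> real n + 1 / 2"
  shows "cmod (f z) \<le> B"
proof -
  define a where "a = real n + 1 / 2"
  define Q where "Q = cbox (Complex (- a) (- a)) (Complex a a)"
  show ?thesis
  proof (rule maximum_modulus_frontier[where S = Q and f = f and \<xi> = z])
    show "f holomorphic_on interior Q" using f holomorphic_on_subset by blast
    show "continuous_on (closure Q) f"
      using holomorphic_on_imp_continuous_on[OF f] continuous_on_subset by blast
    show "bounded Q" unfolding Q_def by (rule bounded_cbox)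
    show "cmod (f w) \<le> B" if "w \<in> frontier Q" for w
    proof (rule B)
      have "w \<in> Q - box (Complex (- a) (- a)) (Complex a a)"
        using that by (simp add: Q_def frontier_cbox)
      then show "w \<in> square n"
        by (auto simp: Q_def in_cbox_complex_iff in_box_complex_iff square_def a_def[symmetric] max_def abs_if)
    qed
    show "z \<in> Q" using z by (auto simp: Q_def in_cbox_complex_iff a_def abs_if split: if_splits)
  qed
qed

lemma entire_eq_0_squares:
  assumes f: "f holomorphic_on UNIV"
    and small: "\<And>e. e > 0 \<Longrightarrow> \<exists>n0. \<forall>n\<ge>n0. \<forall>\<rho>\<in>square n. cmod (f \<rho>) \<le> e"
  shows "f z = 0"
proof -
  have "cmod (f z) \<le> 0"
  proof (rule field_le_epsilon)
    fix e :: real assume "e > 0"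
    obtain n0 where n0: "\<forall>n\<ge>n0. \<forall>\<rho>\<in>square n. cmod (f \<rho>) \<le> e" using small[OF \<open>e > 0\<close>] by blast
    obtain m :: nat where m: "max \<bar>Re z\<bar> \<bar>Im z\<bar> \<le> real m" using real_arch_simple by blast
    have "cmod (f z) \<le> e"
      by (rule maximum_modulus_square[OF f, of "max m n0"]) (use n0[rule_format, of "max m n0"] m in auto)
    then show "cmod (f z) \<le> 0 + e" by simp
  qed
  then show ?thesis by simp
qed

text \<open>Linear growth leaves a polynomial of degree at most one, and evenness removes its linear
  term. The gain of one degree is what the substitution \<open>l = \<rho>\<^sup>2\<close> is
  for.\<close>

lemma entire_even_linear_growth_constant:
  assumes f: "f holomorphic_on UNIV" and even: "\<And>z. f (- z) = f z"
    and le: "\<And>n \<rho>. n \<ge> n0 \<Longrightarrow> \<rho> \<in> square n \<Longrightarrow> cmod (f \<rho>) \<le> C * cmod \<rho>"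
  shows "f z = f 0"
proof -
  define C' where "C' = max C 0"
  \<comment> \<open>The point \<open>z\<close> lies inside the square number \<open>n\<close>, where
    \<open>n\<close> is the ceiling of \<open>max |Re z| |Im z|\<close>. There
    \<open>2 * n + 1 <= 2 * |z| + 3\<close>, which is below \<open>10 * |z|\<close> because
    \<open>|z| >= 2\<close>.\<close>
  have bound: "cmod (f z) \<le> 10 * C' * cmod z ^ 1" if z: "2 * (real n0 + 1) \<le> cmod z" for z
  proof -
    define m where "m = max \<bar>Re z\<bar> \<bar>Im z\<bar>"
    have m1: "m \<le> cmod z" "cmod z \<le> 2 * m"
      using abs_Re_le_cmod[of z] abs_Im_le_cmod[of z] cmod_le[of z] by (auto simp: m_def max_def)
    define n where "n = nat \<lceil>m\<rceil>"
    have n: "m \<le> real n" "real n \<le> m + 1"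
      using m1 z unfolding n_def by linarith+
    have "real n0 \<le> real n" using n m1 z by argo
    then have "n0 \<le> n" by simp
    have "cmod (f z) \<le> C' * (2 * real n + 1)"
    proof (rule maximum_modulus_square[OF f, of n])
      fix w assume w: "w \<in> square n"
      have "cmod (f w) \<le> C * cmod w" by (rule le[OF \<open>n0 \<le> n\<close> w])
      also have "\<dots> \<le> C' * (2 * real n + 1)"
        using square_cmod(2)[OF w] by (intro mult_mono) (auto simp: C'_def)
      finally show "cmod (f w) \<le> C' * (2 * real n + 1)" .
    qed (use n in \<open>simp add: m_def\<close>)
    also have "\<dots> \<le> C' * (10 * cmod z)"
      using n m1 z by (intro mult_left_mono) (auto simp: C'_def)
    finally show ?thesis by simp
  qed
  have lin: "f w = f 0 + deriv f 0 * w" for w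
    using Liouville_polynomial[OF f bound, where \<xi> = w] by simp
  have "deriv f 0 * z = deriv f 0 * (- z)"
    using lin[of z] lin[of "- z"] even[of z] by simp
  then have "deriv f 0 * z = 0" by auto
  then show ?thesis using lin[of z] by simp
qed

section \<open>Cauchy transforms and expansions at infinity\<close>

definition circle_mean :: "real \<Rightarrow> (complex \<Rightarrow> complex) \<Rightarrow> complex" where
  "circle_mean R f = 1 / (2 * of_real pi * \<i>) * contour_integral (circlepath 0 R) f"

lemma Gamma_integral_circle_mean: "Gamma_integral p N f = circle_mean (radius p N) f"
  by (simp add: Gamma_integral_def circle_mean_def)

lemma circle_integrable:
  assumes "R > 0" and "continuous_on (sphere 0 R) f"
  shows "f contour_integrable_on (circlepath 0 R)"
  by (rule contour_integrable_continuous_circlepath) (use assms in simp)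

lemma circle_mean_add:
  assumes "R > 0" and "continuous_on (sphere 0 R) f" and "continuous_on (sphere 0 R) g"
  shows "circle_mean R (\<lambda>x. f x + g x) = circle_mean R f + circle_mean R g"
  using assms by (simp add: circle_mean_def contour_integral_add circle_integrable distrib_left)

lemma circle_mean_diff:
  assumes "R > 0" and "continuous_on (sphere 0 R) f" and "continuous_on (sphere 0 R) g"
  shows "circle_mean R (\<lambda>x. f x - g x) = circle_mean R f - circle_mean R g"
  using assms by (simp add: circle_mean_def contour_integral_diff circle_integrable right_diff_distrib)

lemma circle_mean_cmult:
  assumes "R > 0" and "continuous_on (sphere 0 R) f"
  shows "circle_mean R (\<lambda>x. c * f x) = c * circle_mean R f"
  using assms by (simp add: circle_mean_def contour_integral_lmul circle_integrable)

lemma circle_mean_cong: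
  assumes "R > 0" and "\<And>x. cmod x = R \<Longrightarrow> f x = g x"
  shows "circle_mean R f = circle_mean R g"
  unfolding circle_mean_def
  by (rule arg_cong[where f = "\<lambda>w. 1 / (2 * of_real pi * \<i>) * w"], rule contour_integral_cong) (use assms in auto)

lemma circle_mean_has_contour_integral:
  assumes "(f has_contour_integral 2 * of_real pi * \<i> * w) (circlepath 0 R)"
  shows "circle_mean R f = w"
  using contour_integral_unique[OF assms] by (simp add: circle_mean_def)

lemma circle_mean_norm_le:
  assumes R: "R > 0" and f: "continuous_on (sphere 0 R) f" and B: "\<And>x. cmod x = R \<Longrightarrow> cmod (f x) \<le> B"
  shows "cmod (circle_mean R f) \<le> B * R"
proof -
  have "B \<ge> 0" using B[of "of_real R"] R norm_ge_zero[of "f (of_real R)"] by (simp del: norm_ge_zero)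
  have "cmod (contour_integral (circlepath 0 R) f) \<le> B * (2 * pi * R)"
    by (rule has_contour_integral_bound_circlepath[OF has_contour_integral_integral[OF circle_integrable[OF R f]]])
      (use R B \<open>B \<ge> 0\<close> in auto)
  then show ?thesis
    by (simp add: circle_mean_def norm_mult norm_divide field_simps)
qed

lemma continuous_on_cauchy_kernel:
  assumes "cmod l > R" and "continuous_on (sphere 0 R) f"
  shows "continuous_on (sphere 0 R) (\<lambda>x. f x / (l - x))"
  using assms by (auto intro!: continuous_intros)

lemma cauchy_transform_le:
  assumes R: "R > 0" and f: "continuous_on (sphere 0 R) f" and B: "\<And>x. cmod x = R \<Longrightarrow> cmod (f x) \<le> B"
    and l: "cmod l > R"
  shows "cmod (circle_mean R (\<lambda>x. f x / (l - x))) \<le> B * R / (cmod l - R)"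
proof -
  have "B \<ge> 0" using B[of "of_real R"] R norm_ge_zero[of "f (of_real R)"] by (simp del: norm_ge_zero)
  have "cmod (circle_mean R (\<lambda>x. f x / (l - x))) \<le> B / (cmod l - R) * R"
  proof (rule circle_mean_norm_le[OF R continuous_on_cauchy_kernel[OF l f]])
    fix x :: complex assume x: "cmod x = R"
    have "cmod l - R \<le> cmod (l - x)" using norm_triangle_ineq2[of l x] x by simp
    then show "cmod (f x / (l - x)) \<le> B / (cmod l - R)"
      unfolding norm_divide using B[OF x] l \<open>B \<ge> 0\<close> by (intro frac_le) auto
  qed
  then show ?thesis by simp
qed

text \<open>Since \<open>l / (l - x) - 1 = x / (l - x)\<close>, the error is again a Cauchy
  transform. So the mean of \<open>f\<close> is the coefficient of \<open>1 / l\<close> at infinity,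
  with an explicit rate.\<close>

lemma cauchy_transform_moment_le:
  assumes R: "R > 0" and f: "continuous_on (sphere 0 R) f" and B: "\<And>x. cmod x = R \<Longrightarrow> cmod (f x) \<le> B"
    and l: "cmod l > R"
  shows "cmod (l * circle_mean R (\<lambda>x. f x / (l - x)) - circle_mean R f) \<le> B * R\<^sup>2 / (cmod l - R)"
proof -
  have c: "continuous_on (sphere 0 R) (\<lambda>x. x * f x)" by (intro continuous_intros f)
  have "l * circle_mean R (\<lambda>x. f x / (l - x)) - circle_mean R f
      = circle_mean R (\<lambda>x. l * (f x / (l - x)) - f x)"
    by (simp add: circle_mean_diff[OF R _ f] circle_mean_cmult[OF R] continuous_on_cauchy_kernel[OF l f]
        continuous_on_mult_left del: times_divide_eq_right)
  also have "\<dots> = circle_mean R (\<lambda>x. (x * f x) / (l - x))"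
  proof (rule circle_mean_cong[OF R])
    fix x :: complex assume "cmod x = R"
    then have "l - x \<noteq> 0" using l by auto
    then show "l * (f x / (l - x)) - f x = x * f x / (l - x)"
      by (simp add: divide_simps, (simp add: algebra_simps)?)
  qed
  finally have "cmod (l * circle_mean R (\<lambda>x. f x / (l - x)) - circle_mean R f)
      = cmod (circle_mean R (\<lambda>x. (x * f x) / (l - x)))" by simp
  also have "\<dots> \<le> (R * B) * R / (cmod l - R)"
    by (rule cauchy_transform_le[OF R c _ l]) (use B R in \<open>auto simp: norm_mult intro!: mult_left_mono\<close>)
  finally show ?thesis by (simp add: power2_eq_square mult_ac)
qed

text \<open>\<open>m\<close> behaves like the principal part of a Laurent expansion at infinity: for an
  entire \<open>g\<close>, the Cauchy transform of \<open>m g\<close> is \<open>m g\<close> minus its entire part.\<close>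

definition principal_at_infinity :: "real \<Rightarrow> (complex \<Rightarrow> complex) \<Rightarrow> bool" where
  "principal_at_infinity R m \<longleftrightarrow> continuous_on {z. R \<le> cmod z} m \<and>
     (\<forall>g. g holomorphic_on UNIV \<longrightarrow> (\<exists>G. G holomorphic_on UNIV \<and>
        (\<forall>l. cmod l > R \<longrightarrow> m l * g l = G l + circle_mean R (\<lambda>x. m x * g x / (l - x)))))"

lemma principal_at_infinity_sphere:
  assumes "principal_at_infinity R m" and "g holomorphic_on UNIV"
  shows "continuous_on (sphere 0 R) (\<lambda>x. m x * g x)"
proof (intro continuous_intros)
  show "continuous_on (sphere 0 R) m"
    by (rule continuous_on_subset[of "{z. R \<le> cmod z}"]) (use assms in \<open>auto simp: principal_at_infinity_def\<close>)
  show "continuous_on (sphere 0 R) g"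
    using assms(2) holomorphic_on_imp_continuous_on continuous_on_subset by blast
qed

lemma principal_at_infinity_zero: "principal_at_infinity R (\<lambda>_. 0)"
  by (auto simp: principal_at_infinity_def circle_mean_def intro!: exI[of _ "\<lambda>_. 0"])

lemma principal_at_infinity_add:
  assumes R: "R > 0" and m: "principal_at_infinity R m" and n: "principal_at_infinity R n"
  shows "principal_at_infinity R (\<lambda>x. m x + n x)"
  unfolding principal_at_infinity_def
proof (intro conjI allI impI)
  show "continuous_on {z. R \<le> cmod z} (\<lambda>x. m x + n x)"
    using m n by (auto simp: principal_at_infinity_def intro: continuous_on_add)
  fix g :: "complex \<Rightarrow> complex" assume g: "g holomorphic_on UNIV"
  obtain G where G: "G holomorphic_on UNIV"
    "\<forall>l. cmod l > R \<longrightarrow> m l * g l = G l + circle_mean R (\<lambda>x. m x * g x / (l - x))"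
    using m g unfolding principal_at_infinity_def by blast
  obtain H where H: "H holomorphic_on UNIV"
    "\<forall>l. cmod l > R \<longrightarrow> n l * g l = H l + circle_mean R (\<lambda>x. n x * g x / (l - x))"
    using n g unfolding principal_at_infinity_def by blast
  show "\<exists>G. G holomorphic_on UNIV \<and> (\<forall>l. cmod l > R \<longrightarrow>
      (m l + n l) * g l = G l + circle_mean R (\<lambda>x. (m x + n x) * g x / (l - x)))"
  proof (intro exI[of _ "\<lambda>l. G l + H l"] conjI allI impI)
    show "(\<lambda>l. G l + H l) holomorphic_on UNIV" by (intro holomorphic_intros G H)
    fix l :: complex assume l: "cmod l > R"
    have "circle_mean R (\<lambda>x. (m x + n x) * g x / (l - x)) =
        circle_mean R (\<lambda>x. m x * g x / (l - x) + n x * g x / (l - x))"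
      by (simp add: distrib_right add_divide_distrib)
    also have "\<dots> = circle_mean R (\<lambda>x. m x * g x / (l - x)) + circle_mean R (\<lambda>x. n x * g x / (l - x))"
      by (intro circle_mean_add R continuous_on_cauchy_kernel l principal_at_infinity_sphere m n g)
    finally show "(m l + n l) * g l = G l + H l + circle_mean R (\<lambda>x. (m x + n x) * g x / (l - x))"
      using G(2) H(2) l by (simp add: distrib_right)
  qed
qed

lemma principal_at_infinity_cmult:
  assumes R: "R > 0" and m: "principal_at_infinity R m"
  shows "principal_at_infinity R (\<lambda>x. c * m x)"
  unfolding principal_at_infinity_def
proof (intro conjI allI impI)
  show "continuous_on {z. R \<le> cmod z} (\<lambda>x. c * m x)"
    using m by (auto simp: principal_at_infinity_def intro: continuous_on_mult_left)
  fix g :: "complex \<Rightarrow> complex" assume g: "g holomorphic_on UNIV"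
  obtain G where G: "G holomorphic_on UNIV"
    "\<forall>l. cmod l > R \<longrightarrow> m l * g l = G l + circle_mean R (\<lambda>x. m x * g x / (l - x))"
    using m g unfolding principal_at_infinity_def by blast
  show "\<exists>G. G holomorphic_on UNIV \<and> (\<forall>l. cmod l > R \<longrightarrow>
      (c * m l) * g l = G l + circle_mean R (\<lambda>x. (c * m x) * g x / (l - x)))"
  proof (intro exI[of _ "\<lambda>l. c * G l"] conjI allI impI)
    show "(\<lambda>l. c * G l) holomorphic_on UNIV" by (intro holomorphic_intros G)
    fix l :: complex assume l: "cmod l > R"
    have "circle_mean R (\<lambda>x. (c * m x) * g x / (l - x)) = circle_mean R (\<lambda>x. c * (m x * g x / (l - x)))"
      by (simp add: mult.assoc)
    also have "\<dots> = c * circle_mean R (\<lambda>x. m x * g x / (l - x))"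
      by (intro circle_mean_cmult R continuous_on_cauchy_kernel l principal_at_infinity_sphere m g)
    finally show "(c * m l) * g l = c * G l + circle_mean R (\<lambda>x. (c * m x) * g x / (l - x))"
      using G(2) l by (simp add: mult.assoc distrib_left)
  qed
qed

text \<open>Induction by the partial fraction identity \<open>(l - x) + (x - a) = l - a\<close>. A
  residue arises only from the simple pole at \<open>a\<close>; since \<open>l\<close> lies outside
  the circle, \<open>1 / (l - x)\<close> alone integrates to 0.\<close>

lemma circle_integral_cauchy_power:
  assumes a: "cmod a < R" and l: "cmod l > R"
  shows "((\<lambda>x. 1 / ((x - a) ^ k * (l - x))) has_contour_integral
      (if k = 0 then 0 else 2 * of_real pi * \<i> / (l - a) ^ k)) (circlepath 0 R)"
proof (induction k)
  case 0
  have R: "R > 0" using a norm_ge_zero[of a] by linarith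
  have "((\<lambda>x. 1 / (l - x)) has_contour_integral 0) (circlepath 0 R)"
  proof (rule Cauchy_theorem_convex_simple[of _ "ball 0 (cmod l)"])
    show "(\<lambda>x. 1 / (l - x)) holomorphic_on ball 0 (cmod l)"
      by (intro holomorphic_intros) auto
  qed (use l R in auto)
  then show ?case by simp
next
  case (Suc k)
  have R: "R > 0" using a norm_ge_zero[of a] by linarith
  have la: "l \<noteq> a" using a l by auto
  have p: "((\<lambda>x. 1 / (x - a) ^ Suc k) has_contour_integral (if k = 0 then 2 * of_real pi * \<i> else 0)) (circlepath 0 R)"
    using Cauchy_has_contour_integral_higher_derivative_circlepath[of 0 R "\<lambda>_. 1" a k] a by (auto split: if_splits)
  have "((\<lambda>x. 1 / (l - a) * (1 / (x - a) ^ Suc k + 1 / ((x - a) ^ k * (l - x)))) has_contour_integral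
      1 / (l - a) * ((if k = 0 then 2 * of_real pi * \<i> else 0) +
        (if k = 0 then 0 else 2 * of_real pi * \<i> / (l - a) ^ k))) (circlepath 0 R)"
    by (intro has_contour_integral_lmul has_contour_integral_add p Suc)
  then have "((\<lambda>x. 1 / (l - a) * (1 / (x - a) ^ Suc k + 1 / ((x - a) ^ k * (l - x)))) has_contour_integral
      2 * of_real pi * \<i> / (l - a) ^ Suc k) (circlepath 0 R)"
    by (cases "k = 0") simp_all
  then have "((\<lambda>x. 1 / ((x - a) ^ Suc k * (l - x))) has_contour_integral
      2 * of_real pi * \<i> / (l - a) ^ Suc k) (circlepath 0 R)"
  proof (rule has_contour_integral_eq)
    fix x assume "x \<in> path_image (circlepath 0 R)"
    then have "x - a \<noteq> 0" "l - x \<noteq> 0" using R a l by auto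
    then show "1 / (l - a) * (1 / (x - a) ^ Suc k + 1 / ((x - a) ^ k * (l - x))) = 1 / ((x - a) ^ Suc k * (l - x))"
      using la by (simp add: divide_simps)
  qed
  then show ?case by simp
qed

text \<open>Induction on the order of the pole: \<open>g\<close> is its value at \<open>a\<close>
  plus \<open>(z - a)\<close> times an entire function. The first part is covered by the explicit
  integral of a pole, the second has a pole of lower order.\<close>

lemma principal_at_infinity_pole:
  assumes a: "cmod a < R"
  shows "principal_at_infinity R (\<lambda>x. 1 / (x - a) ^ Suc k)"
  unfolding principal_at_infinity_def
proof (intro conjI allI impI)
  have R: "R > 0" using a norm_ge_zero[of a] by linarith
  have ca: "continuous_on {z. R \<le> cmod z} (\<lambda>x. 1 / (x - a) ^ k)" for k
    using a by (auto intro!: continuous_intros)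
  then show "continuous_on {z. R \<le> cmod z} (\<lambda>x. 1 / (x - a) ^ Suc k)" .
  fix g :: "complex \<Rightarrow> complex" assume "g holomorphic_on UNIV"
  then have "\<exists>G. G holomorphic_on UNIV \<and> (\<forall>l. cmod l > R \<longrightarrow>
      1 / (l - a) ^ j * g l = G l + circle_mean R (\<lambda>x. 1 / (x - a) ^ j * g x / (l - x)))" for j
  proof (induction j arbitrary: g)
    case 0
    show ?case
    proof (intro exI[of _ g] conjI allI impI 0)
      fix l :: complex assume l: "cmod l > R"
      have "((\<lambda>x. g x / (l - x)) has_contour_integral 0) (circlepath 0 R)"
      proof (rule Cauchy_theorem_convex_simple[of _ "ball 0 (cmod l)"])
        show "(\<lambda>x. g x / (l - x)) holomorphic_on ball 0 (cmod l)"
          using 0 by (auto intro!: holomorphic_intros intro: holomorphic_on_subset)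
      qed (use l R in auto)
      then have "circle_mean R (\<lambda>x. g x / (l - x)) = 0"
        by (simp add: circle_mean_def contour_integral_unique)
      then show "1 / (l - a) ^ 0 * g l = g l + circle_mean R (\<lambda>x. 1 / (x - a) ^ 0 * g x / (l - x))"
        by simp
    qed
  next
    case (Suc j)
    \<comment> \<open>The derivative is the removable value of the difference quotient, so
      \<open>g1\<close> is entire.\<close>
    define g1 where "g1 z = (if z = a then deriv g a else (g z - g a) / (z - a))" for z
    have g1: "g1 holomorphic_on UNIV"
      unfolding g1_def using pole_lemma_open[OF Suc.prems open_UNIV, of a] .
    have gg1: "g z = g a + (z - a) * g1 z" for z by (simp add: g1_def)
    obtain G where G: "G holomorphic_on UNIV" "\<forall>l. cmod l > R \<longrightarrow>
      1 / (l - a) ^ j * g1 l = G l + circle_mean R (\<lambda>x. 1 / (x - a) ^ j * g1 x / (l - x))"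
      using Suc.IH[OF g1] by blast
    show ?case
    proof (intro exI[of _ G] conjI allI impI G(1))
      fix l :: complex assume l: "cmod l > R"
      have la: "l - a \<noteq> 0" using a l by auto
      have cs: "continuous_on (sphere 0 R) (\<lambda>x. 1 / (x - a) ^ j)" for j
        by (rule continuous_on_subset[OF ca]) auto
      have cg1: "continuous_on (sphere 0 R) g1"
        using g1 holomorphic_on_imp_continuous_on continuous_on_subset by blast
      have "circle_mean R (\<lambda>x. 1 / (x - a) ^ Suc j * g x / (l - x)) =
          circle_mean R (\<lambda>x. g a * (1 / ((x - a) ^ Suc j) / (l - x)) + 1 / (x - a) ^ j * g1 x / (l - x))"
      proof (rule circle_mean_cong[OF R])
        fix x :: complex assume "cmod x = R"
        then have "x - a \<noteq> 0" "l - x \<noteq> 0" using a l by auto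
        then show "1 / (x - a) ^ Suc j * g x / (l - x) =
            g a * (1 / ((x - a) ^ Suc j) / (l - x)) + 1 / (x - a) ^ j * g1 x / (l - x)"
          by (subst gg1) (simp add: divide_simps, (simp add: algebra_simps)?)
      qed
      also have "\<dots> = g a * circle_mean R (\<lambda>x. 1 / ((x - a) ^ Suc j) / (l - x)) +
          circle_mean R (\<lambda>x. 1 / (x - a) ^ j * g1 x / (l - x))"
      proof -
        note c1 = continuous_on_cauchy_kernel[OF l cs[of "Suc j"]]
        note c2 = continuous_on_cauchy_kernel[OF l continuous_on_mult[OF cs[of j] cg1]]
        show ?thesis
          unfolding circle_mean_add[OF R continuous_on_mult_left[OF c1] c2] circle_mean_cmult[OF R c1] ..
      qed
      also have "circle_mean R (\<lambda>x. 1 / ((x - a) ^ Suc j) / (l - x)) = 1 / (l - a) ^ Suc j"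
        using circle_integral_cauchy_power[OF a l, of "Suc j"]
        by (intro circle_mean_has_contour_integral) simp
      finally show "1 / (l - a) ^ Suc j * g l = G l + circle_mean R (\<lambda>x. 1 / (x - a) ^ Suc j * g x / (l - x))"
        using G(2)[rule_format, OF l] la by (subst gg1) (simp add: field_simps)
    qed
  qed
  then show "\<exists>G. G holomorphic_on UNIV \<and> (\<forall>l. cmod l > R \<longrightarrow>
      1 / (l - a) ^ Suc k * g l = G l + circle_mean R (\<lambda>x. 1 / (x - a) ^ Suc k * g x / (l - x)))" .
qed

lemma principal_at_infinity_sum:
  assumes "R > 0" and "finite I" and "\<And>i. i \<in> I \<Longrightarrow> principal_at_infinity R (m i)"
  shows "principal_at_infinity R (\<lambda>x. \<Sum>i\<in>I. m i x)"
  using assms(2,3)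
  by (induction I) (auto intro: principal_at_infinity_zero principal_at_infinity_add[OF assms(1)])

text \<open>Growth of order at most \<open>sqrt \<bar>l\<bar>\<close> on a sequence of expanding contours
  leaves only a constant in the entire part.\<close>

lemma laurent_constant_part:
  assumes R: "R > 0" and m: "principal_at_infinity R m"
    and E: "E holomorphic_on UNIV" and g: "g holomorphic_on UNIV"
    and le: "\<And>n \<rho>. n \<ge> n0 \<Longrightarrow> \<rho> \<in> square n \<Longrightarrow> cmod (E (\<rho>\<^sup>2) + m (\<rho>\<^sup>2) * g (\<rho>\<^sup>2)) \<le> C * cmod \<rho>"
  shows "\<exists>\<kappa>. \<forall>l. cmod l > R \<longrightarrow> E l + m l * g l = \<kappa> + circle_mean R (\<lambda>x. m x * g x / (l - x))"
proof -
  obtain G where G: "G holomorphic_on UNIV"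
    "\<forall>l. cmod l > R \<longrightarrow> m l * g l = G l + circle_mean R (\<lambda>x. m x * g x / (l - x))"
    using m g unfolding principal_at_infinity_def by blast
  define H where "H l = E l + G l" for l
  have H: "H holomorphic_on UNIV" unfolding H_def by (intro holomorphic_intros E G)
  have cmg: "continuous_on (sphere 0 R) (\<lambda>x. m x * g x)" by (rule principal_at_infinity_sphere[OF m g])
  have "bounded ((\<lambda>x. m x * g x) ` sphere 0 R)"
    by (rule compact_imp_bounded[OF compact_continuous_image[OF cmg compact_sphere]])
  then obtain B where "\<forall>x\<in>sphere 0 R. cmod (m x * g x) \<le> B" by (auto simp: bounded_iff)
  then have B: "\<And>x. cmod x = R \<Longrightarrow> cmod (m x * g x) \<le> B" by simp
  have "B \<ge> 0" using B[of "of_real R"] R norm_ge_zero[of "m (of_real R) * g (of_real R)"] by (simp del: norm_ge_zero)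
  \<comment> \<open>From this square on \<open>|\<rho>\<^sup>2| >= R + 1\<close>, so the points lie
    outside the circle and the Cauchy transform is bounded by \<open>B * R\<close>.\<close>
  obtain n1 :: nat where n1: "real n1 \<ge> R + 1" using real_arch_simple by blast
  have Hsq: "H (\<rho>\<^sup>2) = H (0\<^sup>2)" for \<rho>
  proof (rule entire_even_linear_growth_constant[where f = "\<lambda>\<rho>. H (\<rho>\<^sup>2)" and ?n0.0 = "max n0 n1" and C = "C + B * R"])
    have "(\<lambda>\<rho>::complex. \<rho>\<^sup>2) holomorphic_on UNIV" by (intro holomorphic_intros)
    from holomorphic_on_compose_gen[OF this H]
    show "(\<lambda>\<rho>. H (\<rho>\<^sup>2)) holomorphic_on UNIV" by (simp add: o_def)
    fix n and \<rho> :: complex assume n: "max n0 n1 \<le> n" and \<rho>: "\<rho> \<in> square n"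
    have r: "cmod \<rho> \<ge> real n1" "cmod \<rho> \<ge> 1" using square_cmod(1)[OF \<rho>] n n1 R by auto
    have "cmod \<rho> * 1 \<le> cmod \<rho> * cmod \<rho>" by (rule mult_left_mono) (use r in auto)
    then have r2: "cmod (\<rho>\<^sup>2) \<ge> R + 1" using r n1 by (simp add: norm_mult power2_eq_square)
    have "H (\<rho>\<^sup>2) = (E (\<rho>\<^sup>2) + m (\<rho>\<^sup>2) * g (\<rho>\<^sup>2)) - circle_mean R (\<lambda>x. m x * g x / (\<rho>\<^sup>2 - x))"
      using G(2) r2 by (simp add: H_def)
    then have "cmod (H (\<rho>\<^sup>2)) \<le> cmod (E (\<rho>\<^sup>2) + m (\<rho>\<^sup>2) * g (\<rho>\<^sup>2)) + cmod (circle_mean R (\<lambda>x. m x * g x / (\<rho>\<^sup>2 - x)))"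
      using norm_triangle_ineq4 by metis
    also have "\<dots> \<le> C * cmod \<rho> + B * R / (cmod (\<rho>\<^sup>2) - R)"
      by (rule add_mono[OF le[OF _ \<rho>] cauchy_transform_le[OF R cmg B]]) (use n r2 in auto)
    also have "B * R / (cmod (\<rho>\<^sup>2) - R) \<le> B * R / 1"
      by (intro divide_left_mono) (use r2 R \<open>B \<ge> 0\<close> in auto)
    also have "\<dots> \<le> B * R * cmod \<rho>"
      using mult_left_mono[OF r(2), of "B * R"] R \<open>B \<ge> 0\<close> by simp
    finally show "cmod (H (\<rho>\<^sup>2)) \<le> (C + B * R) * cmod \<rho>" by (simp add: algebra_simps)
  qed simp
  \<comment> \<open>Every complex number is a square, so constancy in \<open>\<rho>\<close> gives
    constancy in \<open>l\<close>.\<close>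
  have "H l = H 0" for l
    using Hsq[of "csqrt l"] by simp
  then have "E l + m l * g l = H 0 + circle_mean R (\<lambda>x. m x * g x / (l - x))" if "cmod l > R" for l
    using G(2)[rule_format, OF that] \<open>\<And>l. H l = H 0\<close>[of l] by (simp add: H_def)
  then show ?thesis by blast
qed

section \<open>Quotients of entire functions with equal zeros\<close>

lemma eventually_nonzero_entire:
  assumes f: "f holomorphic_on UNIV" and "f w \<noteq> 0"
  shows "\<forall>\<^sub>F x in at z. f x \<noteq> 0"
proof (cases "f z = 0")
  case True
  obtain r where "r > 0" "\<And>x. x \<in> ball z r - {z} \<Longrightarrow> f x \<noteq> 0"
    using isolated_zeros[OF f open_UNIV connected_UNIV UNIV_I True UNIV_I \<open>f w \<noteq> 0\<close>] by metis
  then show ?thesis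
    unfolding eventually_at by (intro exI[of _ r]) (auto simp: dist_commute)
next
  case False
  have "isCont f z" using f holomorphic_on_imp_continuous_on continuous_on_interior by fastforce
  then show ?thesis using False tendsto_imp_eventually_ne unfolding isCont_def by blast
qed

text \<open>Equal orders of zeros make \<open>f / g\<close> extend to an entire function
  \<open>h\<close>. The maximum principle on the squares, applied to
  \<open>h (\<rho>\<^sup>2) - 1\<close>, forces \<open>h = 1\<close>.\<close>

lemma entire_quotient_eq_1:
  assumes f: "f holomorphic_on UNIV" and g: "g holomorphic_on UNIV"
    and nz: "f w1 \<noteq> 0" "g w2 \<noteq> 0" and ord: "\<And>z. zorder f z = zorder g z"
    and small: "\<And>e. e > 0 \<Longrightarrow> \<exists>n0. \<forall>n\<ge>n0. \<forall>\<rho>\<in>square n. g (\<rho>\<^sup>2) \<noteq> 0 \<and> cmod (f (\<rho>\<^sup>2) / g (\<rho>\<^sup>2) - 1) \<le> e"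
  shows "f z = g z"
proof -
  define h where "h = remove_sings (\<lambda>z. f z / g z)"
  have "f analytic_on UNIV" "g analytic_on UNIV" using f g by (simp_all add: analytic_on_open)
  then have fa: "f analytic_on {z}" and ga: "g analytic_on {z}" for z
    using analytic_on_subset by blast+
  have nzf: "\<forall>\<^sub>F x in at z. f x \<noteq> 0" and nzg: "\<forall>\<^sub>F x in at z. g x \<noteq> 0" for z
    using eventually_nonzero_entire f g nz by blast+
  have h_ana: "h analytic_on {z}" and h_lim: "(\<lambda>z. f z / g z) \<midarrow>z\<rightarrow> h z" for z
  proof -
    have iso: "isolated_singularity_at (\<lambda>z. f z / g z) z"
      using fa[of z] ga[of z] nzg[of z]
      by (intro singularity_intros) (auto intro: not_essential_analytic isolated_singularity_at_analytic)
    have ness: "not_essential (\<lambda>z. f z / g z) z"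
      using fa[of z] ga[of z] nzg[of z]
      by (intro singularity_intros) (auto intro: not_essential_analytic isolated_singularity_at_analytic)
    \<comment> \<open>The quotient has order 0 everywhere, whereas a pole would have negative order;
      the singularities are therefore removable.\<close>
    have "zorder (\<lambda>z. f z / g z) z = zorder f z - zorder g z"
      by (rule zorder_divide)
        (use fa[of z] ga[of z] nzf[of z] nzg[of z] in \<open>auto intro: analytic_on_imp_meromorphic_on eventually_frequently\<close>)
    then have "\<not> is_pole (\<lambda>z. f z / g z) z"
      using isolated_pole_imp_neg_zorder[OF iso] ord[of z] by auto
    then obtain c where c: "(\<lambda>z. f z / g z) \<midarrow>z\<rightarrow> c" using ness unfolding not_essential_def by blast
    show "h analytic_on {z}" unfolding h_def by (rule remove_sings_analytic_at[OF iso c])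
    show "(\<lambda>z. f z / g z) \<midarrow>z\<rightarrow> h z" using c remove_sings_eqI[OF c] by (simp add: h_def)
  qed
  have h: "h holomorphic_on UNIV"
    using h_ana analytic_on_analytic_at analytic_imp_holomorphic by blast
  have heq: "h z = f z / g z" if "g z \<noteq> 0" for z
  proof -
    have "(\<lambda>z. f z / g z) analytic_on {z}" using fa ga that by (intro analytic_intros) auto
    then show ?thesis unfolding h_def by (rule remove_sings_at_analytic)
  qed
  have hsq: "h (\<rho>\<^sup>2) - 1 = 0" for \<rho>
  proof (rule entire_eq_0_squares[where f = "\<lambda>\<rho>. h (\<rho>\<^sup>2) - 1"])
    have "(\<lambda>\<rho>::complex. \<rho>\<^sup>2) holomorphic_on UNIV" by (intro holomorphic_intros)
    from holomorphic_on_compose_gen[OF this h]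
    show "(\<lambda>\<rho>. h (\<rho>\<^sup>2) - 1) holomorphic_on UNIV" by (auto simp: o_def intro!: holomorphic_intros)
    fix e :: real assume "e > 0"
    from small[OF this] obtain n0 where
      n0: "\<forall>n\<ge>n0. \<forall>\<rho>\<in>square n. g (\<rho>\<^sup>2) \<noteq> 0 \<and> cmod (f (\<rho>\<^sup>2) / g (\<rho>\<^sup>2) - 1) \<le> e" by blast
    then show "\<exists>n0. \<forall>n\<ge>n0. \<forall>\<rho>\<in>square n. cmod (h (\<rho>\<^sup>2) - 1) \<le> e"
      using heq by (intro exI[of _ n0]) auto
  qed
  have h1: "h z = 1" for z
    using hsq[of "csqrt z"] by simp
  have "\<forall>\<^sub>F x in at z. f x - g x = 0"
    using nzg[of z] by eventually_elim (use heq h1 in \<open>force simp: field_simps\<close>)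
  moreover have "(\<lambda>x. f x - g x) \<midarrow>z\<rightarrow> f z - g z"
    using fa[of z] ga[of z] by (intro tendsto_diff) (auto dest!: analytic_at_imp_isCont simp: isCont_def)
  ultimately have "f z - g z = 0"
    by (metis tendsto_eventually tendsto_unique trivial_limit_at)
  then show ?thesis by simp
qed

section \<open>Characteristic functions and decay of the Weyl solution\<close>

lemma cmod_poly_le:
  fixes q :: "complex poly"
  assumes "degree q \<le> p"
  shows "\<exists>K\<ge>0. \<forall>z. cmod z \<ge> 1 \<longrightarrow> cmod (poly q z) \<le> K * cmod z ^ p"
proof (intro exI conjI allI impI)
  show "(\<Sum>i\<le>degree q. cmod (coeff q i)) \<ge> 0" by (intro sum_nonneg) auto
  fix z :: complex assume z: "cmod z \<ge> 1"
  have "cmod (poly q z) \<le> (\<Sum>i\<le>degree q. cmod (coeff q i * z ^ i))"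
    unfolding poly_altdef by (rule norm_sum)
  also have "\<dots> \<le> (\<Sum>i\<le>degree q. cmod (coeff q i) * cmod z ^ p)"
    using assms z by (intro sum_mono) (auto simp: norm_mult norm_power intro!: mult_left_mono power_increasing)
  finally show "cmod (poly q z) \<le> (\<Sum>i\<le>degree q. cmod (coeff q i)) * cmod z ^ p"
    by (simp add: sum_distrib_right)
qed

text \<open>Cancelling the leading term gains one power of \<open>z\<close>. The gain is written as
  a factor on the left, so that \<open>p = 0\<close> needs no negative exponent.\<close>

lemma cmod_monic_poly_diff_le:
  fixes q :: "complex poly"
  assumes deg: "degree q = p" and lead: "lead_coeff q = 1"
  shows "\<exists>K\<ge>0. \<forall>z. cmod z \<ge> 1 \<longrightarrow> cmod (poly q z - z ^ p) * cmod z \<le> K * cmod z ^ p"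
proof (cases "p = 0")
  case True
  then obtain c where "q = [:c:]" using deg degree_eq_zeroE by blast
  then have "q = [:1:]" using lead by simp
  then show ?thesis using True by (intro exI[of _ 0]) auto
next
  case False
  define d where "d = q - monom 1 p"
  have "coeff d n = 0" if "n > p - 1" for n
    using that deg lead by (cases "n = p") (auto simp: d_def coeff_eq_0)
  then have "degree d \<le> p - 1" by (intro degree_le) auto
  from cmod_poly_le[OF this] obtain K where K: "K \<ge> 0"
    "\<forall>z. cmod z \<ge> 1 \<longrightarrow> cmod (poly d z) \<le> K * cmod z ^ (p - 1)" by blast
  show ?thesis
  proof (intro exI[of _ K] conjI allI impI K(1))
    fix z :: complex assume "cmod z \<ge> 1"
    then have "cmod (poly d z) * cmod z \<le> K * cmod z ^ (p - 1) * cmod z"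
      using K(2) by (intro mult_right_mono) auto
    also have "\<dots> = K * cmod z ^ p"
      using False by (cases p) (auto simp: mult_ac)
    finally show "cmod (poly q z - z ^ p) * cmod z \<le> K * cmod z ^ p"
      by (simp add: d_def poly_monom)
  qed
qed

lemma cmod_sin_le: "cmod (sin (\<rho> * of_real pi)) \<le> exp (\<bar>Im \<rho>\<bar> * pi)"
proof -
  define w where "w = \<i> * (\<rho> * of_real pi)"
  have e: "cmod (exp w) \<le> exp (\<bar>Im \<rho>\<bar> * pi)" "cmod (exp (- w)) \<le> exp (\<bar>Im \<rho>\<bar> * pi)"
    using mult_right_mono[of "- Im \<rho>" "\<bar>Im \<rho>\<bar>" pi] mult_right_mono[of "Im \<rho>" "\<bar>Im \<rho>\<bar>" pi]
    unfolding norm_exp_eq_Re w_def exp_le_cancel_iff by simp_all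
  have "sin (\<rho> * of_real pi) = (exp w - exp (- w)) / (2 * \<i>)"
    by (simp add: sin_exp_eq w_def)
  then have "cmod (sin (\<rho> * of_real pi)) = cmod (exp w - exp (- w)) / 2"
    by (simp add: norm_divide norm_mult)
  also have "\<dots> \<le> (cmod (exp w) + cmod (exp (- w))) / 2"
    by (intro divide_right_mono norm_triangle_ineq4) auto
  also have "\<dots> \<le> exp (\<bar>Im \<rho>\<bar> * pi)" using e by argo
  finally show ?thesis .
qed

lemma phi_growth:
  assumes \<sigma>: "sq_integrable \<sigma>" and \<rho>: "cmod \<rho> \<ge> 1" and x: "x \<in> {0..pi}"
  shows "cmod (phi \<sigma> x (\<rho>\<^sup>2)) \<le> growth_const \<sigma> * exp (\<bar>Im \<rho>\<bar> * x)"
    "cmod (phi_qd \<sigma> x (\<rho>\<^sup>2)) \<le> growth_const \<sigma> * exp (\<bar>Im \<rho>\<bar> * x) * cmod \<rho>"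
proof -
  have b: "cmod \<rho> * cmod (phi \<sigma> x (\<rho>\<^sup>2)) + cmod (phi_qd \<sigma> x (\<rho>\<^sup>2))
      \<le> growth_const \<sigma> * exp (\<bar>Im \<rho>\<bar> * x) * cmod \<rho>"
    using sl_growth_bound[OF \<sigma> phi_sl_system(1)[OF \<sigma>] \<rho> x] phi_sl_system(2,3)[OF \<sigma>] by simp
  show "cmod (phi_qd \<sigma> x (\<rho>\<^sup>2)) \<le> growth_const \<sigma> * exp (\<bar>Im \<rho>\<bar> * x) * cmod \<rho>"
    using b mult_nonneg_nonneg[OF norm_ge_zero norm_ge_zero, of \<rho> "phi \<sigma> x (\<rho>\<^sup>2)"] by linarith
  have "cmod \<rho> * cmod (phi \<sigma> x (\<rho>\<^sup>2)) \<le> cmod \<rho> * (growth_const \<sigma> * exp (\<bar>Im \<rho>\<bar> * x))"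
    using b norm_ge_zero[of "phi_qd \<sigma> x (\<rho>\<^sup>2)"] by (simp add: mult_ac del: norm_ge_zero)
  then show "cmod (phi \<sigma> x (\<rho>\<^sup>2)) \<le> growth_const \<sigma> * exp (\<bar>Im \<rho>\<bar> * x)"
    using \<rho> by (cases "\<rho> = 0") (auto simp: mult_le_cancel_left)
qed

lemma growth_const_pos: "growth_const \<sigma> > 0"
  by (simp add: growth_const_def)

text \<open>The leading term is the product of \<open>\<rho> ^ (2 * p)\<close> from the monic
  \<open>r1\<close> and \<open>- \<rho> sin (pi \<rho>)\<close> from \<open>phi_qd\<close>. The
  error of the latter is small relative to it; the lower coefficients of \<open>r1\<close> and the
  whole \<open>r2\<close> term are smaller by a factor \<open>1 / |\<rho>|\<close>.\<close>

lemma Delta1_asymptotics: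
  assumes \<sigma>: "sq_integrable \<sigma>" and cl: "class_R p r1 r2" and "e > 0"
  shows "\<exists>n0. \<forall>n\<ge>n0. \<forall>\<rho>\<in>square n.
     cmod (Delta1 \<sigma> r1 r2 (\<rho>\<^sup>2) + \<rho> ^ (2 * p + 1) * sin (\<rho> * of_real pi))
       \<le> e * (cmod \<rho> ^ (2 * p + 1) * exp (\<bar>Im \<rho>\<bar> * pi))"
proof -
  define G where "G = growth_const \<sigma>"
  have G: "G > 0" by (simp add: G_def growth_const_pos)
  obtain K1 where K1: "K1 \<ge> 0" "\<forall>z. cmod z \<ge> 1 \<longrightarrow> cmod (poly r1 z) \<le> K1 * cmod z ^ p"
    using cmod_poly_le[of r1 p] cl by (auto simp: class_R_def)
  obtain K2 where K2: "K2 \<ge> 0" "\<forall>z. cmod z \<ge> 1 \<longrightarrow> cmod (poly r2 z) \<le> K2 * cmod z ^ p"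
    using cmod_poly_le[of r2 p] cl by (auto simp: class_R_def)
  obtain K3 where K3: "K3 \<ge> 0" "\<forall>z. cmod z \<ge> 1 \<longrightarrow> cmod (poly r1 z - z ^ p) * cmod z \<le> K3 * cmod z ^ p"
    using cmod_monic_poly_diff_le[of r1 p] cl by (auto simp: class_R_def)
  \<comment> \<open>Half of \<open>e\<close> is reserved for the error of \<open>phi_qd\<close>,
    which gets multiplied by the bound \<open>K1\<close> of \<open>r1\<close>; the other half covers
    the two terms that lack a factor \<open>\<rho>\<close>.\<close>
  define e1 where "e1 = e / (2 * (K1 + 1))"
  have e1: "e1 > 0" "K1 * e1 \<le> e / 2" using \<open>e > 0\<close> K1(1) by (auto simp: e1_def divide_simps)
  obtain R where R: "\<forall>\<rho> x. cmod \<rho> \<ge> R \<longrightarrow> x \<in> {0..pi} \<longrightarrow>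
      cmod (phi_qd \<sigma> x (\<rho>\<^sup>2) + \<rho> * sin (\<rho> * of_real x)) \<le> e1 * cmod \<rho> * exp (\<bar>Im \<rho>\<bar> * x)"
    using phi_qd_asymptotics[OF \<sigma> e1(1)] by blast
  obtain n0 :: nat where n0: "real n0 \<ge> max R (max 1 (2 * (K3 + K2 * G) / e))"
    using real_arch_simple by blast
  have "cmod (Delta1 \<sigma> r1 r2 (\<rho>\<^sup>2) + \<rho> ^ (2 * p + 1) * sin (\<rho> * of_real pi))
       \<le> e * (cmod \<rho> ^ (2 * p + 1) * exp (\<bar>Im \<rho>\<bar> * pi))" if n: "n \<ge> n0" and \<rho>: "\<rho> \<in> square n" for n \<rho>
  proof -
    have r: "cmod \<rho> \<ge> R" "cmod \<rho> \<ge> 1" "cmod \<rho> \<ge> 2 * (K3 + K2 * G) / e"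
      using square_cmod(1)[OF \<rho>] n n0 by auto
    define T where "T = exp (\<bar>Im \<rho>\<bar> * pi)"
    have T: "T > 0" by (simp add: T_def)
    define c where "c = cmod \<rho>"
    have c: "c \<ge> 1" using r by (simp add: c_def)
    have z1: "cmod (\<rho>\<^sup>2) \<ge> 1" using r(2) by (simp add: norm_power)
    have zp: "cmod (\<rho>\<^sup>2) ^ p = c ^ (2 * p)" by (simp add: c_def norm_power power_mult)
    have a1: "cmod (poly r1 (\<rho>\<^sup>2) * (phi_qd \<sigma> pi (\<rho>\<^sup>2) + \<rho> * sin (\<rho> * of_real pi))) \<le> K1 * c ^ (2 * p) * (e1 * c * T)"
      unfolding norm_mult using K1 z1 R[rule_format, OF r(1), of pi] zp
      by (intro mult_mono) (auto simp: c_def T_def)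
    have a2: "cmod ((\<rho> ^ (2 * p) - poly r1 (\<rho>\<^sup>2)) * (\<rho> * sin (\<rho> * of_real pi))) \<le> K3 * c ^ (2 * p) * T"
    proof -
      have "cmod (poly r1 (\<rho>\<^sup>2) - (\<rho>\<^sup>2) ^ p) * c \<le> cmod (poly r1 (\<rho>\<^sup>2) - (\<rho>\<^sup>2) ^ p) * cmod (\<rho>\<^sup>2)"
      proof (rule mult_left_mono)
        show "c \<le> cmod (\<rho>\<^sup>2)"
          using mult_left_mono[OF c, of c] c by (simp add: c_def norm_power power2_eq_square norm_mult)
      qed auto
      also have "\<dots> \<le> K3 * c ^ (2 * p)" using K3(2) z1 zp by auto
      finally have "cmod (\<rho> ^ (2 * p) - poly r1 (\<rho>\<^sup>2)) * c \<le> K3 * c ^ (2 * p)"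
        by (simp add: norm_minus_commute power_mult)
      then have "cmod (\<rho> ^ (2 * p) - poly r1 (\<rho>\<^sup>2)) * c * cmod (sin (\<rho> * of_real pi)) \<le> K3 * c ^ (2 * p) * T"
        by (rule mult_mono) (use cmod_sin_le[of \<rho>] K3(1) c in \<open>auto simp: T_def\<close>)
      then show ?thesis by (simp add: norm_mult c_def mult_ac)
    qed
    have a3: "cmod (poly r2 (\<rho>\<^sup>2) * phi \<sigma> pi (\<rho>\<^sup>2)) \<le> K2 * c ^ (2 * p) * (G * T)"
      unfolding norm_mult using K2 z1 zp phi_growth(1)[OF \<sigma> r(2), of pi]
      by (intro mult_mono) (auto simp: G_def T_def)
    have "Delta1 \<sigma> r1 r2 (\<rho>\<^sup>2) + \<rho> ^ (2 * p + 1) * sin (\<rho> * of_real pi) =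
        poly r1 (\<rho>\<^sup>2) * (phi_qd \<sigma> pi (\<rho>\<^sup>2) + \<rho> * sin (\<rho> * of_real pi)) +
        (\<rho> ^ (2 * p) - poly r1 (\<rho>\<^sup>2)) * (\<rho> * sin (\<rho> * of_real pi)) + poly r2 (\<rho>\<^sup>2) * phi \<sigma> pi (\<rho>\<^sup>2)"
      by (simp add: Delta1_def algebra_simps)
    then have "cmod (Delta1 \<sigma> r1 r2 (\<rho>\<^sup>2) + \<rho> ^ (2 * p + 1) * sin (\<rho> * of_real pi)) \<le>
        K1 * c ^ (2 * p) * (e1 * c * T) + K3 * c ^ (2 * p) * T + K2 * c ^ (2 * p) * (G * T)"
      using norm_triangle_mono[OF norm_triangle_mono[OF a1 a2] a3] by (simp only:)
    also have "\<dots> = c ^ (2 * p) * T * (K1 * e1 * c + (K3 + K2 * G))" by (simp add: algebra_simps)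
    also have "\<dots> \<le> c ^ (2 * p) * T * (e / 2 * c + e / 2 * c)"
    proof (intro mult_left_mono add_mono mult_right_mono e1(2))
      have "2 * (K3 + K2 * G) \<le> c * e" using r(3) \<open>e > 0\<close> by (simp add: c_def divide_simps)
      then show "K3 + K2 * G \<le> e / 2 * c" by (simp add: mult.commute)
    qed (use c T in auto)
    also have "\<dots> = e * (cmod \<rho> ^ (2 * p + 1) * exp (\<bar>Im \<rho>\<bar> * pi))"
      by (simp add: c_def T_def algebra_simps)
    finally show ?thesis .
  qed
  then show ?thesis by blast
qed

lemma Delta1_square_ge:
  assumes \<sigma>: "sq_integrable \<sigma>" and cl: "class_R p r1 r2"
  shows "\<exists>n0. \<forall>n\<ge>n0. \<forall>\<rho>\<in>square n.
     cmod (Delta1 \<sigma> r1 r2 (\<rho>\<^sup>2)) \<ge> cmod \<rho> ^ (2 * p + 1) * exp (\<bar>Im \<rho>\<bar> * pi) / 8"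
proof -
  obtain n0 where n0: "\<forall>n\<ge>n0. \<forall>\<rho>\<in>square n.
     cmod (Delta1 \<sigma> r1 r2 (\<rho>\<^sup>2) + \<rho> ^ (2 * p + 1) * sin (\<rho> * of_real pi))
       \<le> 1 / 8 * (cmod \<rho> ^ (2 * p + 1) * exp (\<bar>Im \<rho>\<bar> * pi))"
    using Delta1_asymptotics[OF \<sigma> cl, of "1 / 8"] by auto
  have "cmod (Delta1 \<sigma> r1 r2 (\<rho>\<^sup>2)) \<ge> cmod \<rho> ^ (2 * p + 1) * exp (\<bar>Im \<rho>\<bar> * pi) / 8"
    if "n \<ge> n0" and \<rho>: "\<rho> \<in> square n" for n \<rho>
  proof -
    define X where "X = cmod \<rho> ^ (2 * p + 1) * exp (\<bar>Im \<rho>\<bar> * pi)"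
    have "cmod \<rho> ^ (2 * p + 1) * (exp (\<bar>Im \<rho>\<bar> * pi) / 4) \<le> cmod \<rho> ^ (2 * p + 1) * cmod (sin (\<rho> * of_real pi))"
      by (intro mult_left_mono cmod_sin_ge_on_square[OF \<rho>]) auto
    then have "X / 4 \<le> cmod (\<rho> ^ (2 * p + 1) * sin (\<rho> * of_real pi))"
      by (simp add: X_def norm_mult norm_power)
    moreover have "cmod (Delta1 \<sigma> r1 r2 (\<rho>\<^sup>2) + \<rho> ^ (2 * p + 1) * sin (\<rho> * of_real pi)) \<le> 1 / 8 * X"
      using n0 that by (simp only: X_def)
    moreover have "cmod (\<rho> ^ (2 * p + 1) * sin (\<rho> * of_real pi)) \<le>
        cmod (Delta1 \<sigma> r1 r2 (\<rho>\<^sup>2) + \<rho> ^ (2 * p + 1) * sin (\<rho> * of_real pi)) + cmod (Delta1 \<sigma> r1 r2 (\<rho>\<^sup>2))"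
      using norm_triangle_ineq4[of "Delta1 \<sigma> r1 r2 (\<rho>\<^sup>2) + \<rho> ^ (2 * p + 1) * sin (\<rho> * of_real pi)" "Delta1 \<sigma> r1 r2 (\<rho>\<^sup>2)"]
      by simp
    ultimately show ?thesis unfolding X_def[symmetric] by linarith
  qed
  then show ?thesis by blast
qed

lemma half_integer_in_square: "of_real (real n + 1 / 2) \<in> square n"
  by (simp add: square_def)

lemma Delta1_holomorphic:
  assumes "sq_integrable \<sigma>"
  shows "Delta1 \<sigma> r1 r2 holomorphic_on A" "Delta0 \<sigma> r1 r2 holomorphic_on A"
proof -
  have "(\<lambda>\<mu>. poly r1 \<mu> * phi_qd \<sigma> pi \<mu> + poly r2 \<mu> * phi \<sigma> pi \<mu>) holomorphic_on A"
    "(\<lambda>\<mu>. poly r1 \<mu> * S_qd \<sigma> pi \<mu> + poly r2 \<mu> * S \<sigma> pi \<mu>) holomorphic_on A"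
    using holomorphic_phi_S[OF assms, of pi A] by (auto intro!: holomorphic_intros)
  then show "Delta1 \<sigma> r1 r2 holomorphic_on A" "Delta0 \<sigma> r1 r2 holomorphic_on A"
    by (simp_all add: Delta1_def[abs_def] Delta0_def[abs_def])
qed

lemma Delta1_not_zero:
  assumes "sq_integrable \<sigma>" and "class_R p r1 r2"
  shows "\<exists>w. Delta1 \<sigma> r1 r2 w \<noteq> 0"
proof -
  obtain n where "\<forall>\<rho>\<in>square n. cmod (Delta1 \<sigma> r1 r2 (\<rho>\<^sup>2)) \<ge> cmod \<rho> ^ (2 * p + 1) * exp (\<bar>Im \<rho>\<bar> * pi) / 8"
    using Delta1_square_ge[OF assms] by blast
  note * = this[rule_format, OF half_integer_in_square]
  define \<rho> where "\<rho> = complex_of_real (real n + 1 / 2)"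
  have "cmod \<rho> > 0" unfolding \<rho>_def norm_of_real by simp
  then have "cmod \<rho> ^ (2 * p + 1) * exp (\<bar>Im \<rho>\<bar> * pi) / 8 > 0" by simp
  then have "cmod (Delta1 \<sigma> r1 r2 (\<rho>\<^sup>2)) > 0" using * unfolding \<rho>_def[symmetric] by linarith
  then show ?thesis by auto
qed

text \<open>Reflection changes the sign of \<open>y'\<close>, so the quasi-derivative becomes
  \<open>- z\<close>, and this is consistent only if \<open>\<sigma>\<close> changes its sign as
  well.\<close>

lemma sl_system_reflect:
  assumes "sl_system \<sigma> \<mu> y z"
  shows "sl_system (\<lambda>x. - \<sigma> (pi - x)) \<mu> (\<lambda>x. y (pi - x)) (\<lambda>x. - z (pi - x))"
  unfolding sl_system_def
proof
  note p = assms[unfolded sl_system_def]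
  show "primitive_on 0 pi (\<lambda>x. y (pi - x)) (\<lambda>x. - z (pi - x) + - \<sigma> (pi - x) * y (pi - x))"
    by (rule primitive_on_cong[OF primitive_on_reflect[OF conjunct1[OF p]]]) (simp_all add: algebra_simps)
  show "primitive_on 0 pi (\<lambda>x. - z (pi - x))
      (\<lambda>x. - (- \<sigma> (pi - x)) * (- z (pi - x)) - ((- \<sigma> (pi - x))\<^sup>2 + \<mu>) * y (pi - x))"
    by (rule primitive_on_cong[OF primitive_on_cmult[OF primitive_on_reflect[OF conjunct2[OF p]], of "- 1"]])
      (simp_all add: algebra_simps)
qed

lemma sq_integrable_reflect:
  assumes "sq_integrable \<sigma>"
  shows "sq_integrable (\<lambda>x. - \<sigma> (pi - x))"
proof -
  have "(\<lambda>x. - f (pi - x)) absolutely_integrable_on {0..pi}" if "f absolutely_integrable_on {0..pi}"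
    for f :: "real \<Rightarrow> complex"
  proof -
    have "primitive_on 0 pi (\<lambda>x. integral {0..x} f) f" using that by (simp add: primitive_on_def)
    from primitive_on_reflect[OF this] show ?thesis unfolding primitive_on_def by blast
  qed
  from this[of \<sigma>] this[of "\<lambda>x. - (\<sigma> x)\<^sup>2"] show ?thesis
    using assms absolutely_integrable_continuous_mult[OF continuous_on_const, of 0 pi "\<lambda>x. (\<sigma> x)\<^sup>2" "- 1"]
    by (auto simp: sq_integrable_def)
qed

text \<open>The Weyl solution satisfies the boundary condition at \<open>\<pi>\<close>; solving from that endpoint shows
  that it decays like \<open>exp (- \<bar>Im \<rho>\<bar> x)\<close>.\<close>

lemma weyl_solution_decay:
  assumes \<sigma>: "sq_integrable \<sigma>" and cl: "class_R p r1 r2"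
  shows "\<exists>C n0. C \<ge> 0 \<and> (\<forall>n\<ge>n0. \<forall>\<rho>\<in>square n. \<forall>x\<in>{0..pi}. Delta1 \<sigma> r1 r2 (\<rho>\<^sup>2) \<noteq> 0 \<and>
     cmod \<rho> * cmod (S \<sigma> x (\<rho>\<^sup>2) + weyl_M \<sigma> r1 r2 (\<rho>\<^sup>2) * phi \<sigma> x (\<rho>\<^sup>2)) +
       cmod (S_qd \<sigma> x (\<rho>\<^sup>2) + weyl_M \<sigma> r1 r2 (\<rho>\<^sup>2) * phi_qd \<sigma> x (\<rho>\<^sup>2)) \<le> C * exp (- \<bar>Im \<rho>\<bar> * x))"
proof -
  define \<sigma>' where "\<sigma>' = (\<lambda>x. - \<sigma> (pi - x))"
  have \<sigma>': "sq_integrable \<sigma>'" unfolding \<sigma>'_def by (rule sq_integrable_reflect[OF \<sigma>])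
  define G where "G = growth_const \<sigma>'"
  have G: "G > 0" by (simp add: G_def growth_const_pos)
  obtain K1 where K1: "K1 \<ge> 0" "\<forall>z. cmod z \<ge> 1 \<longrightarrow> cmod (poly r1 z) \<le> K1 * cmod z ^ p"
    using cmod_poly_le[of r1 p] cl by (auto simp: class_R_def)
  obtain K2 where K2: "K2 \<ge> 0" "\<forall>z. cmod z \<ge> 1 \<longrightarrow> cmod (poly r2 z) \<le> K2 * cmod z ^ p"
    using cmod_poly_le[of r2 p] cl by (auto simp: class_R_def)
  obtain n0 where n0: "\<forall>n\<ge>n0. \<forall>\<rho>\<in>square n.
     cmod (Delta1 \<sigma> r1 r2 (\<rho>\<^sup>2)) \<ge> cmod \<rho> ^ (2 * p + 1) * exp (\<bar>Im \<rho>\<bar> * pi) / 8"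
    using Delta1_square_ge[OF \<sigma> cl] by blast
  have main: "Delta1 \<sigma> r1 r2 (\<rho>\<^sup>2) \<noteq> 0 \<and>
     cmod \<rho> * cmod (S \<sigma> x (\<rho>\<^sup>2) + weyl_M \<sigma> r1 r2 (\<rho>\<^sup>2) * phi \<sigma> x (\<rho>\<^sup>2)) +
       cmod (S_qd \<sigma> x (\<rho>\<^sup>2) + weyl_M \<sigma> r1 r2 (\<rho>\<^sup>2) * phi_qd \<sigma> x (\<rho>\<^sup>2)) \<le> (G * 8 * (K1 + K2)) * exp (- \<bar>Im \<rho>\<bar> * x)"
    if n: "n \<ge> max 1 n0" and \<rho>: "\<rho> \<in> square n" and x: "x \<in> {0..pi}" for n \<rho> x
  proof
    have r: "cmod \<rho> \<ge> 1" using square_cmod(1)[OF \<rho>] n by auto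
    define c where "c = cmod \<rho>"
    define T where "T = exp (\<bar>Im \<rho>\<bar> * pi)"
    have cT: "c \<ge> 1" "T > 0" using r by (auto simp: c_def T_def)
    define D where "D = Delta1 \<sigma> r1 r2 (\<rho>\<^sup>2)"
    have D: "cmod D \<ge> c ^ (2 * p + 1) * T / 8" using n0 n \<rho> by (auto simp: D_def c_def T_def)
    have "c ^ (2 * p + 1) * T / 8 > 0" using cT by auto
    then have D0: "D \<noteq> 0" using D by auto
    then show "Delta1 \<sigma> r1 r2 (\<rho>\<^sup>2) \<noteq> 0" by (simp add: D_def)
    define u where "u x = S \<sigma> x (\<rho>\<^sup>2) + weyl_M \<sigma> r1 r2 (\<rho>\<^sup>2) * phi \<sigma> x (\<rho>\<^sup>2)" for x
    define v where "v x = S_qd \<sigma> x (\<rho>\<^sup>2) + weyl_M \<sigma> r1 r2 (\<rho>\<^sup>2) * phi_qd \<sigma> x (\<rho>\<^sup>2)" for x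
    have sys: "sl_system \<sigma> (\<rho>\<^sup>2) u v"
      unfolding u_def v_def by (intro sl_system_add sl_system_cmult phi_sl_system S_sl_system \<sigma>)
    have w: "phi \<sigma> pi (\<rho>\<^sup>2) * S_qd \<sigma> pi (\<rho>\<^sup>2) - phi_qd \<sigma> pi (\<rho>\<^sup>2) * S \<sigma> pi (\<rho>\<^sup>2) = 1"
      using wronskian_constant[where x = pi, OF phi_sl_system(1)[OF \<sigma>, of "\<rho>\<^sup>2"] S_sl_system(1)[OF \<sigma>]]
        phi_sl_system(2,3)[OF \<sigma>] S_sl_system(2,3)[OF \<sigma>] by simp
    \<comment> \<open>By the Wronskian identity the values of the Weyl solution and its
      quasi-derivative at \<open>pi\<close> are \<open>- r1 / Delta1\<close> and
      \<open>r2 / Delta1\<close>. They are small because \<open>Delta1\<close> has the additional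
      factor \<open>|\<rho>| * exp (pi |Im \<rho>|)\<close>.\<close>
    have upi: "u pi * D = - poly r1 (\<rho>\<^sup>2)" "v pi * D = poly r2 (\<rho>\<^sup>2)"
    proof -
      have M: "weyl_M \<sigma> r1 r2 (\<rho>\<^sup>2) * D = - Delta0 \<sigma> r1 r2 (\<rho>\<^sup>2)" using D0 by (simp add: weyl_M_def D_def)
      have "u pi * D = S \<sigma> pi (\<rho>\<^sup>2) * D + (weyl_M \<sigma> r1 r2 (\<rho>\<^sup>2) * D) * phi \<sigma> pi (\<rho>\<^sup>2)"
        by (simp add: u_def algebra_simps)
      also have "\<dots> = - poly r1 (\<rho>\<^sup>2) * (phi \<sigma> pi (\<rho>\<^sup>2) * S_qd \<sigma> pi (\<rho>\<^sup>2) - phi_qd \<sigma> pi (\<rho>\<^sup>2) * S \<sigma> pi (\<rho>\<^sup>2))"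
        unfolding M by (simp add: D_def Delta1_def Delta0_def algebra_simps)
      finally show "u pi * D = - poly r1 (\<rho>\<^sup>2)" unfolding w by simp
      have "v pi * D = S_qd \<sigma> pi (\<rho>\<^sup>2) * D + (weyl_M \<sigma> r1 r2 (\<rho>\<^sup>2) * D) * phi_qd \<sigma> pi (\<rho>\<^sup>2)"
        by (simp add: v_def algebra_simps)
      also have "\<dots> = poly r2 (\<rho>\<^sup>2) * (phi \<sigma> pi (\<rho>\<^sup>2) * S_qd \<sigma> pi (\<rho>\<^sup>2) - phi_qd \<sigma> pi (\<rho>\<^sup>2) * S \<sigma> pi (\<rho>\<^sup>2))"
        unfolding M by (simp add: D_def Delta1_def Delta0_def algebra_simps)
      finally show "v pi * D = poly r2 (\<rho>\<^sup>2)" unfolding w by simp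
    qed
    have z1: "cmod (\<rho>\<^sup>2) \<ge> 1" using r by (simp add: norm_power)
    have zp: "cmod (\<rho>\<^sup>2) ^ p = c ^ (2 * p)" by (simp add: c_def norm_power power_mult)
    have "(c * cmod (u pi) + cmod (v pi)) * cmod D = c * cmod (u pi * D) + cmod (v pi * D)"
      by (simp add: norm_mult algebra_simps)
    also have "\<dots> \<le> c * (K1 * c ^ (2 * p)) + K2 * c ^ (2 * p)"
      unfolding upi using K1(2) K2(2) z1 zp cT by (intro add_mono mult_left_mono) auto
    also have "\<dots> \<le> (K1 + K2) * c ^ (2 * p + 1)"
      using mult_right_mono[OF cT(1), of "K2 * c ^ (2 * p)"] K2(1) cT by (simp add: algebra_simps)
    finally have i1: "(c * cmod (u pi) + cmod (v pi)) * cmod D \<le> (K1 + K2) * c ^ (2 * p + 1)" .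
    \<comment> \<open>Dividing by the power \<open>X\<close> leaves \<open>W * T\<close> bounded: at
      \<open>pi\<close> the solution has the size \<open>1 / T\<close>, and growth from
      \<open>pi\<close> back to \<open>x\<close> turns this into
      \<open>exp (- |Im \<rho>| * x)\<close>.\<close>
    define W where "W = c * cmod (u pi) + cmod (v pi)"
    define X where "X = c ^ (2 * p + 1)"
    have WX: "W \<ge> 0" "X > 0" using cT by (auto simp: W_def X_def)
    have "W * (X * T / 8) \<le> W * cmod D"
      using D WX by (intro mult_left_mono) (auto simp: X_def)
    also have "\<dots> \<le> (K1 + K2) * X" using i1 by (simp only: W_def X_def)
    finally have "W * T * X \<le> (8 * (K1 + K2)) * X" by (simp add: mult_ac)
    then have i2: "(c * cmod (u pi) + cmod (v pi)) * T \<le> 8 * (K1 + K2)"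
      using WX unfolding W_def[symmetric] by (subst (asm) mult_le_cancel_right) auto
    have "pi - x \<in> {0..pi}" using x by auto
    from sl_growth_bound[OF \<sigma>' sl_system_reflect[OF sys, folded \<sigma>'_def] r this]
    have "c * cmod (u x) + cmod (v x) \<le> G * exp (\<bar>Im \<rho>\<bar> * (pi - x)) * (c * cmod (u pi) + cmod (v pi))"
      by (simp add: c_def G_def)
    also have "exp (\<bar>Im \<rho>\<bar> * (pi - x)) = T * exp (- \<bar>Im \<rho>\<bar> * x)"
      by (simp add: T_def exp_add[symmetric] algebra_simps)
    also have "G * (T * exp (- \<bar>Im \<rho>\<bar> * x)) * (c * cmod (u pi) + cmod (v pi)) =
        G * exp (- \<bar>Im \<rho>\<bar> * x) * ((c * cmod (u pi) + cmod (v pi)) * T)" by (simp add: mult_ac)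
    also have "\<dots> \<le> G * exp (- \<bar>Im \<rho>\<bar> * x) * (8 * (K1 + K2))"
      using i2 G by (intro mult_left_mono) auto
    finally show "cmod \<rho> * cmod (S \<sigma> x (\<rho>\<^sup>2) + weyl_M \<sigma> r1 r2 (\<rho>\<^sup>2) * phi \<sigma> x (\<rho>\<^sup>2)) +
       cmod (S_qd \<sigma> x (\<rho>\<^sup>2) + weyl_M \<sigma> r1 r2 (\<rho>\<^sup>2) * phi_qd \<sigma> x (\<rho>\<^sup>2)) \<le> (G * 8 * (K1 + K2)) * exp (- \<bar>Im \<rho>\<bar> * x)"
      by (simp add: u_def v_def c_def mult_ac)
  qed
  have "G * 8 * (K1 + K2) \<ge> 0" using G K1(1) K2(1) by auto
  then show ?thesis using main by blast
qed

section \<open>The transfer matrix\<close>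

text \<open>Dominated convergence for integrated differential equations: only pointwise limits and
  one integrable bound are required. It carries the equation of \<open>P\<close> to \<open>l\<close>
  at infinity.\<close>

lemma primitive_on_limit:
  assumes p: "\<And>n. primitive_on a b (F n) (f n)" and h: "h integrable_on {a..b}"
    and le: "\<And>n t. t \<in> {a..b} \<Longrightarrow> cmod (f n t) \<le> h t"
    and f: "\<And>t. t \<in> {a..b} \<Longrightarrow> (\<lambda>n. f n t) \<longlonglongrightarrow> g t"
    and F: "\<And>t. t \<in> {a..b} \<Longrightarrow> (\<lambda>n. F n t) \<longlonglongrightarrow> G t"
  shows "primitive_on a b G g"
  unfolding primitive_on_def
proof (intro conjI ballI)
  show "g absolutely_integrable_on {a..b}"
  proof (rule dominated_convergence_absolutely_integrable[OF _ h _ f])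
    show "f n absolutely_integrable_on {a..b}" for n using p[of n] unfolding primitive_on_def by blast
    show "cmod (g t) \<le> h t" if "t \<in> {a..b}" for t
      by (rule Lim_norm_ubound[OF _ f[OF that]]) (use le[OF that] in auto)
  qed
  fix x assume x: "x \<in> {a..b}"
  then have ab: "a \<in> {a..b}" and sub: "{a..x} \<subseteq> {a..b}" by auto
  have "(\<lambda>n. integral {a..x} (f n)) \<longlonglongrightarrow> integral {a..x} g"
  proof (rule dominated_convergence(2))
    show "f n integrable_on {a..x}" for n by (rule primitive_on_integrand(1)[OF p x])
    show "h integrable_on {a..x}" by (rule integrable_on_subinterval[OF h sub])
  qed (use le f sub in blast)+
  from tendsto_add[OF F[OF ab] this]
  have "(\<lambda>n. F n x) \<longlonglongrightarrow> G a + integral {a..x} g"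
    using primitive_onD[OF p x] by simp
  then show "G x = G a + integral {a..x} g"
    using F[OF x] LIMSEQ_unique by blast
qed

lemma sl_product_primitives:
  assumes u: "sl_system \<sigma> l u u1" and v: "sl_system \<sigma>' l v v1"
  shows "primitive_on 0 pi (\<lambda>x. u x * v x) (\<lambda>x. u x * (v1 x + \<sigma>' x * v x) + (u1 x + \<sigma> x * u x) * v x)"
    "primitive_on 0 pi (\<lambda>x. u x * v1 x)
      (\<lambda>x. u x * (- \<sigma>' x * v1 x - ((\<sigma>' x)\<^sup>2 + l) * v x) + (u1 x + \<sigma> x * u x) * v1 x)"
    "primitive_on 0 pi (\<lambda>x. u1 x * v1 x) (\<lambda>x. u1 x * (- \<sigma>' x * v1 x - ((\<sigma>' x)\<^sup>2 + l) * v x) +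
      (- \<sigma> x * u1 x - ((\<sigma> x)\<^sup>2 + l) * u x) * v1 x)"
proof -
  note u = u[unfolded sl_system_def] and v = v[unfolded sl_system_def]
  show "primitive_on 0 pi (\<lambda>x. u x * v x) (\<lambda>x. u x * (v1 x + \<sigma>' x * v x) + (u1 x + \<sigma> x * u x) * v x)"
    by (rule primitive_on_mult[OF conjunct1[OF u] conjunct1[OF v]])
  show "primitive_on 0 pi (\<lambda>x. u x * v1 x)
      (\<lambda>x. u x * (- \<sigma>' x * v1 x - ((\<sigma>' x)\<^sup>2 + l) * v x) + (u1 x + \<sigma> x * u x) * v1 x)"
    by (rule primitive_on_mult[OF conjunct1[OF u] conjunct2[OF v]])
  show "primitive_on 0 pi (\<lambda>x. u1 x * v1 x) (\<lambda>x. u1 x * (- \<sigma>' x * v1 x - ((\<sigma>' x)\<^sup>2 + l) * v x) +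
      (- \<sigma> x * u1 x - ((\<sigma> x)\<^sup>2 + l) * u x) * v1 x)"
    by (rule primitive_on_mult[OF conjunct2[OF u] conjunct2[OF v]])
qed

lemma continuous_AE_zero_imp_zero:
  fixes f :: "real \<Rightarrow> complex"
  assumes "a < b" and f: "continuous_on {a..b} f" and N: "negligible N" "\<forall>x\<in>{a..b} - N. f x = 0"
    and x: "x \<in> {a..b}"
  shows "f x = 0"
proof -
  have "((\<lambda>x. 0) has_integral 0) (cbox a b)" by simp
  then have "((\<lambda>x. cmod (f x)) has_integral 0) (cbox a b)"
    by (rule has_integral_spike[OF N(1), rotated]) (use N(2) in auto)
  moreover have "continuous_on (cbox a b) (\<lambda>x. cmod (f x))" using f by (auto intro: continuous_intros)
  ultimately have "cmod (f x) = 0"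
    by (intro has_integral_0_cbox_imp_0[of a b "\<lambda>x. cmod (f x)"]) (use x \<open>a < b\<close> in auto)
  then show ?thesis by simp
qed

text \<open>The comparison of two problems, separated from the spectral data: \<open>m\<close>
  stands for \<open>M_hat\<close>, and of its origin only the Laurent behaviour outside the circle
  and the relation to the Weyl functions enter.\<close>

locale two_problems =
  fixes \<sigma> \<sigma>t :: "real \<Rightarrow> complex" and r1 r2 r1t r2t :: "complex poly" and p :: nat
    and R :: real and m :: "complex \<Rightarrow> complex"
  assumes sq: "sq_integrable \<sigma>" and sqt: "sq_integrable \<sigma>t"
    and cl: "class_R p r1 r2" and clt: "class_R p r1t r2t"
    and R: "R > 0" and m: "principal_at_infinity R m"
    and weyl: "\<And>\<mu>. Delta1 \<sigma> r1 r2 \<mu> \<noteq> 0 \<Longrightarrow> Delta1 \<sigma>t r1t r2t \<mu> \<noteq> 0 \<Longrightarrow>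
       weyl_M \<sigma> r1 r2 \<mu> - weyl_M \<sigma>t r1t r2t \<mu> = m \<mu>"
begin

text \<open>The entries of \<open>P = Y [[1, m], [0, 1]] inverse(Yt)\<close>, where the rows of \<open>Y\<close> are \<open>(phi, S)\<close> and
  \<open>(phi_qd, S_qd)\<close>. As \<open>m\<close> is the difference of the Weyl functions, \<open>S\<close> may be replaced by the
  Weyl solution \<open>S + M phi\<close> in both \<open>Y\<close> and \<open>Yt\<close>, with the identity in place of \<open>[[1, m], [0, 1]]\<close>.\<close>

definition P11 where
  "P11 x l = phi \<sigma> x l * (S_qd \<sigma>t x l - m l * phi_qd \<sigma>t x l) - S \<sigma> x l * phi_qd \<sigma>t x l"

definition P12 where
  "P12 x l = S \<sigma> x l * phi \<sigma>t x l - phi \<sigma> x l * (S \<sigma>t x l - m l * phi \<sigma>t x l)"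

definition P21 where
  "P21 x l = phi_qd \<sigma> x l * (S_qd \<sigma>t x l - m l * phi_qd \<sigma>t x l) - S_qd \<sigma> x l * phi_qd \<sigma>t x l"

definition P22 where
  "P22 x l = S_qd \<sigma> x l * phi \<sigma>t x l - phi_qd \<sigma> x l * (S \<sigma>t x l - m l * phi \<sigma>t x l)"

text \<open>Both fundamental matrices have Wronskian 1 and the triangular factor has determinant
  1.\<close>

lemma P_det:
  assumes x: "x \<in> {0..pi}"
  shows "P11 x l * P22 x l - P12 x l * P21 x l = 1"
proof -
  have 1: "phi \<sigma> x l * S_qd \<sigma> x l - phi_qd \<sigma> x l * S \<sigma> x l = 1"
    using wronskian_constant[OF phi_sl_system(1)[OF sq] S_sl_system(1)[OF sq] x, of l]
    by (simp add: phi_sl_system[OF sq] S_sl_system[OF sq])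
  have 2: "phi \<sigma>t x l * S_qd \<sigma>t x l - phi_qd \<sigma>t x l * S \<sigma>t x l = 1"
    using wronskian_constant[OF phi_sl_system(1)[OF sqt] S_sl_system(1)[OF sqt] x, of l]
    by (simp add: phi_sl_system[OF sqt] S_sl_system[OF sqt])
  have "P11 x l * P22 x l - P12 x l * P21 x l =
      (phi \<sigma> x l * S_qd \<sigma> x l - phi_qd \<sigma> x l * S \<sigma> x l) * (phi \<sigma>t x l * S_qd \<sigma>t x l - phi_qd \<sigma>t x l * S \<sigma>t x l)"
    unfolding P11_def P12_def P21_def P22_def by algebra
  then show ?thesis using 1 2 by simp
qed

text \<open>Entries of the matrix equation \<open>P' = A P - P At\<close>, where \<open>A\<close>
  and \<open>At\<close> are the coefficient matrices of the two systems. The factor with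
  \<open>m\<close> does not depend on \<open>x\<close>, so \<open>S - m phi\<close> of the second
  problem is again a solution.\<close>

lemma P_primitives:
  shows "primitive_on 0 pi (\<lambda>x. P11 x l) (\<lambda>x. (\<sigma> x - \<sigma>t x) * P11 x l + P21 x l + ((\<sigma>t x)\<^sup>2 + l) * P12 x l)"
    "primitive_on 0 pi (\<lambda>x. P12 x l) (\<lambda>x. (\<sigma> x + \<sigma>t x) * P12 x l + P22 x l - P11 x l)"
    "primitive_on 0 pi (\<lambda>x. P21 x l)
      (\<lambda>x. - (\<sigma> x + \<sigma>t x) * P21 x l - ((\<sigma> x)\<^sup>2 + l) * P11 x l + ((\<sigma>t x)\<^sup>2 + l) * P22 x l)"
proof -
  have V: "sl_system \<sigma>t l (\<lambda>x. S \<sigma>t x l - m l * phi \<sigma>t x l) (\<lambda>x. S_qd \<sigma>t x l - m l * phi_qd \<sigma>t x l)"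
    by (intro sl_system_diff sl_system_cmult phi_sl_system S_sl_system sqt)
  note a = sl_product_primitives[OF phi_sl_system(1)[OF sq] V]
  note b = sl_product_primitives[OF S_sl_system(1)[OF sq] phi_sl_system(1)[OF sqt], of l]
  show "primitive_on 0 pi (\<lambda>x. P11 x l) (\<lambda>x. (\<sigma> x - \<sigma>t x) * P11 x l + P21 x l + ((\<sigma>t x)\<^sup>2 + l) * P12 x l)"
    by (rule primitive_on_cong[OF primitive_on_diff[OF a(2) b(2)]])
      (simp_all add: P11_def P12_def P21_def, algebra?)
  show "primitive_on 0 pi (\<lambda>x. P12 x l) (\<lambda>x. (\<sigma> x + \<sigma>t x) * P12 x l + P22 x l - P11 x l)"
    by (rule primitive_on_cong[OF primitive_on_diff[OF b(1) a(1)]])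
      (simp_all add: P11_def P12_def P22_def, algebra?)
  show "primitive_on 0 pi (\<lambda>x. P21 x l)
      (\<lambda>x. - (\<sigma> x + \<sigma>t x) * P21 x l - ((\<sigma> x)\<^sup>2 + l) * P11 x l + ((\<sigma>t x)\<^sup>2 + l) * P22 x l)"
    by (rule primitive_on_cong[OF primitive_on_diff[OF a(3) b(3)]])
      (simp_all add: P11_def P21_def P22_def, algebra?)
qed

text \<open>Every term is the product of a solution growing like
  \<open>exp (|Im \<rho>| * x)\<close> and a Weyl solution decaying at the same rate. The powers of
  \<open>\<rho>\<close> are those of the factors: 0 for \<open>phi\<close>, 1 for
  \<open>phi_qd\<close>, -1 for the Weyl solution and 0 for its quasi-derivative.\<close>

lemma P_square_bounds:
  "\<exists>C n0. C \<ge> 0 \<and> (\<forall>n\<ge>n0. \<forall>\<rho>\<in>square n. \<forall>x\<in>{0..pi}.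
     cmod (P11 x (\<rho>\<^sup>2)) \<le> C \<and> cmod \<rho> * cmod (P12 x (\<rho>\<^sup>2)) \<le> C \<and>
     cmod (P21 x (\<rho>\<^sup>2)) \<le> C * cmod \<rho> \<and> cmod (P22 x (\<rho>\<^sup>2)) \<le> C)"
proof -
  define G where "G = growth_const \<sigma>"
  define Gt where "Gt = growth_const \<sigma>t"
  have G: "G > 0" "Gt > 0" by (simp_all add: G_def Gt_def growth_const_pos)
  obtain C1 n1 where C1: "C1 \<ge> 0" "\<forall>n\<ge>n1. \<forall>\<rho>\<in>square n. \<forall>x\<in>{0..pi}. Delta1 \<sigma> r1 r2 (\<rho>\<^sup>2) \<noteq> 0 \<and>
     cmod \<rho> * cmod (S \<sigma> x (\<rho>\<^sup>2) + weyl_M \<sigma> r1 r2 (\<rho>\<^sup>2) * phi \<sigma> x (\<rho>\<^sup>2)) +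
       cmod (S_qd \<sigma> x (\<rho>\<^sup>2) + weyl_M \<sigma> r1 r2 (\<rho>\<^sup>2) * phi_qd \<sigma> x (\<rho>\<^sup>2)) \<le> C1 * exp (- \<bar>Im \<rho>\<bar> * x)"
    using weyl_solution_decay[OF sq cl] by blast
  obtain C2 n2 where C2: "C2 \<ge> 0" "\<forall>n\<ge>n2. \<forall>\<rho>\<in>square n. \<forall>x\<in>{0..pi}. Delta1 \<sigma>t r1t r2t (\<rho>\<^sup>2) \<noteq> 0 \<and>
     cmod \<rho> * cmod (S \<sigma>t x (\<rho>\<^sup>2) + weyl_M \<sigma>t r1t r2t (\<rho>\<^sup>2) * phi \<sigma>t x (\<rho>\<^sup>2)) +
       cmod (S_qd \<sigma>t x (\<rho>\<^sup>2) + weyl_M \<sigma>t r1t r2t (\<rho>\<^sup>2) * phi_qd \<sigma>t x (\<rho>\<^sup>2)) \<le> C2 * exp (- \<bar>Im \<rho>\<bar> * x)"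
    using weyl_solution_decay[OF sqt clt] by blast
  define C where "C = G * C2 + C1 * Gt"
  have C0: "C \<ge> 0" using G C1(1) C2(1) by (simp add: C_def)
  have "cmod (P11 x (\<rho>\<^sup>2)) \<le> C \<and> cmod \<rho> * cmod (P12 x (\<rho>\<^sup>2)) \<le> C \<and>
     cmod (P21 x (\<rho>\<^sup>2)) \<le> C * cmod \<rho> \<and> cmod (P22 x (\<rho>\<^sup>2)) \<le> C"
    if n: "n \<ge> max 1 (max n1 n2)" and \<rho>: "\<rho> \<in> square n" and x: "x \<in> {0..pi}" for n \<rho> x
  proof -
    define c where "c = cmod \<rho>"
    have r: "cmod \<rho> \<ge> 1" using square_cmod(1)[OF \<rho>] n by auto
    have c: "c \<ge> 1" using r by (simp add: c_def)
    define l where "l = \<rho>\<^sup>2"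
    define T where "T = exp (\<bar>Im \<rho>\<bar> * x)"
    have T: "T > 0" "exp (- \<bar>Im \<rho>\<bar> * x) = 1 / T" by (simp_all add: T_def exp_minus inverse_eq_divide)
    define U where "U = S \<sigma> x l + weyl_M \<sigma> r1 r2 l * phi \<sigma> x l"
    define U1 where "U1 = S_qd \<sigma> x l + weyl_M \<sigma> r1 r2 l * phi_qd \<sigma> x l"
    define Ut where "Ut = S \<sigma>t x l + weyl_M \<sigma>t r1t r2t l * phi \<sigma>t x l"
    define Ut1 where "Ut1 = S_qd \<sigma>t x l + weyl_M \<sigma>t r1t r2t l * phi_qd \<sigma>t x l"
    have D: "Delta1 \<sigma> r1 r2 l \<noteq> 0" "Delta1 \<sigma>t r1t r2t l \<noteq> 0"
      and u: "c * cmod U + cmod U1 \<le> C1 * (1 / T)" "c * cmod Ut + cmod Ut1 \<le> C2 * (1 / T)"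
      using C1(2) C2(2) n \<rho> x unfolding U_def U1_def Ut_def Ut1_def l_def c_def T(2)[symmetric] by auto
    have "0 \<le> c * cmod U" "0 \<le> c * cmod Ut" using c by auto
    then have U: "c * cmod U \<le> C1 / T" "cmod U1 \<le> C1 / T" "c * cmod Ut \<le> C2 / T" "cmod Ut1 \<le> C2 / T"
      using u norm_ge_zero[of U1] norm_ge_zero[of Ut1] by (auto simp del: norm_ge_zero)
    have f: "cmod (phi \<sigma> x l) \<le> G * T" "cmod (phi_qd \<sigma> x l) \<le> G * T * c"
      "cmod (phi \<sigma>t x l) \<le> Gt * T" "cmod (phi_qd \<sigma>t x l) \<le> Gt * T * c"
      using phi_growth[OF sq r x] phi_growth[OF sqt r x] by (simp_all add: G_def Gt_def T_def c_def l_def)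
    have ml: "m l = weyl_M \<sigma> r1 r2 l - weyl_M \<sigma>t r1t r2t l" using weyl[OF D] by simp
    \<comment> \<open>As \<open>m\<close> is the difference of the Weyl functions, the terms added
      to pass from \<open>S\<close> to the Weyl solutions cancel exactly.\<close>
    have eq: "P11 x l = phi \<sigma> x l * Ut1 - U * phi_qd \<sigma>t x l" "P12 x l = U * phi \<sigma>t x l - phi \<sigma> x l * Ut"
      "P21 x l = phi_qd \<sigma> x l * Ut1 - U1 * phi_qd \<sigma>t x l" "P22 x l = U1 * phi \<sigma>t x l - phi_qd \<sigma> x l * Ut"
      by (simp_all add: P11_def P12_def P21_def P22_def ml U_def U1_def Ut_def Ut1_def algebra_simps)
    have GT: "0 \<le> G * T" "0 \<le> Gt * T" "0 \<le> G * T * c" "0 \<le> Gt * T * c" using G T c by auto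
    have CC: "C = G * T * (C2 / T) + C1 / T * (Gt * T)" using T by (simp add: C_def)
    have i11: "cmod (phi \<sigma> x l) * cmod Ut1 \<le> G * T * (C2 / T)"
      using f U GT by (intro mult_mono) auto
    have i12: "cmod U * cmod (phi_qd \<sigma>t x l) \<le> C1 / T * (Gt * T)"
    proof -
      have "cmod U * cmod (phi_qd \<sigma>t x l) \<le> cmod U * (Gt * T * c)" using f by (intro mult_left_mono) auto
      also have "\<dots> = (c * cmod U) * (Gt * T)" by simp
      also have "\<dots> \<le> C1 / T * (Gt * T)" using U GT by (intro mult_right_mono) auto
      finally show ?thesis .
    qed
    have i21: "c * cmod U * cmod (phi \<sigma>t x l) \<le> C1 / T * (Gt * T)"
      using f U GT c C1(1) T(1) by (intro mult_mono) auto
    have i22: "cmod (phi \<sigma> x l) * (c * cmod Ut) \<le> G * T * (C2 / T)"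
      using f U GT c by (intro mult_mono) auto
    have i31: "cmod (phi_qd \<sigma> x l) * cmod Ut1 \<le> G * T * c * (C2 / T)"
      using f U GT by (intro mult_mono) auto
    have i32: "cmod U1 * cmod (phi_qd \<sigma>t x l) \<le> C1 / T * (Gt * T * c)"
      using f U GT C1(1) T(1) by (intro mult_mono) auto
    have i41: "cmod U1 * cmod (phi \<sigma>t x l) \<le> C1 / T * (Gt * T)"
      using f U GT C1(1) T(1) by (intro mult_mono) auto
    have i42: "cmod (phi_qd \<sigma> x l) * cmod Ut \<le> G * T * (C2 / T)"
    proof -
      have "cmod (phi_qd \<sigma> x l) * cmod Ut \<le> (G * T * c) * cmod Ut" using f by (intro mult_right_mono) auto
      also have "\<dots> = (G * T) * (c * cmod Ut)" by simp
      also have "\<dots> \<le> G * T * (C2 / T)" using U GT by (intro mult_left_mono) auto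
      finally show ?thesis .
    qed
    have "cmod (P11 x l) \<le> C"
      unfolding eq CC using norm_triangle_ineq4[of "phi \<sigma> x l * Ut1" "U * phi_qd \<sigma>t x l"] i11 i12
      by (simp only: norm_mult)
    moreover have "c * cmod (P12 x l) \<le> C"
    proof -
      have "c * cmod (P12 x l) \<le> c * (cmod U * cmod (phi \<sigma>t x l) + cmod (phi \<sigma> x l) * cmod Ut)"
        unfolding eq using norm_triangle_ineq4[of "U * phi \<sigma>t x l" "phi \<sigma> x l * Ut"] c
        by (intro mult_left_mono) (auto simp: norm_mult)
      also have "\<dots> = c * cmod U * cmod (phi \<sigma>t x l) + cmod (phi \<sigma> x l) * (c * cmod Ut)"
        by (simp add: algebra_simps)
      also have "\<dots> \<le> C" unfolding CC using i21 i22 by linarith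
      finally show ?thesis .
    qed
    moreover have "cmod (P21 x l) \<le> C * c"
    proof -
      have "cmod (P21 x l) \<le> G * T * c * (C2 / T) + C1 / T * (Gt * T * c)"
        unfolding eq using norm_triangle_ineq4[of "phi_qd \<sigma> x l * Ut1" "U1 * phi_qd \<sigma>t x l"] i31 i32
        by (simp only: norm_mult)
      also have "\<dots> = C * c" unfolding CC by (simp add: algebra_simps)
      finally show ?thesis .
    qed
    moreover have "cmod (P22 x l) \<le> C"
      unfolding eq CC using norm_triangle_ineq4[of "U1 * phi \<sigma>t x l" "phi_qd \<sigma> x l * Ut"] i41 i42
      by (simp only: norm_mult)
    ultimately show ?thesis by (simp add: l_def c_def)
  qed
  then show ?thesis using C0 by blast
qed

section \<open>Cauchy transforms of products of solutions, and the expansion of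
  \<open>P\<close>\<close>

definition mean :: "(real \<Rightarrow> complex \<Rightarrow> complex) \<Rightarrow> real \<Rightarrow> complex" where
  "mean f x = circle_mean R (\<lambda>\<mu>. m \<mu> * f x \<mu>)"

definition transform :: "(real \<Rightarrow> complex \<Rightarrow> complex) \<Rightarrow> real \<Rightarrow> complex \<Rightarrow> complex" where
  "transform f x l = circle_mean R (\<lambda>\<mu>. m \<mu> * f x \<mu> / (l - \<mu>))"

text \<open>The bound on the circle is uniform in \<open>x\<close>; the dominating function used in
  the limit of the differential equation rests on this.\<close>

definition admissible :: "(real \<Rightarrow> complex \<Rightarrow> complex) \<Rightarrow> bool" where
  "admissible f \<longleftrightarrow> (\<forall>x\<in>{0..pi}. f x holomorphic_on UNIV) \<and>
     (\<exists>B. \<forall>x\<in>{0..pi}. \<forall>\<mu>. cmod \<mu> = R \<longrightarrow> cmod (m \<mu> * f x \<mu>) \<le> B)"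

lemma admissible_products:
  "admissible (\<lambda>x \<mu>. phi \<sigma> x \<mu> * phi \<sigma>t x \<mu>)" "admissible (\<lambda>x \<mu>. phi \<sigma> x \<mu> * phi_qd \<sigma>t x \<mu>)"
  "admissible (\<lambda>x \<mu>. phi_qd \<sigma> x \<mu> * phi \<sigma>t x \<mu>)" "admissible (\<lambda>x \<mu>. phi_qd \<sigma> x \<mu> * phi_qd \<sigma>t x \<mu>)"
proof -
  define K where "K = 2 * exp (2 * integral {0..pi} (kernel_bound \<sigma> R))"
  define Kt where "Kt = 2 * exp (2 * integral {0..pi} (kernel_bound \<sigma>t R))"
  have "compact (sphere (0::complex) R)" by simp
  moreover have "continuous_on (sphere 0 R) m"
    using principal_at_infinity_sphere[OF m, of "\<lambda>_. 1"] by simp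
  ultimately have "bounded (m ` sphere 0 R)" by (intro compact_imp_bounded compact_continuous_image)
  then obtain B where B: "\<forall>\<mu>\<in>sphere 0 R. cmod (m \<mu>) \<le> B" by (auto simp: bounded_iff)
  have b: "cmod (phi \<sigma> x \<mu>) \<le> K" "cmod (phi_qd \<sigma> x \<mu>) \<le> K" "cmod (phi \<sigma>t x \<mu>) \<le> Kt" "cmod (phi_qd \<sigma>t x \<mu>) \<le> Kt"
    if "x \<in> {0..pi}" "cmod \<mu> = R" for x \<mu>
  proof -
    have "cmod (phi \<sigma> x \<mu>) + cmod (phi_qd \<sigma> x \<mu>) \<le> K"
      using sl_system_bound[OF sq phi_sl_system(1)[OF sq], of \<mu> R x] that
      by (simp add: K_def phi_sl_system[OF sq])
    then show "cmod (phi \<sigma> x \<mu>) \<le> K" "cmod (phi_qd \<sigma> x \<mu>) \<le> K"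
      using norm_ge_zero[of "phi \<sigma> x \<mu>"] norm_ge_zero[of "phi_qd \<sigma> x \<mu>"] by linarith+
    have "cmod (phi \<sigma>t x \<mu>) + cmod (phi_qd \<sigma>t x \<mu>) \<le> Kt"
      using sl_system_bound[OF sqt phi_sl_system(1)[OF sqt], of \<mu> R x] that
      by (simp add: Kt_def phi_sl_system[OF sqt])
    then show "cmod (phi \<sigma>t x \<mu>) \<le> Kt" "cmod (phi_qd \<sigma>t x \<mu>) \<le> Kt"
      using norm_ge_zero[of "phi \<sigma>t x \<mu>"] norm_ge_zero[of "phi_qd \<sigma>t x \<mu>"] by linarith+
  qed
  have adm: "admissible (\<lambda>x \<mu>. f x \<mu> * g x \<mu>)"
    if f: "\<And>x. x \<in> {0..pi} \<Longrightarrow> f x holomorphic_on UNIV" "\<And>x \<mu>. x \<in> {0..pi} \<Longrightarrow> cmod \<mu> = R \<Longrightarrow> cmod (f x \<mu>) \<le> K"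
      and g: "\<And>x. x \<in> {0..pi} \<Longrightarrow> g x holomorphic_on UNIV" "\<And>x \<mu>. x \<in> {0..pi} \<Longrightarrow> cmod \<mu> = R \<Longrightarrow> cmod (g x \<mu>) \<le> Kt"
    for f g
    unfolding admissible_def
  proof (intro conjI ballI exI[of _ "B * (K * Kt)"] allI impI)
    show "(\<lambda>\<mu>. f x \<mu> * g x \<mu>) holomorphic_on UNIV" if "x \<in> {0..pi}" for x
      using f(1)[OF that] g(1)[OF that] by (rule holomorphic_on_mult)
    fix x \<mu> assume x: "x \<in> {0..pi}" and \<mu>: "cmod \<mu> = R"
    have "cmod (m \<mu>) \<le> B" using B \<mu> by simp
    moreover have "cmod (f x \<mu> * g x \<mu>) \<le> K * Kt"
      unfolding norm_mult using f(2)[OF x \<mu>] g(2)[OF x \<mu>] by (intro mult_mono) (auto simp: K_def)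
    ultimately show "cmod (m \<mu> * (f x \<mu> * g x \<mu>)) \<le> B * (K * Kt)"
      unfolding norm_mult[of "m \<mu>"] by (intro mult_mono) (auto intro: order_trans[OF norm_ge_zero])
  qed
  show "admissible (\<lambda>x \<mu>. phi \<sigma> x \<mu> * phi \<sigma>t x \<mu>)" "admissible (\<lambda>x \<mu>. phi \<sigma> x \<mu> * phi_qd \<sigma>t x \<mu>)"
    "admissible (\<lambda>x \<mu>. phi_qd \<sigma> x \<mu> * phi \<sigma>t x \<mu>)" "admissible (\<lambda>x \<mu>. phi_qd \<sigma> x \<mu> * phi_qd \<sigma>t x \<mu>)"
    by (intro adm b holomorphic_phi_S sq sqt; assumption)+
qed

lemma admissible_sphere:
  assumes "admissible f" and "x \<in> {0..pi}"
  shows "continuous_on (sphere 0 R) (\<lambda>\<mu>. m \<mu> * f x \<mu>)"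
  using assms by (intro principal_at_infinity_sphere[OF m]) (auto simp: admissible_def)

abbreviation "ff \<equiv> (\<lambda>x \<mu>. phi \<sigma> x \<mu> * phi \<sigma>t x \<mu>)"
abbreviation "fg \<equiv> (\<lambda>x \<mu>. phi \<sigma> x \<mu> * phi_qd \<sigma>t x \<mu>)"
abbreviation "gf \<equiv> (\<lambda>x \<mu>. phi_qd \<sigma> x \<mu> * phi \<sigma>t x \<mu>)"
abbreviation "gg \<equiv> (\<lambda>x \<mu>. phi_qd \<sigma> x \<mu> * phi_qd \<sigma>t x \<mu>)"

text \<open>Each entry is an entire function plus or minus \<open>m\<close> times a product of
  solutions, so the expansion at infinity applies at every fixed \<open>x\<close>;
  \<open>P11\<close> and \<open>P21\<close> contain \<open>m\<close> with a minus sign. The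
  constants depend on \<open>x\<close> in a way that is still unknown here.\<close>

lemma P_laurent:
  assumes x: "x \<in> {0..pi}"
  shows "\<exists>\<kappa>. \<forall>l. cmod l > R \<longrightarrow> P11 x l = \<kappa> - transform fg x l"
    "\<exists>\<kappa>. \<forall>l. cmod l > R \<longrightarrow> P12 x l = \<kappa> + transform ff x l"
    "\<exists>\<kappa>. \<forall>l. cmod l > R \<longrightarrow> P21 x l = \<kappa> - transform gg x l"
    "\<exists>\<kappa>. \<forall>l. cmod l > R \<longrightarrow> P22 x l = \<kappa> + transform gf x l"
proof -
  obtain C n0 where C: "C \<ge> 0" "\<forall>n\<ge>n0. \<forall>\<rho>\<in>square n. \<forall>x\<in>{0..pi}.
     cmod (P11 x (\<rho>\<^sup>2)) \<le> C \<and> cmod \<rho> * cmod (P12 x (\<rho>\<^sup>2)) \<le> C \<and>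
     cmod (P21 x (\<rho>\<^sup>2)) \<le> C * cmod \<rho> \<and> cmod (P22 x (\<rho>\<^sup>2)) \<le> C"
    using P_square_bounds by blast
  have b: "cmod (P11 x (\<rho>\<^sup>2)) \<le> C * cmod \<rho>" "cmod (P12 x (\<rho>\<^sup>2)) \<le> C * cmod \<rho>"
    "cmod (P21 x (\<rho>\<^sup>2)) \<le> C * cmod \<rho>" "cmod (P22 x (\<rho>\<^sup>2)) \<le> C * cmod \<rho>"
    if n: "n \<ge> max 1 n0" and \<rho>: "\<rho> \<in> square n" for n \<rho>
  proof -
    have r: "cmod \<rho> \<ge> 1" using square_cmod(1)[OF \<rho>] n by auto
    have "C * 1 \<le> C * cmod \<rho>" using r C(1) by (intro mult_left_mono) auto
    moreover have "1 * cmod (P12 x (\<rho>\<^sup>2)) \<le> cmod \<rho> * cmod (P12 x (\<rho>\<^sup>2))" using r by (intro mult_right_mono) auto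
    ultimately show "cmod (P11 x (\<rho>\<^sup>2)) \<le> C * cmod \<rho>" "cmod (P12 x (\<rho>\<^sup>2)) \<le> C * cmod \<rho>"
      "cmod (P21 x (\<rho>\<^sup>2)) \<le> C * cmod \<rho>" "cmod (P22 x (\<rho>\<^sup>2)) \<le> C * cmod \<rho>"
      using C(2)[rule_format, OF _ \<rho> x] n by fastforce+
  qed
  note h = holomorphic_phi_S[OF sq x] holomorphic_phi_S[OF sqt x]
  have hol: "(\<lambda>l. S \<sigma> x l * phi_qd \<sigma>t x l - phi \<sigma> x l * S_qd \<sigma>t x l) holomorphic_on UNIV"
    "(\<lambda>l. S \<sigma> x l * phi \<sigma>t x l - phi \<sigma> x l * S \<sigma>t x l) holomorphic_on UNIV"
    "(\<lambda>l. S_qd \<sigma> x l * phi_qd \<sigma>t x l - phi_qd \<sigma> x l * S_qd \<sigma>t x l) holomorphic_on UNIV"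
    "(\<lambda>l. S_qd \<sigma> x l * phi \<sigma>t x l - phi_qd \<sigma> x l * S \<sigma>t x l) holomorphic_on UNIV"
    by (intro holomorphic_on_diff holomorphic_on_mult h)+
  have holg: "ff x holomorphic_on UNIV" "fg x holomorphic_on UNIV" "gf x holomorphic_on UNIV" "gg x holomorphic_on UNIV"
    by (intro holomorphic_on_mult h)+
  have eq: "- P11 x l = S \<sigma> x l * phi_qd \<sigma>t x l - phi \<sigma> x l * S_qd \<sigma>t x l + m l * fg x l"
    "P12 x l = S \<sigma> x l * phi \<sigma>t x l - phi \<sigma> x l * S \<sigma>t x l + m l * ff x l"
    "- P21 x l = S_qd \<sigma> x l * phi_qd \<sigma>t x l - phi_qd \<sigma> x l * S_qd \<sigma>t x l + m l * gg x l"
    "P22 x l = S_qd \<sigma> x l * phi \<sigma>t x l - phi_qd \<sigma> x l * S \<sigma>t x l + m l * gf x l" for l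
    unfolding P11_def P12_def P21_def P22_def by algebra+
  have "\<exists>\<kappa>. \<forall>l. cmod l > R \<longrightarrow> - P11 x l = \<kappa> + transform fg x l"
    unfolding transform_def eq
    by (rule laurent_constant_part[OF R m hol(1) holg(2)], unfold eq[symmetric] norm_minus_cancel) (rule b)
  then obtain \<kappa> where \<kappa>: "\<forall>l. cmod l > R \<longrightarrow> - P11 x l = \<kappa> + transform fg x l" by blast
  have "P11 x l = - \<kappa> - transform fg x l" if "cmod l > R" for l
    using arg_cong[OF \<kappa>[rule_format, OF that], of uminus] by simp
  then show "\<exists>\<kappa>. \<forall>l. cmod l > R \<longrightarrow> P11 x l = \<kappa> - transform fg x l" by blast
  show "\<exists>\<kappa>. \<forall>l. cmod l > R \<longrightarrow> P12 x l = \<kappa> + transform ff x l"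
    unfolding transform_def eq
    by (rule laurent_constant_part[OF R m hol(2) holg(1)], unfold eq[symmetric]) (rule b)
  have "\<exists>\<kappa>. \<forall>l. cmod l > R \<longrightarrow> - P21 x l = \<kappa> + transform gg x l"
    unfolding transform_def eq
    by (rule laurent_constant_part[OF R m hol(3) holg(4)], unfold eq[symmetric] norm_minus_cancel) (rule b)
  then obtain \<kappa> where \<kappa>: "\<forall>l. cmod l > R \<longrightarrow> - P21 x l = \<kappa> + transform gg x l" by blast
  have "P21 x l = - \<kappa> - transform gg x l" if "cmod l > R" for l
    using arg_cong[OF \<kappa>[rule_format, OF that], of uminus] by simp
  then show "\<exists>\<kappa>. \<forall>l. cmod l > R \<longrightarrow> P21 x l = \<kappa> - transform gg x l" by blast
  show "\<exists>\<kappa>. \<forall>l. cmod l > R \<longrightarrow> P22 x l = \<kappa> + transform gf x l"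
    unfolding transform_def eq
    by (rule laurent_constant_part[OF R m hol(4) holg(3)], unfold eq[symmetric]) (rule b)
qed

text \<open>For \<open>|l| >= R + 1\<close> the distance to the circle is at least 1, so the
  decaying bounds also serve as constant ones. The two summands of \<open>B\<close> come from the
  transform and from its first moment.\<close>

lemma transform_bounds:
  assumes f: "admissible f"
  shows "\<exists>B\<ge>0. \<forall>x\<in>{0..pi}. \<forall>l. cmod l \<ge> R + 1 \<longrightarrow>
     cmod (transform f x l) \<le> B / (cmod l - R) \<and> cmod (l * transform f x l - mean f x) \<le> B / (cmod l - R) \<and>
     cmod (transform f x l) \<le> B \<and> cmod (l * transform f x l) \<le> B"
proof -
  obtain B0 where B0: "\<forall>x\<in>{0..pi}. \<forall>\<mu>. cmod \<mu> = R \<longrightarrow> cmod (m \<mu> * f x \<mu>) \<le> B0"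
    using f by (auto simp: admissible_def)
  define B1 where "B1 = max B0 0"
  define B where "B = B1 * R + B1 * R\<^sup>2"
  have B1: "B1 \<ge> 0" by (simp add: B1_def)
  have le: "B1 * R \<le> B" "B1 * R\<^sup>2 \<le> B" "B \<ge> 0" using B1 R by (auto simp: B_def)
  show ?thesis
  proof (intro exI[of _ B] conjI ballI allI impI)
    show "B \<ge> 0" by fact
    fix x :: real and l :: complex assume x: "x \<in> {0..pi}" and l: "cmod l \<ge> R + 1"
    have b: "\<And>\<mu>. cmod \<mu> = R \<Longrightarrow> cmod (m \<mu> * f x \<mu>) \<le> B1"
      using B0 x by (auto simp: B1_def intro: max.coboundedI1)
    have lR: "cmod l > R" "cmod l - R \<ge> 1" "cmod l - R > 0" using l by auto
    note c = admissible_sphere[OF f x]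
    have t1: "cmod (transform f x l) \<le> B1 * R / (cmod l - R)"
      unfolding transform_def by (rule cauchy_transform_le[OF R c b lR(1)])
    have t2: "cmod (l * transform f x l - mean f x) \<le> B1 * R\<^sup>2 / (cmod l - R)"
      unfolding transform_def mean_def by (rule cauchy_transform_moment_le[OF R c b lR(1)])
    have t3: "cmod (mean f x) \<le> B1 * R"
      unfolding mean_def by (rule circle_mean_norm_le[OF R c b])
    show "cmod (transform f x l) \<le> B / (cmod l - R)"
      using t1 divide_right_mono[OF le(1), of "cmod l - R"] lR by linarith
    show "cmod (l * transform f x l - mean f x) \<le> B / (cmod l - R)"
      using t2 divide_right_mono[OF le(2), of "cmod l - R"] lR by linarith
    have "B1 * R / (cmod l - R) \<le> B1 * R / 1"
      by (rule divide_left_mono) (use lR B1 R in auto)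
    then show "cmod (transform f x l) \<le> B" using t1 le by simp
    have "B1 * R\<^sup>2 / (cmod l - R) \<le> B1 * R\<^sup>2 / 1"
      by (rule divide_left_mono) (use lR B1 R in auto)
    then have "cmod (l * transform f x l) \<le> B1 * R\<^sup>2 + B1 * R"
      using t2 t3 norm_triangle_ineq2[of "l * transform f x l" "mean f x"] by simp
    then show "cmod (l * transform f x l) \<le> B" by (simp add: B_def)
  qed
qed

lemma transform_bounded:
  assumes f: "admissible f"
  shows "\<exists>B\<ge>0. \<forall>x\<in>{0..pi}. \<forall>l. cmod l \<ge> R + 1 \<longrightarrow>
     cmod (transform f x l) \<le> B \<and> cmod (l * transform f x l) \<le> B"
proof -
  obtain B where B: "B \<ge> 0" "\<forall>x\<in>{0..pi}. \<forall>l. cmod l \<ge> R + 1 \<longrightarrow>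
     cmod (transform f x l) \<le> B / (cmod l - R) \<and> cmod (l * transform f x l - mean f x) \<le> B / (cmod l - R) \<and>
     cmod (transform f x l) \<le> B \<and> cmod (l * transform f x l) \<le> B"
    using transform_bounds[OF f] by blast
  show ?thesis by (rule exI[of _ B]) (use B in simp)
qed

lemma transform_tendsto:
  assumes f: "admissible f" and x: "x \<in> {0..pi}"
    and L: "\<And>n. cmod (L n) \<ge> R + 1" "filterlim (\<lambda>n. cmod (L n)) at_top sequentially"
  shows "(\<lambda>n. transform f x (L n)) \<longlonglongrightarrow> 0" "(\<lambda>n. L n * transform f x (L n)) \<longlonglongrightarrow> mean f x"
proof -
  obtain B where B: "\<forall>x\<in>{0..pi}. \<forall>l. cmod l \<ge> R + 1 \<longrightarrow>
     cmod (transform f x l) \<le> B / (cmod l - R) \<and> cmod (l * transform f x l - mean f x) \<le> B / (cmod l - R)"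
    using transform_bounds[OF f] by blast
  have "filterlim (\<lambda>n. - R + cmod (L n)) at_top sequentially"
    by (rule filterlim_tendsto_add_at_top[OF tendsto_const L(2)])
  then have "(\<lambda>n. B / (- R + cmod (L n))) \<longlonglongrightarrow> 0"
    by (intro tendsto_divide_0[OF tendsto_const] filterlim_at_top_imp_at_infinity)
  then have z: "(\<lambda>n. B / (cmod (L n) - R)) \<longlonglongrightarrow> 0" by simp
  show "(\<lambda>n. transform f x (L n)) \<longlonglongrightarrow> 0"
    by (rule Lim_null_comparison[OF _ z]) (use B x L(1) in auto)
  have "(\<lambda>n. L n * transform f x (L n) - mean f x) \<longlonglongrightarrow> 0"
    by (rule Lim_null_comparison[OF _ z]) (use B x L(1) in auto)
  then show "(\<lambda>n. L n * transform f x (L n)) \<longlonglongrightarrow> mean f x"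
    by (simp only: LIM_zero_iff)
qed

text \<open>Inserting the expansions of the entries of \<open>P\<close> at infinity into the differential equation of
  \<open>P\<close> and comparing coefficients determines the constant terms and the difference of the potentials.\<close>

lemma transfer_matrix:
  shows "\<And>x l. x \<in> {0..pi} \<Longrightarrow> cmod l > R \<Longrightarrow> P11 x l = 1 - transform fg x l"
    "\<And>x l. x \<in> {0..pi} \<Longrightarrow> cmod l > R \<Longrightarrow> P12 x l = transform ff x l"
    "\<And>x l. x \<in> {0..pi} \<Longrightarrow> cmod l > R \<Longrightarrow> P21 x l = mean ff x - mean ff 0 - transform gg x l"
    "\<And>x l. x \<in> {0..pi} \<Longrightarrow> cmod l > R \<Longrightarrow> P22 x l = 1 + transform gf x l"
    "\<exists>N. negligible N \<and> (\<forall>x\<in>{0..pi} - N. \<sigma> x = \<sigma>t x - (2 * mean ff x - mean ff 0))"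
proof -
  obtain C n0 where C: "C \<ge> 0" "\<forall>n\<ge>n0. \<forall>\<rho>\<in>square n. \<forall>x\<in>{0..pi}.
     cmod (P11 x (\<rho>\<^sup>2)) \<le> C \<and> cmod \<rho> * cmod (P12 x (\<rho>\<^sup>2)) \<le> C \<and>
     cmod (P21 x (\<rho>\<^sup>2)) \<le> C * cmod \<rho> \<and> cmod (P22 x (\<rho>\<^sup>2)) \<le> C"
    using P_square_bounds by blast
  note adm = admissible_products
  obtain k11 where k11: "\<And>x l. x \<in> {0..pi} \<Longrightarrow> cmod l > R \<Longrightarrow> P11 x l = k11 x - transform fg x l"
    using P_laurent(1) by metis
  obtain k12 where k12: "\<And>x l. x \<in> {0..pi} \<Longrightarrow> cmod l > R \<Longrightarrow> P12 x l = k12 x + transform ff x l"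
    using P_laurent(2) by metis
  obtain k21 where k21: "\<And>x l. x \<in> {0..pi} \<Longrightarrow> cmod l > R \<Longrightarrow> P21 x l = k21 x - transform gg x l"
    using P_laurent(3) by metis
  obtain k22 where k22: "\<And>x l. x \<in> {0..pi} \<Longrightarrow> cmod l > R \<Longrightarrow> P22 x l = k22 x + transform gf x l"
    using P_laurent(4) by metis
  obtain n1 :: nat where n1: "real n1 \<ge> max (real n0) (max 1 (R + 1))" using real_arch_simple by blast
  \<comment> \<open>Real points on the squares: the bounds for \<open>P\<close> hold there, and
    their squares \<open>L n\<close> form a sequence tending to infinity outside the circle.\<close>
  define \<rho> where "\<rho> n = complex_of_real (real (n + n1) + 1 / 2)" for n
  define L where "L n = (\<rho> n)\<^sup>2" for n
  have \<rho>sq: "\<rho> n \<in> square (n + n1)" "n + n1 \<ge> n0" for n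
    using n1 half_integer_in_square[of "n + n1"] by (auto simp only: \<rho>_def of_nat_add)
  have c\<rho>: "cmod (\<rho> n) = real (n + n1) + 1 / 2" for n unfolding \<rho>_def norm_of_real by simp
  have \<rho>1: "cmod (\<rho> n) \<ge> 1" "cmod (\<rho> n) \<ge> R + 1" "cmod (\<rho> n) \<ge> real n" for n
    using n1 unfolding c\<rho> by auto
  have L\<rho>: "cmod (L n) \<ge> cmod (\<rho> n)" for n
    using mult_left_mono[OF \<rho>1(1), of "cmod (\<rho> n)" n] by (simp add: L_def norm_mult power2_eq_square)
  have L1: "cmod (L n) \<ge> R + 1" for n using L\<rho>[of n] \<rho>1(2)[of n] by linarith
  have L1': "cmod (L n) > R" for n using L1[of n] by linarith
  have \<rho>top: "filterlim (\<lambda>n. cmod (\<rho> n)) at_top sequentially"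
    by (rule filterlim_at_top_mono[OF filterlim_real_sequentially]) (use \<rho>1(3) in auto)
  have Ltop: "filterlim (\<lambda>n. cmod (L n)) at_top sequentially"
    by (rule filterlim_at_top_mono[OF \<rho>top]) (use L\<rho> in auto)
  note T = transform_tendsto[OF _ _ L1 Ltop]
  have bP: "cmod (P11 x (L n)) \<le> C" "cmod (\<rho> n) * cmod (P12 x (L n)) \<le> C" "cmod (P12 x (L n)) \<le> C"
    "cmod (P21 x (L n)) \<le> C * cmod (\<rho> n)" "cmod (P22 x (L n)) \<le> C" if "x \<in> {0..pi}" for x n
  proof -
    show a: "cmod (P11 x (L n)) \<le> C" "cmod (\<rho> n) * cmod (P12 x (L n)) \<le> C"
      "cmod (P21 x (L n)) \<le> C * cmod (\<rho> n)" "cmod (P22 x (L n)) \<le> C"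
      using C(2)[rule_format, OF \<rho>sq(2) \<rho>sq(1) that, of n] by (auto simp: L_def)
    have "1 * cmod (P12 x (L n)) \<le> cmod (\<rho> n) * cmod (P12 x (L n))" using \<rho>1 by (intro mult_right_mono) auto
    then show "cmod (P12 x (L n)) \<le> C" using a by simp
  qed
  \<comment> \<open>The bound for \<open>P12\<close> decays like \<open>1 / |\<rho>|\<close>, which
    leaves no constant term.\<close>
  have k12_0: "k12 x = 0" if x: "x \<in> {0..pi}" for x
  proof -
    have "(\<lambda>n. P12 x (L n)) \<longlonglongrightarrow> k12 x + 0"
      unfolding k12[OF x L1'] by (intro tendsto_intros T adm x)
    moreover have "(\<lambda>n. P12 x (L n)) \<longlonglongrightarrow> 0"
    proof (rule Lim_null_comparison)
      show "\<forall>\<^sub>F n in sequentially. cmod (P12 x (L n)) \<le> C / cmod (\<rho> n)"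
      proof (intro always_eventually allI)
        fix n
        have "cmod (\<rho> n) > 0" using \<rho>1(1)[of n] by linarith
        then show "cmod (P12 x (L n)) \<le> C / cmod (\<rho> n)"
          using bP(2)[OF x, of n] by (simp add: pos_le_divide_eq mult.commute)
      qed
      show "(\<lambda>n. C / cmod (\<rho> n)) \<longlonglongrightarrow> 0"
        by (intro tendsto_divide_0[OF tendsto_const] filterlim_at_top_imp_at_infinity \<rho>top)
    qed
    ultimately show ?thesis using LIMSEQ_unique by fastforce
  qed
  have lim11: "(\<lambda>n. P11 x (L n)) \<longlonglongrightarrow> k11 x" and lim12: "(\<lambda>n. P12 x (L n)) \<longlonglongrightarrow> 0"
    and lim21: "(\<lambda>n. P21 x (L n)) \<longlonglongrightarrow> k21 x" and lim22: "(\<lambda>n. P22 x (L n)) \<longlonglongrightarrow> k22 x"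
    and limL12: "(\<lambda>n. L n * P12 x (L n)) \<longlonglongrightarrow> mean ff x" if x: "x \<in> {0..pi}" for x
  proof -
    have "(\<lambda>n. k11 x - transform fg x (L n)) \<longlonglongrightarrow> k11 x - 0" by (intro tendsto_intros T adm x)
    then show "(\<lambda>n. P11 x (L n)) \<longlonglongrightarrow> k11 x" unfolding k11[OF x L1'] by simp
    have "(\<lambda>n. k21 x - transform gg x (L n)) \<longlonglongrightarrow> k21 x - 0" by (intro tendsto_intros T adm x)
    then show "(\<lambda>n. P21 x (L n)) \<longlonglongrightarrow> k21 x" unfolding k21[OF x L1'] by simp
    have "(\<lambda>n. k22 x + transform gf x (L n)) \<longlonglongrightarrow> k22 x + 0" by (intro tendsto_intros T adm x)
    then show "(\<lambda>n. P22 x (L n)) \<longlonglongrightarrow> k22 x" unfolding k22[OF x L1'] by simp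
    show "(\<lambda>n. P12 x (L n)) \<longlonglongrightarrow> 0" "(\<lambda>n. L n * P12 x (L n)) \<longlonglongrightarrow> mean ff x"
      unfolding k12[OF x L1'] k12_0[OF x] add_0 by (intro T adm x)+
  qed
  \<comment> \<open>In the limit of the determinant identity the product \<open>P12 * P21\<close>
    disappears, since \<open>P12\<close> tends to 0 and \<open>P21\<close> converges.\<close>
  have det: "k11 x * k22 x = 1" if x: "x \<in> {0..pi}" for x
  proof -
    have "(\<lambda>n. P11 x (L n) * P22 x (L n) - P12 x (L n) * P21 x (L n)) \<longlonglongrightarrow> k11 x * k22 x - 0 * k21 x"
      by (intro tendsto_intros lim11 lim12 lim21 lim22 x)
    then have "(\<lambda>n. 1) \<longlonglongrightarrow> k11 x * k22 x" by (simp add: P_det[OF x])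
    from LIMSEQ_unique[OF tendsto_const this] show ?thesis by simp
  qed
  obtain Bff where Bff: "Bff \<ge> 0" "\<forall>x\<in>{0..pi}. \<forall>l. cmod l \<ge> R + 1 \<longrightarrow>
      cmod (transform ff x l) \<le> Bff \<and> cmod (l * transform ff x l) \<le> Bff"
    using transform_bounded[OF adm(1)] by (elim exE conjE) (rule that)
  obtain Bfg where Bfg: "Bfg \<ge> 0" "\<forall>x\<in>{0..pi}. \<forall>l. cmod l \<ge> R + 1 \<longrightarrow>
      cmod (transform fg x l) \<le> Bfg \<and> cmod (l * transform fg x l) \<le> Bfg"
    using transform_bounded[OF adm(2)] by (elim exE conjE) (rule that)
  obtain Bgf where Bgf: "Bgf \<ge> 0" "\<forall>x\<in>{0..pi}. \<forall>l. cmod l \<ge> R + 1 \<longrightarrow>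
      cmod (transform gf x l) \<le> Bgf \<and> cmod (l * transform gf x l) \<le> Bgf"
    using transform_bounded[OF adm(3)] by (elim exE conjE) (rule that)
  obtain Bgg where Bgg: "Bgg \<ge> 0" "\<forall>x\<in>{0..pi}. \<forall>l. cmod l \<ge> R + 1 \<longrightarrow>
      cmod (transform gg x l) \<le> Bgg \<and> cmod (l * transform gg x l) \<le> Bgg"
    using transform_bounded[OF adm(4)] by (elim exE conjE) (rule that)
  \<comment> \<open>The bound on the squares only says that \<open>P21\<close> is of order
    \<open>\<rho>\<close>, which is useless as a dominating function. The Laurent form transports
    the bound at the single point \<open>L 0\<close> to all \<open>L n\<close>, uniformly in
    \<open>x\<close>.\<close>
  have b21: "cmod (P21 x (L n)) \<le> C * cmod (\<rho> 0) + 2 * Bgg" if x: "x \<in> {0..pi}" for x n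
  proof -
    have "k21 x = P21 x (L 0) + transform gg x (L 0)" using k21[OF x L1', of 0] by simp
    then have "P21 x (L n) = P21 x (L 0) + transform gg x (L 0) - transform gg x (L n)"
      using k21[OF x L1', of n] by simp
    then have "cmod (P21 x (L n)) \<le> cmod (P21 x (L 0)) + cmod (transform gg x (L 0)) + cmod (transform gg x (L n))"
      using norm_triangle_ineq4[of "P21 x (L 0) + transform gg x (L 0)" "transform gg x (L n)"]
        norm_triangle_ineq[of "P21 x (L 0)" "transform gg x (L 0)"] by simp
    moreover have "cmod (transform gg x (L 0)) \<le> Bgg" "cmod (transform gg x (L n)) \<le> Bgg"
      using Bgg(2) x L1 by auto
    ultimately show ?thesis using bP(4)[OF x, of 0] by simp
  qed
  have bL12: "cmod (L n * P12 x (L n)) \<le> Bff" if x: "x \<in> {0..pi}" for x n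
    using Bff(2) x L1[of n] unfolding k12[OF x L1'] k12_0[OF x] add_0 by auto
  define D where "D = C + (C * cmod (\<rho> 0) + 2 * Bgg) + Bff + Bfg + Bgf"
  have D: "C \<le> D" "C * cmod (\<rho> 0) + 2 * Bgg \<le> D" "Bff \<le> D" "Bfg + Bgf \<le> D" "D \<ge> 0"
    using C(1) Bff(1) Bfg(1) Bgf(1) Bgg(1) by (auto simp: D_def)
  \<comment> \<open>Up to the factor \<open>D\<close> this is the sum of the two kernel bounds; it
    dominates all integrands below, each of which is a combination of bounded quantities with
    coefficients linear or quadratic in the potentials.\<close>
  define h where "h t = D * (2 + 2 * (cmod (\<sigma> t) + cmod (\<sigma>t t)) + (cmod (\<sigma> t))\<^sup>2 + (cmod (\<sigma>t t))\<^sup>2)" for t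
  have h: "h integrable_on {0..pi}"
  proof -
    have "(\<lambda>t. D * (kernel_bound \<sigma> 0 t + kernel_bound \<sigma>t 0 t)) integrable_on {0..pi}"
      using kernel_bound_absolutely_integrable[OF sq, of 0] kernel_bound_absolutely_integrable[OF sqt, of 0]
      by (intro integrable_on_mult_right integrable_add) (auto simp: absolutely_integrable_on_def)
    moreover have "(\<lambda>t. D * (kernel_bound \<sigma> 0 t + kernel_bound \<sigma>t 0 t)) = h"
      by (auto simp: h_def kernel_bound_def algebra_simps)
    ultimately show ?thesis by simp
  qed
  have comb: "cmod (s * a + s2 * b + s3 * c + d + e) \<le> h t"
    if "cmod s \<le> cmod (\<sigma> t) + cmod (\<sigma>t t)" "cmod s2 \<le> (cmod (\<sigma> t))\<^sup>2" "cmod s3 \<le> (cmod (\<sigma>t t))\<^sup>2"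
      "cmod a \<le> D" "cmod b \<le> D" "cmod c \<le> D" "cmod d \<le> D" "cmod e \<le> D" for s s2 s3 a b c d e t
  proof -
    have "cmod (s * a) \<le> (cmod (\<sigma> t) + cmod (\<sigma>t t)) * D" "cmod (s2 * b) \<le> (cmod (\<sigma> t))\<^sup>2 * D"
      "cmod (s3 * c) \<le> (cmod (\<sigma>t t))\<^sup>2 * D"
      unfolding norm_mult using that by (auto intro!: mult_mono)
    moreover have "cmod (s * a + s2 * b + s3 * c + d + e) \<le> cmod (s * a) + cmod (s2 * b) + cmod (s3 * c) + cmod d + cmod e"
      by (intro order_trans[OF norm_triangle_ineq] add_right_mono) auto
    moreover have "(cmod (\<sigma> t) + cmod (\<sigma>t t)) * D + (cmod (\<sigma> t))\<^sup>2 * D + (cmod (\<sigma>t t))\<^sup>2 * D + D + D \<le> h t"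
      using D(5) by (simp add: h_def algebra_simps)
    ultimately show ?thesis using that(7,8) by linarith
  qed
  have sbound: "cmod (\<sigma> t - \<sigma>t t) \<le> cmod (\<sigma> t) + cmod (\<sigma>t t)" "cmod (\<sigma> t + \<sigma>t t) \<le> cmod (\<sigma> t) + cmod (\<sigma>t t)"
    "cmod (- (\<sigma> t + \<sigma>t t)) \<le> cmod (\<sigma> t) + cmod (\<sigma>t t)" "cmod (- (\<sigma> t)\<^sup>2) \<le> (cmod (\<sigma> t))\<^sup>2"
    "cmod ((\<sigma>t t)\<^sup>2) \<le> (cmod (\<sigma>t t))\<^sup>2" "cmod 0 \<le> (cmod (\<sigma> t))\<^sup>2" "cmod 0 \<le> (cmod (\<sigma>t t))\<^sup>2" for t
    unfolding norm_minus_cancel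
    by (rule norm_triangle_ineq4 norm_triangle_ineq | simp add: norm_power)+
  have bD: "cmod (P11 x (L n)) \<le> D" "cmod (P12 x (L n)) \<le> D" "cmod (P21 x (L n)) \<le> D" "cmod (P22 x (L n)) \<le> D"
    "cmod (L n * P12 x (L n)) \<le> D" "cmod (- P11 x (L n)) \<le> D" if x: "x \<in> {0..pi}" for x n
    using bP[OF x, of n] b21[OF x, of n] bL12[OF x, of n] D by auto
  \<comment> \<open>In the equation for \<open>P12\<close> the left side and the term with
    \<open>P12\<close> vanish in the limit, which leaves \<open>k22 = k11\<close> almost
    everywhere.\<close>
  have "primitive_on 0 pi (\<lambda>_. 0) (\<lambda>t. k22 t - k11 t)"
  proof (rule primitive_on_limit[OF P_primitives(2)[of "L n" for n] h])
    fix n t assume t: "t \<in> {0..pi}"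
    show "cmod ((\<sigma> t + \<sigma>t t) * P12 t (L n) + P22 t (L n) - P11 t (L n)) \<le> h t"
      using comb[OF sbound(2) sbound(6,7),
          where a = "P12 t (L n)" and b = 0 and c = 0
            and d = "P22 t (L n)" and e = "- P11 t (L n)"]
        bD[OF t, of n] D(5) by simp
  next
    fix t assume t: "t \<in> {0..pi}"
    have "(\<lambda>n. (\<sigma> t + \<sigma>t t) * P12 t (L n) + P22 t (L n) - P11 t (L n)) \<longlonglongrightarrow> (\<sigma> t + \<sigma>t t) * 0 + k22 t - k11 t"
      by (intro tendsto_intros lim11 lim12 lim22 t)
    then show "(\<lambda>n. (\<sigma> t + \<sigma>t t) * P12 t (L n) + P22 t (L n) - P11 t (L n)) \<longlonglongrightarrow> k22 t - k11 t" by simp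
  qed (rule lim12)
  from primitive_on_constant_imp_AE_zero[OF this refl] obtain N1 where
    N1: "negligible N1" "\<forall>x\<in>{0..pi} - N1. k22 x - k11 x = 0" by blast
  \<comment> \<open>Although \<open>P12\<close> tends to 0, the product \<open>l * P12\<close> tends
    to \<open>mean ff\<close>, and this is where the mean enters the equation.\<close>
  have prim11: "primitive_on 0 pi k11 (\<lambda>t. (\<sigma> t - \<sigma>t t) * k11 t + k21 t + mean ff t)"
  proof (rule primitive_on_limit[OF P_primitives(1)[of "L n" for n] h])
    fix n t assume t: "t \<in> {0..pi}"
    have eq: "(\<sigma> t - \<sigma>t t) * P11 t (L n) + P21 t (L n) + ((\<sigma>t t)\<^sup>2 + L n) * P12 t (L n) =
        (\<sigma> t - \<sigma>t t) * P11 t (L n) + 0 * 0 + (\<sigma>t t)\<^sup>2 * P12 t (L n) + P21 t (L n) + L n * P12 t (L n)"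
      by (simp add: algebra_simps)
    show "cmod ((\<sigma> t - \<sigma>t t) * P11 t (L n) + P21 t (L n) + ((\<sigma>t t)\<^sup>2 + L n) * P12 t (L n)) \<le> h t"
      unfolding eq using comb[OF sbound(1,6,5),
          where a = "P11 t (L n)" and b = 0 and c = "P12 t (L n)"
            and d = "P21 t (L n)" and e = "L n * P12 t (L n)"]
        bD[OF t, of n] D(5)
      by simp
  next
    fix t assume t: "t \<in> {0..pi}"
    have "(\<lambda>n. (\<sigma> t - \<sigma>t t) * P11 t (L n) + P21 t (L n) + ((\<sigma>t t)\<^sup>2 * P12 t (L n) + L n * P12 t (L n))) \<longlonglongrightarrow>
        (\<sigma> t - \<sigma>t t) * k11 t + k21 t + ((\<sigma>t t)\<^sup>2 * 0 + mean ff t)"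
      by (intro tendsto_intros lim11 lim12 lim21 limL12 t)
    then show "(\<lambda>n. (\<sigma> t - \<sigma>t t) * P11 t (L n) + P21 t (L n) + ((\<sigma>t t)\<^sup>2 + L n) * P12 t (L n)) \<longlonglongrightarrow>
        (\<sigma> t - \<sigma>t t) * k11 t + k21 t + mean ff t"
      by (simp add: distrib_right)
  qed (rule lim11)
  have c11: "continuous_on {0..pi} k11" by (rule primitive_on_continuous[OF prim11])
  \<comment> \<open>From \<open>k11 * k22 = 1\<close> and \<open>k22 = k11\<close> almost
    everywhere; continuity of \<open>k11\<close> removes the exceptional set.\<close>
  have sq11: "k11 x * k11 x - 1 = 0" if x: "x \<in> {0..pi}" for x
  proof (rule continuous_AE_zero_imp_zero[OF pi_gt_zero _ N1(1) _ x])
    show "continuous_on {0..pi} (\<lambda>x. k11 x * k11 x - 1)" by (intro continuous_intros c11)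
    show "\<forall>x\<in>{0..pi} - N1. k11 x * k11 x - 1 = 0"
    proof
      fix x assume x: "x \<in> {0..pi} - N1"
      then have "k22 x = k11 x" using N1(2) by auto
      then show "k11 x * k11 x - 1 = 0" using det[of x] x by auto
    qed
  qed
  have at0: "transform fg 0 l = 0" "transform gg 0 l = 0" for l
    by (simp_all add: transform_def phi_sl_system[OF sq] phi_sl_system[OF sqt] circle_mean_def)
  have zero_in: "0 \<in> {0..pi}" by simp
  have k11_0: "k11 0 = 1"
    using k11[OF zero_in L1', of 0]
    by (simp add: at0 P11_def phi_sl_system[OF sq] phi_sl_system[OF sqt] S_sl_system[OF sq] S_sl_system[OF sqt])
  have k21_0: "k21 0 = 0"
    using k21[OF zero_in L1', of 0]
    by (simp add: at0 P21_def phi_sl_system[OF sq] phi_sl_system[OF sqt] S_sl_system[OF sq] S_sl_system[OF sqt])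
  have "k11 ` {0..pi} \<subseteq> {1, - 1}"
  proof
    fix w assume "w \<in> k11 ` {0..pi}"
    then obtain x where "x \<in> {0..pi}" "w = k11 x" by blast
    then have "w\<^sup>2 = 1" using sq11[of x] by (simp add: power2_eq_square)
    then show "w \<in> {1, - 1}" by (simp add: power2_eq_1_iff)
  qed
  then have "finite (k11 ` {0..pi})" by (rule finite_subset) auto
  \<comment> \<open>A continuous function on an interval with values 1 and -1 is constant; the
    initial values at 0 select 1.\<close>
  then have "k11 constant_on {0..pi}"
    by (intro continuous_finite_range_constant c11) auto
  then have k11_1: "k11 x = 1" if "x \<in> {0..pi}" for x
    using k11_0 that zero_in unfolding constant_on_def by metis
  have k22_1: "k22 x = 1" if "x \<in> {0..pi}" for x
    using det[OF that] k11_1[OF that] by simp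
  \<comment> \<open>As \<open>k11\<close> is constant, its derivative vanishes. This is the formula
    for the difference of the potentials, with \<open>k21\<close> still to be found.\<close>
  obtain N2 where N2: "negligible N2" "\<forall>x\<in>{0..pi} - N2. (\<sigma> x - \<sigma>t x) * k11 x + k21 x + mean ff x = 0"
    using primitive_on_constant_imp_AE_zero[OF prim11 k11_1] by blast
  \<comment> \<open>The limit of \<open>l * (P22 - P11)\<close>. It occurs in the equations for both
    \<open>k21\<close> and \<open>mean ff\<close> and cancels in their difference, so its value is
    never computed.\<close>
  define q where "q x = mean gf x + mean fg x" for x
  have Lq: "L n * (P22 x (L n) - P11 x (L n)) = L n * transform gf x (L n) + L n * transform fg x (L n)"
    if x: "x \<in> {0..pi}" for x n
    unfolding k22[OF x L1'] k11[OF x L1'] k11_1[OF x] k22_1[OF x] by (simp add: algebra_simps)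
  have limq: "(\<lambda>n. L n * (P22 x (L n) - P11 x (L n))) \<longlonglongrightarrow> q x" if x: "x \<in> {0..pi}" for x
    unfolding Lq[OF x] q_def by (intro tendsto_add T adm x)
  have bq: "cmod (L n * (P22 x (L n) - P11 x (L n))) \<le> D" if x: "x \<in> {0..pi}" for x n
  proof -
    have "cmod (L n * transform gf x (L n)) \<le> Bgf" "cmod (L n * transform fg x (L n)) \<le> Bfg"
      using Bgf(2) Bfg(2) x L1[of n] by auto
    then show ?thesis unfolding Lq[OF x]
      using norm_triangle_ineq[of "L n * transform gf x (L n)" "L n * transform fg x (L n)"] D(4) by linarith
  qed
  have prim21: "primitive_on 0 pi k21 (\<lambda>t. - (\<sigma> t + \<sigma>t t) * k21 t + - (\<sigma> t)\<^sup>2 * k11 t + (\<sigma>t t)\<^sup>2 * k22 t + q t)"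
  proof (rule primitive_on_limit[OF P_primitives(3)[of "L n" for n] h])
    fix n t
    have "- (\<sigma> t + \<sigma>t t) * P21 t (L n) - ((\<sigma> t)\<^sup>2 + L n) * P11 t (L n) + ((\<sigma>t t)\<^sup>2 + L n) * P22 t (L n) =
      - (\<sigma> t + \<sigma>t t) * P21 t (L n) + - (\<sigma> t)\<^sup>2 * P11 t (L n) + (\<sigma>t t)\<^sup>2 * P22 t (L n) + L n * (P22 t (L n) - P11 t (L n))"
      for t n by (simp add: algebra_simps)
    note eq = this
    {
      assume t: "t \<in> {0..pi}"
      show "cmod (- (\<sigma> t + \<sigma>t t) * P21 t (L n) - ((\<sigma> t)\<^sup>2 + L n) * P11 t (L n) + ((\<sigma>t t)\<^sup>2 + L n) * P22 t (L n)) \<le> h t"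
        unfolding eq
        using comb[OF sbound(3,4,5),
            where a = "P21 t (L n)" and b = "P11 t (L n)" and c = "P22 t (L n)"
              and d = "L n * (P22 t (L n) - P11 t (L n))" and e = 0]
          bD[OF t, of n] D(5) bq[OF t, of n] by simp
    }
    {
      assume t: "t \<in> {0..pi}"
      show "(\<lambda>n. - (\<sigma> t + \<sigma>t t) * P21 t (L n) - ((\<sigma> t)\<^sup>2 + L n) * P11 t (L n) + ((\<sigma>t t)\<^sup>2 + L n) * P22 t (L n)) \<longlonglongrightarrow>
        - (\<sigma> t + \<sigma>t t) * k21 t + - (\<sigma> t)\<^sup>2 * k11 t + (\<sigma>t t)\<^sup>2 * k22 t + q t"
        unfolding eq by (intro tendsto_add tendsto_mult tendsto_const lim11 lim21 lim22 limq t)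
    }
  qed (rule lim21)
  \<comment> \<open>The equation for \<open>P12\<close> once more, multiplied by \<open>l\<close>
    before passing to the limit: comparison at the order \<open>1 / l\<close>.\<close>
  have primff: "primitive_on 0 pi (mean ff) (\<lambda>t. (\<sigma> t + \<sigma>t t) * mean ff t + q t)"
  proof (rule primitive_on_limit[OF primitive_on_cmult[OF P_primitives(2)[of "L n" for n], of "L n" for n] h])
    fix n t
    have "L n * ((\<sigma> t + \<sigma>t t) * P12 t (L n) + P22 t (L n) - P11 t (L n)) =
      (\<sigma> t + \<sigma>t t) * (L n * P12 t (L n)) + L n * (P22 t (L n) - P11 t (L n))" for t n
      by (simp add: algebra_simps)
    note eq = this
    {
      assume t: "t \<in> {0..pi}"
      show "cmod (L n * ((\<sigma> t + \<sigma>t t) * P12 t (L n) + P22 t (L n) - P11 t (L n))) \<le> h t"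
        unfolding eq
        using comb[OF sbound(2,6,7),
            where a = "L n * P12 t (L n)" and b = 0 and c = 0
              and d = "L n * (P22 t (L n) - P11 t (L n))" and e = 0]
          bD[OF t, of n] D(5) bq[OF t, of n] by simp
    }
    {
      assume t: "t \<in> {0..pi}"
      show "(\<lambda>n. L n * ((\<sigma> t + \<sigma>t t) * P12 t (L n) + P22 t (L n) - P11 t (L n))) \<longlonglongrightarrow>
        (\<sigma> t + \<sigma>t t) * mean ff t + q t"
        unfolding eq by (intro tendsto_add tendsto_mult tendsto_const limL12 limq t)
    }
  qed (rule limL12)
  have k21_eq: "k21 x = mean ff x - mean ff 0" if x: "x \<in> {0..pi}" for x
  proof -
    \<comment> \<open>Eliminating \<open>mean ff\<close> by the relation for the potentials reduces
      the derivative of the difference to an algebraic identity, so \<open>k21\<close> and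
      \<open>mean ff\<close> differ by their values at 0.\<close>
    have "k21 x - mean ff x = k21 0 - mean ff 0"
    proof (rule primitive_on_AE_zero_imp_constant[OF primitive_on_diff[OF prim21 primff] N2(1) _ x], rule ballI)
      fix t assume t: "t \<in> {0..pi} - N2"
      have 1: "k11 t = 1" "k22 t = 1" using k11_1 k22_1 t by auto
      have "(\<sigma> t - \<sigma>t t) * k11 t + k21 t + mean ff t = 0" using N2(2) t by blast
      then have "mean ff t = \<sigma>t t - \<sigma> t - k21 t" unfolding 1 by algebra
      then show "- (\<sigma> t + \<sigma>t t) * k21 t + - (\<sigma> t)\<^sup>2 * k11 t + (\<sigma>t t)\<^sup>2 * k22 t + q t -
          ((\<sigma> t + \<sigma>t t) * mean ff t + q t) = 0"
        unfolding 1 by algebra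
    qed
    then show ?thesis using k21_0 by (simp add: algebra_simps)
  qed
  show "P11 x l = 1 - transform fg x l" "P12 x l = transform ff x l"
    "P21 x l = mean ff x - mean ff 0 - transform gg x l" "P22 x l = 1 + transform gf x l"
    if x: "x \<in> {0..pi}" and l: "cmod l > R" for x l
    using k11[OF x l] k12[OF x l] k21[OF x l] k22[OF x l] k11_1[OF x] k12_0[OF x] k21_eq[OF x] k22_1[OF x] by simp_all
  show "\<exists>N. negligible N \<and> (\<forall>x\<in>{0..pi} - N. \<sigma> x = \<sigma>t x - (2 * mean ff x - mean ff 0))"
  proof (intro exI[of _ N2] conjI ballI N2(1))
    fix x assume x: "x \<in> {0..pi} - N2"
    have 1: "k11 x = 1" "k21 x = mean ff x - mean ff 0" using k11_1 k21_eq x by auto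
    have "(\<sigma> x - \<sigma>t x) * k11 x + k21 x + mean ff x = 0" using N2(2) x by blast
    then show "\<sigma> x = \<sigma>t x - (2 * mean ff x - mean ff 0)" unfolding 1 by algebra
  qed
qed

section \<open>Formulas for the potential and the boundary polynomials\<close>

lemma mean_ff_0: "mean ff 0 = circle_mean R m"
  by (simp add: mean_def phi_sl_system[OF sq] phi_sl_system[OF sqt])

text \<open>The \<open>- 1\<close> in the integrand is the mean at \<open>x = 0\<close>, where both
  \<open>phi\<close> equal 1.\<close>

lemma potential_difference:
  assumes x: "x \<in> {0..pi}"
  shows "circle_mean R (\<lambda>\<mu>. (2 * phi \<sigma>t x \<mu> * phi \<sigma> x \<mu> - 1) * m \<mu>) = 2 * mean ff x - mean ff 0"
proof -
  note c = admissible_sphere[OF admissible_products(1) x]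
  have cm: "continuous_on (sphere 0 R) m"
    using principal_at_infinity_sphere[OF m, of "\<lambda>_. 1"] by simp
  have "circle_mean R (\<lambda>\<mu>. (2 * phi \<sigma>t x \<mu> * phi \<sigma> x \<mu> - 1) * m \<mu>) = circle_mean R (\<lambda>\<mu>. 2 * (m \<mu> * ff x \<mu>) - m \<mu>)"
    by (simp add: algebra_simps)
  also have "\<dots> = 2 * mean ff x - circle_mean R m"
    using circle_mean_diff[OF R continuous_on_mult_left[OF c, of 2] cm] circle_mean_cmult[OF R c, of 2]
    by (simp add: mean_def)
  finally show ?thesis by (simp add: mean_ff_0)
qed

text \<open>By the Wronskian identity at \<open>pi\<close>, the pair \<open>(Delta1, Delta0)\<close>
  can be solved for \<open>(r1, r2)\<close>. Once both are expressed through the second problem, the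
  coefficients of its polynomials assemble to the entries of \<open>P\<close> at
  \<open>pi\<close>.\<close>

lemma boundary_polynomials:
  assumes z: "cmod z > R"
    and D1: "Delta1 \<sigma> r1 r2 z = c * Delta1 \<sigma>t r1t r2t z"
    and D0: "Delta0 \<sigma> r1 r2 z = c * (Delta0 \<sigma>t r1t r2t z - m z * Delta1 \<sigma>t r1t r2t z)"
  shows "poly r1 z = c * (poly r1t z - circle_mean R (\<lambda>\<mu>.
      (poly r1t z * phi_qd \<sigma>t pi \<mu> + poly r2t z * phi \<sigma>t pi \<mu>) / (z - \<mu>) * phi \<sigma> pi \<mu> * m \<mu>))"
    "poly r2 z = c * (poly r2t z - poly r1t z * circle_mean R (\<lambda>\<mu>. (phi \<sigma>t pi \<mu> * phi \<sigma> pi \<mu> - 1) * m \<mu>)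
      + circle_mean R (\<lambda>\<mu>.
      (poly r1t z * phi_qd \<sigma>t pi \<mu> + poly r2t z * phi \<sigma>t pi \<mu>) / (z - \<mu>) * phi_qd \<sigma> pi \<mu> * m \<mu>))"
proof -
  have x: "pi \<in> {0..pi}" by simp
  note tr = transfer_matrix(1-4)[OF x z]
  have w: "phi \<sigma> pi z * S_qd \<sigma> pi z - phi_qd \<sigma> pi z * S \<sigma> pi z = 1"
    using wronskian_constant[OF phi_sl_system(1)[OF sq] S_sl_system(1)[OF sq] x, of z]
    by (simp add: phi_sl_system[OF sq] S_sl_system[OF sq])
  have k: "continuous_on (sphere 0 R) (\<lambda>\<mu>. m \<mu> * f pi \<mu> / (z - \<mu>))" if "admissible f" for f
    by (rule continuous_on_cauchy_kernel[OF z admissible_sphere[OF that x]])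
  note adm = admissible_products
  have lin: "circle_mean R (\<lambda>\<mu>. (poly r1t z * phi_qd \<sigma>t pi \<mu> + poly r2t z * phi \<sigma>t pi \<mu>) / (z - \<mu>) * u pi \<mu> * m \<mu>)
      = poly r1t z * transform (\<lambda>x \<mu>. u x \<mu> * phi_qd \<sigma>t x \<mu>) pi z + poly r2t z * transform (\<lambda>x \<mu>. u x \<mu> * phi \<sigma>t x \<mu>) pi z"
    if a: "admissible (\<lambda>x \<mu>. u x \<mu> * phi_qd \<sigma>t x \<mu>)" "admissible (\<lambda>x \<mu>. u x \<mu> * phi \<sigma>t x \<mu>)" for u
  proof -
    have "circle_mean R (\<lambda>\<mu>. (poly r1t z * phi_qd \<sigma>t pi \<mu> + poly r2t z * phi \<sigma>t pi \<mu>) / (z - \<mu>) * u pi \<mu> * m \<mu>) =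
        circle_mean R (\<lambda>\<mu>. poly r1t z * (m \<mu> * (u pi \<mu> * phi_qd \<sigma>t pi \<mu>) / (z - \<mu>)) +
          poly r2t z * (m \<mu> * (u pi \<mu> * phi \<sigma>t pi \<mu>) / (z - \<mu>)))"
      by (rule arg_cong[of _ _ "circle_mean R"]) (auto simp: fun_eq_iff add_divide_distrib algebra_simps)
    also have "\<dots> = poly r1t z * transform (\<lambda>x \<mu>. u x \<mu> * phi_qd \<sigma>t x \<mu>) pi z +
        poly r2t z * transform (\<lambda>x \<mu>. u x \<mu> * phi \<sigma>t x \<mu>) pi z"
      unfolding transform_def
        circle_mean_add[OF R continuous_on_mult_left[OF k[OF a(1)]] continuous_on_mult_left[OF k[OF a(2)]]]
        circle_mean_cmult[OF R k[OF a(1)]] circle_mean_cmult[OF R k[OF a(2)]] ..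
    finally show ?thesis .
  qed
  have mn: "circle_mean R (\<lambda>\<mu>. (phi \<sigma>t pi \<mu> * phi \<sigma> pi \<mu> - 1) * m \<mu>) = mean ff pi - mean ff 0"
  proof -
    note cf = admissible_sphere[OF adm(1) x]
    have cm: "continuous_on (sphere 0 R) m"
      using principal_at_infinity_sphere[OF m, of "\<lambda>_. 1"] by simp
    have "circle_mean R (\<lambda>\<mu>. (phi \<sigma>t pi \<mu> * phi \<sigma> pi \<mu> - 1) * m \<mu>) = circle_mean R (\<lambda>\<mu>. m \<mu> * ff pi \<mu> - m \<mu>)"
      by (simp add: algebra_simps)
    then show ?thesis using circle_mean_diff[OF R cf cm] by (simp add: mean_def mean_ff_0[unfolded mean_def])
  qed
  have "poly r1 z = poly r1 z * (phi \<sigma> pi z * S_qd \<sigma> pi z - phi_qd \<sigma> pi z * S \<sigma> pi z)" unfolding w by simp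
  also have "\<dots> = phi \<sigma> pi z * Delta0 \<sigma> r1 r2 z - S \<sigma> pi z * Delta1 \<sigma> r1 r2 z"
    unfolding Delta0_def Delta1_def by algebra
  also have "\<dots> = c * (poly r1t z * P11 pi z - poly r2t z * P12 pi z)"
    unfolding D0 D1 unfolding Delta0_def Delta1_def P11_def P12_def by algebra
  finally have "poly r1 z = c * (poly r1t z - (poly r1t z * transform fg pi z + poly r2t z * transform ff pi z))"
    unfolding tr by (simp add: algebra_simps)
  then show "poly r1 z = c * (poly r1t z - circle_mean R (\<lambda>\<mu>.
      (poly r1t z * phi_qd \<sigma>t pi \<mu> + poly r2t z * phi \<sigma>t pi \<mu>) / (z - \<mu>) * phi \<sigma> pi \<mu> * m \<mu>))"
    unfolding lin[of "phi \<sigma>", OF adm(2,1)] .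
  have "poly r2 z = poly r2 z * (phi \<sigma> pi z * S_qd \<sigma> pi z - phi_qd \<sigma> pi z * S \<sigma> pi z)" unfolding w by simp
  also have "\<dots> = S_qd \<sigma> pi z * Delta1 \<sigma> r1 r2 z - phi_qd \<sigma> pi z * Delta0 \<sigma> r1 r2 z"
    unfolding Delta0_def Delta1_def by algebra
  also have "\<dots> = c * (poly r2t z * P22 pi z - poly r1t z * P21 pi z)"
    unfolding D0 D1 unfolding Delta0_def Delta1_def P21_def P22_def by algebra
  finally have "poly r2 z = c * (poly r2t z - poly r1t z * (mean ff pi - mean ff 0) +
      (poly r1t z * transform gg pi z + poly r2t z * transform gf pi z))"
    unfolding tr by (simp add: algebra_simps)
  then show "poly r2 z = c * (poly r2t z - poly r1t z * circle_mean R (\<lambda>\<mu>. (phi \<sigma>t pi \<mu> * phi \<sigma> pi \<mu> - 1) * m \<mu>)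
      + circle_mean R (\<lambda>\<mu>.
      (poly r1t z * phi_qd \<sigma>t pi \<mu> + poly r2t z * phi \<sigma>t pi \<mu>) / (z - \<mu>) * phi_qd \<sigma> pi \<mu> * m \<mu>))"
    unfolding lin[of "phi_qd \<sigma>", OF adm(4,3)] mn .
qed

text \<open>Away from the zeros of both characteristic functions this is the relation of the Weyl
  functions cleared of denominators. Common eigenvalues may lie outside the circle, but zeros are
  isolated and both sides are continuous there.\<close>

lemma Delta0_relation:
  assumes A: "continuous_on UNIV A" and B: "continuous_on UNIV B"
    and D1: "\<And>z. Delta1 \<sigma> r1 r2 z * B z = Delta1 \<sigma>t r1t r2t z * A z"
    and z: "cmod z > R"
  shows "Delta0 \<sigma> r1 r2 z * B z = A z * (Delta0 \<sigma>t r1t r2t z - m z * Delta1 \<sigma>t r1t r2t z)"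
proof -
  define K where "K z = Delta0 \<sigma> r1 r2 z * B z - A z * (Delta0 \<sigma>t r1t r2t z - m z * Delta1 \<sigma>t r1t r2t z)" for z
  define U where "U = {z::complex. R < cmod z}"
  have U: "open U" "z \<in> U" using z by (auto simp: U_def intro!: open_Collect_less continuous_intros)
  have "continuous_on U m"
    by (rule continuous_on_subset[of "{z. R \<le> cmod z}"]) (use m in \<open>auto simp: principal_at_infinity_def U_def\<close>)
  moreover have "continuous_on U A" "continuous_on U B" using A B continuous_on_subset by blast+
  moreover have "continuous_on U (Delta1 \<sigma>t r1t r2t)" "continuous_on U (Delta0 \<sigma>t r1t r2t)" "continuous_on U (Delta0 \<sigma> r1 r2)"
    by (auto intro: holomorphic_on_imp_continuous_on Delta1_holomorphic sq sqt)
  ultimately have "continuous_on U K" unfolding K_def by (intro continuous_intros)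
  then have "isCont K z" using U continuous_on_eq_continuous_at by blast
  then have lim: "K \<midarrow>z\<rightarrow> K z" by (simp add: isCont_def)
  obtain w1 w2 where "Delta1 \<sigma> r1 r2 w1 \<noteq> 0" "Delta1 \<sigma>t r1t r2t w2 \<noteq> 0"
    using Delta1_not_zero[OF sq cl] Delta1_not_zero[OF sqt clt] by blast
  then have "\<forall>\<^sub>F x in at z. Delta1 \<sigma> r1 r2 x \<noteq> 0" "\<forall>\<^sub>F x in at z. Delta1 \<sigma>t r1t r2t x \<noteq> 0"
    by (auto intro!: eventually_nonzero_entire Delta1_holomorphic sq sqt)
  then have "\<forall>\<^sub>F x in at z. K x = 0"
  proof eventually_elim
    case (elim x)
    define a where "a = Delta1 \<sigma> r1 r2 x"
    define b where "b = Delta1 \<sigma>t r1t r2t x"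
    have ab: "a \<noteq> 0" "b \<noteq> 0" using elim by (auto simp: a_def b_def)
    have "- Delta0 \<sigma> r1 r2 x / a + Delta0 \<sigma>t r1t r2t x / b = m x"
      using weyl[OF elim] by (simp add: weyl_M_def a_def b_def)
    then have "(- Delta0 \<sigma> r1 r2 x / a + Delta0 \<sigma>t r1t r2t x / b) * (a * b) = m x * (a * b)" by (simp only:)
    moreover have "(- u / a + v / b) * (a * b) = - u * b + a * v" for u v using ab by (simp add: field_simps)
    ultimately have "- Delta0 \<sigma> r1 r2 x * b + a * Delta0 \<sigma>t r1t r2t x = m x * (a * b)" by (simp only:)
    then have e: "Delta0 \<sigma> r1 r2 x * b = a * (Delta0 \<sigma>t r1t r2t x - m x * b)" by algebra
    have "b * K x = (Delta0 \<sigma> r1 r2 x * b) * B x - (b * A x) * (Delta0 \<sigma>t r1t r2t x - m x * b)"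
      by (simp add: K_def b_def algebra_simps)
    also have "\<dots> = 0" unfolding e using D1[of x] unfolding a_def b_def by algebra
    finally show "K x = 0" using ab by simp
  qed
  then have "K \<midarrow>z\<rightarrow> 0" by (rule tendsto_eventually)
  then have "K z = 0" using lim LIM_unique by blast
  then show ?thesis by (simp add: K_def)
qed

end

section \<open>The spectral data\<close>

lemma prod_ratio_tendsto_1:
  fixes a b :: "nat \<Rightarrow> complex"
  assumes "finite I"
  shows "((\<lambda>z. \<Prod>k\<in>I. (z - b k) / (z - a k)) \<longlongrightarrow> 1) at_infinity"
proof -
  have "((\<lambda>z. (z - b k) / (z - a k)) \<longlongrightarrow> 1) at_infinity" for k
  proof -
    have "filterlim (\<lambda>z. - a k + z) at_infinity at_infinity"
      by (rule tendsto_add_filterlim_at_infinity[OF tendsto_const filterlim_ident])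
    then have "((\<lambda>z. 1 + (a k - b k) / (- a k + z)) \<longlongrightarrow> 1 + 0) at_infinity"
      by (intro tendsto_add tendsto_const tendsto_divide_0[OF tendsto_const])
    moreover have "\<forall>\<^sub>F z in at_infinity. 1 + (a k - b k) / (- a k + z) = (z - b k) / (z - a k)"
      unfolding eventually_at_infinity
    proof (intro exI[of _ "cmod (a k) + 1"] allI impI)
      fix z assume "cmod (a k) + 1 \<le> cmod z"
      then have "z - a k \<noteq> 0" by auto
      then show "1 + (a k - b k) / (- a k + z) = (z - b k) / (z - a k)"
        by (simp add: field_simps)
    qed
    ultimately show ?thesis by (simp add: tendsto_cong)
  qed
  then have "((\<lambda>z. \<Prod>k\<in>I. (z - b k) / (z - a k)) \<longlongrightarrow> (\<Prod>k\<in>I. 1)) at_infinity"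
    by (intro tendsto_prod)
  then show ?thesis by simp
qed

lemma zorder_prod_linear:
  fixes a :: "nat \<Rightarrow> complex"
  assumes I: "finite I" and f: "f holomorphic_on UNIV" "f w \<noteq> 0"
  shows "zorder (\<lambda>x. f x * (\<Prod>k\<in>I. x - a k)) z = zorder f z + int (card {k\<in>I. a k = z})"
proof -
  have "\<forall>\<^sub>F x in at z. x - b \<noteq> 0" for b
    by (rule eventually_nonzero_entire[where w = "b + 1"]) (intro holomorphic_intros, simp)
  then have ev: "\<forall>\<^sub>F x in at z. (\<Prod>k\<in>I. x - a k) \<noteq> 0"
    using I by (simp add: prod_zero_iff eventually_ball_finite_distrib)
  have fa: "f analytic_on {z}"
    using f(1) analytic_on_open[OF open_UNIV, of f] analytic_on_subset by blast
  have ev': "\<forall>\<^sub>F x in at z. f x * (\<Prod>k\<in>I. x - a k) \<noteq> 0"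
    using ev eventually_nonzero_entire[OF f] by eventually_elim simp
  have lin: "zorder (\<lambda>x. x - b) z = (if b = z then 1 else 0)" for b
  proof (cases "b = z")
    case True
    have "zorder (\<lambda>x. x - z) z = 1"
      by (rule zorder_eqI[OF open_UNIV UNIV_I, of "\<lambda>_. 1"]) auto
    then show ?thesis using True by simp
  next
    case False
    then show ?thesis by (simp add: zorder_eq_0I analytic_intros)
  qed
  have "zorder (\<lambda>x. f x * (\<Prod>k\<in>I. x - a k)) z = zorder f z + zorder (\<lambda>x. \<Prod>k\<in>I. x - a k) z"
    by (rule zorder_times_analytic[OF fa _ ev']) (intro analytic_intros)
  also have "zorder (\<lambda>x. \<Prod>k\<in>I. x - a k) z = (\<Sum>k\<in>I. zorder (\<lambda>x. x - a k) z)"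
    by (rule zorder_prod_analytic[OF _ ev]) (intro analytic_intros)
  also have "\<dots> = int (card {k\<in>I. a k = z})"
    unfolding lin using I by (simp add: sum.If_cases Int_def)
  finally show ?thesis .
qed

text \<open>The order at any point is the number of indices carrying that value; at a point that is
  not an eigenvalue both are 0. In this form orders can be compared without naming
  eigenvalues.\<close>

lemma zorder_Delta1:
  assumes \<sigma>: "sq_integrable \<sigma>" and ev: "eigenvalue_seq p \<sigma> r1 r2 ev"
  shows "zorder (Delta1 \<sigma> r1 r2) z = int (card {k. 1 \<le> k \<and> ev k = z})" "finite {k. 1 \<le> k \<and> ev k = z}"
proof -
  have im: "ev ` {1..} = {\<mu>. Delta1 \<sigma> r1 r2 \<mu> = 0}"
    and fin: "\<forall>n\<ge>1. finite {k. 1 \<le> k \<and> ev k = ev n} \<and> int (Defs.mult ev n) = zorder (Delta1 \<sigma> r1 r2) (ev n)"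
    using ev unfolding eigenvalue_seq_def by blast+
  have "zorder (Delta1 \<sigma> r1 r2) z = int (card {k. 1 \<le> k \<and> ev k = z}) \<and> finite {k. 1 \<le> k \<and> ev k = z}"
  proof (cases "Delta1 \<sigma> r1 r2 z = 0")
    case True
    then obtain n where "n \<ge> 1" "z = ev n" using im by force
    then show ?thesis using fin by (auto simp: Defs.mult_def)
  next
    case False
    then have e: "{k. 1 \<le> k \<and> ev k = z} = {}" using im by force
    have "Delta1 \<sigma> r1 r2 analytic_on {z}"
      using Delta1_holomorphic(1)[OF \<sigma>, of r1 r2 UNIV] analytic_on_open[OF open_UNIV] analytic_on_subset by blast
    then have "zorder (Delta1 \<sigma> r1 r2) z = 0" using False by (rule zorder_eq_0I)
    then show ?thesis unfolding e by simp
  qed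
  then show "zorder (Delta1 \<sigma> r1 r2) z = int (card {k. 1 \<le> k \<and> ev k = z})" "finite {k. 1 \<le> k \<and> ev k = z}" by auto
qed

lemma card_split_at:
  fixes ev :: "nat \<Rightarrow> complex"
  assumes "finite {k. 1 \<le> k \<and> ev k = z}"
  shows "card {k. 1 \<le> k \<and> ev k = z} = card {k\<in>{1..<N}. ev k = z} + card {k. 1 \<le> k \<and> N \<le> k \<and> ev k = z}"
proof -
  have "{k. 1 \<le> k \<and> ev k = z} = {k\<in>{1..<N}. ev k = z} \<union> {k. 1 \<le> k \<and> N \<le> k \<and> ev k = z}" by auto
  moreover have "finite {k. 1 \<le> k \<and> N \<le> k \<and> ev k = z}" by (rule finite_subset[OF _ assms]) auto
  ultimately show ?thesis by (simp only:) (rule card_Un_disjoint, auto)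
qed

text \<open>The numerator of the difference is at most \<open>7/2 * d\<close> and the denominator at
  least \<open>1/2\<close>, which gives 7 and leaves room up to 8.\<close>

lemma cmod_quotient_near_1:
  fixes a b c :: complex
  assumes "cmod (a - 1) \<le> d" "cmod (b - 1) \<le> d" "cmod (c - 1) \<le> d" "d \<le> 1 / 2"
  shows "b \<noteq> 0" "cmod (a * c / b - 1) \<le> 8 * d"
proof -
  have d: "0 \<le> d" using assms(1) norm_ge_zero order_trans by blast
  have b: "cmod b \<ge> 1 / 2" using norm_triangle_ineq2[of 1 "1 - b"] assms(2,4) by (simp add: norm_minus_commute)
  then show b0: "b \<noteq> 0" by auto
  have a: "cmod a \<le> 3 / 2" using norm_triangle_ineq[of 1 "a - 1"] assms(1,4) by simp
  have "a * c / b - 1 = (a * (c - 1) + (a - 1) - (b - 1)) / b" using b0 by (simp add: field_simps)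
  then have "cmod (a * c / b - 1) = cmod (a * (c - 1) + (a - 1) - (b - 1)) / cmod b" by (simp add: norm_divide)
  also have "\<dots> \<le> (3 / 2 * d + d + d) / (1 / 2)"
  proof (rule frac_le)
    have "cmod (a * (c - 1) + (a - 1) - (b - 1)) \<le> cmod (a * (c - 1)) + cmod (a - 1) + cmod (b - 1)"
      using norm_triangle_ineq4[of "a * (c - 1) + (a - 1)" "b - 1"] norm_triangle_ineq[of "a * (c - 1)" "a - 1"] by simp
    moreover have "cmod (a * (c - 1)) \<le> 3 / 2 * d" unfolding norm_mult using a assms(3) by (intro mult_mono) auto
    ultimately show "cmod (a * (c - 1) + (a - 1) - (b - 1)) \<le> 3 / 2 * d + d + d" using assms by linarith
  qed (use b d in auto)
  also have "\<dots> \<le> 8 * d" using d by simp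
  finally show "cmod (a * c / b - 1) \<le> 8 * d" .
qed

text \<open>Each side is multiplied by the linear factors of the other problem, so both are entire
  with the same zeros. The characteristic functions share their leading term and the ratio of the
  linear factors tends to 1, hence the quotient tends to 1 on the squares.\<close>

lemma Delta1_ratio:
  assumes sq: "sq_integrable \<sigma>" and sqt: "sq_integrable \<sigma>t"
    and cl: "class_R p r1 r2" and clt: "class_R p r1t r2t"
    and ev: "eigenvalue_seq p \<sigma> r1 r2 ev" and evt: "eigenvalue_seq p \<sigma>t r1t r2t evt"
    and eq: "\<And>n. n \<ge> N \<Longrightarrow> ev n = evt n"
  shows "Delta1 \<sigma> r1 r2 z * (\<Prod>k=1..<N. z - evt k) = Delta1 \<sigma>t r1t r2t z * (\<Prod>k=1..<N. z - ev k)"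
proof -
  define f where "f z = Delta1 \<sigma> r1 r2 z * (\<Prod>k=1..<N. z - evt k)" for z
  define g where "g z = Delta1 \<sigma>t r1t r2t z * (\<Prod>k=1..<N. z - ev k)" for z
  have f: "f holomorphic_on UNIV" and g: "g holomorphic_on UNIV"
    unfolding f_def g_def by (intro holomorphic_intros Delta1_holomorphic sq sqt)+
  obtain w1 w2 where w: "Delta1 \<sigma> r1 r2 w1 \<noteq> 0" "Delta1 \<sigma>t r1t r2t w2 \<noteq> 0"
    using Delta1_not_zero[OF sq cl] Delta1_not_zero[OF sqt clt] by blast
  \<comment> \<open>Indices from \<open>N\<close> on carry the same values in both problems, and
    those below \<open>N\<close> are counted on each side once through \<open>Delta1\<close> and
    once through the product.\<close>
  have ord: "zorder f z = zorder g z" for z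
  proof -
    have "{k. 1 \<le> k \<and> N \<le> k \<and> ev k = z} = {k. 1 \<le> k \<and> N \<le> k \<and> evt k = z}" using eq by auto
    then show ?thesis
      unfolding f_def g_def zorder_prod_linear[OF finite_atLeastLessThan Delta1_holomorphic(1)[OF sq] w(1)]
        zorder_prod_linear[OF finite_atLeastLessThan Delta1_holomorphic(1)[OF sqt] w(2)]
        zorder_Delta1(1)[OF sq ev] zorder_Delta1(1)[OF sqt evt]
        card_split_at[OF zorder_Delta1(2)[OF sq ev], of z N] card_split_at[OF zorder_Delta1(2)[OF sqt evt], of z N]
      by simp
  qed
  have small: "\<exists>n0. \<forall>n\<ge>n0. \<forall>\<rho>\<in>square n. g (\<rho>\<^sup>2) \<noteq> 0 \<and> cmod (f (\<rho>\<^sup>2) / g (\<rho>\<^sup>2) - 1) \<le> e" if "e > 0" for e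
  proof -
    \<comment> \<open>The 8 is the loss in \<open>cmod_quotient_near_1\<close>; the accuracy
      \<open>d / 4\<close> below makes up for the factor \<open>1/4\<close> in the lower bound of
      the sine.\<close>
    define d where "d = min (1 / 2) (e / 8)"
    have d: "d > 0" "d \<le> 1 / 2" "8 * d \<le> e" using \<open>e > 0\<close> by (auto simp: d_def)
    have "d / 4 > 0" using d by simp
    obtain n1 where n1: "\<forall>n\<ge>n1. \<forall>\<rho>\<in>square n.
        cmod (Delta1 \<sigma> r1 r2 (\<rho>\<^sup>2) + \<rho> ^ (2 * p + 1) * sin (\<rho> * of_real pi)) \<le> d / 4 * (cmod \<rho> ^ (2 * p + 1) * exp (\<bar>Im \<rho>\<bar> * pi))"
      using Delta1_asymptotics[OF sq cl \<open>d / 4 > 0\<close>] by blast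
    obtain n2 where n2: "\<forall>n\<ge>n2. \<forall>\<rho>\<in>square n.
        cmod (Delta1 \<sigma>t r1t r2t (\<rho>\<^sup>2) + \<rho> ^ (2 * p + 1) * sin (\<rho> * of_real pi)) \<le> d / 4 * (cmod \<rho> ^ (2 * p + 1) * exp (\<bar>Im \<rho>\<bar> * pi))"
      using Delta1_asymptotics[OF sqt clt \<open>d / 4 > 0\<close>] by blast
    have "\<forall>\<^sub>F z in at_infinity. dist (\<Prod>k=1..<N. (z - evt k) / (z - ev k)) 1 < d"
      by (rule tendstoD[OF prod_ratio_tendsto_1 d(1)]) auto
    then obtain b where b: "\<And>z. cmod z \<ge> b \<Longrightarrow> cmod ((\<Prod>k=1..<N. (z - evt k) / (z - ev k)) - 1) < d"
      unfolding eventually_at_infinity dist_norm by blast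
    obtain n3 :: nat where n3: "real n3 \<ge> max b 1" using real_arch_simple by blast
    have "g (\<rho>\<^sup>2) \<noteq> 0 \<and> cmod (f (\<rho>\<^sup>2) / g (\<rho>\<^sup>2) - 1) \<le> e"
      if n: "n \<ge> max n1 (max n2 n3)" and \<rho>: "\<rho> \<in> square n" for n \<rho>
    proof -
      have r: "cmod \<rho> \<ge> b" "cmod \<rho> \<ge> 1" using square_cmod(1)[OF \<rho>] n n3 by auto
      have zb: "cmod (\<rho>\<^sup>2) \<ge> b"
        using mult_left_mono[OF r(2), of "cmod \<rho>"] r by (simp add: norm_mult power2_eq_square)
      define X where "X = - (\<rho> ^ (2 * p + 1) * sin (\<rho> * of_real pi))"
      have "cmod \<rho> ^ (2 * p + 1) * (exp (\<bar>Im \<rho>\<bar> * pi) / 4) \<le> cmod \<rho> ^ (2 * p + 1) * cmod (sin (\<rho> * of_real pi))"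
        by (intro mult_left_mono cmod_sin_ge_on_square[OF \<rho>]) auto
      then have Xge: "cmod \<rho> ^ (2 * p + 1) * exp (\<bar>Im \<rho>\<bar> * pi) \<le> 4 * cmod X"
        by (simp add: X_def norm_mult norm_power)
      have "cmod \<rho> ^ (2 * p + 1) * exp (\<bar>Im \<rho>\<bar> * pi) > 0"
        using r(2) by (intro mult_pos_pos zero_less_power) auto
      then have X0: "X \<noteq> 0" using Xge by auto
      have near: "cmod (u / X - 1) \<le> d"
        if "cmod (u + \<rho> ^ (2 * p + 1) * sin (\<rho> * of_real pi)) \<le> d / 4 * (cmod \<rho> ^ (2 * p + 1) * exp (\<bar>Im \<rho>\<bar> * pi))" for u
      proof -
        have "cmod (u - X) \<le> d / 4 * (cmod \<rho> ^ (2 * p + 1) * exp (\<bar>Im \<rho>\<bar> * pi))"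
          using that unfolding X_def by (simp only: diff_minus_eq_add)
        also have "\<dots> \<le> d / 4 * (4 * cmod X)" by (rule mult_left_mono[OF Xge]) (use d in simp)
        finally have "cmod (u - X) \<le> d / 4 * (4 * cmod X)" .
        then have "cmod (u - X) \<le> d * cmod X" by simp
        moreover have "u / X - 1 = (u - X) / X" using X0 by (simp add: diff_divide_distrib)
        ultimately show ?thesis using X0 by (simp add: norm_divide divide_le_eq)
      qed
      define u where "u = Delta1 \<sigma> r1 r2 (\<rho>\<^sup>2) / X"
      define v where "v = Delta1 \<sigma>t r1t r2t (\<rho>\<^sup>2) / X"
      define A where "A = (\<Prod>k=1..<N. \<rho>\<^sup>2 - ev k)"
      define B where "B = (\<Prod>k=1..<N. \<rho>\<^sup>2 - evt k)"
      have u: "cmod (u - 1) \<le> d" and v: "cmod (v - 1) \<le> d"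
        using near n1 n2 n \<rho> by (auto simp: u_def v_def)
      have c: "cmod (B / A - 1) \<le> d" using b[OF zb] by (simp add: A_def B_def prod_dividef)
      have "A \<noteq> 0" using c d(2) by auto
      have "v \<noteq> 0" by (rule cmod_quotient_near_1(1)[OF u v c d(2)])
      then have g0: "g (\<rho>\<^sup>2) \<noteq> 0" using \<open>A \<noteq> 0\<close> X0 by (simp add: g_def v_def A_def)
      have "f (\<rho>\<^sup>2) / g (\<rho>\<^sup>2) = u * (B / A) / v"
        using X0 by (simp add: f_def g_def u_def v_def A_def B_def)
      then show ?thesis using g0 cmod_quotient_near_1(2)[OF u v c d(2)] d(3) by simp
    qed
    then show ?thesis by blast
  qed
  have "f holomorphic_on UNIV" "g holomorphic_on UNIV" by fact+
  moreover obtain v1 where "f v1 \<noteq> 0"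
  proof -
    obtain n where "\<forall>\<rho>\<in>square n. g (\<rho>\<^sup>2) \<noteq> 0 \<and> cmod (f (\<rho>\<^sup>2) / g (\<rho>\<^sup>2) - 1) \<le> 1 / 2"
      using small[of "1 / 2"] by auto
    from this[rule_format, OF half_integer_in_square] show thesis
      by (intro that[of "(of_real (real n + 1 / 2))\<^sup>2"]) auto
  qed
  moreover obtain v2 where "g v2 \<noteq> 0"
  proof -
    obtain n where "\<forall>\<rho>\<in>square n. g (\<rho>\<^sup>2) \<noteq> 0 \<and> cmod (f (\<rho>\<^sup>2) / g (\<rho>\<^sup>2) - 1) \<le> 1 / 2"
      using small[of "1 / 2"] by auto
    from this[rule_format, OF half_integer_in_square] show thesis
      by (intro that[of "(of_real (real n + 1 / 2))\<^sup>2"]) auto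
  qed
  ultimately have "f z = g z" by (rule entire_quotient_eq_1[OF _ _ _ _ ord small])
  then show ?thesis by (simp add: f_def g_def)
qed

section \<open>The truncated Weyl functions and their difference\<close>

lemma principal_at_infinity_M_trunc:
  assumes R: "R > 0" and ev: "\<And>n. 1 \<le> n \<Longrightarrow> n < N \<Longrightarrow> cmod (ev n) < R"
  shows "principal_at_infinity R (M_trunc N ev wt)"
proof -
  have "principal_at_infinity R (\<lambda>\<mu>. \<Sum>n\<in>{n \<in> idx_set ev. n < N}. \<Sum>k<Defs.mult ev n. wt (n + k) * (1 / (\<mu> - ev n) ^ Suc k))"
  proof (intro principal_at_infinity_sum principal_at_infinity_cmult principal_at_infinity_pole R)
    show "finite {n \<in> idx_set ev. n < N}" by simp
    show "cmod (ev n) < R" if "n \<in> {n \<in> idx_set ev. n < N}" for n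
      using that by (intro ev) (auto simp: idx_set_def)
  qed auto
  moreover have "(\<lambda>\<mu>. \<Sum>n\<in>{n \<in> idx_set ev. n < N}. \<Sum>k<Defs.mult ev n. wt (n + k) * (1 / (\<mu> - ev n) ^ Suc k)) = M_trunc N ev wt"
    by (rule ext) (simp add: M_trunc_def principal_part_def)
  ultimately show ?thesis by simp
qed

text \<open>Blocks of equal eigenvalues starting at or after \<open>N\<close> contribute equally to both Weyl functions;
  a block that starts before \<open>N\<close> belongs to the truncation even if it extends beyond \<open>N\<close>.\<close>

lemma weyl_M_diff:
  assumes sd: "spectral_data p \<sigma> r1 r2 ev wt" and sdt: "spectral_data p \<sigma>t r1t r2t evt wtt"
    and ev_eq: "\<And>n. n \<ge> N \<Longrightarrow> ev n = evt n" and wt_eq: "\<And>n. n \<ge> N \<Longrightarrow> wt n = wtt n"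
    and N: "N \<ge> 1" and idxN: "N \<in> idx_set ev \<longleftrightarrow> N \<in> idx_set evt"
    and nz: "Delta1 \<sigma> r1 r2 \<mu> \<noteq> 0" "Delta1 \<sigma>t r1t r2t \<mu> \<noteq> 0"
  shows "weyl_M \<sigma> r1 r2 \<mu> - weyl_M \<sigma>t r1t r2t \<mu> = M_trunc N ev wt \<mu> - M_trunc N evt wtt \<mu>"
proof -
  define I where "I e = {n \<in> idx_set e. N \<le> n}" for e
  have hs: "((\<lambda>n. principal_part e w n \<mu>) has_sum (W - M_trunc N e w \<mu>)) (I e)"
    if "((\<lambda>n. principal_part e w n \<mu>) has_sum W) (idx_set e)" for e w W
  proof -
    have "((\<lambda>n. principal_part e w n \<mu>) has_sum M_trunc N e w \<mu>) {n \<in> idx_set e. n < N}"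
      unfolding M_trunc_def by (rule has_sum_finite) auto
    moreover have "idx_set e - {n \<in> idx_set e. n < N} = I e" by (auto simp: I_def)
    ultimately show ?thesis
      using has_sum_Diff[OF that, of "{n \<in> idx_set e. n < N}" "M_trunc N e w \<mu>"] by auto
  qed
  have 1: "((\<lambda>n. principal_part ev wt n \<mu>) has_sum (weyl_M \<sigma> r1 r2 \<mu> - M_trunc N ev wt \<mu>)) (I ev)"
    by (rule hs) (use sd nz in \<open>simp add: spectral_data_def\<close>)
  have 2: "((\<lambda>n. principal_part evt wtt n \<mu>) has_sum (weyl_M \<sigma>t r1t r2t \<mu> - M_trunc N evt wtt \<mu>)) (I evt)"
    by (rule hs) (use sdt nz in \<open>simp add: spectral_data_def\<close>)
  \<comment> \<open>Whether \<open>n\<close> starts a block depends on the values at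
    \<open>n\<close> and \<open>n - 1\<close>, both common to the two problems when
    \<open>n > N\<close>. At \<open>n = N\<close> the index \<open>N - 1\<close> is involved, and
    the assumption on \<open>N\<close> decides.\<close>
  have idx: "n \<in> idx_set ev \<longleftrightarrow> n \<in> idx_set evt" if "n \<ge> N" for n
  proof (cases "n = N")
    case False
    then have "n - 1 \<ge> N" using that by simp
    then show ?thesis using ev_eq[of n] ev_eq[of "n - 1"] that by (simp add: idx_set_def)
  qed (use idxN in simp)
  then have II: "I ev = I evt" by (auto simp: I_def)
  \<comment> \<open>The multiplicity counts all indices with a given value. For the first index of a
    block equal values are consecutive, so only indices from \<open>n\<close> on occur, and there
    the sequences agree.\<close>
  have block: "{k. 1 \<le> k \<and> e k = e n} = {k. n \<le> k \<and> e k = e n}"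
    if n: "n \<in> idx_set e" and cons: "\<forall>m k n. 1 \<le> m \<and> m \<le> k \<and> k \<le> n \<and> e m = e n \<longrightarrow> e k = e m"
    for e :: "nat \<Rightarrow> complex" and n
  proof -
    have n1: "1 \<le> n" using n by (auto simp: idx_set_def)
    have "n \<le> k" if k: "1 \<le> k" "e k = e n" for k
    proof (rule ccontr)
      assume "\<not> n \<le> k"
      then have "1 < n" "k \<le> n - 1" "n - 1 \<le> n" using k by auto
      then have "e (n - 1) = e n" using cons[rule_format, of k "n - 1" n] k by auto
      then show False using n \<open>1 < n\<close> by (auto simp: idx_set_def)
    qed
    then show ?thesis using n1 by auto
  qed
  have cons: "\<forall>m k n. 1 \<le> m \<and> m \<le> k \<and> k \<le> n \<and> ev m = ev n \<longrightarrow> ev k = ev m"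
    "\<forall>m k n. 1 \<le> m \<and> m \<le> k \<and> k \<le> n \<and> evt m = evt n \<longrightarrow> evt k = evt m"
    using sd sdt unfolding spectral_data_def eigenvalue_seq_def by - (elim conjE, assumption)+
  have pp: "principal_part ev wt n \<mu> = principal_part evt wtt n \<mu>" if n: "n \<in> I ev" for n
  proof -
    have nN: "n \<ge> N" "n \<in> idx_set ev" "n \<in> idx_set evt" using n II by (auto simp: I_def)
    have "{k. n \<le> k \<and> ev k = ev n} = {k. n \<le> k \<and> evt k = evt n}"
      using ev_eq nN by auto
    then have "Defs.mult ev n = Defs.mult evt n"
      unfolding Defs.mult_def block[OF nN(2) cons(1)] block[OF nN(3) cons(2)] by (rule arg_cong)
    then show ?thesis using ev_eq[OF nN(1)] wt_eq nN by (simp add: principal_part_def)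
  qed
  have "((\<lambda>n. principal_part evt wtt n \<mu>) has_sum (weyl_M \<sigma> r1 r2 \<mu> - M_trunc N ev wt \<mu>)) (I evt)"
    using 1 has_sum_cong[of "I ev", OF pp] unfolding II by (simp only:)
  then have "weyl_M \<sigma> r1 r2 \<mu> - M_trunc N ev wt \<mu> = weyl_M \<sigma>t r1t r2t \<mu> - M_trunc N evt wtt \<mu>"
    by (rule has_sum_unique[OF _ 2])
  then show ?thesis by (simp add: algebra_simps)
qed

theorem theorem2p4:
  fixes N p :: nat
    and \<sigma> \<sigma>t :: "real \<Rightarrow> complex"
    and r1 r2 r1t r2t :: "complex poly"
    and ev evt wt wtt :: "nat \<Rightarrow> complex"
    and M_hat :: "complex \<Rightarrow> complex"
  assumes "N \<ge> 1"
    and "L2_0_pi \<sigma>" and "L2_0_pi \<sigma>t"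
    and "coprime r1 r2" and "coprime r1t r2t"
    and "class_R p r1 r2" and "class_R p r1t r2t"
    and "spectral_data p \<sigma> r1 r2 ev wt"
    and "spectral_data p \<sigma>t r1t r2t evt wtt"
    and "\<And>n. n \<ge> N \<Longrightarrow> ev n = evt n"
    and "\<And>n. n \<ge> N \<Longrightarrow> wt n = wtt n"
    and "N \<in> idx_set ev \<longleftrightarrow> N \<in> idx_set evt"
    and "\<And>n. 1 \<le> n \<Longrightarrow> n < N \<Longrightarrow> ev n \<in> ball 0 (radius p N) \<and> evt n \<in> ball 0 (radius p N)"
    and "\<And>\<mu>. M_hat \<mu> = M_trunc N ev wt \<mu> - M_trunc N evt wtt \<mu>"
  shows
    "(AE x in lebesgue_on {0<..<pi}.
        \<sigma> x = \<sigma>t x - Gamma_integral p N (\<lambda>\<mu>. (2 * phi \<sigma>t x \<mu> * phi \<sigma> x \<mu> - 1) * M_hat \<mu>))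
   \<and> (\<forall>z. cmod z > radius p N \<longrightarrow>
        poly r1 z =
          (\<Prod>k = 1..<N. (z - ev k) / (z - evt k)) *
          (poly r1t z
           - Gamma_integral p N (\<lambda>\<mu>.
               (poly r1t z * phi_qd \<sigma>t pi \<mu> + poly r2t z * phi \<sigma>t pi \<mu>) / (z - \<mu>)
               * phi \<sigma> pi \<mu> * M_hat \<mu>)))
   \<and> (\<forall>z. cmod z > radius p N \<longrightarrow>
        poly r2 z =
          (\<Prod>k = 1..<N. (z - ev k) / (z - evt k)) *
          (poly r2t z
           - poly r1t z * Gamma_integral p N (\<lambda>\<mu>. (phi \<sigma>t pi \<mu> * phi \<sigma> pi \<mu> - 1) * M_hat \<mu>)
           + Gamma_integral p N (\<lambda>\<mu>.
               (poly r1t z * phi_qd \<sigma>t pi \<mu> + poly r2t z * phi \<sigma>t pi \<mu>) / (z - \<mu>)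
               * phi_qd \<sigma> pi \<mu> * M_hat \<mu>)))"
proof -
  define R where "R = radius p N"
  \<comment> \<open>By parity: equality would make the even number \<open>2 * N\<close> equal to the
    odd number \<open>2 * p + 3\<close>. Hence the circle is not degenerate.\<close>
  have "real N - real p - 3 / 2 \<noteq> 0"
  proof
    assume "real N - real p - 3 / 2 = 0"
    then have "real (2 * N) = real (2 * p + 3)" by simp
    then have "2 * N = 2 * p + 3" by (simp only: of_nat_eq_iff)
    then show False by presburger
  qed
  then have R: "R > 0" by (simp add: R_def radius_def)
  have inside: "cmod (ev n) < R" "cmod (evt n) < R" if "1 \<le> n" "n < N" for n
    using assms(13)[OF that] by (auto simp: R_def)
  have "principal_at_infinity R (\<lambda>\<mu>. M_trunc N ev wt \<mu> + (- 1) * M_trunc N evt wtt \<mu>)"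
    by (intro principal_at_infinity_add principal_at_infinity_cmult principal_at_infinity_M_trunc R inside)
  moreover have M_hat: "M_hat = (\<lambda>\<mu>. M_trunc N ev wt \<mu> + (- 1) * M_trunc N evt wtt \<mu>)"
    by (rule ext) (simp add: assms(14))
  ultimately have m: "principal_at_infinity R M_hat" by simp
  interpret two_problems \<sigma> \<sigma>t r1 r2 r1t r2t p R M_hat
  proof
    show "weyl_M \<sigma> r1 r2 \<mu> - weyl_M \<sigma>t r1t r2t \<mu> = M_hat \<mu>"
      if "Delta1 \<sigma> r1 r2 \<mu> \<noteq> 0" "Delta1 \<sigma>t r1t r2t \<mu> \<noteq> 0" for \<mu>
      unfolding assms(14) by (rule weyl_M_diff[OF assms(8,9) _ _ assms(1,12) that]) (fact assms(10,11))+
  qed (use assms R m L2_imp_sq_integrable in auto)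
  have ae: "AE x in lebesgue_on {0<..<pi}.
        \<sigma> x = \<sigma>t x - Gamma_integral p N (\<lambda>\<mu>. (2 * phi \<sigma>t x \<mu> * phi \<sigma> x \<mu> - 1) * M_hat \<mu>)"
  proof -
    obtain N0 where N0: "negligible N0" "\<forall>x\<in>{0..pi} - N0. \<sigma> x = \<sigma>t x - (2 * mean ff x - mean ff 0)"
      using transfer_matrix(5) by blast
    have "\<forall>x\<in>{0<..<pi} - N0.
        \<sigma> x = \<sigma>t x - Gamma_integral p N (\<lambda>\<mu>. (2 * phi \<sigma>t x \<mu> * phi \<sigma> x \<mu> - 1) * M_hat \<mu>)"
    proof
      fix x assume x: "x \<in> {0<..<pi} - N0"
      then have "x \<in> {0..pi}" "x \<in> {0..pi} - N0" by auto
      then show "\<sigma> x = \<sigma>t x - Gamma_integral p N (\<lambda>\<mu>. (2 * phi \<sigma>t x \<mu> * phi \<sigma> x \<mu> - 1) * M_hat \<mu>)"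
        unfolding Gamma_integral_circle_mean R_def[symmetric] potential_difference[OF \<open>x \<in> {0..pi}\<close>]
        using N0(2) by blast
    qed
    then show ?thesis
      using N0(1) by (subst AE_lebesgue_on_iff_negligible) auto
  qed
  have evs: "eigenvalue_seq p \<sigma> r1 r2 ev" "eigenvalue_seq p \<sigma>t r1t r2t evt"
    using assms(8,9) by (simp_all add: spectral_data_def)
  have ratio: "Delta1 \<sigma> r1 r2 z * (\<Prod>k=1..<N. z - evt k) = Delta1 \<sigma>t r1t r2t z * (\<Prod>k=1..<N. z - ev k)" for z
    by (rule Delta1_ratio[OF sq sqt cl clt evs]) (rule assms(10))
  have polys: "Delta1 \<sigma> r1 r2 z = (\<Prod>k = 1..<N. (z - ev k) / (z - evt k)) * Delta1 \<sigma>t r1t r2t z"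
    "Delta0 \<sigma> r1 r2 z = (\<Prod>k = 1..<N. (z - ev k) / (z - evt k)) *
        (Delta0 \<sigma>t r1t r2t z - M_hat z * Delta1 \<sigma>t r1t r2t z)" if z: "cmod z > R" for z
  proof -
    define A where "A z = (\<Prod>k = 1..<N. z - ev k)" for z
    define B where "B z = (\<Prod>k = 1..<N. z - evt k)" for z
    \<comment> \<open>The eigenvalues with index below \<open>N\<close> lie inside the circle and
      \<open>z\<close> outside, so the product of the linear factors may be divided out.\<close>
    have "z - evt k \<noteq> 0" if "k \<in> {1..<N}" for k using inside(2)[of k] that z by auto
    then have B0: "B z \<noteq> 0" by (simp add: B_def prod_zero_iff)
    have c: "(\<Prod>k = 1..<N. (z - ev k) / (z - evt k)) = A z / B z" by (simp add: A_def B_def prod_dividef)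
    have cA: "continuous_on UNIV A" and cB: "continuous_on UNIV B"
      unfolding A_def B_def by (intro continuous_intros)+
    show "Delta1 \<sigma> r1 r2 z = (\<Prod>k = 1..<N. (z - ev k) / (z - evt k)) * Delta1 \<sigma>t r1t r2t z"
      using ratio[of z, folded A_def B_def] B0 unfolding c by (simp add: field_simps)
    have "Delta0 \<sigma> r1 r2 z * B z = A z * (Delta0 \<sigma>t r1t r2t z - M_hat z * Delta1 \<sigma>t r1t r2t z)"
      by (rule Delta0_relation[OF cA cB _ z]) (use ratio in \<open>simp add: A_def B_def\<close>)
    then show "Delta0 \<sigma> r1 r2 z = (\<Prod>k = 1..<N. (z - ev k) / (z - evt k)) *
        (Delta0 \<sigma>t r1t r2t z - M_hat z * Delta1 \<sigma>t r1t r2t z)"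
      using B0 unfolding c by (simp add: field_simps)
  qed
  show ?thesis
    using ae boundary_polynomials[OF _ polys] unfolding Gamma_integral_circle_mean R_def by blast
qed

end
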